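(* There are exactly three inequivalent binary self-dual $[44,22,8]$ codes having an automorphism of type $7$-$(3,23)$.
   Context: A binary linear $[n,k,d]$ code is a $k$-dimensional subspace of $\mathbb{F}_2^n$ whose minimum nonzero Hamming weight is $d$. A code $C$ is self-dual if $C=C^\perp$ with respect to the standard inner product $(u,v)=\sum_i u_iv_i$. Two binary codes are equivalent if one is obtained from the other by a permutation of coordinates. A permutation $\sigma\in S_n$ is an automorphism of $C$ if $\sigma(C)=C$. A permutation $\sigma$ of prime order $p$ is of type $p$-$(c,f)$ if its cycle decomposition consists of exactly $c$ independent $p$-cycles and $f=n-cp$ fixed points. *)

theory Defs
  imports
    "HOL-Analysis.Cartesian_Space"
    "HOL-Library.Z2"
    "HOL-Library.Numeral_Type"
    "HOL-Combinatorics.Orbits"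
    "HOL-Computational_Algebra.Primes"
begin

definition weight :: "bit ^ 'n::finite \<Rightarrow> nat" where
  "weight v = card {i. v $ i \<noteq> 0}"

text \<open>Only meaningful when the code contains a nonzero vector.\<close>

definition min_weight :: "(bit ^ 'n::finite) set \<Rightarrow> nat" where
  "min_weight C = Min (weight ` (C - {0}))"

definition linear_code :: "nat \<Rightarrow> nat \<Rightarrow> nat \<Rightarrow> (bit ^ 'n::finite) set \<Rightarrow> bool" where
  "linear_code n k d C \<longleftrightarrow>
     CARD('n) = n \<and> vec.subspace C \<and> vec.dim C = k \<and> min_weight C = d"

definition dual_code :: "(bit ^ 'n::finite) set \<Rightarrow> (bit ^ 'n) set" where
  "dual_code C = {u. \<forall>v\<in>C. (\<Sum>i\<in>UNIV. u $ i * v $ i) = 0}"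

definition self_dual :: "(bit ^ 'n::finite) set \<Rightarrow> bool" where
  "self_dual C \<longleftrightarrow> C = dual_code C"

text \<open>The left action of permutations: the entry at position \<open>i\<close> moves to position \<open>\<sigma> i\<close>.\<close>

definition permute_coords :: "('n \<Rightarrow> 'n) \<Rightarrow> bit ^ 'n::finite \<Rightarrow> bit ^ 'n" where
  "permute_coords \<sigma> v = (\<chi> i. v $ inv \<sigma> i)"

definition code_equiv :: "((bit ^ 'n::finite) set \<times> (bit ^ 'n) set) set" where
  "code_equiv = {(C, D). \<exists>\<sigma>. \<sigma> permutes UNIV \<and> D = permute_coords \<sigma> ` C}"

definition code_automorphism :: "('n \<Rightarrow> 'n) \<Rightarrow> (bit ^ 'n::finite) set \<Rightarrow> bool" where
  "code_automorphism \<sigma> C \<longleftrightarrow> \<sigma> permutes UNIV \<and> permute_coords \<sigma> ` C = C"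

definition perm_order :: "('n::finite \<Rightarrow> 'n) \<Rightarrow> nat" where
  "perm_order \<sigma> = (LEAST m. 0 < m \<and> \<sigma> ^^ m = id)"

text \<open>
  Cycles are represented by their supports, i.e. the orbits of \<open>\<sigma>\<close>.  The condition
  \<open>c * p + f = CARD('n)\<close> says that there are no cycles besides the \<open>p\<close>-cycles and fixed points.
\<close>

definition perm_of_type :: "nat \<Rightarrow> nat \<Rightarrow> nat \<Rightarrow> ('n::finite \<Rightarrow> 'n) \<Rightarrow> bool" where
  "perm_of_type p c f \<sigma> \<longleftrightarrow>
     \<sigma> permutes UNIV \<and> prime p \<and> perm_order \<sigma> = p \<and>
     card {X \<in> range (orbit \<sigma>). card X = p} = c \<and>
     card {i. \<sigma> i = i} = f \<and>
     c * p + f = CARD('n)"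

lemma permute_coords_id: "permute_coords id = id"
  by (simp add: permute_coords_def fun_eq_iff)

lemma permute_coords_comp:
  assumes "\<sigma> permutes UNIV" and "\<tau> permutes UNIV"
  shows "permute_coords \<sigma> (permute_coords \<tau> v) = permute_coords (\<sigma> \<circ> \<tau>) v"
  using assms by (simp add: permute_coords_def permutes_inv_o vec_eq_iff o_inv_distrib permutes_bij)

lemma equiv_code_equiv: "equiv UNIV (code_equiv :: ((bit ^ 'n::finite) set \<times> (bit ^ 'n) set) set)"
proof (rule equivI)
  show "refl (code_equiv :: ((bit ^ 'n) set \<times> (bit ^ 'n) set) set)"
    by (auto simp: refl_on_def code_equiv_def permute_coords_id intro!: exI[of _ id] permutes_id)
  show "sym (code_equiv :: ((bit ^ 'n) set \<times> (bit ^ 'n) set) set)"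
  proof (rule symI)
    fix C D :: "(bit ^ 'n) set"
    assume "(C, D) \<in> code_equiv"
    then obtain \<sigma> where s: "\<sigma> permutes UNIV" and D: "D = permute_coords \<sigma> ` C"
      by (auto simp: code_equiv_def)
    have "permute_coords (inv \<sigma>) ` D = C"
      using s by (simp add: D image_image permute_coords_comp permutes_inv permutes_inv_o
          permute_coords_id)
    with s show "(D, C) \<in> code_equiv"
      by (auto simp: code_equiv_def intro!: exI[of _ "inv \<sigma>"] permutes_inv)
  qed
  show "trans (code_equiv :: ((bit ^ 'n) set \<times> (bit ^ 'n) set) set)"
  proof (rule transI)
    fix C D E :: "(bit ^ 'n) set"
    assume "(C, D) \<in> code_equiv" and "(D, E) \<in> code_equiv"
    then obtain \<sigma> \<tau> where s: "\<sigma> permutes UNIV" "\<tau> permutes UNIV"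
      and "D = permute_coords \<sigma> ` C" "E = permute_coords \<tau> ` D"
      by (auto simp: code_equiv_def)
    then have "E = permute_coords (\<tau> \<circ> \<sigma>) ` C"
      by (simp add: image_image permute_coords_comp)
    with s show "(C, E) \<in> code_equiv"
      by (auto simp: code_equiv_def intro!: exI[of _ "\<tau> \<circ> \<sigma>"] permutes_compose)
  qed
qed simp_all

end

theory Submission
  imports Defs "HOL-Combinatorics.Cycles"
begin

text \<open>
  Words are identified with their supports. Label the coordinates so that the automorphism rotates
  \<open>{0..<7}\<close>, \<open>{7..<14}\<close>, \<open>{14..<21}\<close> and fixes the remaining 23 coordinates. The words of the code
  with even weight on every cycle and zero on the fixed points form a sum of two modules, a code of
  length 3 over the field with 8 elements and its dual. Minimum weight 8 forces one of the two, after
  possibly reversing the cycles, to be spanned by a word without zeros; rotating the cycles turns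
  that word into the all-one word, so this part is unique.

  The words supported on the fixed points form a self-orthogonal code of dimension 10, and the three
  cycles are glued to words of length 23 of odd weight. Power moments and a Gauss sum show that this
  code, extended by one coordinate and the all-one word, lies in the Golay code of length 24. The
  Golay code is labelled explicitly through a dodecad, the biplane on 11 points that it carries, and
  Hussain's description of that biplane by pentagons on 5 vertices. The code of dimension 10 is then
  the hyperplane of the shortened Golay code orthogonal to a set of 1, 2 or 3 coordinates; the
  labelling can be chosen with prescribed names for these, which leaves three codes.

  The three codes have different numbers of words of weight 8.
\<close>

section \<open>Binary codes as set systems\<close>

text \<open>Averaging over the rotation makes a codeword constant on the cycles. What is left over
  is even on each cycle and splits into two modules dual to each other, so one of them determines
  the other. The glue words are orthonormal modulo the fixed-point code; in a binary space of
  dimension 3 an orthonormal basis is unique up to order, and permuting the cycles absorbs the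
  order. The obstacle is the fixed-point code: its weight bound reaches only the words that avoid
  the added coordinate. Neither divisibility by 4 nor the absence of light words through that
  coordinate comes for free. Divisibility follows by comparing the weight distributions of the code
  and of its doubly even half, the minimum weight by choosing between the two doubly even self-dual
  codes above it. Classically the transitivity of the Mathieu group would now name the coordinates;
  an explicit labelling with prescribed points takes its place. The sets of 1, 2 or 3 coordinates
  arise because the punctured Golay code has covering radius 3.\<close>

definition sym_diff_set :: "'a set \<Rightarrow> 'a set \<Rightarrow> 'a set" (infixl "\<triangle>" 65) where
  "A \<triangle> B = (A - B) \<union> (B - A)"

lemma in_sd: "x \<in> A \<triangle> B \<longleftrightarrow> (x \<in> A) \<noteq> (x \<in> B)"
  by (auto simp: sym_diff_set_def)

lemma sd_empty [simp]: "A \<triangle> {} = A" "{} \<triangle> A = A"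
  by (auto simp: sym_diff_set_def)

lemma sd_self [simp]: "A \<triangle> A = {}"
  by (auto simp: sym_diff_set_def)

lemma sd_comm: "A \<triangle> B = B \<triangle> A"
  by (auto simp: sym_diff_set_def)

lemma sd_assoc: "(A \<triangle> B) \<triangle> C = A \<triangle> (B \<triangle> C)"
  by (auto simp: sym_diff_set_def)

lemma sd_left_comm: "A \<triangle> (B \<triangle> C) = B \<triangle> (A \<triangle> C)"
  by (auto simp: sym_diff_set_def)

lemma sd_cancel [simp]: "A \<triangle> (A \<triangle> B) = B"
  by (auto simp: sym_diff_set_def)

lemmas sd_ac = sd_assoc sd_comm sd_left_comm

lemma sd_eq_empty [simp]: "A \<triangle> B = {} \<longleftrightarrow> A = B"
  by (auto simp: sym_diff_set_def)

lemma sd_subset: "A \<subseteq> X \<Longrightarrow> B \<subseteq> X \<Longrightarrow> A \<triangle> B \<subseteq> X"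
  by (auto simp: sym_diff_set_def)

lemma finite_sd [simp]: "finite A \<Longrightarrow> finite B \<Longrightarrow> finite (A \<triangle> B)"
  by (auto simp: sym_diff_set_def)

lemma sd_Int: "(A \<triangle> B) \<inter> C = (A \<inter> C) \<triangle> (B \<inter> C)"
  by (auto simp: sym_diff_set_def)

lemma Int_sd: "C \<inter> (A \<triangle> B) = (C \<inter> A) \<triangle> (C \<inter> B)"
  by (auto simp: sym_diff_set_def)

lemma inj_sd: "inj_on ((\<triangle>) A) X"
  by (rule inj_onI) (metis sd_cancel)

lemma sd_image: "inj_on f X \<Longrightarrow> A \<subseteq> X \<Longrightarrow> B \<subseteq> X \<Longrightarrow> f ` (A \<triangle> B) = f ` A \<triangle> f ` B"
  unfolding sym_diff_set_def by (auto simp: inj_on_def)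

lemma card_sd:
  assumes "finite A" "finite B"
  shows "card (A \<triangle> B) + 2 * card (A \<inter> B) = card A + card B"
proof -
  have "card (A \<triangle> B) = card (A - B) + card (B - A)"
    unfolding sym_diff_set_def using assms by (intro card_Un_disjoint) auto
  moreover have "card A = card (A - B) + card (A \<inter> B)"
    using assms by (metis card_Int_Diff add.commute)
  moreover have "card B = card (B - A) + card (A \<inter> B)"
    using assms by (metis card_Int_Diff add.commute Int_commute)
  ultimately show ?thesis by simp
qed

lemma even_card_sd:
  assumes "finite A" "finite B"
  shows "even (card (A \<triangle> B)) \<longleftrightarrow> (even (card A) \<longleftrightarrow> even (card B))"
  using card_sd[OF assms] by presburger

lemma even_meet_sd:
  assumes "finite A" "finite B"
  shows "even (card ((A \<triangle> B) \<inter> C)) \<longleftrightarrow> (even (card (A \<inter> C)) \<longleftrightarrow> even (card (B \<inter> C)))"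
    and "even (card (C \<inter> (A \<triangle> B))) \<longleftrightarrow> (even (card (C \<inter> A)) \<longleftrightarrow> even (card (C \<inter> B)))"
  using assms by (simp_all add: sd_Int Int_sd even_card_sd)

lemma even_card_complement:
  assumes "finite X" "A \<subseteq> X"
  shows "card (X \<triangle> A) = card X - card A"
  using assms by (simp add: sym_diff_set_def card_Diff_subset finite_subset Diff_eq_empty_iff[THEN iffD2])

text \<open>A binary linear code with coordinate set \<open>X\<close>: words are added by symmetric
  difference, and over the field with two elements closure under addition is linearity. Likewise the
  parity of an intersection in \<open>dual_on\<close> is the inner product.\<close>

definition code_on :: "'a set \<Rightarrow> 'a set set \<Rightarrow> bool" where
  "code_on X C \<longleftrightarrow> C \<subseteq> Pow X \<and> {} \<in> C \<and> (\<forall>a\<in>C. \<forall>b\<in>C. a \<triangle> b \<in> C)"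

definition dual_on :: "'a set \<Rightarrow> 'a set set \<Rightarrow> 'a set set" where
  "dual_on X C = {u. u \<subseteq> X \<and> (\<forall>c\<in>C. even (card (u \<inter> c)))}"

lemma code_onD:
  assumes "code_on X C"
  shows "c \<in> C \<Longrightarrow> c \<subseteq> X" "{} \<in> C" "a \<in> C \<Longrightarrow> b \<in> C \<Longrightarrow> a \<triangle> b \<in> C"
  using assms by (auto simp: code_on_def)

lemma code_on_finite: "finite X \<Longrightarrow> code_on X C \<Longrightarrow> finite C"
  by (metis code_on_def finite_Pow_iff finite_subset)

lemma code_on_mem_finite: "finite X \<Longrightarrow> code_on X C \<Longrightarrow> c \<in> C \<Longrightarrow> finite c"
  by (metis code_onD(1) finite_subset)

lemma dual_onD: "u \<in> dual_on X C \<Longrightarrow> c \<in> C \<Longrightarrow> even (card (u \<inter> c))"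
  by (simp add: dual_on_def)

lemma code_on_dual:
  assumes "finite X" shows "code_on X (dual_on X C)"
  unfolding code_on_def dual_on_def
  using assms by (auto simp: even_meet_sd finite_subset dest: sd_subset)

lemma finite_dual_on: "finite X \<Longrightarrow> finite (dual_on X C)"
  by (rule code_on_finite[OF _ code_on_dual])

lemma code_on_coset_union:
  assumes C: "code_on X C" and x: "x \<subseteq> X"
  shows "code_on X (C \<union> (\<triangle>) x ` C)"
proof -
  have "a \<triangle> b \<in> C \<union> (\<triangle>) x ` C" if "a \<in> C \<union> (\<triangle>) x ` C" "b \<in> C \<union> (\<triangle>) x ` C" for a b
  proof -
    obtain a' where a': "a' \<in> C" "a = a' \<or> a = x \<triangle> a'" using \<open>a \<in> _\<close> by auto
    obtain b' where b': "b' \<in> C" "b = b' \<or> b = x \<triangle> b'" using \<open>b \<in> _\<close> by auto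
    have "a \<triangle> b = a' \<triangle> b' \<or> a \<triangle> b = x \<triangle> (a' \<triangle> b')"
      using a'(2) b'(2) by (elim disjE) (simp_all add: sd_assoc sd_left_comm[of a' x])
    with code_onD(3)[OF C a'(1) b'(1)] show ?thesis by auto
  qed
  moreover have "C \<union> (\<triangle>) x ` C \<subseteq> Pow X"
  proof (intro Un_least image_subsetI)
    show "C \<subseteq> Pow X" using C by (simp add: code_on_def)
    show "x \<triangle> c \<in> Pow X" if "c \<in> C" for c
      using sd_subset[OF x code_onD(1)[OF C that]] by simp
  qed
  ultimately show ?thesis
    using code_onD(2)[OF C] by (simp add: code_on_def)
qed

section \<open>Characters of the space of words and the size of the dual\<close>

definition chr :: "'a set \<Rightarrow> 'a set \<Rightarrow> int" where
  "chr u c = (if even (card (u \<inter> c)) then 1 else -1)"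

lemma chr_sd:
  assumes "finite u" "finite v"
  shows "chr (u \<triangle> v) c = chr u c * chr v c" "chr c (u \<triangle> v) = chr c u * chr c v"
  using even_meet_sd[OF assms] by (simp_all add: chr_def)

lemma sum_sd_shift:
  assumes "code_on X C" "a \<in> C"
  shows "(\<Sum>c\<in>C. f (a \<triangle> c)) = (\<Sum>c\<in>C. f c)"
  by (rule sum.reindex_bij_witness[of _ "(\<triangle>) a" "(\<triangle>) a"])
     (use code_onD(3)[OF assms(1)] assms(2) in auto)

text \<open>Orthogonality of characters: if some codeword \<open>a\<close> meets \<open>u\<close>
  oddly, translation by \<open>a\<close> permutes the code and changes the sign of every term, so
  the sum is its own negative.\<close>

lemma sum_chr:
  assumes X: "finite X" and C: "code_on X C" and u: "u \<subseteq> X"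
  shows "(\<Sum>c\<in>C. chr u c) = (if u \<in> dual_on X C then int (card C) else 0)"
proof (cases "u \<in> dual_on X C")
  case True
  then have "chr u c = 1" if "c \<in> C" for c
    using that by (simp add: chr_def dual_on_def)
  with True show ?thesis by simp
next
  case False
  then obtain a where a: "a \<in> C" "odd (card (u \<inter> a))"
    using u by (auto simp: dual_on_def)
  have "(\<Sum>c\<in>C. chr u c) = (\<Sum>c\<in>C. chr u (a \<triangle> c))"
    using sum_sd_shift[OF C a(1), of "chr u"] by simp
  also have "\<dots> = (\<Sum>c\<in>C. - chr u c)"
    using a code_on_mem_finite[OF X C]
    by (intro sum.cong) (auto simp: chr_sd, simp add: chr_def)
  finally show ?thesis using False by (simp add: sum_negf)
qed

lemma code_on_Pow: "code_on X (Pow X)"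
  by (auto simp: code_on_def sym_diff_set_def)

lemma dual_on_Pow: "finite X \<Longrightarrow> dual_on X (Pow X) = {{}}"
proof -
  have "u = {}" if "u \<subseteq> X" "\<forall>c\<in>Pow X. even (card (u \<inter> c))" for u
  proof (rule ccontr)
    assume "u \<noteq> {}"
    then obtain x where "x \<in> u" by auto
    then have "u \<inter> {x} = {x}" "{x} \<in> Pow X" using that by auto
    with that(2) have "even (card {x})" by metis
    then show False by simp
  qed
  then show ?thesis by (auto simp: dual_on_def)
qed

lemma chr_comm: "chr u c = chr c u"
  by (simp add: chr_def Int_commute)

text \<open>The sum of \<open>chr u c\<close> over all subsets \<open>u\<close> and all codewords
  \<open>c\<close> is evaluated in both orders: summing over \<open>c\<close> first leaves the dual
  words, summing over \<open>u\<close> first leaves the zero word.\<close>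

lemma card_dual_on:
  assumes X: "finite X" and C: "code_on X C"
  shows "card C * card (dual_on X C) = 2 ^ card X"
proof -
  have fC: "finite C" by (rule code_on_finite[OF X C])
  have "int (card C * card (dual_on X C)) = (\<Sum>u\<in>Pow X. if u \<in> dual_on X C then int (card C) else 0)"
  proof -
    have "dual_on X C \<subseteq> Pow X" by (auto simp: dual_on_def)
    then have "Pow X \<inter> dual_on X C = dual_on X C" by auto
    then show ?thesis using X by (simp add: sum.If_cases)
  qed
  also have "\<dots> = (\<Sum>u\<in>Pow X. \<Sum>c\<in>C. chr u c)"
    using sum_chr[OF X C] by (intro sum.cong) auto
  also have "\<dots> = (\<Sum>c\<in>C. \<Sum>u\<in>Pow X. chr c u)"
    by (subst sum.swap) (simp add: chr_comm)
  also have "\<dots> = (\<Sum>c\<in>C. if c \<in> {{}} then 2 ^ card X else 0)"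
    using sum_chr[OF X code_on_Pow] code_onD(1)[OF C] dual_on_Pow[OF X] X
    by (intro sum.cong) (auto simp: card_Pow)
  also have "\<dots> = 2 ^ card X"
    using fC code_onD(2)[OF C] by simp
  finally show ?thesis by (metis of_nat_eq_iff of_nat_numeral of_nat_power)
qed

lemma self_dual_if_card:
  assumes X: "finite X" and C: "code_on X C" and so: "C \<subseteq> dual_on X C"
    and c: "card C ^ 2 = 2 ^ card X"
  shows "dual_on X C = C"
proof (rule sym, rule card_subset_eq[OF finite_dual_on[OF X] so])
  have "card C \<noteq> 0" using c by (metis power_not_zero zero_neq_numeral zero_power2)
  then show "card C = card (dual_on X C)"
    using card_dual_on[OF X C] c by (metis mult_cancel1 power2_eq_square)
qed

section \<open>Power moments of the weight distribution\<close>

text \<open>The character sum of a word over all coordinates recovers its weight, so power moments of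
  the weight distribution of a code count words of small weight in its dual.\<close>

lemma sum_chr_singletons:
  assumes "finite X" "c \<subseteq> X"
  shows "(\<Sum>i\<in>X. chr {i} c) = int (card X) - 2 * int (card c)"
proof -
  have "(\<Sum>i\<in>X. chr {i} c) = (\<Sum>i\<in>X. if i \<in> c then -1 else 1)"
    by (intro sum.cong) (auto simp: chr_def Int_insert_left)
  also have "\<dots> = - int (card (X \<inter> c)) + int (card (X \<inter> - c))"
    using assms by (simp add: sum.If_cases)
  also have "X \<inter> c = c" using assms by auto
  also have "X \<inter> - c = X - c" by auto
  finally show ?thesis using assms by (simp add: card_Diff_subset finite_subset card_mono of_nat_diff)
qed

lemma card_in_set_sum: "finite A \<Longrightarrow> (\<Sum>p\<in>A. if P p then k else 0) = int (card {p \<in> A. P p}) * k"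
  for k :: int
  by (simp add: sum.If_cases Int_def)

text \<open>The square becomes a double sum of characters; after exchanging the summations only
  those pairs survive whose sum lies in the dual.\<close>

lemma second_moment:
  assumes X: "finite X" and C: "code_on X C"
  shows "(\<Sum>c\<in>C. (int (card X) - 2 * int (card c)) ^ 2)
       = int (card {(i,j) \<in> X \<times> X. {i} \<triangle> {j} \<in> dual_on X C}) * int (card C)"
proof -
  have "(\<Sum>c\<in>C. (int (card X) - 2 * int (card c)) ^ 2)
      = (\<Sum>c\<in>C. \<Sum>i\<in>X. \<Sum>j\<in>X. chr ({i} \<triangle> {j}) c)"
    using sum_chr_singletons[OF X] code_onD(1)[OF C]
    by (intro sum.cong) (auto simp: power2_eq_square sum_product chr_sd simp flip: sum_chr_singletons[OF X])
  also have "\<dots> = (\<Sum>i\<in>X. \<Sum>j\<in>X. \<Sum>c\<in>C. chr ({i} \<triangle> {j}) c)"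
    by (subst sum.swap, rule sum.cong[OF refl], subst sum.swap, rule refl)
  also have "\<dots> = (\<Sum>i\<in>X. \<Sum>j\<in>X. if {i} \<triangle> {j} \<in> dual_on X C then int (card C) else 0)"
    by (intro sum.cong refl sum_chr[OF X C] sd_subset) auto
  also have "\<dots> = (\<Sum>p\<in>X \<times> X. if (case p of (i,j) \<Rightarrow> {i} \<triangle> {j} \<in> dual_on X C) then int (card C) else 0)"
    by (subst sum.cartesian_product) (auto intro!: sum.cong)
  also have "\<dots> = int (card {p \<in> X \<times> X. case p of (i,j) \<Rightarrow> {i} \<triangle> {j} \<in> dual_on X C}) * int (card C)"
    using X by (subst card_in_set_sum) auto
  also have "{p \<in> X \<times> X. case p of (i,j) \<Rightarrow> {i} \<triangle> {j} \<in> dual_on X C} = {(i,j) \<in> X \<times> X. {i} \<triangle> {j} \<in> dual_on X C}"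
    by auto
  finally show ?thesis .
qed

text \<open>The factor \<open>chr {t} c\<close> adds \<open>t\<close> to every index set. The signed
  moments therefore measure how the words of a given weight are divided between those containing
  \<open>t\<close> and those avoiding it.\<close>

lemma signed_first_moment:
  assumes X: "finite X" and C: "code_on X C" and t: "t \<in> X"
  shows "(\<Sum>c\<in>C. chr {t} c * (int (card X) - 2 * int (card c)))
       = int (card {i \<in> X. {t} \<triangle> {i} \<in> dual_on X C}) * int (card C)"
proof -
  have "(\<Sum>c\<in>C. chr {t} c * (int (card X) - 2 * int (card c)))
      = (\<Sum>c\<in>C. \<Sum>i\<in>X. chr ({t} \<triangle> {i}) c)"
    using code_onD(1)[OF C]
    by (intro sum.cong) (auto simp: sum_distrib_left chr_sd simp flip: sum_chr_singletons[OF X])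
  also have "\<dots> = (\<Sum>i\<in>X. \<Sum>c\<in>C. chr ({t} \<triangle> {i}) c)"
    by (rule sum.swap)
  also have "\<dots> = (\<Sum>i\<in>X. if {t} \<triangle> {i} \<in> dual_on X C then int (card C) else 0)"
    using t by (intro sum.cong refl sum_chr[OF X C] sd_subset) auto
  finally show ?thesis using X by (simp add: card_in_set_sum)
qed

lemma signed_third_moment:
  assumes X: "finite X" and C: "code_on X C" and t: "t \<in> X"
  shows "(\<Sum>c\<in>C. chr {t} c * (int (card X) - 2 * int (card c)) ^ 3)
       = int (card {(i,j,k) \<in> X \<times> X \<times> X. {t} \<triangle> {i} \<triangle> {j} \<triangle> {k} \<in> dual_on X C}) * int (card C)"
proof -
  have "(\<Sum>c\<in>C. chr {t} c * (int (card X) - 2 * int (card c)) ^ 3)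
      = (\<Sum>c\<in>C. \<Sum>i\<in>X. \<Sum>j\<in>X. \<Sum>k\<in>X. chr ({t} \<triangle> {i} \<triangle> {j} \<triangle> {k}) c)"
  proof (rule sum.cong[OF refl])
    fix c assume "c \<in> C"
    then have e: "int (card X) - 2 * int (card c) = (\<Sum>i\<in>X. chr {i} c)"
      using code_onD(1)[OF C] by (simp add: sum_chr_singletons[OF X])
    have "(\<Sum>i\<in>X. \<Sum>j\<in>X. \<Sum>k\<in>X. chr ({t} \<triangle> {i} \<triangle> {j} \<triangle> {k}) c)
        = (\<Sum>i\<in>X. \<Sum>j\<in>X. \<Sum>k\<in>X. chr {t} c * chr {i} c * chr {j} c * chr {k} c)"
      by (simp only: chr_sd finite.emptyI finite.insertI finite_sd)
    also have "\<dots> = chr {t} c * (\<Sum>i\<in>X. chr {i} c) * (\<Sum>i\<in>X. chr {i} c) * (\<Sum>i\<in>X. chr {i} c)"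
      by (simp only: sum_distrib_left[symmetric] sum_distrib_right[symmetric])
    finally show "chr {t} c * (int (card X) - 2 * int (card c)) ^ 3
        = (\<Sum>i\<in>X. \<Sum>j\<in>X. \<Sum>k\<in>X. chr ({t} \<triangle> {i} \<triangle> {j} \<triangle> {k}) c)"
      unfolding e by (simp only: power3_eq_cube mult.assoc)
  qed
  also have "\<dots> = (\<Sum>i\<in>X. \<Sum>j\<in>X. \<Sum>k\<in>X. \<Sum>c\<in>C. chr ({t} \<triangle> {i} \<triangle> {j} \<triangle> {k}) c)"
    by (subst sum.swap, rule sum.cong[OF refl], subst sum.swap, rule sum.cong[OF refl],
        subst sum.swap, rule refl)
  also have "\<dots> = (\<Sum>i\<in>X. \<Sum>j\<in>X. \<Sum>k\<in>X. if {t} \<triangle> {i} \<triangle> {j} \<triangle> {k} \<in> dual_on X C then int (card C) else 0)"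
    using t by (intro sum.cong refl sum_chr[OF X C] sd_subset) auto
  also have "\<dots> = (\<Sum>p\<in>X \<times> X \<times> X. if (case p of (i,j,k) \<Rightarrow> {t} \<triangle> {i} \<triangle> {j} \<triangle> {k} \<in> dual_on X C) then int (card C) else 0)"
    by (simp add: sum.cartesian_product case_prod_unfold)
  also have "\<dots> = int (card {p \<in> X \<times> X \<times> X. case p of (i,j,k) \<Rightarrow> {t} \<triangle> {i} \<triangle> {j} \<triangle> {k} \<in> dual_on X C}) * int (card C)"
    using X by (subst card_in_set_sum) auto
  also have "{p \<in> X \<times> X \<times> X. case p of (i,j,k) \<Rightarrow> {t} \<triangle> {i} \<triangle> {j} \<triangle> {k} \<in> dual_on X C} = {(i,j,k) \<in> X \<times> X \<times> X. {t} \<triangle> {i} \<triangle> {j} \<triangle> {k} \<in> dual_on X C}"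
    by auto
  finally show ?thesis .
qed

section \<open>A Gauss sum over the dual of a doubly even code\<close>

lemma sum_Pow_prod:
  fixes f :: "'a \<Rightarrow> 'b::comm_semiring_1"
  assumes "finite X"
  shows "(\<Sum>v\<in>Pow X. \<Prod>j\<in>v. f j) = (\<Prod>j\<in>X. 1 + f j)"
  using assms
proof (induction X)
  case (insert x X)
  have "(\<Sum>v\<in>Pow (insert x X). prod f v) = (\<Sum>v\<in>Pow X. prod f v) + (\<Sum>v\<in>insert x ` Pow X. prod f v)"
    unfolding Pow_insert using insert by (intro sum.union_disjoint) auto
  also have "(\<Sum>v\<in>insert x ` Pow X. prod f v) = (\<Sum>v\<in>Pow X. prod f (insert x v))"
    using insert by (intro sum.reindex_cong[of "insert x"]) (auto simp: inj_on_def)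
  also have "\<dots> = (\<Sum>v\<in>Pow X. f x * prod f v)"
    using insert by (intro sum.cong) (auto intro!: prod.insert dest: finite_subset)
  finally show ?case using insert by (simp add: sum_distrib_left[symmetric] algebra_simps)
qed simp

text \<open>The sum splits into one factor per coordinate, \<open>1 - \<i>\<close> on
  \<open>c\<close> and \<open>1 + \<i>\<close> off \<open>c\<close>. Both have fourth power -4, so
  in length 24 and for weight divisible by 4 the product is \<open>(-4) ^ 6\<close>, whatever
  \<open>c\<close> is.\<close>

lemma gauss_sum_coset:
  assumes X: "finite X" "card X = 24" and c: "c \<subseteq> X" "4 dvd card c"
  shows "(\<Sum>v\<in>Pow X. of_int (chr c v) * \<i> ^ card v) = (4096 :: complex)"
proof -
  define f :: "'a \<Rightarrow> complex" where "f j = (if j \<in> c then - \<i> else \<i>)" for j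
  have "of_int (chr c v) * \<i> ^ card v = prod f v" if "v \<in> Pow X" for v
  proof -
    have v: "finite v" using that X by (auto intro: finite_subset)
    have "prod f v = (- \<i>) ^ card (v \<inter> c) * \<i> ^ card (v \<inter> - c)"
      unfolding f_def using v by (simp add: prod.If_cases)
    also have "\<dots> = (-1) ^ card (v \<inter> c) * (\<i> ^ card (v \<inter> c) * \<i> ^ card (v \<inter> - c))"
      by (simp add: power_minus[of \<i>])
    also have "\<i> ^ card (v \<inter> c) * \<i> ^ card (v \<inter> - c) = \<i> ^ card v"
      using v by (simp add: power_add[symmetric] card_Int_Diff[of v c] Diff_eq)
    finally show ?thesis by (simp add: chr_def Int_commute)
  qed
  then have "(\<Sum>v\<in>Pow X. of_int (chr c v) * \<i> ^ card v) = (\<Sum>v\<in>Pow X. prod f v)"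
    by (intro sum.cong) auto
  also have "\<dots> = (\<Prod>j\<in>X. 1 + f j)" by (rule sum_Pow_prod[OF X(1)])
  finally have "(\<Sum>v\<in>Pow X. of_int (chr c v) * \<i> ^ card v) = (\<Prod>j\<in>X. 1 + f j)" .
  also have "\<dots> = (\<Prod>j\<in>X. if j \<in> c then 1 - \<i> else 1 + \<i>)"
    by (intro prod.cong) (auto simp: f_def)
  also have "\<dots> = (1 - \<i>) ^ card (X \<inter> c) * (1 + \<i>) ^ card (X \<inter> - c)"
    using X by (simp add: prod.If_cases)
  also have "X \<inter> c = c" using c by auto
  also have "X \<inter> - c = X - c" by auto
  also have "card (X - c) = 24 - card c" using X c by (simp add: card_Diff_subset finite_subset)
  finally have e: "(\<Sum>v\<in>Pow X. of_int (chr c v) * \<i> ^ card v) = (1 - \<i>) ^ card c * (1 + \<i>) ^ (24 - card c)" .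
  obtain k where k: "card c = 4 * k" using c(2) by auto
  have "card c \<le> 24" using X c card_mono by metis
  then have "k \<le> 6" using k by simp
  then have k': "24 - card c = 4 * (6 - k)" using k by simp
  have "(1 - \<i>) ^ 4 = -4" "(1 + \<i>) ^ 4 = -4"
    by (simp_all add: power4_eq_xxxx algebra_simps)
  then have "(1 - \<i>) ^ card c * (1 + \<i>) ^ (24 - card c) = (-4) ^ k * (-4) ^ (6 - k)"
    unfolding k' unfolding k by (simp only: power_mult)
  also have "\<dots> = (-4) ^ 6" using \<open>k \<le> 6\<close> by (simp flip: power_add)
  finally show ?thesis using e by simp
qed

text \<open>The Gauss sum of \<open>\<i> ^ card v\<close> over the dual, evaluated by Poisson summation.\<close>

lemma doubly_even_dual_counts:
  assumes X: "finite X" "card X = 24" and C: "code_on X C" "X \<in> C" and de: "\<And>c. c \<in> C \<Longrightarrow> 4 dvd card c"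
  shows "card {v \<in> dual_on X C. 4 dvd card v} = card {v \<in> dual_on X C. \<not> 4 dvd card v} + 4096"
proof -
  let ?D = "dual_on X C"
  have fD: "finite ?D" by (rule finite_dual_on[OF X(1)])
  have fC: "finite C" by (rule code_on_finite[OF X(1) C(1)])
  have cC: "card C \<noteq> 0" using fC C(2) by auto
  \<comment> \<open>As the all-one word lies in the code, dual words have even weight and
    \<open>\<i> ^ card v\<close> is a sign.\<close>
  have ev: "\<i> ^ card v = (if 4 dvd card v then 1 else -1)" if "v \<in> ?D" for v
  proof -
    have "v \<inter> X = v" using that by (auto simp: dual_on_def)
    then have "even (card v)" using that C(2) by (metis dual_onD)
    then obtain k where k: "card v = 2 * k" by auto
    have "4 dvd card v \<longleftrightarrow> even k" unfolding k by presburger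
    then show ?thesis unfolding k by (simp add: power_mult)
  qed
  have "of_nat (card C) * (\<Sum>v\<in>?D. \<i> ^ card v)
      = (\<Sum>v\<in>Pow X. if v \<in> ?D then of_nat (card C) * \<i> ^ card v else 0)"
  proof -
    have "Pow X \<inter> ?D = ?D" by (auto simp: dual_on_def)
    then show ?thesis using X by (simp add: sum.If_cases sum_distrib_left)
  qed
  \<comment> \<open>The indicator of the dual is replaced by the character sum over the
    code.\<close>
  also have "\<dots> = (\<Sum>v\<in>Pow X. of_int (\<Sum>c\<in>C. chr v c) * \<i> ^ card v)"
    using sum_chr[OF X(1) C(1)] by (intro sum.cong) auto
  also have "\<dots> = (\<Sum>v\<in>Pow X. \<Sum>c\<in>C. of_int (chr c v) * \<i> ^ card v)"
    by (simp add: sum_distrib_right chr_comm)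
  also have "\<dots> = (\<Sum>c\<in>C. \<Sum>v\<in>Pow X. of_int (chr c v) * \<i> ^ card v)"
    by (rule sum.swap)
  also have "\<dots> = (\<Sum>c\<in>C. 4096)"
    using gauss_sum_coset[OF X] code_onD(1)[OF C(1)] de by (intro sum.cong) auto
  finally have "(\<Sum>v\<in>?D. \<i> ^ card v) = 4096" using cC by simp
  then have "(\<Sum>v\<in>?D. if 4 dvd card v then 1 else -1) = (4096::complex)"
    using ev by (simp cong: sum.cong)
  moreover have "(\<Sum>v\<in>?D. if 4 dvd card v then 1 else -1)
    = (of_nat (card {v \<in> ?D. 4 dvd card v}) - of_nat (card {v \<in> ?D. \<not> 4 dvd card v}) :: complex)"
    using fD by (simp add: sum.If_cases Int_def)
  ultimately have "(of_nat (card {v \<in> ?D. 4 dvd card v}) :: complex) = of_nat (card {v \<in> ?D. \<not> 4 dvd card v} + 4096)"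
    by (simp add: algebra_simps)
  then show ?thesis by (simp only: of_nat_eq_iff)
qed

section \<open>The Golay code\<close>

lemma sum_group_by:
  fixes F :: "'b \<Rightarrow> int"
  assumes "finite C" "finite W" "\<And>c. c \<in> C \<Longrightarrow> g c \<in> W"
  shows "(\<Sum>c\<in>C. h c * F (g c)) = (\<Sum>w\<in>W. (\<Sum>c\<in>{c\<in>C. g c = w}. h c) * F w)"
proof -
  have "(\<Sum>c\<in>C. h c * F (g c)) = (\<Sum>w\<in>W. \<Sum>c\<in>{c\<in>C. g c = w}. h c * F (g c))"
    using assms by (intro sum.group[symmetric]) auto
  also have "\<dots> = (\<Sum>w\<in>W. (\<Sum>c\<in>{c\<in>C. g c = w}. h c) * F w)"
    by (intro sum.cong refl) (auto simp: sum_distrib_right)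
  finally show ?thesis .
qed

text \<open>Each coordinate contributes its pair on the diagonal, each word of weight 2 the two
  orderings of its elements.\<close>

lemma pair_count:
  assumes X: "finite X" and D: "D \<subseteq> Pow X" "{} \<in> D"
  shows "card {(i,j) \<in> X \<times> X. {i} \<triangle> {j} \<in> D} = card X + 2 * card {v \<in> D. card v = 2}"
proof -
  let ?E = "\<lambda>v. {(i,j). i \<noteq> j \<and> v = {i,j}}"
  have fD: "finite D" using X D by (meson finite_Pow_iff finite_subset)
  have c2: "card (?E v) = 2 \<and> finite (?E v)" if v: "v \<in> {v \<in> D. card v = 2}" for v
  proof -
    obtain a b where ab: "v = {a,b}" "a \<noteq> b" using v by (auto simp: card_2_iff)
    then have "?E v = {(a,b),(b,a)}" by (auto simp: doubleton_eq_iff)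
    then show ?thesis using ab by simp
  qed
  have "{(i,j) \<in> X \<times> X. {i} \<triangle> {j} \<in> D} = (\<lambda>i. (i,i)) ` X \<union> (\<Union>v\<in>{v \<in> D. card v = 2}. ?E v)"
  proof (rule set_eqI)
    fix p :: "'a \<times> 'a"
    obtain i j where p: "p = (i,j)" by (cases p)
    show "p \<in> {(i,j) \<in> X \<times> X. {i} \<triangle> {j} \<in> D} \<longleftrightarrow> p \<in> (\<lambda>i. (i,i)) ` X \<union> (\<Union>v\<in>{v \<in> D. card v = 2}. ?E v)"
    proof (cases "i = j")
      case True
      then show ?thesis using D(2) by (auto simp: p)
    next
      case False
      then have "{i} \<triangle> {j} = {i,j}" "card {i,j} = 2" by (auto simp: sym_diff_set_def)
      then show ?thesis using False D(1) by (auto simp: p)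
    qed
  qed
  moreover have "card ((\<lambda>i. (i,i)) ` X \<union> (\<Union>v\<in>{v \<in> D. card v = 2}. ?E v))
     = card ((\<lambda>i. (i,i)) ` X) + card (\<Union>v\<in>{v \<in> D. card v = 2}. ?E v)"
    using X fD c2 by (intro card_Un_disjoint) auto
  moreover have "card ((\<lambda>i. (i,i)) ` X) = card X" by (rule card_image) (auto simp: inj_on_def)
  moreover have "card (\<Union>v\<in>{v \<in> D. card v = 2}. ?E v) = (\<Sum>v\<in>{v \<in> D. card v = 2}. card (?E v))"
    using fD c2 by (intro card_UN_disjoint) auto
  moreover have "\<dots> = (\<Sum>v\<in>{v \<in> D. card v = 2}. 2)" using c2 by (intro sum.cong) auto
  ultimately show ?thesis by simp
qed

text \<open>The moments of order 0 and 2. Complementation pairs the weights \<open>w\<close> and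
  \<open>24 - w\<close>, so the coefficients of the second moment are
  \<open>2 * (24 - 2 * w) ^ 2\<close> for \<open>w < 12\<close>, and weight 12 drops out of
  it.\<close>

lemma even_weight_moments:
  fixes C :: "'a set set" and A :: "nat \<Rightarrow> nat"
  assumes X: "finite X" "card X = 24" and C: "code_on X C" "X \<in> C"
    and ev: "\<And>c. c \<in> C \<Longrightarrow> even (card c)"
  defines "A \<equiv> \<lambda>w. card {c \<in> C. card c = w}"
  shows "2 + 2 * A 2 + 2 * A 4 + 2 * A 6 + 2 * A 8 + 2 * A 10 + A 12 = card C"
    and "1152 + 800 * A 2 + 512 * A 4 + 288 * A 6 + 128 * A 8 + 32 * A 10
       = (24 + 2 * card {v \<in> dual_on X C. card v = 2}) * card C"
proof -
  have fC: "finite C" by (rule code_on_finite[OF X(1) C(1)])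
  define W :: "nat set" where "W = {0,2,4,6,8,10,12,14,16,18,20,22,24}"
  have W: "card c \<in> W" if cC: "c \<in> C" for c
  proof -
    have "card c \<le> 24" using that X code_onD(1)[OF C(1)] card_mono by metis
    moreover obtain k where "card c = 2 * k" using ev[OF cC] by auto
    ultimately have "k \<le> 12" by simp
    then have "k \<in> {0,1,2,3,4,5,6,7,8,9,10,11,12}" by (simp add: numeral_eq_Suc le_Suc_eq)
    then show ?thesis using \<open>card c = 2 * k\<close> by (auto simp: W_def)
  qed
  have A0: "A 0 = 1"
  proof -
    have "{c \<in> C. card c = 0} = {{}}"
      using code_onD(2)[OF C(1)] code_on_mem_finite[OF X(1) C(1)] by auto
    then show ?thesis by (simp add: A_def)
  qed
  have sym: "A (24 - w) = A w" if "w \<le> 24" for w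
    unfolding A_def
  proof (rule bij_betw_same_card[of "(\<triangle>) X"], rule bij_betwI[of _ _ _ "(\<triangle>) X"])
    have cc: "card (X \<triangle> c) = 24 - card c" "card c \<le> 24" "X \<triangle> c \<in> C" if "c \<in> C" for c
      using that X code_onD[OF C(1)] even_card_complement[OF X(1)] card_mono C(2) by metis+
    show "(\<triangle>) X \<in> {c \<in> C. card c = 24 - w} \<rightarrow> {c \<in> C. card c = w}"
      using cc \<open>w \<le> 24\<close> by auto
    show "(\<triangle>) X \<in> {c \<in> C. card c = w} \<rightarrow> {c \<in> C. card c = 24 - w}"
      using cc by auto
  qed auto
  have s: "A 14 = A 10" "A 16 = A 8" "A 18 = A 6" "A 20 = A 4" "A 22 = A 2" "A 24 = A 0"
    using sym[of 10] sym[of 8] sym[of 6] sym[of 4] sym[of 2] sym[of 0] by simp_all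
  have S: "(\<Sum>c\<in>C. F (card c)) = (\<Sum>w\<in>W. int (A w) * F w)" for F :: "nat \<Rightarrow> int"
    using sum_group_by[OF fC _ W, where h="\<lambda>_. 1" and F=F] by (simp add: W_def A_def)
  have "int (card C) = (\<Sum>c\<in>C. 1)" by simp
  also have "\<dots> = (\<Sum>w\<in>W. int (A w) * 1)" by (rule S)
  finally show "2 + 2 * A 2 + 2 * A 4 + 2 * A 6 + 2 * A 8 + 2 * A 10 + A 12 = card C"
    by (simp add: W_def s A0)
  have "(\<Sum>c\<in>C. (int (card X) - 2 * int (card c)) ^ 2) = (\<Sum>w\<in>W. int (A w) * (24 - 2 * int w) ^ 2)"
    using S[of "\<lambda>w. (24 - 2 * int w) ^ 2"] X by simp
  also have "\<dots> = int (1152 + 800 * A 2 + 512 * A 4 + 288 * A 6 + 128 * A 8 + 32 * A 10)"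
    by (simp add: W_def s A0)
  finally have "int (1152 + 800 * A 2 + 512 * A 4 + 288 * A 6 + 128 * A 8 + 32 * A 10)
      = int (card {(i,j) \<in> X \<times> X. {i} \<triangle> {j} \<in> dual_on X C} * card C)"
    using second_moment[OF X(1) C(1)] by simp
  moreover have "card {(i,j) \<in> X \<times> X. {i} \<triangle> {j} \<in> dual_on X C} = 24 + 2 * card {v \<in> dual_on X C. card v = 2}"
    using pair_count[OF X(1), of "dual_on X C"] X(2) code_on_dual[OF X(1), of C]
    by (simp add: code_on_def)
  ultimately show "1152 + 800 * A 2 + 512 * A 4 + 288 * A 6 + 128 * A 8 + 32 * A 10
       = (24 + 2 * card {v \<in> dual_on X C. card v = 2}) * card C"
    by (simp only: of_nat_eq_iff)
qed

text \<open>The 70 trivial triples consist of \<open>t\<close> and a repeated coordinate: 24 with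
  \<open>t\<close> in first place and 23 more for each of the other two places, since
  \<open>(t,t,t)\<close> is already counted. The remaining triples are the six orderings of each
  word of weight 4 through \<open>t\<close>; words of weight 2 are ruled out by
  divisibility.\<close>

lemma triple_count:
  assumes X: "finite X" "card X = 24" "t \<in> X" and D: "D \<subseteq> Pow X" "{} \<in> D"
    and de: "\<And>c. c \<in> D \<Longrightarrow> 4 dvd card c"
  shows "card {(i,j,k) \<in> X \<times> X \<times> X. {t} \<triangle> {i} \<triangle> {j} \<triangle> {k} \<in> D}
    = 70 + 6 * card {v \<in> D. card v = 4 \<and> t \<in> v}"
proof -
  let ?T = "{v \<in> D. card v = 4 \<and> t \<in> v}"
  let ?E = "\<lambda>v. {(i,j,k). distinct [t,i,j,k] \<and> v = {t,i,j,k}}"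
  let ?Z = "(\<lambda>j. (t,j,j)) ` X \<union> (\<lambda>i. (i,t,i)) ` (X - {t}) \<union> (\<lambda>i. (i,i,t)) ` (X - {t})"
  have fD: "finite D" using X D by (meson finite_Pow_iff finite_subset)
  have c6: "card (?E v) = 6 \<and> finite (?E v)" if v: "v \<in> ?T" for v
  proof -
    have "card (v - {t}) = 3" using v by simp
    then obtain a b c where abc: "v - {t} = {a,b,c}" "a \<noteq> b" "b \<noteq> c" "a \<noteq> c" by (auto simp: card_3_iff)
    have vt: "v = {t,a,b,c}" "t \<notin> {a,b,c}" using v abc(1) by auto
    have "?E v = {(a,b,c),(a,c,b),(b,a,c),(b,c,a),(c,a,b),(c,b,a)}" (is "_ = ?R")
    proof
      show "?R \<subseteq> ?E v" using vt abc by auto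
      show "?E v \<subseteq> ?R"
      proof
        fix p assume p: "p \<in> ?E v"
        obtain i j k where ijk: "p = (i,j,k)" by (cases p)
        with p have d: "distinct [t,i,j,k]" "v = {t,i,j,k}" by auto
        then have "{i,j,k} = v - {t}" by auto
        then have "{i,j,k} = {a,b,c}" using abc by simp
        then have "i \<in> {a,b,c}" "j \<in> {a,b,c}" "k \<in> {a,b,c}" by auto
        then show "p \<in> ?R" using d(1) unfolding ijk by auto
      qed
    qed
    then show ?thesis using abc by simp
  qed
  have eq: "{(i,j,k) \<in> X \<times> X \<times> X. {t} \<triangle> {i} \<triangle> {j} \<triangle> {k} \<in> D} = ?Z \<union> (\<Union>v\<in>?T. ?E v)" (is "?L = ?R")
  proof
    show "?L \<subseteq> ?R"
    proof
      fix p assume p: "p \<in> ?L"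
      obtain i j k where ijk: "p = (i,j,k)" by (cases p)
      with p have d: "i \<in> X" "j \<in> X" "k \<in> X" "{t} \<triangle> {i} \<triangle> {j} \<triangle> {k} \<in> D" by auto
      show "p \<in> ?R"
      proof (cases "distinct [t,i,j,k]")
        case True
        then have "{t} \<triangle> {i} \<triangle> {j} \<triangle> {k} = {t,i,j,k}" by (auto simp: sym_diff_set_def)
        moreover have "card {t,i,j,k} = 4" using True by simp
        ultimately show ?thesis using d True by (auto simp: ijk)
      next
        case False
        have no2: "x = y" if "{x} \<triangle> {y} \<in> D" for x y
        proof (rule ccontr)
          assume "x \<noteq> y"
          then have "{x} \<triangle> {y} = {x,y}" by (auto simp: sym_diff_set_def)
          then have "card ({x} \<triangle> {y}) = 2" using \<open>x \<noteq> y\<close> by simp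
          with de[OF that] show False by simp
        qed
        consider "i = t" | "j = t" "i \<noteq> t" | "k = t" "i \<noteq> t" "j \<noteq> t" | "i = j" "k \<noteq> t" | "i = k" "j \<noteq> t" | "j = k" "i \<noteq> t"
          using False by auto
        then show ?thesis
        proof cases
          case 1 then have "{j} \<triangle> {k} \<in> D" using d by (simp add: sd_ac)
          then have "j = k" by (rule no2)
          then show ?thesis using 1 d by (auto simp: ijk)
        next
          case 2 then have "{i} \<triangle> {k} \<in> D" using d by (simp add: sd_ac)
          then have "i = k" by (rule no2)
          then show ?thesis using 2 d by (auto simp: ijk)
        next
          case 3 then have "{i} \<triangle> {j} \<in> D" using d by (simp add: sd_ac)
          then have "i = j" by (rule no2)
          then show ?thesis using 3 d by (auto simp: ijk)
        next
          case 4 then have "{t} \<triangle> {k} \<in> D" using d by (simp add: sd_ac)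
          then show ?thesis using no2 4 by metis
        next
          case 5 then have "{t} \<triangle> {j} \<in> D" using d by (simp add: sd_ac)
          then show ?thesis using no2 5 by metis
        next
          case 6 then have "{t} \<triangle> {i} \<in> D" using d by (simp add: sd_ac)
          then show ?thesis using no2 6 by metis
        qed
      qed
    qed
    show "?R \<subseteq> ?L"
    proof
      fix p assume p: "p \<in> ?R"
      then consider j where "p = (t,j,j)" "j \<in> X" | i where "p = (i,t,i)" "i \<in> X" | i where "p = (i,i,t)" "i \<in> X"
        | i j k where "p = (i,j,k)" "distinct [t,i,j,k]" "{t,i,j,k} \<in> D"
        by auto
      then show "p \<in> ?L"
      proof cases
        case 4
        then have "{t} \<triangle> {i} \<triangle> {j} \<triangle> {k} = {t,i,j,k}" by (auto simp: sym_diff_set_def)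
        moreover have "{i,j,k} \<subseteq> X" using 4 D by auto
        ultimately show ?thesis using 4 by auto
      qed (use X D in \<open>simp_all add: sd_ac\<close>)
    qed
  qed
  have "card ?Z = 70"
  proof -
    have "card ((\<lambda>j. (t,j,j)) ` X) = 24" using X by (subst card_image) (auto simp: inj_on_def)
    moreover have "card ((\<lambda>i. (i,t,i)) ` (X - {t})) = 23" using X by (subst card_image) (auto simp: inj_on_def)
    moreover have "card ((\<lambda>i. (i,i,t)) ` (X - {t})) = 23" using X by (subst card_image) (auto simp: inj_on_def)
    moreover have "card ?Z = card ((\<lambda>j. (t,j,j)) ` X) + card ((\<lambda>i. (i,t,i)) ` (X - {t})) + card ((\<lambda>i. (i,i,t)) ` (X - {t}))"
      using X by (subst card_Un_disjoint, simp, simp, force, subst card_Un_disjoint) auto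
    ultimately show ?thesis by simp
  qed
  moreover have "card (?Z \<union> (\<Union>v\<in>?T. ?E v)) = card ?Z + card (\<Union>v\<in>?T. ?E v)"
    using X fD c6 by (intro card_Un_disjoint) auto
  moreover have "card (\<Union>v\<in>?T. ?E v) = (\<Sum>v\<in>?T. card (?E v))"
    using fD c6 by (intro card_UN_disjoint) auto
  moreover have "\<dots> = (\<Sum>v\<in>?T. 6)" using c6 by (intro sum.cong) auto
  ultimately show ?thesis unfolding eq by simp
qed

text \<open>Obtained by comparing the signed first and third moments; it makes the words of weight 4 a 1-design.\<close>

lemma doubly_even_self_dual_tetrads:
  assumes X: "finite X" "card X = 24" "t \<in> X" and D: "code_on X D" "dual_on X D = D" "X \<in> D"
    and de: "\<And>c. c \<in> D \<Longrightarrow> 4 dvd card c"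
  shows "card {c \<in> D. card c = 4 \<and> t \<notin> c} = 5 * card {c \<in> D. card c = 4 \<and> t \<in> c}"
proof -
  have fD: "finite D" by (rule code_on_finite[OF X(1) D(1)])
  have cD: "card D = 4096"
  proof -
    have "card D * card D = 4096 * 4096" using card_dual_on[OF X(1) D(1)] X D by simp
    then show ?thesis by (metis power2_eq_iff_nonneg power2_eq_square zero_le)
  qed
  define W :: "nat set" where "W = {0,4,8,12,16,20,24}"
  define s where "s w = (\<Sum>c\<in>{c\<in>D. card c = w}. chr {t} c)" for w
  have W: "card c \<in> W" if cD: "c \<in> D" for c
  proof -
    have "card c \<le> 24" using that X code_onD(1)[OF D(1)] card_mono by metis
    moreover obtain k where "card c = 4 * k" using de[OF cD] by auto
    ultimately have "k \<le> 6" by simp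
    then have "k \<in> {0,1,2,3,4,5,6}" by (simp add: numeral_eq_Suc le_Suc_eq)
    then show ?thesis using \<open>card c = 4 * k\<close> by (auto simp: W_def)
  qed
  have s0: "s 0 = 1"
  proof -
    have "{c \<in> D. card c = 0} = {{}}"
      using code_onD(2)[OF D(1)] code_on_mem_finite[OF X(1) D(1)] by auto
    then show ?thesis by (simp add: s_def chr_def)
  qed
  \<comment> \<open>Exactly one of a word and its complement contains \<open>t\<close>, hence the
    signed counts for \<open>w\<close> and \<open>24 - w\<close> are opposite; in particular the one
    for weight 12 vanishes.\<close>
  have sym: "s (24 - w) = - s w" if "w \<le> 24" for w
  proof -
    have cc: "card (X \<triangle> c) = 24 - card c" "card c \<le> 24" "X \<triangle> c \<in> D" "chr {t} (X \<triangle> c) = - chr {t} c" if "c \<in> D" for c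
    proof -
      show "card (X \<triangle> c) = 24 - card c" "card c \<le> 24" "X \<triangle> c \<in> D"
        using that X code_onD[OF D(1)] even_card_complement[OF X(1)] card_mono D(3) by metis+
      have "chr {t} (X \<triangle> c) = chr {t} X * chr {t} c"
        using code_on_mem_finite[OF X(1) D(1) that] X by (simp add: chr_sd)
      also have "chr {t} X = -1" using X by (simp add: chr_def)
      finally show "chr {t} (X \<triangle> c) = - chr {t} c" by simp
    qed
    have "s (24 - w) = (\<Sum>c\<in>{c\<in>D. card c = w}. - chr {t} c)"
      unfolding s_def
      by (rule sum.reindex_bij_witness[of _ "(\<triangle>) X" "(\<triangle>) X"]) (use cc that in auto)
    then show ?thesis by (simp add: s_def sum_negf)
  qed
  have s12: "s 12 = 0" using sym[of 12] by simp
  have ss: "s 16 = - s 8" "s 20 = - s 4" "s 24 = - s 0"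
    using sym[of 8] sym[of 4] sym[of 0] by simp_all
  have S: "(\<Sum>c\<in>D. chr {t} c * F (card c)) = (\<Sum>w\<in>W. s w * F w)" for F :: "nat \<Rightarrow> int"
    using sum_group_by[OF fD _ W, where h="chr {t}" and F=F] by (simp add: W_def s_def)
  have "{i \<in> X. {t} \<triangle> {i} \<in> D} = {t}"
  proof -
    have False if "i \<noteq> t" "{t} \<triangle> {i} \<in> D" for i
    proof -
      have "{t} \<triangle> {i} = {t,i}" using that by (auto simp: sym_diff_set_def)
      then have "card ({t} \<triangle> {i}) = 2" using that(1) by simp
      then show False using de[OF that(2)] by simp
    qed
    then show ?thesis using X code_onD(2)[OF D(1)] by auto
  qed
  then have "(\<Sum>c\<in>D. chr {t} c * (24 - 2 * int (card c))) = 4096"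
    using signed_first_moment[OF X(1) D(1) X(3)] X(2) D(2) cD by simp
  \<comment> \<open>The coefficients are \<open>2 * (24 - 2 * w)\<close>, and
    \<open>2 * (24 - 2 * w) ^ 3\<close> in the third moment below. The right-hand side is the size
    of \<open>D\<close>, as only the index \<open>t\<close> itself survives.\<close>
  then have e1: "48 + 32 * s 4 + 16 * s 8 = 4096"
    using S[of "\<lambda>w. 24 - 2 * int w"] by (simp add: W_def ss s0 s12)
  define r where "r = card {c \<in> D. card c = 4 \<and> t \<in> c}"
  have "(\<Sum>c\<in>D. chr {t} c * (24 - 2 * int (card c)) ^ 3) = (70 + 6 * int r) * 4096"
    using signed_third_moment[OF X(1) D(1) X(3)] X(2) D(2) cD
      triple_count[OF X _ code_onD(2)[OF D(1)] de] D(1) unfolding r_def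
    by (simp add: code_on_def)
  then have e3: "27648 + 8192 * s 4 + 1024 * s 8 = (70 + 6 * int r) * 4096"
    using S[of "\<lambda>w. (24 - 2 * int w) ^ 3"] by (simp add: W_def ss s0 s12)
  have "s 8 = 253 - 2 * s 4" using e1 by simp
  with e3 have "s 4 = 4 * int r" by simp
  moreover have "s 4 = int (card {c \<in> D. card c = 4 \<and> t \<notin> c}) - int r"
  proof -
    have "s 4 = (\<Sum>c\<in>{c\<in>D. card c = 4}. if t \<in> c then -1 else 1)"
      unfolding s_def by (intro sum.cong) (auto simp: chr_def)
    also have "\<dots> = int (card ({c\<in>D. card c = 4} \<inter> - {c. t \<in> c})) - int (card ({c\<in>D. card c = 4} \<inter> {c. t \<in> c}))"
      using fD by (simp add: sum.If_cases)
    also have "{c\<in>D. card c = 4} \<inter> - {c. t \<in> c} = {c \<in> D. card c = 4 \<and> t \<notin> c}" by auto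
    also have "{c\<in>D. card c = 4} \<inter> {c. t \<in> c} = {c \<in> D. card c = 4 \<and> t \<in> c}" by auto
    finally show ?thesis by (simp add: r_def)
  qed
  ultimately show ?thesis unfolding r_def by linarith
qed

section \<open>From a weight bound off one coordinate to a Golay code\<close>

definition golay :: "'a set \<Rightarrow> 'a set set \<Rightarrow> bool" where
  "golay X D \<longleftrightarrow> finite X \<and> card X = 24 \<and> code_on X D \<and> dual_on X D = D \<and> X \<in> D \<and>
     (\<forall>c\<in>D. 4 dvd card c) \<and> (\<forall>c\<in>D. c \<noteq> {} \<longrightarrow> 8 \<le> card c)"

text \<open>Intended for the fixed-point code, extended by a zero coordinate \<open>t\<close> and
  then by the all-one word. Words avoiding \<open>t\<close> come from the original code and inherit
  its weight bound; words through \<open>t\<close> are complements of these and might a priori be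
  light.\<close>

locale pregolay =
  fixes X :: "'a set" and K :: "'a set set" and t :: 'a
  assumes fX: "finite X" and cX: "card X = 24" and tX: "t \<in> X"
    and K: "code_on X K" and XK: "X \<in> K" and so: "K \<subseteq> dual_on X K" and cK: "card K = 2048"
    and low: "\<And>c. c \<in> K \<Longrightarrow> t \<notin> c \<Longrightarrow> c \<noteq> {} \<Longrightarrow> 8 \<le> card c"
begin

lemma finK: "finite K" and finw: "c \<in> K \<Longrightarrow> finite c"
  using code_on_finite[OF fX K] code_on_mem_finite[OF fX K] by auto

lemma orthK: "c \<in> K \<Longrightarrow> d \<in> K \<Longrightarrow> even (card (c \<inter> d))"
  using so by (auto simp: dual_on_def)

lemma evenK: "c \<in> K \<Longrightarrow> even (card c)"
  using orthK[of c c] by simp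

lemma card_dualK: "card (dual_on X K) = 8192"
  using card_dual_on[OF fX K] cX cK by simp

lemma four_dvd_sd:
  assumes "finite a" "finite b" "even (card (a \<inter> b))" "4 dvd card b"
  shows "4 dvd card (a \<triangle> b) \<longleftrightarrow> 4 dvd card a"
  using card_sd[OF assms(1,2)] assms(3,4) by presburger

text \<open>The dual is a union of four cosets of \<open>K\<close>, of which the Gauss sum makes
  three doubly even: \<open>K\<close> and the cosets of \<open>x\<close> and \<open>y\<close>. Each
  of the last two completes \<open>K\<close> to a doubly even self-dual code. If neither were a
  Golay code, each would have at least five words of weight 4 avoiding \<open>t\<close>. Within one
  of the codes these are pairwise disjoint, across the two codes they meet oddly: a set of four
  points would have to meet five disjoint sets.\<close>

lemma doubly_even_extends:
  assumes de: "\<And>c. c \<in> K \<Longrightarrow> 4 dvd card c"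
  shows "\<exists>D. golay X D \<and> K \<subseteq> D"
proof -
  let ?P = "dual_on X K"
  let ?Q = "{v \<in> ?P. 4 dvd card v}"
  have P: "code_on X ?P" by (rule code_on_dual[OF fX])
  have fP: "finite ?P" by (rule finite_dual_on[OF fX])
  have fPw: "finite v" if "v \<in> ?P" for v using code_on_mem_finite[OF fX P that] .
  have "card ?Q + card {v \<in> ?P. \<not> 4 dvd card v} = card ?P"
  proof -
    have "?P = ?Q \<union> {v \<in> ?P. \<not> 4 dvd card v}" by auto
    then show ?thesis using fP by (metis (no_types, lifting) card_Un_disjoint disjoint_iff finite_Un mem_Collect_eq)
  qed
  then have cQ: "card ?Q = 6144"
    using doubly_even_dual_counts[OF fX cX K XK de] card_dualK by simp
  have KQ: "K \<subseteq> ?Q" using so de by auto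
  have coset: "card ((\<triangle>) x ` K) = 2048" for x
    using card_image[OF inj_sd] cK by metis
  have ext: "code_on X (K \<union> (\<triangle>) x ` K)" "dual_on X (K \<union> (\<triangle>) x ` K) = K \<union> (\<triangle>) x ` K"
    "K \<union> (\<triangle>) x ` K \<subseteq> ?Q" "card (K \<union> (\<triangle>) x ` K) = 4096"
    if x: "x \<in> ?Q - K" for x
  proof -
    let ?D = "K \<union> (\<triangle>) x ` K"
    have xX: "x \<subseteq> X" using x by (auto simp: dual_on_def)
    show c: "code_on X ?D" by (rule code_on_coset_union[OF K xX])
    have "K \<inter> (\<triangle>) x ` K = {}"
    proof -
      have "x \<in> K" if "c \<in> K" "c = x \<triangle> k" "k \<in> K" for c k
      proof -
        have "c \<triangle> k = x" using that by (simp add: sd_ac)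
        then show ?thesis using code_onD(3)[OF K that(1,3)] by simp
      qed
      then show ?thesis using x by auto
    qed
    then show cd: "card ?D = 4096"
      using coset[of x] cK finK by (simp add: card_Un_disjoint)
    have m: "x \<triangle> k \<in> ?Q" if "k \<in> K" for k
    proof -
      have "x \<triangle> k \<in> ?P" using code_onD(3)[OF P, of x k] x so that by auto
      moreover have "even (card (x \<inter> k))" using x that by (auto simp: dual_on_def)
      ultimately show ?thesis using four_dvd_sd[of x k] x de[OF that] finw[OF that] fPw[of x] by auto
    qed
    then show DQ: "?D \<subseteq> ?Q" using KQ by auto
    have "?D \<subseteq> dual_on X ?D"
    proof
      fix d assume d: "d \<in> ?D"
      have "even (card (d \<inter> e))" if e: "e \<in> ?D" for e
      proof -
        have "d \<triangle> e \<in> ?Q" using code_onD(3)[OF c d e] DQ by auto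
        then have "4 dvd card (d \<triangle> e)" "4 dvd card d" "4 dvd card e" "finite d" "finite e" using DQ d e fPw by auto
        then show ?thesis using card_sd[of d e] by presburger
      qed
      then show "d \<in> dual_on X ?D" using code_onD(1)[OF c d] by (auto simp: dual_on_def)
    qed
    then show "dual_on X ?D = ?D"
      by (rule self_dual_if_card[OF fX c]) (simp add: cd cX)
  qed
  have "\<not> ?Q \<subseteq> K"
  proof
    assume "?Q \<subseteq> K" then show False using card_mono[OF finK, of ?Q] cQ cK by simp
  qed
  then obtain x where x: "x \<in> ?Q - K" by auto
  define D1 where "D1 = K \<union> (\<triangle>) x ` K"
  note E1 = ext[OF x, folded D1_def]
  have fD1: "finite D1" using code_on_finite[OF fX E1(1)] .
  have "\<not> ?Q \<subseteq> D1"
  proof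
    assume "?Q \<subseteq> D1" then show False using card_mono[OF fD1, of ?Q] cQ E1(4) by simp
  qed
  then obtain y where y: "y \<in> ?Q" "y \<notin> D1" by auto
  then have y': "y \<in> ?Q - K" by (auto simp: D1_def)
  define D2 where "D2 = K \<union> (\<triangle>) y ` K"
  note E2 = ext[OF y', folded D2_def]
  \<comment> \<open>Otherwise all four cosets would be doubly even, giving 8192 words where only
    6144 exist.\<close>
  have odd_xy: "odd (card (x \<inter> y))"
  proof
    assume e: "even (card (x \<inter> y))"
    have DP: "D1 \<subseteq> ?P" using E1(3) by auto
    have "(\<triangle>) y ` D1 \<subseteq> ?Q"
    proof
      fix z assume "z \<in> (\<triangle>) y ` D1"
      then obtain d where d: "d \<in> D1" "z = y \<triangle> d" by auto
      have "y \<triangle> d \<in> ?P" using code_onD(3)[OF P] y d DP by auto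
      moreover have "even (card (y \<inter> d))"
      proof -
        obtain k where k: "k \<in> K" "d = k \<or> d = x \<triangle> k" using d by (auto simp: D1_def)
        have "even (card (y \<inter> k))" using y k by (auto simp: dual_on_def)
        then show ?thesis using k e fPw[of x] x finw[of k] by (auto simp: even_meet_sd Int_commute)
      qed
      ultimately show "z \<in> ?Q" using four_dvd_sd[of y d] d E1(3) y fPw by auto
    qed
    moreover have "D1 \<inter> (\<triangle>) y ` D1 = {}"
    proof -
      have False if "c \<in> D1" "c = y \<triangle> k" "k \<in> D1" for c k
      proof -
        have "c \<triangle> k = y" using that by (simp add: sd_ac)
        then show ?thesis using code_onD(3)[OF E1(1) that(1,3)] y by simp
      qed
      then show ?thesis by auto
    qed
    moreover have "card ((\<triangle>) y ` D1) = 4096" using card_image[OF inj_sd] E1(4) by metis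
    ultimately have "card (D1 \<union> (\<triangle>) y ` D1) = 8192" "D1 \<union> (\<triangle>) y ` D1 \<subseteq> ?Q"
      using fD1 E1(3,4) by (auto simp: card_Un_disjoint)
    then show False using card_mono[of ?Q "D1 \<union> (\<triangle>) y ` D1"] fP cQ by simp
  qed
  have meet: "odd (card (d \<inter> e))" if de: "d \<in> D1 - K" "e \<in> D2 - K" for d e
  proof -
    obtain k l where kl: "k \<in> K" "d = x \<triangle> k" "l \<in> K" "e = y \<triangle> l" using de by (auto simp: D1_def D2_def)
    have "even (card (k \<inter> y))" "even (card (x \<inter> l))" "even (card (k \<inter> l))"
      using y x kl orthK by (auto simp: dual_on_def Int_commute)
    then show ?thesis using odd_xy x y kl finw fPw by (simp add: even_meet_sd)
  qed
  \<comment> \<open>The sum of the two words lies in \<open>K\<close> and avoids \<open>t\<close>,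
    so it has weight at least 8, which leaves no room for an intersection.\<close>
  have disj: "c \<inter> d = {}" if D: "D = K \<union> (\<triangle>) z ` K" "z \<in> ?Q - K"
      and c: "c \<in> D" "card c = 4" "t \<notin> c" and d: "d \<in> D" "card d = 4" "t \<notin> d" and "c \<noteq> d" for D z c d
  proof -
    have "c \<notin> K" "d \<notin> K" using low c d by fastforce+
    then obtain k l where kl: "k \<in> K" "c = z \<triangle> k" "l \<in> K" "d = z \<triangle> l" using D c d by auto
    have "c \<triangle> d = k \<triangle> l" unfolding kl by (simp add: sd_ac)
    then have "c \<triangle> d \<in> K" using code_onD(3)[OF K] kl by simp
    moreover have "t \<notin> c \<triangle> d" using c d by (auto simp: in_sd)
    moreover have "c \<triangle> d \<noteq> {}" using \<open>c \<noteq> d\<close> by simp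
    ultimately have "8 \<le> card (c \<triangle> d)" using low by blast
    moreover have "finite c" "finite d" using c d by (auto intro: card_ge_0_finite)
    ultimately have "card (c \<inter> d) = 0" using card_sd[of c d] c d by linarith
    then show ?thesis using \<open>finite c\<close> by simp
  qed
  \<comment> \<open>A nonzero word lighter than 8 has weight 4; since those avoiding
    \<open>t\<close> are five times as many as those through \<open>t\<close>, there are at least
    five of them.\<close>
  have many: "5 \<le> card {c \<in> D. card c = 4 \<and> t \<notin> c}" if D: "D = K \<union> (\<triangle>) z ` K" "z \<in> ?Q - K"
      and g: "\<not> golay X D" for D z
  proof -
    note E = ext[OF D(2), folded D(1)]
    have de: "\<forall>c\<in>D. 4 dvd card c" using E(3) by auto
    have fD: "finite D" using code_on_finite[OF fX E(1)] .
    have XD: "X \<in> D" using D XK by auto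
    obtain c where c: "c \<in> D" "c \<noteq> {}" "\<not> 8 \<le> card c"
      using g E(1,2) fX cX XD de unfolding golay_def by blast
    have "card c \<noteq> 0" using c code_on_mem_finite[OF fX E(1)] by auto
    then have c4: "card c = 4" using de c by (auto elim!: dvdE)
    have "card {c \<in> D. card c = 4 \<and> t \<notin> c} = 5 * card {c \<in> D. card c = 4 \<and> t \<in> c}"
      using doubly_even_self_dual_tetrads[OF fX cX tX E(1,2) XD] de by auto
    moreover have "card {c \<in> D. card c = 4 \<and> t \<notin> c} > 0 \<or> card {c \<in> D. card c = 4 \<and> t \<in> c} > 0"
      using c(1) c4 fD by (auto simp: card_gt_0_iff)
    ultimately show ?thesis by (cases "card {c \<in> D. card c = 4 \<and> t \<in> c} = 0") auto
  qed
  show ?thesis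
  proof (rule ccontr)
    assume n: "\<nexists>D. golay X D \<and> K \<subseteq> D"
    have n1: "\<not> golay X D1" and n2: "\<not> golay X D2" using n by (auto simp: D1_def D2_def)
    let ?T1 = "{c \<in> D1. card c = 4 \<and> t \<notin> c}"
    have m1: "5 \<le> card ?T1" by (rule many[OF D1_def x n1])
    have m2: "5 \<le> card {c \<in> D2. card c = 4 \<and> t \<notin> c}" by (rule many[OF D2_def y' n2])
    then have "{c \<in> D2. card c = 4 \<and> t \<notin> c} \<noteq> {}" by (metis card.empty not_numeral_le_zero)
    then obtain e where e: "e \<in> D2" "card e = 4" "t \<notin> e" by auto
    have eK: "e \<notin> K" using low e by fastforce
    have fe: "finite e" using e by (auto intro: card_ge_0_finite)
    have "1 \<le> card (c \<inter> e)" if "c \<in> ?T1" for c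
    proof -
      have "c \<notin> K" using low that by fastforce
      then have "odd (card (c \<inter> e))" using meet[of c e] that e eK by auto
      then show ?thesis by (metis Suc_leI One_nat_def odd_pos)
    qed
    then have "card ?T1 * 1 \<le> (\<Sum>c\<in>?T1. card (c \<inter> e))"
      by (metis (no_types, lifting) sum_bounded_below of_nat_id)
    also have "\<dots> = card (\<Union>c\<in>?T1. c \<inter> e)"
    proof (rule card_UN_disjoint[symmetric])
      show "finite ?T1" using fD1 by simp
      show "\<forall>c\<in>?T1. \<forall>d\<in>?T1. c \<noteq> d \<longrightarrow> (c \<inter> e) \<inter> (d \<inter> e) = {}"
        using disj[OF D1_def x] by blast
    qed (use fe in auto)
    also have "\<dots> \<le> card e" using fe by (intro card_mono) auto
    finally show False using m1 e by simp
  qed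
qed

text \<open>Both words contain \<open>t\<close>, hence meet, and being orthogonal they share at
  least 2 coordinates. Their sum is nonzero and avoids \<open>t\<close>, so it has weight at least
  8; two weights of at most 6 only just allow this.\<close>

lemma low_words:
  assumes c: "c \<in> K" "c \<noteq> {}" "card c \<le> 6" and d: "d \<in> K" "d \<noteq> {}" "card d \<le> 6" and "c \<noteq> d"
  shows "card c = 6" "card d = 6" "card (c \<inter> d) = 2" "t \<in> c" "t \<in> d"
proof -
  show t: "t \<in> c" "t \<in> d" using low c d by fastforce+
  have f: "finite c" "finite d" using finw c d by auto
  have "8 \<le> card (c \<triangle> d)"
    using low[of "c \<triangle> d"] code_onD(3)[OF K c(1) d(1)] t \<open>c \<noteq> d\<close> by (auto simp: in_sd)
  moreover have "card (c \<inter> d) \<noteq> 0" using t f by auto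
  then have "2 \<le> card (c \<inter> d)" using orthK[OF c(1) d(1)] by presburger
  ultimately show "card c = 6" "card d = 6" "card (c \<inter> d) = 2"
    using card_sd[OF f] c(3) d(3) by linarith+
qed

text \<open>Deleting \<open>t\<close> turns the words of weight 6 into 5-sets on 23 points, any two
  sharing exactly one point. If \<open>r p\<close> of them pass through \<open>p\<close>, then the
  sums of \<open>r p\<close> and of its square are \<open>5 * n\<close> and
  \<open>n * (n + 4)\<close>; as \<open>r p\<close> is at most 5, this gives
  \<open>n + 4 \<le> 25\<close>.\<close>

lemma card_weight_6: "card {c \<in> K. card c = 6} \<le> 21"
proof -
  let ?S = "{c \<in> K. card c = 6}" and ?Y = "X - {t}"
  define n where "n = card ?S"
  define r where "r p = card {c \<in> ?S. p \<in> c}" for p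
  have fS: "finite ?S" using finK by simp
  have ne: "c \<noteq> {}" if "c \<in> ?S" for c using that by auto
  show ?thesis
  proof (cases "n \<le> 1")
    case False
    have tc: "t \<in> c" if "c \<in> ?S" for c
      using low that by fastforce
    have two: "card (c \<inter> d) = 2" if "c \<in> ?S" "d \<in> ?S" "c \<noteq> d" for c d
      using low_words(3)[of c d] that ne by simp
    have cY: "card (c \<inter> ?Y) = 5" if "c \<in> ?S" for c
    proof -
      have "c \<inter> ?Y = c - {t}" using that code_onD(1)[OF K] by auto
      then show ?thesis using that tc[OF that] by simp
    qed
    have cdY: "card (c \<inter> d \<inter> ?Y) = 1" if "c \<in> ?S" "d \<in> ?S" "c \<noteq> d" for c d
    proof -
      have "c \<inter> d \<inter> ?Y = c \<inter> d - {t}" using that code_onD(1)[OF K] by auto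
      then show ?thesis using two[OF that] tc that by simp
    qed
    have cs: "card {c \<in> A. P c} = (\<Sum>c\<in>A. if P c then 1 else 0)" if "finite A" for A :: "'b set" and P
      using that by (simp add: sum.If_cases Int_def)
    have R1: "(\<Sum>p\<in>?Y. r p) = 5 * n"
    proof -
      have "(\<Sum>p\<in>?Y. r p) = (\<Sum>p\<in>?Y. \<Sum>c\<in>?S. if p \<in> c then 1 else 0)"
        unfolding r_def by (intro sum.cong refl cs[OF fS])
      also have "\<dots> = (\<Sum>c\<in>?S. \<Sum>p\<in>?Y. if p \<in> c then 1 else 0)" by (rule sum.swap)
      also have "\<dots> = (\<Sum>c\<in>?S. card (c \<inter> ?Y))"
        using fX by (intro sum.cong refl) (simp add: sum.If_cases Int_commute)
      also have "\<dots> = (\<Sum>c\<in>?S. 5)" using cY by (intro sum.cong) auto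
      finally show ?thesis by (simp add: n_def)
    qed
    have R2: "(\<Sum>p\<in>?Y. r p * r p) = n * (n + 4)"
    proof -
      have "r p * r p = (\<Sum>c\<in>?S. \<Sum>d\<in>?S. if p \<in> c \<inter> d then 1 else 0)" for p
      proof -
        have "r p * r p = (\<Sum>c\<in>?S. if p \<in> c then 1 else 0) * (\<Sum>d\<in>?S. if p \<in> d then 1 else 0)"
          unfolding r_def by (simp only: cs[OF fS])
        also have "\<dots> = (\<Sum>c\<in>?S. \<Sum>d\<in>?S. (if p \<in> c then 1 else 0) * (if p \<in> d then 1 else 0))"
          by (rule sum_product)
        also have "\<dots> = (\<Sum>c\<in>?S. \<Sum>d\<in>?S. if p \<in> c \<inter> d then 1 else 0)"
          by (intro sum.cong refl) auto
        finally show ?thesis .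
      qed
      then have "(\<Sum>p\<in>?Y. r p * r p) = (\<Sum>p\<in>?Y. \<Sum>c\<in>?S. \<Sum>d\<in>?S. if p \<in> c \<inter> d then 1 else 0)" by simp
      also have "\<dots> = (\<Sum>c\<in>?S. \<Sum>d\<in>?S. \<Sum>p\<in>?Y. if p \<in> c \<inter> d then 1 else 0)"
        by (subst sum.swap, rule sum.cong[OF refl], subst sum.swap, rule refl)
      also have "\<dots> = (\<Sum>c\<in>?S. \<Sum>d\<in>?S. card (c \<inter> d \<inter> ?Y))"
      proof -
        have "(\<Sum>p\<in>?Y. if p \<in> e then 1 else 0) = card (e \<inter> ?Y)" for e
          using fX by (simp add: sum.If_cases Int_commute)
        then show ?thesis by (simp only:)
      qed
      also have "\<dots> = (\<Sum>c\<in>?S. \<Sum>d\<in>?S. if d = c then 5 else 1)"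
        using cY cdY by (intro sum.cong refl) auto
      also have "\<dots> = (\<Sum>c\<in>?S. n + 4)"
      proof (rule sum.cong[OF refl])
        fix c assume c: "c \<in> ?S"
        have "(\<Sum>d\<in>?S. if d = c then 5 else 1) = (\<Sum>d\<in>?S. 1 + (if d = c then 4 else 0 :: nat))"
          by (intro sum.cong) auto
        also have "\<dots> = (\<Sum>d\<in>?S. 1) + (\<Sum>d\<in>?S. if d = c then 4 else 0)" by (rule sum.distrib)
        also have "\<dots> = n + 4" using c fS by (simp add: n_def)
        finally show "(\<Sum>d\<in>?S. if d = c then 5 else 1) = n + 4" .
      qed
      finally show ?thesis by (simp add: n_def)
    qed
    \<comment> \<open>The words through \<open>t\<close> and \<open>p\<close> are otherwise
      disjoint, and their four further points each must fit into 22 coordinates.\<close>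
    have r5: "r p \<le> 5" if p: "p \<in> ?Y" for p
    proof -
      let ?R = "{c \<in> ?S. p \<in> c}"
      have "card (\<Union>c\<in>?R. c - {t,p}) = (\<Sum>c\<in>?R. card (c - {t,p}))"
      proof (rule card_UN_disjoint)
        show "\<forall>c\<in>?R. \<forall>d\<in>?R. c \<noteq> d \<longrightarrow> (c - {t,p}) \<inter> (d - {t,p}) = {}"
        proof (intro ballI impI)
          fix c d assume cd: "c \<in> ?R" "d \<in> ?R" "c \<noteq> d"
          have "{t,p} \<subseteq> c \<inter> d" using cd tc by auto
          moreover have "card {t,p} = 2" using p by auto
          ultimately have "c \<inter> d = {t,p}" using two[of c d] cd finw[of c]
            by (metis (no_types, lifting) card_subset_eq finite_Int mem_Collect_eq)
          then show "(c - {t,p}) \<inter> (d - {t,p}) = {}" by auto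
        qed
      qed (use finK finw in auto)
      also have "\<dots> = (\<Sum>c\<in>?R. 4)"
      proof (rule sum.cong[OF refl])
        fix c assume c: "c \<in> ?R"
        have "{t,p} \<subseteq> c" "card {t,p} = 2" using c tc p by auto
        then show "card (c - {t,p}) = 4" using c finw by (simp add: card_Diff_subset)
      qed
      finally have "card (\<Union>c\<in>?R. c - {t,p}) = 4 * r p" by (simp add: r_def)
      moreover have "card (\<Union>c\<in>?R. c - {t,p}) \<le> card (X - {t,p})"
        using fX code_onD(1)[OF K] by (intro card_mono) auto
      moreover have "card (X - {t,p}) = 22"
      proof -
        have "card {t,p} = 2" using p by auto
        then show ?thesis using fX cX tX p by (simp add: card_Diff_subset)
      qed
      ultimately show ?thesis by simp
    qed
    have "n * (n + 4) \<le> (\<Sum>p\<in>?Y. 5 * r p)"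
      unfolding R2[symmetric] using r5 by (intro sum_mono mult_right_mono) auto
    also have "\<dots> = 25 * n" using R1 by (simp add: sum_distrib_left[symmetric])
    finally have "n + 4 \<le> 25" using False by (simp add: mult.commute)
    then show ?thesis by (simp add: n_def)
  qed (simp add: n_def)
qed

text \<open>Otherwise the doubly even words form a subcode \<open>K0\<close> of index 2. The moments
  of \<open>K\<close> and \<open>K0\<close> together tie the numbers of words of weight 2 and 6 in
  \<open>K\<close> to those of weight 2 in the duals, and demand many of them. But light words are
  scarce: two words of weight 2 in \<open>Q\<close> add up to a codeword of weight at most 4, two
  light codewords both have weight 6 by \<open>low_words\<close>, and at most 21 have weight
  6.\<close>

lemma weights_div_4:
  assumes "c \<in> K" shows "4 dvd card c"
proof (rule ccontr)
  assume c: "\<not> 4 dvd card c"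
  define s where "s = c"
  have s: "s \<in> K" "\<not> 4 dvd card s" using assms c by (auto simp: s_def)
  define K0 where "K0 = {c \<in> K. 4 dvd card c}"
  let ?P = "dual_on X K" and ?PZ = "dual_on X K0"
  have K0: "code_on X K0"
    unfolding code_on_def K0_def
  proof (intro conjI ballI)
    fix a b assume "a \<in> {c \<in> K. 4 dvd card c}" "b \<in> {c \<in> K. 4 dvd card c}"
    then show "a \<triangle> b \<in> {c \<in> K. 4 dvd card c}"
      using code_onD(3)[OF K] four_dvd_sd[of a b] orthK finw by auto
  qed (use code_onD[OF K] in auto)
  have XK0: "X \<in> K0" using XK cX by (simp add: K0_def)
  have de0: "4 dvd card c" if "c \<in> K0" for c using that by (simp add: K0_def)
  have split: "4 dvd card (s \<triangle> k) \<longleftrightarrow> \<not> 4 dvd card k" if "k \<in> K" for k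
  proof -
    have "even (card (s \<inter> k))" "even (card s)" "even (card k)" using orthK evenK s that by auto
    then show ?thesis using card_sd[OF finw[OF s(1)] finw[OF that]] s(2) by presburger
  qed
  have sK0: "(\<triangle>) s ` K0 = K - K0"
  proof
    show "(\<triangle>) s ` K0 \<subseteq> K - K0" using split code_onD(3)[OF K s(1)] by (auto simp: K0_def)
    show "K - K0 \<subseteq> (\<triangle>) s ` K0"
    proof
      fix k assume k: "k \<in> K - K0"
      then have "s \<triangle> k \<in> K0" using split[of k] code_onD(3)[OF K s(1)] by (auto simp: K0_def)
      then show "k \<in> (\<triangle>) s ` K0" by (metis image_eqI sd_cancel)
    qed
  qed
  have cK0: "card K0 = 1024"
  proof -
    have "card (K - K0) = card K0" unfolding sK0[symmetric] by (rule card_image[OF inj_sd])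
    moreover have "card (K - K0) = card K - card K0"
      using finK by (intro card_Diff_subset) (auto simp: K0_def)
    moreover have "card K0 \<le> card K" using finK by (intro card_mono) (auto simp: K0_def)
    ultimately show ?thesis using cK by simp
  qed
  have fP0: "finite ?PZ" by (rule finite_dual_on[OF fX])
  have fP: "finite ?P" by (rule finite_dual_on[OF fX])
  have cP0: "card ?PZ = 16384" using card_dual_on[OF fX K0] cX cK0 by simp
  have P0: "code_on X ?PZ" and P: "code_on X ?P" using code_on_dual[OF fX] by auto
  have fw: "finite v" if "v \<in> ?PZ" for v using code_on_mem_finite[OF fX P0 that] .
  have PP0: "?P \<subseteq> ?PZ" by (auto simp: dual_on_def K0_def)
  have P_iff: "v \<in> ?P \<longleftrightarrow> even (card (v \<inter> s))" if v: "v \<in> ?PZ" for v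
  proof
    assume "v \<in> ?P" then show "even (card (v \<inter> s))" using s(1) by (rule dual_onD)
  next
    assume e: "even (card (v \<inter> s))"
    have "even (card (v \<inter> k))" if kK: "k \<in> K" for k
    proof (cases "k \<in> K0")
      case True then show ?thesis by (rule dual_onD[OF v])
    next
      case False
      then have "k \<in> (\<triangle>) s ` K0" unfolding sK0 using kK by simp
      then obtain l where l: "l \<in> K0" "k = s \<triangle> l" by auto
      then have "even (card (v \<inter> l))" using v dual_onD by metis
      then show ?thesis using e l finw[of s] finw[of l] s by (auto simp: even_meet_sd K0_def)
    qed
    then show "v \<in> ?P" using v by (auto simp: dual_on_def)
  qed
  have evP0: "even (card v)" if "v \<in> ?PZ" for v
  proof -
    have "v \<inter> X = v" using that by (auto simp: dual_on_def)
    then show ?thesis using dual_onD[OF that XK0] by simp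
  qed
  \<comment> \<open>The Gauss sum divides the 16384 dual words of \<open>K0\<close> into 10240 of
    weight divisible by 4 and 6144 others.\<close>
  have c2P0: "card {v \<in> ?PZ. \<not> 4 dvd card v} = 6144"
  proof -
    have "?PZ = {v \<in> ?PZ. 4 dvd card v} \<union> {v \<in> ?PZ. \<not> 4 dvd card v}" by auto
    then have "card ?PZ = card {v \<in> ?PZ. 4 dvd card v} + card {v \<in> ?PZ. \<not> 4 dvd card v}"
      using fP0 by (subst card_Un_disjoint[symmetric]) auto
    then show ?thesis
      using doubly_even_dual_counts[OF fX cX K0 XK0 de0] cP0 by simp
  qed
  \<comment> \<open>Adding \<open>s\<close>, which has weight 2 modulo 4 and meets every dual word
    of \<open>K\<close> evenly, exchanges the two residues, so each of them has 4096 words.\<close>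
  have c2P: "card {v \<in> ?P. \<not> 4 dvd card v} = 4096"
  proof -
    have flip: "s \<triangle> v \<in> ?P \<and> (4 dvd card (s \<triangle> v) \<longleftrightarrow> \<not> 4 dvd card v)" if v: "v \<in> ?P" for v
    proof -
      have "even (card (s \<inter> v))" using dual_onD[OF v s(1)] by (simp add: Int_commute)
      moreover have "even (card v)" "finite v" using evP0 fw PP0 v by auto
      moreover have "even (card s)" using evenK s by auto
      ultimately have "4 dvd card (s \<triangle> v) \<longleftrightarrow> \<not> 4 dvd card v"
        using card_sd[OF finw[OF s(1)], of v] s(2) by presburger
      moreover have "s \<triangle> v \<in> ?P" using code_onD(3)[OF P _ v] so s by auto
      ultimately show ?thesis by simp
    qed
    have "card {v \<in> ?P. \<not> 4 dvd card v} = card {v \<in> ?P. 4 dvd card v}"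
    proof (rule bij_betw_same_card[of "(\<triangle>) s"], rule bij_betwI[of _ _ _ "(\<triangle>) s"])
      show "(\<triangle>) s \<in> {v \<in> ?P. \<not> 4 dvd card v} \<rightarrow> {v \<in> ?P. 4 dvd card v}" using flip by auto
      show "(\<triangle>) s \<in> {v \<in> ?P. 4 dvd card v} \<rightarrow> {v \<in> ?P. \<not> 4 dvd card v}" using flip by auto
    qed auto
    moreover have "?P = {v \<in> ?P. 4 dvd card v} \<union> {v \<in> ?P. \<not> 4 dvd card v}" by auto
    then have "card ?P = card {v \<in> ?P. 4 dvd card v} + card {v \<in> ?P. \<not> 4 dvd card v}"
      using fP by (subst card_Un_disjoint[symmetric]) auto
    ultimately show ?thesis using card_dualK by simp
  qed
  define Q where "Q = {v \<in> ?PZ - ?P. \<not> 4 dvd card v}"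
  have fQ: "finite Q" using fP0 by (simp add: Q_def)
  have cQ: "card Q = 2048"
  proof -
    have "{v \<in> ?PZ. \<not> 4 dvd card v} = {v \<in> ?P. \<not> 4 dvd card v} \<union> Q"
      using PP0 by (auto simp: Q_def)
    moreover have "card ({v \<in> ?P. \<not> 4 dvd card v} \<union> Q) = card {v \<in> ?P. \<not> 4 dvd card v} + card Q"
      using fP fQ by (intro card_Un_disjoint) (auto simp: Q_def)
    ultimately show ?thesis using c2P c2P0 by simp
  qed
  \<comment> \<open>Translation by \<open>K\<close> preserves \<open>Q\<close>: for \<open>k\<close>
    outside \<open>K0\<close> the weight of \<open>k\<close> is 2 modulo 4, and the odd intersection
    of \<open>k\<close> with \<open>x\<close> compensates this. Having 2048 elements,
    \<open>Q\<close> is a single coset of \<open>K\<close>.\<close>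
  have QK: "x \<triangle> y \<in> K" if x: "x \<in> Q" and y: "y \<in> Q" for x y
  proof -
    have xs: "odd (card (x \<inter> s))" "\<not> 4 dvd card x" "x \<in> ?PZ" using P_iff[of x] x by (auto simp: Q_def)
    have "(\<triangle>) x ` K \<subseteq> Q"
    proof
      fix z assume "z \<in> (\<triangle>) x ` K"
      then obtain k where k: "k \<in> K" "z = x \<triangle> k" by auto
      have z0: "z \<in> ?PZ" using code_onD(3)[OF P0 xs(3)] k so PP0 by auto
      have fk: "finite k" using finw k by simp
      have "even (card (k \<inter> s))" using orthK k s by simp
      then have "odd (card (z \<inter> s))" using xs k fw fk by (simp add: even_meet_sd)
      then have "z \<notin> ?P" using P_iff[OF z0] by simp
      moreover have "\<not> 4 dvd card z"
      proof (cases "k \<in> K0")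
        case True
        then have "even (card (x \<inter> k))" using xs(3) dual_onD by metis
        then show ?thesis using four_dvd_sd[of x k] xs fw fk de0[OF True] k by simp
      next
        case False
        then have nk: "\<not> 4 dvd card k" using k by (simp add: K0_def)
        have "k \<in> (\<triangle>) s ` K0" unfolding sK0 using False k by simp
        then obtain l where l: "l \<in> K0" "k = s \<triangle> l" by auto
        then have "even (card (x \<inter> l))" using xs(3) dual_onD by metis
        then have "odd (card (x \<inter> k))" using xs(1) l finw[OF s(1)] finw[of l] by (auto simp: even_meet_sd K0_def)
        then show ?thesis
          using card_sd[OF fw[OF xs(3)] fk] nk xs(2) evenK[OF k(1)] evP0[OF xs(3)] unfolding k(2) by presburger
      qed
      ultimately show "z \<in> Q" using z0 by (simp add: Q_def)
    qed
    moreover have "card ((\<triangle>) x ` K) = card Q" using card_image[OF inj_sd] cK cQ by metis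
    ultimately have "(\<triangle>) x ` K = Q" using fQ by (metis card_subset_eq)
    then obtain k where "k \<in> K" "y = x \<triangle> k" using y by auto
    then show ?thesis by simp
  qed
  define A where "A w = card {c \<in> K. card c = w}" for w
  define B2 where "B2 = card {v \<in> ?P. card v = 2}"
  define N where "N = card {v \<in> Q. card v = 2}"
  have m: "2 + 2 * A 2 + 2 * A 4 + 2 * A 6 + 2 * A 8 + 2 * A 10 + A 12 = 2048"
    "1152 + 800 * A 2 + 512 * A 4 + 288 * A 6 + 128 * A 8 + 32 * A 10 = (24 + 2 * B2) * 2048"
    using even_weight_moments[OF fX cX K XK evenK] cK unfolding A_def B2_def by auto
  have A0: "card {c \<in> K0. card c = w} = A w" if "4 dvd w" for w
    unfolding A_def K0_def using that by (intro arg_cong[of _ _ card]) auto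
  have A0': "card {c \<in> K0. card c = w} = 0" if "\<not> 4 dvd w" for w
  proof -
    have e: "{c \<in> K0. card c = w} = {}" using that by (auto simp: K0_def)
    show ?thesis unfolding e by simp
  qed
  have b2: "card {v \<in> ?PZ. card v = 2} = B2 + N"
  proof -
    have "{v \<in> ?PZ. card v = 2} = {v \<in> ?P. card v = 2} \<union> {v \<in> Q. card v = 2}"
      using PP0 by (auto simp: Q_def)
    moreover have "card ({v \<in> ?P. card v = 2} \<union> {v \<in> Q. card v = 2}) = B2 + N"
      unfolding B2_def N_def using fP fP0 by (intro card_Un_disjoint) (auto simp: Q_def)
    ultimately show ?thesis by simp
  qed
  have m0: "2 + 2 * A 4 + 2 * A 8 + A 12 = 1024"
    "1152 + 512 * A 4 + 128 * A 8 = (24 + 2 * (B2 + N)) * 1024"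
    using even_weight_moments[OF fX cX K0 XK0] de0 cK0 unfolding b2 by (auto simp: A0 A0' dvd_trans[of 2 4])
  \<comment> \<open>Subtracting the moments of \<open>K0\<close> from those of \<open>K\<close>
    cancels the weights 4, 8 and 12; weight 10 is then eliminated, and 256 is the common factor of
    what remains.\<close>
  have "A 10 + (A 2 + A 6) = 512" using m(1) m0(1) by simp
  moreover have "800 * A 2 + 288 * A 6 + 32 * A 10 + 2048 * N = 24576 + 2048 * B2"
    using m(2) m0(2) by simp
  ultimately have "256 * (3 * A 2 + A 6 + 8 * N) = 256 * (32 + 8 * B2)" by simp
  then have key: "3 * A 2 + A 6 + 8 * N = 32 + 8 * B2" by (simp only: mult_cancel1) simp
  have pos: "\<exists>c\<in>K. card c = w" if "0 < A w" for w
    using that by (auto simp: A_def card_gt_0_iff)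
  have Qlow: "x \<triangle> y \<in> K \<and> x \<triangle> y \<noteq> {} \<and> card (x \<triangle> y) \<le> 4"
    if "x \<in> Q" "card x = 2" "y \<in> Q" "card y = 2" "x \<noteq> y" for x y
    using QK[of x y] that card_sd[of x y] fw by (auto simp: Q_def)
  \<comment> \<open>Two light words must both have weight 6, so a word of weight 2 would be the only
    light one; then \<open>key\<close> fails modulo 8.\<close>
  have A2: "A 2 = 0"
  proof (rule ccontr)
    assume "A 2 \<noteq> 0"
    then obtain c where c: "c \<in> K" "card c = 2" using pos by auto
    have "A 6 = 0"
    proof (rule ccontr)
      assume "A 6 \<noteq> 0"
      then obtain d where "d \<in> K" "card d = 6" using pos by auto
      then show False using low_words(1)[of c d] c by fastforce
    qed
    moreover have "A 2 = 1"
    proof -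
      have "{c \<in> K. card c = 2} = {c}"
      proof -
        have False if "d \<in> K" "card d = 2" "d \<noteq> c" for d
          using low_words(1)[of c d] that c by fastforce
        then show ?thesis using c by auto
      qed
      then show ?thesis by (simp add: A_def)
    qed
    ultimately show False using key by presburger
  qed
  show False
  proof (cases "A 6 = 0")
    case True
    \<comment> \<open>Here \<open>8 * N\<close> is at least 32, and three words of weight 2 in
      \<open>Q\<close> already give two different codewords of weight at most 4.\<close>
    then have "3 \<le> card {v \<in> Q. card v = 2}" using key A2 by (simp add: N_def)
    from obtain_subset_with_card_n[OF this] obtain T where T: "T \<subseteq> {v \<in> Q. card v = 2}" "card T = 3" .
    then obtain x y z where xyz: "T = {x,y,z}" "x \<noteq> y" "y \<noteq> z" "x \<noteq> z" by (auto simp: card_3_iff)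
    have 1: "x \<triangle> y \<in> K" "x \<triangle> y \<noteq> {}" "card (x \<triangle> y) \<le> 4" using Qlow[of x y] T xyz by auto
    have 2: "x \<triangle> z \<in> K" "x \<triangle> z \<noteq> {}" "card (x \<triangle> z) \<le> 4" using Qlow[of x z] T xyz by auto
    have "x \<triangle> y \<noteq> x \<triangle> z" using xyz by (metis sd_cancel)
    then show False using low_words(1)[OF 1(1,2) _ 2(1,2)] 1(3) 2(3) by simp
  next
    case False
    then obtain d where d: "d \<in> K" "card d = 6" using pos by auto
    have "N \<le> 1"
    proof (rule ccontr)
      assume "\<not> N \<le> 1"
      then have "2 \<le> card {v \<in> Q. card v = 2}" by (simp add: N_def)
      from obtain_subset_with_card_n[OF this] obtain T where T: "T \<subseteq> {v \<in> Q. card v = 2}" "card T = 2" .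
      then obtain x y where xy: "T = {x,y}" "x \<noteq> y" by (auto simp: card_2_iff)
      have 1: "x \<triangle> y \<in> K" "x \<triangle> y \<noteq> {}" "card (x \<triangle> y) \<le> 4" using Qlow[of x y] T xy by auto
      have "x \<triangle> y \<noteq> d" using 1 d by auto
      then show False using low_words(1)[OF 1(1,2) _ d(1)] 1(3) d(2) by fastforce
    qed
    \<comment> \<open>With \<open>N\<close> at most 1, \<open>key\<close> asks for at least 32 - 8
      words of weight 6, more than the 21 that are possible.\<close>
    then have "24 \<le> A 6" using key A2 by linarith
    then show False using card_weight_6 by (simp add: A_def)
  qed
qed

lemma extends_to_golay: "\<exists>D. golay X D \<and> K \<subseteq> D"
  by (rule doubly_even_extends[OF weights_div_4])

end

section \<open>Biplanes and pentagons\<close>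

text \<open>The order fixes the positions in the characteristic vectors below. Edge 0 joins the
  vertices 0 and 1; it will carry the prescribed block \<open>c\<close>.\<close>

definition K5_edges :: "(nat \<times> nat) list" where
  "K5_edges = [(0,1),(0,2),(0,3),(0,4),(1,2),(1,3),(1,4),(2,3),(2,4),(3,4)]"

text \<open>Pentagons are given by their characteristic vectors on \<open>K5_edges\<close>.  The twelve pentagons
  on five vertices fall into two orbits under the alternating group; two different pentagons have
  exactly two edges in common iff they lie in the same orbit.\<close>

definition pentagons :: "bool list list" where
  "pentagons = [
    [False,False,True,True,True,False,True,True,False,False],
    [False,True,True,False,False,True,True,False,True,False],
    [True,False,False,True,False,True,False,True,True,False],
    [False,True,False,True,True,True,False,False,False,True],
    [True,True,False,False,False,False,True,True,False,True],
    [True,False,True,False,True,False,False,False,True,True]]"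

definition pentagons' :: "bool list list" where
  "pentagons' = [
    [False,True,False,True,False,True,True,True,False,False],
    [False,False,True,True,True,True,False,False,True,False],
    [True,False,True,False,False,False,True,True,True,False],
    [False,True,True,False,True,False,True,False,False,True],
    [True,False,False,True,True,False,False,True,False,True],
    [True,True,False,False,False,True,False,False,True,True]]"

fun bcount :: "bool list \<Rightarrow> nat" where
  "bcount [] = 0"
| "bcount (True # xs) = Suc (bcount xs)"
| "bcount (False # xs) = bcount xs"

fun band :: "bool list \<Rightarrow> bool list \<Rightarrow> bool list" where
  "band (x # xs) (y # ys) = (x \<and> y) # band xs ys"
| "band _ _ = []"

lemma bcount_eq: "bcount (map P xs) = card {x \<in> set xs. P x}" if "distinct xs" for P
  using that
proof (induction xs)
  case (Cons x xs)
  have "{y \<in> set (x # xs). P y} = (if P x then insert x {y \<in> set xs. P y} else {y \<in> set xs. P y})" by auto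
  then show ?case using Cons by (cases "P x") auto
qed simp

lemma band_map: "band (map P xs) (map Q xs) = map (\<lambda>x. P x \<and> Q x) xs"
  by (induction xs) auto

text \<open>The variables follow \<open>K5_edges\<close>, and the hypotheses give each vertex degree
  2. A 2-regular graph on five vertices has no room for two cycles, so it is one of the twelve
  pentagons.\<close>

lemma two_regular_pentagon:
  assumes "bcount [b0,b1,b2,b3] = 2" "bcount [b0,b4,b5,b6] = 2" "bcount [b1,b4,b7,b8] = 2"
    "bcount [b2,b5,b7,b9] = 2" "bcount [b3,b6,b8,b9] = 2"
  shows "[b0,b1,b2,b3,b4,b5,b6,b7,b8,b9] \<in> set pentagons \<union> set pentagons'"
  using assms unfolding pentagons_def pentagons'_def
  by (cases b0; cases b1; cases b2; simp; cases b3; simp; cases b4; simp; cases b5; simp; cases b6; simp; cases b7; simp; cases b8; simp; cases b9; simp)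

lemma pentagons_separate:
  "p \<in> set pentagons \<Longrightarrow> q \<in> set pentagons' \<Longrightarrow> bcount (band p q) \<noteq> 2"
  unfolding pentagons_def pentagons'_def by (elim set_ConsD[elim_format] disjE; simp)+

text \<open>The list on the right results from transposing the vertices 0 and 1. As an odd
  permutation this exchanges the two orbits, while edge 0 stays in place.\<close>

lemma pentagons_swap:
  assumes "[b0,b1,b2,b3,b4,b5,b6,b7,b8,b9] \<in> set pentagons'"
  shows "[b0,b4,b5,b6,b1,b2,b3,b7,b8,b9] \<in> set pentagons"
  using assms unfolding pentagons_def pentagons'_def by auto

lemma pentagons_distinct: "distinct pentagons" "length pentagons = 6"
  unfolding pentagons_def by simp_all

lemma K5_less: "k < 10 \<Longrightarrow> fst (K5_edges ! k) < snd (K5_edges ! k) \<and> snd (K5_edges ! k) < 5"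
proof -
  have "\<forall>e\<in>set K5_edges. fst e < snd e \<and> snd e < 5" unfolding K5_edges_def by simp
  moreover have "length K5_edges = 10" unfolding K5_edges_def by simp
  ultimately show "k < 10 \<Longrightarrow> ?thesis" using nth_mem by metis
qed

text \<open>A biplane on 11 points is determined by one block \<open>U\<close>: the other ten blocks correspond to the
  pairs of points of \<open>U\<close>, and the six points outside \<open>U\<close> to pentagons on \<open>U\<close> that pairwise share
  two edges (Hussain graphs).\<close>

locale biplane =
  fixes I :: "'a set" and J :: "'b set" and inc :: "'a \<Rightarrow> 'b \<Rightarrow> bool"
  assumes fin: "finite I" "finite J" and crd: "card I = 11" "card J = 11"
    and blk: "\<And>i. i \<in> I \<Longrightarrow> card {j \<in> J. inc i j} = 5"
    and blk2: "\<And>i i'. i \<in> I \<Longrightarrow> i' \<in> I \<Longrightarrow> i \<noteq> i' \<Longrightarrow> card {j \<in> J. inc i j \<and> inc i' j} = 2"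
    and pt2: "\<And>j j'. j \<in> J \<Longrightarrow> j' \<in> J \<Longrightarrow> j \<noteq> j' \<Longrightarrow> card {i \<in> I. inc i j \<and> inc i j'} = 2"
begin

definition other_block :: "'a \<Rightarrow> 'b \<Rightarrow> 'b \<Rightarrow> 'a" where
  "other_block b x y = (THE i. i \<in> I \<and> i \<noteq> b \<and> inc i x \<and> inc i y)"

lemma other_block_unique:
  assumes "b \<in> I" "x \<in> J" "y \<in> J" "x \<noteq> y" "inc b x" "inc b y"
  shows "\<exists>!i. i \<in> I \<and> i \<noteq> b \<and> inc i x \<and> inc i y"
proof -
  have "card {i \<in> I. inc i x \<and> inc i y} = 2" using pt2 assms by blast
  moreover have "b \<in> {i \<in> I. inc i x \<and> inc i y}" using assms by simp
  ultimately have "card ({i \<in> I. inc i x \<and> inc i y} - {b}) = 1" by simp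
  then obtain e where "{i \<in> I. inc i x \<and> inc i y} - {b} = {e}" by (auto simp: card_1_singleton_iff)
  then show ?thesis by (intro ex1I[of _ e]) auto
qed

lemmas other_block = theI'[OF other_block_unique, folded other_block_def]

lemma other_block_eq:
  assumes "b \<in> I" "x \<in> J" "y \<in> J" "x \<noteq> y" "inc b x" "inc b y" "i \<in> I" "i \<noteq> b" "inc i x" "inc i y"
  shows "other_block b x y = i"
  using other_block_unique[OF assms(1-6)] other_block[OF assms(1-6)] assms(7-) by blast

lemma other_block_sym: "other_block b x y = other_block b y x"
  unfolding other_block_def by (simp only: conj_commute[of "inc _ x"])

definition edge_block :: "'a \<Rightarrow> 'b list \<Rightarrow> nat \<Rightarrow> 'a" where
  "edge_block b us k = other_block b (us ! fst (K5_edges ! k)) (us ! snd (K5_edges ! k))"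

definition hussain :: "'a \<Rightarrow> 'b list \<Rightarrow> 'b \<Rightarrow> bool list" where
  "hussain b us z = map (\<lambda>k. inc (edge_block b us k) z) [0..<10]"

context
  fixes b :: 'a and us :: "'b list"
  assumes b: "b \<in> I" and us: "distinct us" "length us = 5" "set us = {j \<in> J. inc b j}"
begin

lemma us_nth: "p < 5 \<Longrightarrow> us ! p \<in> J \<and> inc b (us ! p)"
  using nth_mem[of p us] unfolding us(2,3) by simp

lemma us_inj: "p < 5 \<Longrightarrow> q < 5 \<Longrightarrow> us ! p = us ! q \<longleftrightarrow> p = q"
  using us by (simp add: nth_eq_iff_index_eq)

text \<open>A block other than \<open>b\<close> meets \<open>b\<close> in exactly two points, so the
  block labelled by an edge contains the two ends of that edge and no other vertex.\<close>

lemma edge_block_props: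
  assumes "k < 10"
  shows "edge_block b us k \<in> I" "edge_block b us k \<noteq> b"
    "p < 5 \<Longrightarrow> inc (edge_block b us k) (us ! p) \<longleftrightarrow> p = fst (K5_edges ! k) \<or> p = snd (K5_edges ! k)"
proof -
  let ?p = "fst (K5_edges ! k)" and ?q = "snd (K5_edges ! k)"
  have pq: "?p < ?q" "?p < 5" "?q < 5" using K5_less[OF assms] by auto
  then have n: "us ! ?p \<noteq> us ! ?q" using us_inj[of ?p ?q] by simp
  have e: "edge_block b us k \<in> I \<and> edge_block b us k \<noteq> b \<and> inc (edge_block b us k) (us ! ?p) \<and> inc (edge_block b us k) (us ! ?q)"
    unfolding edge_block_def using other_block[OF b _ _ n] us_nth pq by blast
  then show "edge_block b us k \<in> I" "edge_block b us k \<noteq> b" by auto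
  have "card {j \<in> J. inc b j \<and> inc (edge_block b us k) j} = 2" using blk2[OF b, of "edge_block b us k"] e by auto
  moreover have "{us ! ?p, us ! ?q} \<subseteq> {j \<in> J. inc b j \<and> inc (edge_block b us k) j}"
    using e us_nth pq by auto
  moreover have "card {us ! ?p, us ! ?q} = 2" using n by simp
  ultimately have eq: "{us ! ?p, us ! ?q} = {j \<in> J. inc b j \<and> inc (edge_block b us k) j}"
    using fin(2) by (intro card_subset_eq) auto
  show "inc (edge_block b us k) (us ! p) \<longleftrightarrow> p = ?p \<or> p = ?q" if "p < 5"
  proof -
    have "inc (edge_block b us k) (us ! p) \<longleftrightarrow> us ! p \<in> {us ! ?p, us ! ?q}"
      unfolding eq using us_nth[OF that] by simp
    then show ?thesis using us_inj[OF that] pq by simp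
  qed
qed

lemma K5_edges_inj:
  assumes "k < 10" "l < 10" "K5_edges ! k = K5_edges ! l" shows "k = l"
proof -
  have "distinct K5_edges" "length K5_edges = 10" unfolding K5_edges_def by simp_all
  then show ?thesis using assms by (simp add: nth_eq_iff_index_eq)
qed

text \<open>The trace of the block on \<open>b\<close> gives back the edge.\<close>

lemma edge_block_inj: "inj_on (edge_block b us) {..<10}"
proof (rule inj_onI)
  fix k l assume kl: "k \<in> {..<10}" "l \<in> {..<10}" "edge_block b us k = edge_block b us l"
  let ?f = "\<lambda>k. fst (K5_edges ! k)" and ?s = "\<lambda>k. snd (K5_edges ! k)"
  have k: "?f k < ?s k" "?s k < 5" and l: "?f l < ?s l" "?s l < 5" using K5_less kl by auto
  have h: "p = ?f k \<or> p = ?s k \<longleftrightarrow> p = ?f l \<or> p = ?s l" if "p < 5" for p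
    using edge_block_props(3)[of k p] edge_block_props(3)[of l p] kl that by simp
  have "?f k = ?f l \<or> ?f k = ?s l" "?s k = ?f l \<or> ?s k = ?s l"
    using h[of "?f k"] h[of "?s k"] k by simp_all
  then have "?f k = ?f l \<and> ?s k = ?s l"
    using k(1) l(1) by (elim disjE) linarith+
  then have "K5_edges ! k = K5_edges ! l" by (simp add: prod_eq_iff)
  then show "k = l" using K5_edges_inj[of k l] kl by simp
qed

lemma edge_block_image: "edge_block b us ` {..<10} = I - {b}"
proof (rule card_subset_eq)
  show "finite (I - {b})" using fin by simp
  show "edge_block b us ` {..<10} \<subseteq> I - {b}" using edge_block_props by auto
  show "card (edge_block b us ` {..<10}) = card (I - {b})"
    using card_image[OF edge_block_inj] b crd by simp
qed

lemma count_edge_blocks: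
  assumes "\<not> P b"
  shows "card {i \<in> I. P i} = card {k \<in> set [0..<10]. P (edge_block b us k)}"
proof -
  have "{i \<in> I. P i} = edge_block b us ` {k \<in> set [0..<10]. P (edge_block b us k)}"
  proof -
    have "{i \<in> I. P i} = {i \<in> I - {b}. P i}" using assms by auto
    also have "\<dots> = {i \<in> edge_block b us ` {..<10}. P i}" by (simp only: edge_block_image)
    also have "\<dots> = edge_block b us ` {k \<in> set [0..<10]. P (edge_block b us k)}" by auto
    finally show ?thesis .
  qed
  moreover have "inj_on (edge_block b us) {k \<in> set [0..<10]. P (edge_block b us k)}"
    by (rule inj_on_subset[OF edge_block_inj]) auto
  ultimately show ?thesis by (simp add: card_image)
qed

lemma hussain_meet:
  assumes "z \<in> J" "\<not> inc b z" "z' \<in> J" "z \<noteq> z'"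
  shows "bcount (band (hussain b us z) (hussain b us z')) = 2"
proof -
  have "bcount (band (hussain b us z) (hussain b us z'))
      = card {k \<in> set [0..<10]. inc (edge_block b us k) z \<and> inc (edge_block b us k) z'}"
    unfolding hussain_def band_map by (rule bcount_eq) simp
  also have "\<dots> = card {i \<in> I. inc i z \<and> inc i z'}"
    using assms by (intro count_edge_blocks[symmetric]) auto
  also have "\<dots> = 2" using pt2[OF assms(1,3,4)] .
  finally show ?thesis .
qed

lemma upt_10: "[0..<10] = [0,1,2,3,4,5,6,7,8,9::nat]"
  by (simp add: upt_rec)

lemma hussain_explicit: "hussain b us z = [inc (edge_block b us 0) z, inc (edge_block b us 1) z,
    inc (edge_block b us 2) z, inc (edge_block b us 3) z, inc (edge_block b us 4) z,
    inc (edge_block b us 5) z, inc (edge_block b us 6) z, inc (edge_block b us 7) z,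
    inc (edge_block b us 8) z, inc (edge_block b us 9) z]"
  unfolding hussain_def upt_10 by (simp only: list.map)

text \<open>The point \<open>z\<close> and the vertex lie on two common blocks, neither of them
  \<open>b\<close>; these are the two edges at that vertex in the graph of \<open>z\<close>.\<close>

lemma hussain_degree:
  assumes z: "z \<in> J" "\<not> inc b z" and p: "p < 5"
  shows "bcount (map (\<lambda>k. inc (edge_block b us k) z)
    (filter (\<lambda>k. p = fst (K5_edges ! k) \<or> p = snd (K5_edges ! k)) [0..<10])) = 2"
proof -
  have "2 = card {i \<in> I. inc i z \<and> inc i (us ! p)}"
    using pt2[of z "us ! p"] z us_nth[OF p] by fastforce
  also have "\<dots> = card {k \<in> set [0..<10]. inc (edge_block b us k) z \<and> inc (edge_block b us k) (us ! p)}"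
    using z by (intro count_edge_blocks) auto
  also have "{k \<in> set [0..<10]. inc (edge_block b us k) z \<and> inc (edge_block b us k) (us ! p)}
      = {k \<in> set (filter (\<lambda>k. p = fst (K5_edges ! k) \<or> p = snd (K5_edges ! k)) [0..<10]).
          inc (edge_block b us k) z}"
    using edge_block_props(3)[OF _ p] by auto
  finally show ?thesis by (subst bcount_eq) simp_all
qed

lemma hussain_pentagon:
  assumes z: "z \<in> J" "\<not> inc b z"
  shows "hussain b us z \<in> set pentagons \<union> set pentagons'"
proof -
  note d = hussain_degree[OF z, unfolded upt_10 K5_edges_def]
  show ?thesis unfolding hussain_explicit
  proof (rule two_regular_pentagon)
    show "bcount [inc (edge_block b us 0) z, inc (edge_block b us 1) z, inc (edge_block b us 2) z, inc (edge_block b us 3) z] = 2"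
      using d[of 0] by simp
    show "bcount [inc (edge_block b us 0) z, inc (edge_block b us 4) z, inc (edge_block b us 5) z, inc (edge_block b us 6) z] = 2"
      using d[of 1] by simp
    show "bcount [inc (edge_block b us 1) z, inc (edge_block b us 4) z, inc (edge_block b us 7) z, inc (edge_block b us 8) z] = 2"
      using d[of 2] by simp
    show "bcount [inc (edge_block b us 2) z, inc (edge_block b us 5) z, inc (edge_block b us 7) z, inc (edge_block b us 9) z] = 2"
      using d[of 3] by simp
    show "bcount [inc (edge_block b us 3) z, inc (edge_block b us 6) z, inc (edge_block b us 8) z, inc (edge_block b us 9) z] = 2"
      using d[of 4] by simp
  qed
qed

text \<open>The graphs of two different points outside \<open>b\<close> share exactly two edges,
  which cannot happen across the two orbits.\<close>

lemma hussain_class: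
  "(\<forall>z\<in>J. \<not> inc b z \<longrightarrow> hussain b us z \<in> set pentagons) \<or>
   (\<forall>z\<in>J. \<not> inc b z \<longrightarrow> hussain b us z \<in> set pentagons')"
proof (rule ccontr)
  assume "\<not> ?thesis"
  then obtain z z' where z: "z \<in> J" "\<not> inc b z" "hussain b us z \<notin> set pentagons"
    and z': "z' \<in> J" "\<not> inc b z'" "hussain b us z' \<notin> set pentagons'" by auto
  have 1: "hussain b us z \<in> set pentagons'" "hussain b us z' \<in> set pentagons"
    using hussain_pentagon z z' by auto
  then have "z \<noteq> z'" using z by auto
  then have "bcount (band (hussain b us z') (hussain b us z)) = 2"
    using z z' by (intro hussain_meet) auto
  then show False using pentagons_separate[OF 1(2,1)] by simp
qed

end

text \<open>The order of the five vertices is still free. The two points common to \<open>b\<close>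
  and \<open>c\<close> come first, which makes \<open>c\<close> the block of edge 0; should the
  graphs lie in the second orbit, these two are swapped. The six points outside \<open>b\<close>
  have different graphs, so they realise all six pentagons, and \<open>zs\<close> lists them in the
  order of \<open>pentagons\<close>.\<close>

lemma biplane_labelling:
  assumes b: "b \<in> I" and c: "c \<in> I" "c \<noteq> b"
  shows "\<exists>es us zs. distinct es \<and> length es = 10 \<and> set es = I - {b} \<and> es ! 0 = c \<and>
     distinct us \<and> length us = 5 \<and> set us = {j \<in> J. inc b j} \<and>
     distinct zs \<and> length zs = 6 \<and> set zs = {j \<in> J. \<not> inc b j} \<and>
     (\<forall>k<10. \<forall>p<5. inc (es ! k) (us ! p) \<longleftrightarrow> p = fst (K5_edges ! k) \<or> p = snd (K5_edges ! k)) \<and>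
     (\<forall>k<10. \<forall>m<6. inc (es ! k) (zs ! m) \<longleftrightarrow> pentagons ! m ! k)"
proof -
  have "card {j \<in> J. inc b j \<and> inc c j} = 2" using blk2[OF b c(1)] c(2) by simp
  then obtain x y where xy: "{j \<in> J. inc b j \<and> inc c j} = {x,y}" "x \<noteq> y" by (auto simp: card_2_iff)
  have xyJ: "x \<in> J" "inc b x" "inc c x" "y \<in> J" "inc b y" "inc c y" using xy by auto
  let ?U = "{j \<in> J. inc b j}"
  have "card (?U - {x,y}) = 3" using blk[OF b] xyJ xy(2) by (simp add: card_Diff_subset)
  then obtain u v w where uvw: "?U - {x,y} = {u,v,w}" "u \<noteq> v" "v \<noteq> w" "u \<noteq> w" by (auto simp: card_3_iff)
  define us1 where "us1 = [x,y,u,v,w]"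
  define us2 where "us2 = [y,x,u,v,w]"
  have nin: "u \<notin> {x,y}" "v \<notin> {x,y}" "w \<notin> {x,y}" using uvw by blast+
  have U: "?U = {x,y,u,v,w}" using uvw(1) xyJ by auto
  have us1: "distinct us1" "length us1 = 5" "set us1 = ?U"
    using xy(2) uvw nin U by (auto simp: us1_def)
  have us2: "distinct us2" "length us2 = 5" "set us2 = ?U"
    using xy(2) uvw nin U by (auto simp: us2_def)
  have e: "edge_block b us2 0 = edge_block b us1 0" "edge_block b us2 1 = edge_block b us1 4"
    "edge_block b us2 2 = edge_block b us1 5" "edge_block b us2 3 = edge_block b us1 6"
    "edge_block b us2 4 = edge_block b us1 1" "edge_block b us2 5 = edge_block b us1 2"
    "edge_block b us2 6 = edge_block b us1 3" "edge_block b us2 7 = edge_block b us1 7"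
    "edge_block b us2 8 = edge_block b us1 8" "edge_block b us2 9 = edge_block b us1 9"
    unfolding edge_block_def us1_def us2_def K5_edges_def by (simp_all add: other_block_sym)
  have e0: "edge_block b us1 0 = c" "edge_block b us2 0 = c"
    unfolding e unfolding edge_block_def us1_def K5_edges_def
    using other_block_eq[OF b xyJ(1,4) xy(2) xyJ(2,5) c xyJ(3,6)] by simp_all
  obtain us where us: "distinct us" "length us = 5" "set us = ?U" "edge_block b us 0 = c"
    and hp: "\<forall>z\<in>J. \<not> inc b z \<longrightarrow> hussain b us z \<in> set pentagons"
  proof (cases "\<forall>z\<in>J. \<not> inc b z \<longrightarrow> hussain b us1 z \<in> set pentagons")
    case True
    then show ?thesis using that us1 e0 by blast
  next
    case False
    then have "\<forall>z\<in>J. \<not> inc b z \<longrightarrow> hussain b us1 z \<in> set pentagons'"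
      using hussain_class[OF b us1] by blast
    then have "\<forall>z\<in>J. \<not> inc b z \<longrightarrow> hussain b us2 z \<in> set pentagons"
      unfolding hussain_explicit[OF b us1] hussain_explicit[OF b us2] e
      using pentagons_swap by blast
    then show ?thesis using that us2 e0 by blast
  qed
  let ?Z = "{j \<in> J. \<not> inc b j}"
  have inj: "inj_on (hussain b us) ?Z"
  proof (rule inj_onI, rule ccontr)
    fix z z' assume z: "z \<in> ?Z" "z' \<in> ?Z" "hussain b us z = hussain b us z'" "z \<noteq> z'"
    have "bcount (band (hussain b us z) (hussain b us z')) = 2"
      using z by (intro hussain_meet[OF b us(1-3)]) auto
    moreover have "bcount (band p p) \<noteq> 2" if "p \<in> set pentagons" for p
      using that unfolding pentagons_def by auto
    ultimately show False using hp z by auto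
  qed
  have cZ: "card ?Z = 6"
  proof -
    have "?Z = J - ?U" by auto
    moreover have "card (J - ?U) = 11 - 5" using fin crd blk[OF b] by (subst card_Diff_subset) auto
    ultimately show ?thesis by simp
  qed
  have img: "hussain b us ` ?Z = set pentagons"
  proof (rule card_subset_eq)
    show "hussain b us ` ?Z \<subseteq> set pentagons" using hp by auto
    show "card (hussain b us ` ?Z) = card (set pentagons)"
      using card_image[OF inj] cZ pentagons_distinct by (simp add: distinct_card)
  qed simp
  define zs where "zs = map (inv_into ?Z (hussain b us)) pentagons"
  have zs: "zs ! m \<in> ?Z" "hussain b us (zs ! m) = pentagons ! m" if "m < 6" for m
  proof -
    have "pentagons ! m \<in> hussain b us ` ?Z" unfolding img using that pentagons_distinct by simp
    moreover have "zs ! m = inv_into ?Z (hussain b us) (pentagons ! m)"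
      using that pentagons_distinct by (simp add: zs_def)
    ultimately show "zs ! m \<in> ?Z" "hussain b us (zs ! m) = pentagons ! m"
      by (simp_all only: inv_into_into f_inv_into_f)
  qed
  have dzs: "distinct zs" unfolding zs_def distinct_map
    using pentagons_distinct inj_on_inv_into[of "set pentagons" "hussain b us" ?Z] img by auto
  have szs: "set zs = ?Z"
    unfolding zs_def set_map img[symmetric] using inj by (auto simp: image_image inv_into_f_f)
  define es where "es = map (edge_block b us) [0..<10]"
  have "distinct es" unfolding es_def distinct_map using edge_block_inj[OF b us(1-3)] by (simp add: atLeast0LessThan)
  have "set es = I - {b}" unfolding es_def using edge_block_image[OF b us(1-3)] by (simp add: atLeast0LessThan)
  have es_nth: "es ! k = edge_block b us k" if "k < 10" for k using that by (simp add: es_def)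
  have "\<forall>k<10. \<forall>m<6. inc (es ! k) (zs ! m) \<longleftrightarrow> pentagons ! m ! k"
  proof (intro allI impI)
    fix k m :: nat assume km: "k < 10" "m < 6"
    have "inc (edge_block b us k) (zs ! m) \<longleftrightarrow> hussain b us (zs ! m) ! k"
      using km by (simp add: hussain_def)
    then show "inc (es ! k) (zs ! m) \<longleftrightarrow> pentagons ! m ! k" using zs km es_nth by simp
  qed
  have "\<forall>k<10. \<forall>p<5. inc (es ! k) (us ! p) \<longleftrightarrow> p = fst (K5_edges ! k) \<or> p = snd (K5_edges ! k)"
    using edge_block_props(3)[OF b us(1-3)] es_nth by simp
  have "es ! 0 = c" using es_nth[of 0] us(4) by simp
  have "length es = 10" "length zs = 6" by (simp_all add: es_def zs_def pentagons_distinct)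
  show ?thesis
    by (intro exI[of _ es] exI[of _ us] exI[of _ zs] conjI; fact)
qed

end

section \<open>Labelling the Golay code\<close>

text \<open>A word on \<open>U\<close> orthogonal to all restrictions is a dual word supported in
  \<open>U\<close>. If zero is the only one, the restricted code has trivial dual and so consists of
  all subsets of \<open>U\<close>.\<close>

lemma restriction_surj:
  assumes X: "finite X" and C: "code_on X C" and U: "U \<subseteq> X"
    and tr: "\<And>u. u \<in> dual_on X C \<Longrightarrow> u \<subseteq> U \<Longrightarrow> u = {}" and P: "P \<subseteq> U"
  shows "\<exists>c\<in>C. c \<inter> U = P"
proof -
  define R where "R = (\<lambda>c. c \<inter> U) ` C"
  have fU: "finite U" using X U finite_subset by auto
  have R: "code_on U R"
    unfolding code_on_def
  proof (intro conjI ballI)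
    show "R \<subseteq> Pow U" by (auto simp: R_def)
    show "{} \<in> R" using code_onD(2)[OF C] by (force simp: R_def)
    fix x y assume "x \<in> R" "y \<in> R"
    then obtain c d where cd: "c \<in> C" "d \<in> C" "x = c \<inter> U" "y = d \<inter> U" by (auto simp: R_def)
    then have "x \<triangle> y = (c \<triangle> d) \<inter> U" by (simp add: sd_Int)
    then show "x \<triangle> y \<in> R" using code_onD(3)[OF C cd(1,2)] by (auto simp: R_def)
  qed
  have "dual_on U R = {{}}"
  proof -
    have "u = {}" if u: "u \<in> dual_on U R" for u
    proof (rule tr)
      have uU: "u \<subseteq> U" using u by (simp add: dual_on_def)
      then show "u \<subseteq> U" .
      have "even (card (u \<inter> c))" if "c \<in> C" for c
      proof -
        have "even (card (u \<inter> (c \<inter> U)))" using u that by (intro dual_onD[OF u]) (auto simp: R_def)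
        moreover have "u \<inter> (c \<inter> U) = u \<inter> c" using uU by auto
        ultimately show ?thesis by simp
      qed
      then show "u \<in> dual_on X C" using uU U by (auto simp: dual_on_def)
    qed
    moreover have "{} \<in> dual_on U R" by (simp add: dual_on_def)
    ultimately show ?thesis by auto
  qed
  then have "card R = 2 ^ card U" using card_dual_on[OF fU R] by simp
  moreover have "R \<subseteq> Pow U" using R by (simp add: code_on_def)
  ultimately have "R = Pow U" using fU by (intro card_subset_eq) (auto simp: card_Pow)
  then have "P \<in> R" using P by simp
  then show ?thesis by (auto simp: R_def)
qed

section \<open>Dodecads and the biplane inside a Golay code\<close>

locale golay_code =
  fixes X :: "'a set" and D
  assumes G: "golay X D"
begin

lemma fX: "finite X" and cX: "card X = 24" and D: "code_on X D" and dual: "dual_on X D = D"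
  and XD: "X \<in> D" and de: "c \<in> D \<Longrightarrow> 4 dvd card c" and min8: "c \<in> D \<Longrightarrow> c \<noteq> {} \<Longrightarrow> 8 \<le> card c"
  using G by (auto simp: golay_def)

lemma sub: "c \<in> D \<Longrightarrow> c \<subseteq> X" and add: "c \<in> D \<Longrightarrow> d \<in> D \<Longrightarrow> c \<triangle> d \<in> D" and zero: "{} \<in> D"
  using code_onD[OF D] by auto

lemma finD: "finite D" and fin: "c \<in> D \<Longrightarrow> finite c"
  using code_on_finite[OF fX D] code_on_mem_finite[OF fX D] by auto

lemma small: "c \<in> D \<Longrightarrow> card c < 8 \<Longrightarrow> c = {}"
  using min8 by fastforce

lemma cD: "card D = 4096"
proof -
  have "card D * card D = 4096 * 4096" using card_dual_on[OF fX D] cX dual by simp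
  then show ?thesis by (metis power2_eq_iff_nonneg power2_eq_square zero_le)
qed

lemma meet_even: "c \<in> D \<Longrightarrow> d \<in> D \<Longrightarrow> even (card (c \<inter> d))"
  using dual_onD[of c X D d] unfolding dual by simp

lemma compl: "c \<in> D \<Longrightarrow> X \<triangle> c \<in> D \<and> card (X \<triangle> c) = 24 - card c"
  using add[OF XD] even_card_complement[OF fX sub] cX by simp

text \<open>The code is its own dual, so no nonzero dual word fits into fewer than 8
  coordinates.\<close>

lemma pattern:
  assumes "U \<subseteq> X" "card U < 8" "P \<subseteq> U"
  shows "\<exists>c\<in>D. c \<inter> U = P"
proof (rule restriction_surj[OF fX D assms(1) _ assms(3)])
  fix u assume u: "u \<in> dual_on X D" "u \<subseteq> U"
  have "card u \<le> card U" using u assms fX by (meson card_mono finite_subset)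
  then show "u = {}" using small u assms(2) dual by simp
qed

text \<open>Without such a dodecad every word with this pattern on the four points has weight 8 or
  16, and its signed count \<open>S\<close> on the other 20 coordinates is 10 or -6. But any six
  coordinates are independent in the code, so over the coset the mean of the square of
  \<open>S\<close> is 20, as for random words, which is less than 36.\<close>

lemma dodecad_exists:
  assumes pts: "t \<in> X" "a \<in> X" "b \<in> X" "c \<in> X" "distinct [t,a,b,c]"
  shows "\<exists>w\<in>D. card w = 12 \<and> t \<in> w \<and> b \<in> w \<and> c \<in> w \<and> a \<notin> w"
proof (rule ccontr)
  assume no: "\<not> ?thesis"
  define U where "U = {t,a,b,c}"
  define Y where "Y = X - U"
  have U: "U \<subseteq> X" "card U = 4" using pts by (auto simp: U_def)
  have fU: "finite U" by (simp add: U_def)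
  have cY: "card Y = 20" unfolding Y_def using U fX cX fU by (simp add: card_Diff_subset)
  have fY: "finite Y" using fX by (simp add: Y_def)
  obtain w where w: "w \<in> D" "w \<inter> U = {t,b,c}" using pattern[of U "{t,b,c}"] U by (auto simp: U_def)
  define C where "C = {d \<in> D. d \<inter> U = {}}"
  have C: "code_on X C"
    unfolding code_on_def C_def using sub add zero by (auto simp: in_sd)
  have fC: "finite C" using finD by (simp add: C_def)
  have Cne: "card C > 0" using fC zero by (auto simp: C_def card_gt_0_iff)
  define S where "S d = (\<Sum>i\<in>Y. chr {i} (w \<triangle> d))" for d
  have S: "36 \<le> S d * S d" if d: "d \<in> C" for d
  proof -
    let ?e = "w \<triangle> d"
    have e: "?e \<in> D" using add w d by (simp add: C_def)
    have eU: "?e \<inter> U = {t,b,c}" using w d by (simp add: sd_Int C_def)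
    have fe: "finite ?e" using fin[OF e] .
    have "?e = (?e \<inter> U) \<union> (?e \<inter> Y)" using sub[OF e] by (auto simp: Y_def)
    moreover have "card ((?e \<inter> U) \<union> (?e \<inter> Y)) = card (?e \<inter> U) + card (?e \<inter> Y)"
      using fe by (intro card_Un_disjoint) (auto simp: Y_def)
    moreover have "card (?e \<inter> U) = 3" unfolding eU using pts by auto
    ultimately have ce: "card ?e = 3 + card (?e \<inter> Y)" by simp
    have tb: "t \<in> ?e" "b \<in> ?e" "c \<in> ?e" "a \<notin> ?e" using eU pts(5) by (auto simp: U_def)
    have "8 \<le> card ?e" using min8[OF e] tb(1) by blast
    moreover have "card ?e < 24"
    proof -
      have "?e \<subset> X" using sub[OF e] tb pts by auto
      then show ?thesis using fX cX psubset_card_mono by metis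
    qed
    moreover have "card ?e \<noteq> 12" using no e tb by blast
    moreover have "card ?e \<noteq> 20"
    proof
      assume "card ?e = 20"
      then have "X \<triangle> ?e = {}" using compl[OF e] small[of "X \<triangle> ?e"] by linarith
      then have "X = ?e" by simp
      then show False using tb pts by simp
    qed
    moreover have "4 dvd card ?e" using de[OF e] .
    ultimately have "card ?e = 8 \<or> card ?e = 16" by (auto elim!: dvdE)
    moreover have "S d = 20 - 2 * int (card (?e \<inter> Y))"
    proof -
      have "S d = (\<Sum>i\<in>Y. chr {i} (?e \<inter> Y))"
        unfolding S_def
      proof (rule sum.cong[OF refl])
        fix i assume "i \<in> Y"
        then have "{i} \<inter> (?e \<inter> Y) = {i} \<inter> ?e" by auto
        then show "chr {i} ?e = chr {i} (?e \<inter> Y)" by (simp add: chr_def)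
      qed
      also have "\<dots> = 20 - 2 * int (card (?e \<inter> Y))"
        using sum_chr_singletons[OF fY, of "?e \<inter> Y"] cY by simp
      finally show ?thesis .
    qed
    ultimately have "S d = 10 \<or> S d = -6" using ce by auto
    then show ?thesis by auto
  qed
  have "(\<Sum>d\<in>C. S d * S d) = (\<Sum>d\<in>C. \<Sum>i\<in>Y. \<Sum>j\<in>Y. chr ({i} \<triangle> {j}) w * chr ({i} \<triangle> {j}) d)"
  proof (rule sum.cong[OF refl])
    fix d assume d: "d \<in> C"
    have f: "finite w" "finite d" using fin w d by (auto simp: C_def)
    have "S d * S d = (\<Sum>i\<in>Y. \<Sum>j\<in>Y. chr {i} (w \<triangle> d) * chr {j} (w \<triangle> d))"
      unfolding S_def by (rule sum_product)
    also have "\<dots> = (\<Sum>i\<in>Y. \<Sum>j\<in>Y. chr ({i} \<triangle> {j}) w * chr ({i} \<triangle> {j}) d)"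
      by (intro sum.cong refl) (simp add: chr_sd f)
    finally show "S d * S d = (\<Sum>i\<in>Y. \<Sum>j\<in>Y. chr ({i} \<triangle> {j}) w * chr ({i} \<triangle> {j}) d)" .
  qed
  also have "\<dots> = (\<Sum>i\<in>Y. \<Sum>j\<in>Y. \<Sum>d\<in>C. chr ({i} \<triangle> {j}) w * chr ({i} \<triangle> {j}) d)"
    by (subst sum.swap, rule sum.cong[OF refl], subst sum.swap, rule refl)
  also have "\<dots> = (\<Sum>i\<in>Y. \<Sum>j\<in>Y. if i = j then int (card C) else 0)"
  proof (intro sum.cong refl)
    fix i j assume ij: "i \<in> Y" "j \<in> Y"
    have "(\<Sum>d\<in>C. chr ({i} \<triangle> {j}) w * chr ({i} \<triangle> {j}) d) = chr ({i} \<triangle> {j}) w * (\<Sum>d\<in>C. chr ({i} \<triangle> {j}) d)"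
      by (simp add: sum_distrib_left)
    also have "(\<Sum>d\<in>C. chr ({i} \<triangle> {j}) d) = (if {i} \<triangle> {j} \<in> dual_on X C then int (card C) else 0)"
      using ij by (intro sum_chr[OF fX C] sd_subset) (auto simp: Y_def)
    \<comment> \<open>Together with \<open>i\<close> and \<open>j\<close> the set \<open>U\<close>
      has at most six elements, so some word of \<open>C\<close> contains \<open>i\<close> and not
      \<open>j\<close>.\<close>
    also have "{i} \<triangle> {j} \<in> dual_on X C \<longleftrightarrow> i = j"
    proof
      assume d: "{i} \<triangle> {j} \<in> dual_on X C"
      show "i = j"
      proof (rule ccontr)
        assume n: "i \<noteq> j"
        have "card (insert i (insert j U)) < 8"
          using U fU by (simp add: card_insert_if)
        then obtain d where d': "d \<in> D" "d \<inter> insert i (insert j U) = {i}"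
          using pattern[of "insert i (insert j U)" "{i}"] U ij by (auto simp: Y_def)
        have "d \<inter> U = {}"
        proof -
          have "d \<inter> U \<subseteq> {i}" using d'(2) by auto
          then show ?thesis using ij by (auto simp: Y_def)
        qed
        then have "d \<in> C" using d' by (simp add: C_def)
        then have e: "even (card (({i} \<triangle> {j}) \<inter> d))" by (rule dual_onD[OF d])
        have "i \<in> d" using d'(2) by blast
        moreover have "j \<notin> d"
        proof
          assume "j \<in> d"
          then have "j \<in> {i}" unfolding d'(2)[symmetric] by simp
          then show False using n by simp
        qed
        ultimately have "({i} \<triangle> {j}) \<inter> d = {i}" using n by (auto simp: in_sd)
        then show False using e by simp
      qed
    qed (simp add: dual_on_def)
    finally show "(\<Sum>d\<in>C. chr ({i} \<triangle> {j}) w * chr ({i} \<triangle> {j}) d) = (if i = j then int (card C) else 0)"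
      by (auto simp: chr_def)
  qed
  also have "\<dots> = 20 * int (card C)" using fY cY by simp
  finally have "(\<Sum>d\<in>C. S d * S d) = 20 * int (card C)" .
  moreover have "(\<Sum>d\<in>C. 36) \<le> (\<Sum>d\<in>C. S d * S d)" using S by (intro sum_mono) auto
  ultimately show False using Cne by simp
qed

context
  fixes V t a
  assumes V: "V \<in> D" "card V = 12" and t: "t \<in> V" and a: "a \<in> X" "a \<notin> V"
begin

text \<open>The weight is at most 14, hence 8 or 12. A word of weight 12 would have ten points in
  the complementary dodecad, and adding that dodecad would leave weight 4.\<close>

lemma two_meet:
  assumes c: "c \<in> D" "card (c \<inter> V) = 2"
  shows "card c = 8"
proof -
  let ?Y = "X \<triangle> V"
  have Y: "?Y \<in> D" "card ?Y = 12" using compl[OF V(1)] V(2) by auto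
  have f: "finite c" "finite ?Y" using fin c Y by auto
  have "c = (c \<inter> V) \<union> (c \<inter> ?Y)" using sub[OF c(1)] by (auto simp: in_sd)
  moreover have "card ((c \<inter> V) \<union> (c \<inter> ?Y)) = card (c \<inter> V) + card (c \<inter> ?Y)"
    using f sub[OF V(1)] by (intro card_Un_disjoint) (auto simp: in_sd)
  ultimately have cc: "card c = 2 + card (c \<inter> ?Y)" using c by simp
  have ne: "c \<noteq> {}" using c by auto
  have "card (c \<inter> ?Y) \<le> 12" using Y f by (metis card_mono inf_le2)
  moreover have "card c \<noteq> 12"
  proof
    assume "card c = 12"
    then have "card (c \<triangle> ?Y) = 4" using card_sd[OF f] cc Y by simp
    then show False using small[OF add[OF c(1) Y(1)]] by simp
  qed
  moreover have "8 \<le> card c" using min8 c ne by simp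
  moreover have "4 dvd card c" using de c by simp
  ultimately show ?thesis using cc by presburger
qed

text \<open>A nonzero codeword inside the dodecad that misses one of its points would differ from it
  in at most 4 places, so restriction to the other eleven points is onto. A word with trace
  \<open>{t}\<close> there must contain \<open>i\<close> by parity; adding the complementary dodecad
  puts \<open>a\<close> into it if need be.\<close>

lemma octad_exists:
  assumes i: "i \<in> V" "i \<noteq> t"
  shows "\<exists>c\<in>D. c \<inter> V = {t,i} \<and> a \<in> c"
proof -
  have "\<exists>c\<in>D. c \<inter> (V - {i}) = {t}"
  proof (rule restriction_surj[OF fX D])
    show "V - {i} \<subseteq> X" using sub[OF V(1)] by auto
    show "{t} \<subseteq> V - {i}" using t i by auto
    fix u assume u: "u \<in> dual_on X D" "u \<subseteq> V - {i}"
    then have uD: "u \<in> D" and uV: "u \<subseteq> V" using dual by auto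
    show "u = {}"
    proof (rule ccontr)
      assume "u \<noteq> {}"
      then have "8 \<le> card u" using min8 uD by simp
      then have "card (V \<triangle> u) \<le> 4"
        using even_card_complement[of V u] fin[OF V(1)] uV V(2) by simp
      then have "V \<triangle> u = {}" using small[OF add[OF V(1) uD]] by simp
      then show False using u i by auto
    qed
  qed
  then obtain c where c: "c \<in> D" "c \<inter> (V - {i}) = {t}" by auto
  have ti: "c \<inter> V = {t,i}"
  proof -
    have "c \<inter> V = {t} \<or> c \<inter> V = {t,i}" using c(2) t i by auto
    moreover have "c \<inter> V \<noteq> {t}"
    proof
      assume "c \<inter> V = {t}"
      then have "card (c \<inter> V) = 1" by simp
      then show False using meet_even[OF c(1) V(1)] by simp
    qed
    ultimately show ?thesis by blast
  qed
  show ?thesis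
  proof (cases "a \<in> c")
    case False
    let ?d = "c \<triangle> (X \<triangle> V)"
    have "?d \<in> D" using add c compl V by blast
    moreover have "?d \<inter> V = {t,i}" using ti sub[OF V(1)] by (auto simp: in_sd)
    moreover have "a \<in> ?d" using False a by (auto simp: in_sd)
    ultimately show ?thesis by blast
  qed (use c ti in auto)
qed

definition octad :: "'a \<Rightarrow> 'a set" where
  "octad i = (SOME c. c \<in> D \<and> c \<inter> V = {t,i} \<and> a \<in> c)"

lemma octad:
  assumes "i \<in> V - {t}" shows "octad i \<in> D" "octad i \<inter> V = {t,i}" "a \<in> octad i" "card (octad i) = 8"
proof -
  have "\<exists>c. c \<in> D \<and> c \<inter> V = {t,i} \<and> a \<in> c" using octad_exists assms by auto
  from someI_ex[OF this] show o: "octad i \<in> D" "octad i \<inter> V = {t,i}" "a \<in> octad i"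
    unfolding octad_def by auto
  have "card {t,i} = 2" using assms by auto
  then show "card (octad i) = 8" using two_meet o by simp
qed

lemma octad_block:
  assumes i: "i \<in> V - {t}" shows "card {j \<in> X - V - {a}. j \<in> octad i} = 5"
proof -
  have "{j \<in> X - V - {a}. j \<in> octad i} = octad i - {t,i,a}" using octad(2,3)[OF i] sub[OF octad(1)[OF i]] by blast
  moreover have "{t,i,a} \<subseteq> octad i" using octad(2,3)[OF i] by blast
  moreover have "card {t,i,a} = 3"
  proof -
    have "t \<noteq> i" "t \<noteq> a" "i \<noteq> a" using i a t by blast+
    then show ?thesis by simp
  qed
  ultimately show ?thesis using octad(4)[OF i] by (simp add: card_Diff_subset)
qed

text \<open>The sum of the two octads meets \<open>V\<close> in \<open>{i,k}\<close> and so is an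
  octad itself. Hence the two share four points, two of which are \<open>t\<close> and
  \<open>a\<close>.\<close>

lemma octad_block2:
  assumes i: "i \<in> V - {t}" and k: "k \<in> V - {t}" and "i \<noteq> k"
  shows "card {j \<in> X - V - {a}. j \<in> octad i \<and> j \<in> octad k} = 2"
proof -
  note o = octad[OF i] octad[OF k]
  have f: "finite (octad i)" "finite (octad k)" using fin o by auto
  have "(octad i \<triangle> octad k) \<inter> V = {t,i} \<triangle> {t,k}" using o by (simp add: sd_Int)
  also have "\<dots> = {i,k}" using i k \<open>i \<noteq> k\<close> by (auto simp: sym_diff_set_def)
  finally have "card (octad i \<triangle> octad k) = 8" using two_meet[OF add] o \<open>i \<noteq> k\<close> by simp
  then have c4: "card (octad i \<inter> octad k) = 4" using card_sd[OF f] o by simp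
  have "{j \<in> X - V - {a}. j \<in> octad i \<and> j \<in> octad k} = octad i \<inter> octad k - {t,a}"
  proof -
    have "octad i \<inter> octad k \<inter> V = (octad i \<inter> V) \<inter> (octad k \<inter> V)" by blast
    also have "\<dots> = {t}" unfolding o(2,6) using \<open>i \<noteq> k\<close> by blast
    finally show ?thesis using sub[OF o(1)] by blast
  qed
  moreover have "{t,a} \<subseteq> octad i \<inter> octad k" using o(2,3,6,7) by blast
  moreover have "card {t,a} = 2"
  proof -
    have "t \<noteq> a" using a t by blast
    then show ?thesis by simp
  qed
  ultimately show ?thesis using c4 by (simp add: card_Diff_subset)
qed

end

text \<open>The elements of \<open>V\<close> other than \<open>t\<close> serve as blocks, those of
  the complement other than \<open>a\<close> as points of a biplane. Exchanging the two dodecads,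
  and \<open>t\<close> with \<open>a\<close>, gives the dual structure and thereby the axiom on
  pairs of points. Then \<open>b\<close> is the distinguished block and \<open>c\<close> the block
  of edge 0.\<close>

lemma golay_labelling:
  assumes pts: "t \<in> X" "a \<in> X" "b \<in> X" "c \<in> X" "distinct [t,a,b,c]"
  shows "\<exists>es us zs. length es = 10 \<and> length us = 5 \<and> length zs = 6 \<and>
     distinct (t # a # b # es @ us @ zs) \<and> set (t # a # b # es @ us @ zs) = X \<and> es ! 0 = c \<and>
     {t,a,b} \<union> set us \<in> D \<and>
     (\<forall>k<10. {t,a,es ! k,us ! fst (K5_edges ! k),us ! snd (K5_edges ! k)} \<union> {zs ! m |m. m < 6 \<and> pentagons ! m ! k} \<in> D) \<and>
     insert t (insert b (set es)) \<in> D \<and> insert a (set us \<union> set zs) \<in> D"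
proof -
  obtain V where V: "V \<in> D" "card V = 12" "t \<in> V" "b \<in> V" "c \<in> V" "a \<notin> V"
    using dodecad_exists[OF pts] by auto
  define Y where "Y = X \<triangle> V"
  have Y: "Y \<in> D" "card Y = 12" "Y = X - V" using compl[OF V(1)] V(2) sub[OF V(1)] by (auto simp: Y_def in_sd)
  have aY: "a \<in> Y" "t \<notin> Y" using V pts Y by auto
  note V' = V(1-3) pts(2) V(6)
  note Y' = Y(1,2) aY(1) pts(1) aY(2)
  let ?o = "octad V t a" and ?d = "octad Y a t"
  let ?I = "V - {t}" and ?J = "X - V - {a}"
  have YJ: "Y - {a} = ?J" "X - Y - {t} = ?I" using Y sub[OF V(1)] by auto
  \<comment> \<open>The two octads share \<open>t\<close> and \<open>a\<close> and besides at most
    \<open>i\<close> and \<open>j\<close>. Their intersection is even, so \<open>i\<close> and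
    \<open>j\<close> both belong to it or neither does.\<close>
  have dual_inc: "j \<in> ?o i \<longleftrightarrow> i \<in> ?d j" if i: "i \<in> ?I" and j: "j \<in> ?J" for i j
  proof -
    note o = octad[OF V' i]
    have j': "j \<in> Y - {a}" using j YJ by simp
    note d = octad[OF Y' j']
    have "?o i \<inter> ?d j = (?o i \<inter> V) \<inter> ?d j \<union> ?o i \<inter> (?d j \<inter> Y)"
      using sub[OF o(1)] Y(3) by blast
    also have "\<dots> = {t,a} \<union> ({i} \<inter> ?d j) \<union> ({j} \<inter> ?o i)"
      unfolding o(2) d(2) using o(3) d(3) by blast
    finally have eq: "?o i \<inter> ?d j = {t,a} \<union> ({i} \<inter> ?d j) \<union> ({j} \<inter> ?o i)" .
    have n: "t \<noteq> a" "i \<notin> {t,a}" "j \<notin> {t,a}" "i \<noteq> j" using i j V pts by auto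
    have "card ({t,a} \<union> ({i} \<inter> A) \<union> ({j} \<inter> B)) = 2 + (if i \<in> A then 1 else 0) + (if j \<in> B then 1 else 0)" for A B
      using n by auto
    then have "even (2 + (if i \<in> ?d j then 1 else 0) + (if j \<in> ?o i then 1 else 0) :: nat)"
      using meet_even[OF o(1) d(1)] unfolding eq by metis
    then show ?thesis by (simp split: if_splits)
  qed
  interpret bp: biplane ?I ?J "\<lambda>i j. j \<in> ?o i"
  proof
    show "finite ?I" "finite ?J" using fX fin[OF V(1)] by auto
    show "card ?I = 11" using V by simp
    have "card (Y - {a}) = 11" using Y aY by simp
    then show "card ?J = 11" using YJ by simp
    show "card {j \<in> ?J. j \<in> ?o i} = 5" if "i \<in> ?I" for i using octad_block[OF V' that] .
    show "card {j \<in> ?J. j \<in> ?o i \<and> j \<in> ?o i'} = 2" if "i \<in> ?I" "i' \<in> ?I" "i \<noteq> i'" for i i'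
      using octad_block2[OF V' that] .
    show "card {i \<in> ?I. j \<in> ?o i \<and> j' \<in> ?o i} = 2" if j: "j \<in> ?J" "j' \<in> ?J" "j \<noteq> j'" for j j'
    proof -
      have "{i \<in> ?I. j \<in> ?o i \<and> j' \<in> ?o i} = {i \<in> X - Y - {t}. i \<in> ?d j \<and> i \<in> ?d j'}"
        unfolding YJ using dual_inc j by auto
      also have "card \<dots> = 2" using octad_block2[OF Y', of j j'] j YJ by simp
      finally show ?thesis .
    qed
  qed
  have bI: "b \<in> ?I" "c \<in> ?I" "c \<noteq> b" using V pts by auto
  obtain es us zs where es: "distinct es" "length es = 10" "set es = ?I - {b}" "es ! 0 = c"
    and us: "distinct us" "length us = 5" "set us = {j \<in> ?J. j \<in> ?o b}"
    and zs: "distinct zs" "length zs = 6" "set zs = {j \<in> ?J. j \<notin> ?o b}"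
    and eu': "\<forall>k<10. \<forall>p<5. us ! p \<in> ?o (es ! k) \<longleftrightarrow> p = fst (K5_edges ! k) \<or> p = snd (K5_edges ! k)"
    and ez': "\<forall>k<10. \<forall>m<6. zs ! m \<in> ?o (es ! k) \<longleftrightarrow> pentagons ! m ! k"
    using bp.biplane_labelling[OF bI] by (elim exE conjE) (rule that; assumption)
  have eu: "us ! p \<in> ?o (es ! k) \<longleftrightarrow> p = fst (K5_edges ! k) \<or> p = snd (K5_edges ! k)" if "k < 10" "p < 5" for k p
    using eu' that by blast
  have ez: "zs ! m \<in> ?o (es ! k) \<longleftrightarrow> pentagons ! m ! k" if "k < 10" "m < 6" for k m
    using ez' that by blast
  have J: "set us \<union> set zs = ?J" using us zs by auto
  have d: "distinct (t # a # b # es @ us @ zs)"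
  proof -
    have "set es \<inter> ?J = {}" "set us \<inter> set zs = {}" using es us zs by auto
    moreover have "set us \<subseteq> ?J" "set zs \<subseteq> ?J" using us zs by auto
    ultimately show ?thesis using es us zs pts V by auto
  qed
  have s: "set (t # a # b # es @ us @ zs) = X"
    using es J sub[OF V(1)] V pts by auto
  have ob: "{t,a,b} \<union> set us = ?o b"
    using octad[OF V' bI(1)] us(3) sub[of "?o b"] by auto
  have ok: "{t,a,es ! k,us ! fst (K5_edges ! k),us ! snd (K5_edges ! k)} \<union> {zs ! m |m. m < 6 \<and> pentagons ! m ! k} = ?o (es ! k)"
    if k: "k < 10" for k
  proof -
    have ek: "es ! k \<in> ?I" using es k nth_mem[of k es] by auto
    note o = octad[OF V' ek]
    have fs: "fst (K5_edges ! k) < 5" "snd (K5_edges ! k) < 5" using K5_less[OF k] by auto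
    show ?thesis (is "?L = ?R")
    proof
      show "?L \<subseteq> ?R" using o eu[OF k fs(1)] eu[OF k fs(2)] ez[OF k] by auto
      show "?R \<subseteq> ?L"
      proof
        fix x assume x: "x \<in> ?R"
        show "x \<in> ?L"
        proof (cases "x \<in> ?J")
          case True
          then have "x \<in> set us \<or> x \<in> set zs" using J by auto
          then show ?thesis
          proof
            assume "x \<in> set us"
            then obtain p where p: "p < 5" "x = us ! p" using us(2) by (auto simp: in_set_conv_nth)
            then show ?thesis using eu[OF k p(1)] x by auto
          next
            assume "x \<in> set zs"
            then obtain m where m: "m < 6" "x = zs ! m" using zs(2) by (auto simp: in_set_conv_nth)
            then show ?thesis using ez[OF k m(1)] x by auto
          qed
        next
          case False
          then have "x \<in> ?o (es ! k) \<inter> V \<or> x = a" using x sub[OF o(1)] by auto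
          then show ?thesis using o(2) by auto
        qed
      qed
    qed
  qed
  have okD: "{t,a,es ! k,us ! fst (K5_edges ! k),us ! snd (K5_edges ! k)} \<union> {zs ! m |m. m < 6 \<and> pentagons ! m ! k} \<in> D"
    if k: "k < 10" for k
  proof -
    have "es ! k \<in> ?I" using es k nth_mem[of k es] by auto
    then show ?thesis unfolding ok[OF k] using octad(1)[OF V'] by simp
  qed
  have "insert t (insert b (set es)) = V" using es V by auto
  then have VD: "insert t (insert b (set es)) \<in> D" using V(1) by simp
  have "insert a (set us \<union> set zs) = Y" using J Y aY by auto
  then have YD: "insert a (set us \<union> set zs) \<in> D" using Y(1) by simp
  have obD: "{t,a,b} \<union> set us \<in> D" unfolding ob by (rule octad(1)[OF V' bI(1)])
  have okD': "\<forall>k<10. {t,a,es ! k,us ! fst (K5_edges ! k),us ! snd (K5_edges ! k)} \<union> {zs ! m |m. m < 6 \<and> pentagons ! m ! k} \<in> D"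
    using okD by blast
  show ?thesis
    by (intro exI[of _ es] exI[of _ us] exI[of _ zs] conjI; fact)
qed

section \<open>The shortened Golay code and its hyperplanes\<close>

text \<open>The vectors of weight at most 3 off \<open>t\<close> form a transversal of the cosets of the punctured
  (perfect) code, so they represent all linear functionals on the shortened code.\<close>

lemma card_shortened:
  assumes "t \<in> X" shows "card {c \<in> D. t \<notin> c} = 2048"
proof -
  have "bij_betw ((\<triangle>) X) {c \<in> D. t \<notin> c} {c \<in> D. t \<in> c}"
    by (rule bij_betwI[of _ _ _ "(\<triangle>) X"]) (use add[OF XD] assms in \<open>auto simp: in_sd\<close>)
  then have "card {c \<in> D. t \<notin> c} = card {c \<in> D. t \<in> c}" by (rule bij_betw_same_card)
  moreover have "D = {c \<in> D. t \<notin> c} \<union> {c \<in> D. t \<in> c}" by auto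
  then have "card D = card {c \<in> D. t \<notin> c} + card {c \<in> D. t \<in> c}"
    using finD by (subst card_Un_disjoint[symmetric]) auto
  ultimately show ?thesis using cD by simp
qed

text \<open>1 + 23 + 253 + 1771 is a power of two: equality in the sphere packing bound for radius
  3, dimension 12 and length 23.\<close>

lemma card_le_3:
  fixes Y :: "'b set"
  assumes "finite Y" "card Y = 23" shows "card {v. v \<subseteq> Y \<and> card v \<le> 3} = 2048"
proof -
  have "{v. v \<subseteq> Y \<and> card v \<le> 3} = (\<Union>k\<in>{0,1,2,3}. {v. v \<subseteq> Y \<and> card v = k})"
    by (auto simp: numeral_eq_Suc le_Suc_eq)
  also have "card \<dots> = (\<Sum>k\<in>{0,1,2,3}. card {v. v \<subseteq> Y \<and> card v = k})"
    using assms by (intro card_UN_disjoint) auto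
  also have "\<dots> = (\<Sum>k\<in>{0,1,2,3}. 23 choose k)"
    using n_subsets[OF assms(1)] assms(2) by simp
  also have "\<dots> = 2048" by (simp add: eval_nat_numeral)
  finally show ?thesis .
qed

text \<open>A subcode of index 2 is the kernel of a functional, which is given by a word
  \<open>y\<close> modulo the punctured code. The balls of radius 3 around the punctured words fill
  the space, so \<open>y\<close> can be replaced by a word of weight at most 3.\<close>

lemma shortened_hyperplane:
  assumes t: "t \<in> X" and B: "code_on X B" "B \<subseteq> {c \<in> D. t \<notin> c}" "card B = 1024"
  shows "\<exists>v. v \<subseteq> X - {t} \<and> v \<noteq> {} \<and> card v \<le> 3 \<and> B = {c \<in> D. t \<notin> c \<and> even (card (v \<inter> c))}"
proof -
  let ?Y = "X - {t}" and ?S = "{c \<in> D. t \<notin> c}" and ?V = "{v. v \<subseteq> X - {t} \<and> card v \<le> 3}"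
  have Y: "finite ?Y" "card ?Y = 23" using fX cX t by auto
  have S: "code_on ?Y ?S" unfolding code_on_def using sub add zero by (auto simp: in_sd)
  have B': "code_on ?Y B" unfolding code_on_def using code_onD[OF B(1)] B(2) by auto
  have cS: "card ?S = 2048" by (rule card_shortened[OF t])
  let ?G = "dual_on ?Y ?S"
  have G: "code_on ?Y ?G" by (rule code_on_dual[OF Y(1)])
  have cG: "card ?G = 4096" using card_dual_on[OF Y(1) S] Y cS by simp
  have fG: "finite ?G" by (rule finite_dual_on[OF Y(1)])
  \<comment> \<open>The dual of the shortened code is the punctured code; one inclusion and equal
    sizes suffice.\<close>
  have Gp: "?G = (\<lambda>d. d - {t}) ` D"
  proof (rule sym, rule card_subset_eq[OF fG])
    show "(\<lambda>d. d - {t}) ` D \<subseteq> ?G"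
    proof
      fix g assume "g \<in> (\<lambda>d. d - {t}) ` D"
      then obtain d where d: "d \<in> D" "g = d - {t}" by auto
      have "even (card (g \<inter> c))" if "c \<in> ?S" for c
      proof -
        have "g \<inter> c = d \<inter> c" using that d by auto
        then show ?thesis using meet_even[of d c] d that by simp
      qed
      then show "g \<in> ?G" using sub[OF d(1)] d by (auto simp: dual_on_def)
    qed
    have "inj_on (\<lambda>d. d - {t}) D"
    proof (rule inj_onI)
      fix d e assume de: "d \<in> D" "e \<in> D" "d - {t} = e - {t}"
      have "x \<in> d \<longleftrightarrow> x \<in> e" if "x \<noteq> t" for x
        using arg_cong[OF de(3), of "\<lambda>A. x \<in> A"] that by simp
      then have "d \<triangle> e \<subseteq> {t}" unfolding in_sd subset_iff by blast
      then have "card (d \<triangle> e) \<le> card {t}" by (intro card_mono) auto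
      then have "d \<triangle> e = {}" using small[OF add[OF de(1,2)]] by simp
      then show "d = e" by simp
    qed
    then show "card ((\<lambda>d. d - {t}) ` D) = card ?G" using cD cG by (simp add: card_image)
  qed
  have minG: "g = {}" if gG: "g \<in> ?G" "card g \<le> 6" for g
  proof -
    obtain d where d: "d \<in> D" "g = d - {t}" using gG(1) unfolding Gp by auto
    have "card d \<le> card (insert t g)" using d fin[OF d(1)] by (intro card_mono) auto
    also have "\<dots> \<le> Suc (card g)" by (cases "finite g") (simp_all add: card_insert_if)
    finally have "d = {}" using small[OF d(1)] gG(2) by simp
    then show ?thesis using d by simp
  qed
  have fV: "finite v" if "v \<in> ?V" for v using that Y by (auto intro: finite_subset)
  let ?f = "\<lambda>(v,g). v \<triangle> g"
  have inj: "inj_on ?f (?V \<times> ?G)"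
  proof (rule inj_onI)
    fix p q assume p: "p \<in> ?V \<times> ?G" and q: "q \<in> ?V \<times> ?G" and e: "?f p = ?f q"
    obtain v g where vg: "p = (v,g)" by (cases p)
    obtain w h where wh: "q = (w,h)" by (cases q)
    have e': "v \<triangle> g = w \<triangle> h" using e vg wh by simp
    have "v \<triangle> w = (v \<triangle> g) \<triangle> (w \<triangle> g)" by (simp add: sd_ac)
    also have "\<dots> = g \<triangle> h" unfolding e' by (simp add: sd_ac)
    finally have eq: "v \<triangle> w = g \<triangle> h" .
    then have "v \<triangle> w \<in> ?G" using code_onD(3)[OF G] p q vg wh by simp
    moreover have "card (v \<triangle> w) \<le> 6"
      using card_sd[of v w] fV[of v] fV[of w] p q vg wh by auto
    ultimately have "v \<triangle> w = {}" by (rule minG)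
    then show "p = q" using eq vg wh by simp
  qed
  have "?f ` (?V \<times> ?G) = Pow ?Y"
  proof (rule card_subset_eq)
    show "finite (Pow ?Y)" using Y by simp
    show "?f ` (?V \<times> ?G) \<subseteq> Pow ?Y"
    proof
      fix x assume "x \<in> ?f ` (?V \<times> ?G)"
      then obtain v g where "v \<in> ?V" "g \<in> ?G" "x = v \<triangle> g" by auto
      then show "x \<in> Pow ?Y" using sd_subset[of v ?Y g] code_onD(1)[OF G, of g] by simp
    qed
    show "card (?f ` (?V \<times> ?G)) = card (Pow ?Y)"
      using card_image[OF inj] card_le_3[OF Y] cG Y by (simp add: card_cartesian_product card_Pow)
  qed
  moreover have "\<not> dual_on ?Y B \<subseteq> ?G"
  proof
    assume "dual_on ?Y B \<subseteq> ?G"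
    then have "card (dual_on ?Y B) \<le> 4096" using card_mono[OF fG] cG by metis
    then show False using card_dual_on[OF Y(1) B'] Y B(3) by simp
  qed
  then obtain y where y: "y \<in> dual_on ?Y B" "y \<notin> ?G" by auto
  moreover have "y \<in> Pow ?Y" using y by (auto simp: dual_on_def)
  ultimately have "y \<in> ?f ` (?V \<times> ?G)" by simp
  then obtain v g where vg: "v \<in> ?V" "g \<in> ?G" "y = v \<triangle> g" by auto
  have GB: "?G \<subseteq> dual_on ?Y B" using B(2) by (auto simp: dual_on_def)
  have vy: "v = y \<triangle> g" using vg by (simp add: sd_ac)
  have v: "v \<in> dual_on ?Y B" unfolding vy
    using code_onD(3)[OF code_on_dual[OF Y(1)] y(1)] GB vg by auto
  have vG: "v \<notin> ?G"
  proof
    assume "v \<in> ?G" then show False using code_onD(3)[OF G, of v g] vg y by simp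
  qed
  have vne: "v \<noteq> {}" using vG code_onD(2)[OF G] by auto
  let ?H = "{c \<in> D. t \<notin> c \<and> even (card (v \<inter> c))}"
  have fH: "finite ?H" using finD by simp
  have BH: "B \<subseteq> ?H" using B(2) dual_onD[OF v] by auto
  obtain d where d: "d \<in> ?S" "odd (card (v \<inter> d))" using vG vg(1) by (auto simp: dual_on_def)
  \<comment> \<open>Adding a word off the hyperplane embeds it into its complement, so it has at
    most half of the 2048 words and equals \<open>B\<close>.\<close>
  have "(\<triangle>) d ` ?H \<subseteq> ?S - ?H"
  proof
    fix x assume "x \<in> (\<triangle>) d ` ?H"
    then obtain c where c: "c \<in> ?H" "x = d \<triangle> c" by auto
    have "odd (card (v \<inter> x))" using c d fin by (simp add: even_meet_sd)
    moreover have "x \<in> ?S" using c d add by (auto simp: in_sd)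
    ultimately show "x \<in> ?S - ?H" by simp
  qed
  then have "card ((\<triangle>) d ` ?H) \<le> card (?S - ?H)" using finD by (intro card_mono) auto
  moreover have "card ((\<triangle>) d ` ?H) = card ?H" by (rule card_image[OF inj_sd])
  moreover have "card (?S - ?H) = card ?S - card ?H" using fH by (intro card_Diff_subset) auto
  ultimately have "card ?H \<le> 1024" using cS by simp
  moreover have "1024 \<le> card ?H" using card_mono[OF fH BH] B(3) by simp
  ultimately have "B = ?H" using BH fH B(3) by (intro card_subset_eq) auto
  then show ?thesis using vg(1) vne by blast
qed

end

section \<open>Generator lists\<close>

definition supp :: "bool list \<Rightarrow> nat set" where
  "supp l = {i. i < length l \<and> l ! i}"

fun bxor :: "bool list \<Rightarrow> bool list \<Rightarrow> bool list" where
  "bxor (x # xs) (y # ys) = (x \<noteq> y) # bxor xs ys"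
| "bxor _ _ = []"

fun bdot :: "bool list \<Rightarrow> bool list \<Rightarrow> bool" where
  "bdot (x # xs) (y # ys) = ((x \<and> y) \<noteq> bdot xs ys)"
| "bdot _ _ = False"

text \<open>A threshold test with a unary bound: evaluation stops once enough entries are found and
  involves no numeral arithmetic, which keeps the enumeration of whole spans cheap.\<close>

fun bge :: "nat \<Rightarrow> bool list \<Rightarrow> bool" where
  "bge 0 l = True"
| "bge (Suc n) [] = False"
| "bge (Suc n) (True # l) = bge n l"
| "bge (Suc n) (False # l) = bge (Suc n) l"

lemma bge_iff: "bge n l \<longleftrightarrow> n \<le> bcount l"
  by (induction n l rule: bge.induct) auto

lemma supp_Nil [simp]: "supp [] = {}"
  by (simp add: supp_def)

lemma supp_Cons: "supp (x # xs) = (if x then {0} else {}) \<union> Suc ` supp xs"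
proof (rule set_eqI)
  fix i show "i \<in> supp (x # xs) \<longleftrightarrow> i \<in> (if x then {0} else {}) \<union> Suc ` supp xs"
    by (cases i) (auto simp: supp_def)
qed

lemma finite_supp [simp]: "finite (supp l)"
  by (simp add: supp_def)

lemma supp_subset: "supp l \<subseteq> {..<length l}"
  by (auto simp: supp_def)

lemma card_supp: "card (supp l) = bcount l"
proof (induction l)
  case (Cons x l)
  have "card (Suc ` supp l) = card (supp l)" by (rule card_image) simp
  moreover have "0 \<notin> Suc ` supp l" by auto
  ultimately show ?case using Cons by (cases x) (simp_all add: supp_Cons)
qed simp

lemma length_bxor [simp]: "length x = length y \<Longrightarrow> length (bxor x y) = length y"
  by (induction x y rule: bxor.induct) auto

lemma nth_bxor: "length x = length y \<Longrightarrow> i < length y \<Longrightarrow> bxor x y ! i = (x ! i \<noteq> y ! i)"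
  by (induction x y arbitrary: i rule: bxor.induct) (auto simp: nth_Cons split: nat.splits)

lemma supp_bxor: "length x = length y \<Longrightarrow> supp (bxor x y) = supp x \<triangle> supp y"
  by (auto simp: supp_def in_sd nth_bxor)

lemma bdot_iff: "length x = length y \<Longrightarrow> bdot x y \<longleftrightarrow> odd (card (supp x \<inter> supp y))"
proof (induction x y rule: bdot.induct)
  case (1 x xs y ys)
  have e: "supp (x # xs) \<inter> supp (y # ys) = (if x \<and> y then {0} else {}) \<union> Suc ` (supp xs \<inter> supp ys)"
    by (auto simp: supp_Cons)
  have "card (Suc ` (supp xs \<inter> supp ys)) = card (supp xs \<inter> supp ys)" by (rule card_image) simp
  moreover have "0 \<notin> Suc ` (supp xs \<inter> supp ys)" by auto
  ultimately have "card (supp (x # xs) \<inter> supp (y # ys)) = (if x \<and> y then 1 else 0) + card (supp xs \<inter> supp ys)"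
    unfolding e by simp
  then show ?case using 1 by auto
qed auto

lemma supp_append: "supp (x @ y) = supp x \<union> (+) (length x) ` supp y"
proof (rule set_eqI)
  fix i show "i \<in> supp (x @ y) \<longleftrightarrow> i \<in> supp x \<union> (+) (length x) ` supp y"
    by (auto simp: supp_def nth_append image_iff intro: exI[of _ "i - length x"])
qed

lemma supp_replicate_False [simp]: "supp (replicate n False) = {}"
  by (auto simp: supp_def)

fun gspan :: "'a set list \<Rightarrow> 'a set set" where
  "gspan [] = {{}}"
| "gspan (g # gs) = gspan gs \<union> (\<triangle>) g ` gspan gs"

lemma code_on_span: "(\<And>g. g \<in> set gs \<Longrightarrow> g \<subseteq> X) \<Longrightarrow> code_on X (gspan gs)"
proof (induction gs)
  case (Cons g gs)
  then show ?case using code_on_coset_union[of X "gspan gs" g] by simp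
qed (auto simp: code_on_def)

lemma empty_in_span: "{} \<in> gspan gs"
  by (induction gs) auto

lemma gen_in_span: "g \<in> set gs \<Longrightarrow> g \<in> gspan gs"
proof (induction gs)
  case (Cons h gs)
  show ?case
  proof (cases "g = h")
    case True
    then show ?thesis using empty_in_span[of gs] by (auto intro!: image_eqI[of _ _ "{}"])
  qed (use Cons in auto)
qed simp

lemma span_least:
  assumes "code_on X C" "set gs \<subseteq> C" shows "gspan gs \<subseteq> C"
  using assms(2)
proof (induction gs)
  case (Cons g gs)
  then show ?case using code_onD(3)[OF assms(1)] by auto
qed (use code_onD(2)[OF assms(1)] in auto)

lemma span_append: "gspan (gs @ hs) = {x \<triangle> y |x y. x \<in> gspan gs \<and> y \<in> gspan hs}"
proof (induction gs)
  case (Cons g gs)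
  show ?case
  proof (intro equalityI subsetI)
    fix z assume "z \<in> gspan ((g # gs) @ hs)"
    then obtain w where w: "w \<in> gspan (gs @ hs)" "z = w \<or> z = g \<triangle> w" by auto
    then obtain x y where xy: "x \<in> gspan gs" "y \<in> gspan hs" "w = x \<triangle> y" using Cons by auto
    have "z = x \<triangle> y \<or> z = (g \<triangle> x) \<triangle> y" using w xy by (simp add: sd_assoc)
    then show "z \<in> {x \<triangle> y |x y. x \<in> gspan (g # gs) \<and> y \<in> gspan hs}"
      using xy by (auto intro: exI[of _ x] exI[of _ "g \<triangle> x"])
  next
    fix z assume "z \<in> {x \<triangle> y |x y. x \<in> gspan (g # gs) \<and> y \<in> gspan hs}"
    then obtain x y where xy: "x \<in> gspan (g # gs)" "y \<in> gspan hs" "z = x \<triangle> y" by auto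
    then obtain w where w: "w \<in> gspan gs" "x = w \<or> x = g \<triangle> w" by auto
    have "w \<triangle> y \<in> gspan (gs @ hs)" using Cons w xy by auto
    moreover have "z = w \<triangle> y \<or> z = g \<triangle> (w \<triangle> y)" using w xy by (auto simp: sd_assoc)
    ultimately show "z \<in> gspan ((g # gs) @ hs)" by auto
  qed
qed simp

lemma finite_span: "finite (gspan gs)"
  by (induction gs) auto

lemma span_even_meet:
  assumes "\<And>g. g \<in> set gs \<Longrightarrow> finite g \<and> even (card (g \<inter> u))" "x \<in> gspan gs"
  shows "finite x \<and> even (card (x \<inter> u))"
  using assms
proof (induction gs arbitrary: x)
  case (Cons g gs)
  then show ?case by (auto simp: even_meet_sd)
qed simp

lemma span_orthogonal:
  assumes fin: "\<And>g. g \<in> set gs \<Longrightarrow> finite g" "\<And>h. h \<in> set hs \<Longrightarrow> finite h"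
    and ev: "\<And>g h. g \<in> set gs \<Longrightarrow> h \<in> set hs \<Longrightarrow> even (card (g \<inter> h))"
    and x: "x \<in> gspan gs" and y: "y \<in> gspan hs"
  shows "even (card (x \<inter> y))"
proof -
  have "finite h \<and> even (card (h \<inter> x))" if h: "h \<in> set hs" for h
    using span_even_meet[OF _ x, of h] fin ev[OF _ h] h by (simp add: Int_commute)
  then show ?thesis using span_even_meet[OF _ y, of x] by (simp add: Int_commute)
qed

fun all_orth :: "bool list list \<Rightarrow> bool" where
  "all_orth [] = True"
| "all_orth (g # gs) = (list_all (\<lambda>h. \<not> bdot g h) (g # gs) \<and> all_orth gs)"

text \<open>Linear independence is certified by one test vector per generator that is orthogonal to all
  later generators.\<close>

fun triangular :: "bool list list \<Rightarrow> bool list list \<Rightarrow> bool" where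
  "triangular [] us = True"
| "triangular (g # gs) (u # us) = (bdot g u \<and> list_all (\<lambda>h. \<not> bdot h u) gs \<and> triangular gs us)"
| "triangular (g # gs) [] = False"

lemma all_orth_meet:
  assumes "all_orth gs" "\<forall>g\<in>set gs. length g = n" "g \<in> set gs" "h \<in> set gs"
  shows "even (card (supp g \<inter> supp h))"
  using assms
proof (induction gs)
  case (Cons k gs)
  have "even (card (supp k \<inter> supp h))" if "h \<in> set (k # gs)" for h
    using Cons.prems(1,2) that by (auto simp: list_all_iff bdot_iff)
  then show ?case using Cons by (auto simp: Int_commute)
qed simp

lemma triangular_notin:
  assumes "triangular (g # gs) us" "\<forall>h\<in>set (g # gs). length h = n" "\<forall>u\<in>set us. length u = n"
  shows "supp g \<notin> gspan (map supp gs)"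
proof
  assume a: "supp g \<in> gspan (map supp gs)"
  obtain u us' where u: "us = u # us'" using assms(1) by (cases us) auto
  have "finite h \<and> even (card (h \<inter> supp u))" if "h \<in> set (map supp gs)" for h
    using assms that by (auto simp: u list_all_iff bdot_iff)
  then have "even (card (supp g \<inter> supp u))" using span_even_meet[OF _ a, of "supp u"] by blast
  then show False using assms by (auto simp: u bdot_iff)
qed

lemma span_disjoint:
  assumes "g \<notin> gspan gs" shows "gspan gs \<inter> (\<triangle>) g ` gspan gs = {}"
proof -
  have C: "code_on UNIV (gspan gs)" by (rule code_on_span) auto
  have "g \<in> gspan gs" if "x \<in> gspan gs" "y \<in> gspan gs" "x = g \<triangle> y" for x y
  proof -
    have "x \<triangle> y = g" using that(3) by (simp add: sd_ac)
    then show ?thesis using code_onD(3)[OF C that(1,2)] by simp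
  qed
  then show ?thesis using assms by auto
qed

lemma card_span:
  assumes "triangular gs us" "\<forall>h\<in>set gs. length h = n" "\<forall>u\<in>set us. length u = n"
  shows "card (gspan (map supp gs)) = 2 ^ length gs"
  using assms
proof (induction gs us rule: triangular.induct)
  case (2 g gs u us)
  have "gspan (map supp gs) \<inter> (\<triangle>) (supp g) ` gspan (map supp gs) = {}"
    by (rule span_disjoint[OF triangular_notin[OF 2(2-4)]])
  then show ?case using 2 by (simp add: card_Un_disjoint finite_span card_image[OF inj_sd])
qed auto

text \<open>Each generator is added to the accumulator or omitted, so the words visited form the
  coset of \<open>a\<close>. Different starting values reach the glue cosets with the same
  generators.\<close>

fun span_all :: "(bool list \<Rightarrow> bool) \<Rightarrow> bool list list \<Rightarrow> bool list \<Rightarrow> bool" where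
  "span_all P [] a = P a"
| "span_all P (g # gs) a = (span_all P gs a \<and> span_all P gs (bxor g a))"

lemma span_all:
  assumes "span_all P gs a" "\<forall>g\<in>set gs. length g = n" "length a = n" "x \<in> gspan (map supp gs)"
  shows "\<exists>l. length l = n \<and> supp l = x \<triangle> supp a \<and> P l"
  using assms
proof (induction gs arbitrary: a x)
  case (Cons g gs)
  from Cons.prems(4) consider "x \<in> gspan (map supp gs)" | y where "y \<in> gspan (map supp gs)" "x = supp g \<triangle> y" by auto
  then show ?case
  proof cases
    case 1 then show ?thesis using Cons by auto
  next
    case 2
    have "\<exists>l. length l = n \<and> supp l = y \<triangle> supp (bxor g a) \<and> P l"
      using Cons.prems 2 by (intro Cons.IH) auto
    moreover have "y \<triangle> supp (bxor g a) = x \<triangle> supp a"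
      using Cons.prems 2 by (simp add: supp_bxor sd_ac)
    ultimately show ?thesis by simp
  qed
qed auto

fun span_count :: "(bool list \<Rightarrow> bool) \<Rightarrow> bool list list \<Rightarrow> bool list \<Rightarrow> nat" where
  "span_count P [] a = (if P a then 1 else 0)"
| "span_count P (g # gs) a = span_count P gs a + span_count P gs (bxor g a)"

text \<open>The enumeration counts choices of generators; the triangular tests guarantee that
  different choices give different words.\<close>

lemma span_count:
  assumes "triangular gs us" "\<forall>g\<in>set gs. length g = n" "\<forall>u\<in>set us. length u = n" "length a = n"
    and "\<And>l. P l \<longleftrightarrow> Q (supp l)"
  shows "card {x \<in> gspan (map supp gs). Q (x \<triangle> supp a)} = span_count P gs a"
  using assms(1-4)
proof (induction gs us arbitrary: a rule: triangular.induct)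
  case (2 g gs u us)
  let ?S = "gspan (map supp gs)"
  have "{x \<in> gspan (map supp (g # gs)). Q (x \<triangle> supp a)}
      = {x \<in> ?S. Q (x \<triangle> supp a)} \<union> (\<triangle>) (supp g) ` {y \<in> ?S. Q (y \<triangle> supp (bxor g a))}"
    using 2 by (auto simp: supp_bxor sd_ac)
  moreover have "{x \<in> ?S. Q (x \<triangle> supp a)} \<inter> (\<triangle>) (supp g) ` {y \<in> ?S. Q (y \<triangle> supp (bxor g a))} = {}"
    using span_disjoint[OF triangular_notin[OF 2(2-4)]] by blast
  ultimately have "card {x \<in> gspan (map supp (g # gs)). Q (x \<triangle> supp a)}
      = card {x \<in> ?S. Q (x \<triangle> supp a)} + card {y \<in> ?S. Q (y \<triangle> supp (bxor g a))}"
    by (simp add: card_Un_disjoint finite_span card_image[OF inj_sd])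
  then show ?case using 2 by simp
next
  case (1 us)
  have "{x. x = {} \<and> Q (x \<triangle> supp a)} = (if Q (supp a) then {{}} else {})" by auto
  then show ?case using assms(5) by simp
qed auto


section \<open>Explicit generators on the cycles and on the fixed coordinates\<close>

definition bits :: "nat \<Rightarrow> nat list \<Rightarrow> bool list" where
  "bits n ps = map (\<lambda>i. List.member ps i) [0..<n]"

text \<open>Even-weight words on a 7-cycle: the minimal cyclic codes generated by
  \<open>{0,1,2,4}\<close> and by \<open>{0,3,5,6}\<close>.\<close>

definition zero7 :: "bool list" where "zero7 = replicate 7 False"
definition A0 :: "bool list" where "A0 = bits 7 [0,1,2,4]"
definition A1 :: "bool list" where "A1 = bits 7 [1,2,3,5]"
definition A2 :: "bool list" where "A2 = bits 7 [2,3,4,6]"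
definition C0 :: "bool list" where "C0 = bits 7 [0,3,5,6]"
definition C1 :: "bool list" where "C1 = bits 7 [0,1,4,6]"
definition C2 :: "bool list" where "C2 = bits 7 [0,1,2,5]"

text \<open>Over the field with 8 elements: the line of constant triples in the first module, and in
  the second module its dual, the triples with sum zero. Their binary dimensions are 3 and
  6.\<close>

definition E_gens :: "bool list list" where
  "E_gens = [A0 @ A0 @ A0, A1 @ A1 @ A1, A2 @ A2 @ A2,
     C0 @ C0 @ zero7, C1 @ C1 @ zero7, C2 @ C2 @ zero7,
     zero7 @ C0 @ C0, zero7 @ C1 @ C1, zero7 @ C2 @ C2]"

text \<open>The first three vectors are \<open>C0\<close>, \<open>C1\<close> and \<open>C2\<close>
  on the first cycle, which pair with the first module and annihilate the second. All tests have
  even weight on every cycle and thus also annihilate full cycles.\<close>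

definition E_tests :: "bool list list" where
  "E_tests = map (bits 21) [[0,3,5,6],[0,1,4,6],[0,1,2,5],[0,1],[0,2],[0,3],[7,8],[7,9],[7,10]]"

text \<open>The coordinates of length 23 are, in this order: the points \<open>a\<close> and \<open>b\<close>, the ten edges of
  \<open>K5_edges\<close>, the five vertices and the six pentagons.  The lists below are the Golay octads through
  \<open>t\<close> and \<open>a\<close> given by the block \<open>b\<close> and by the edges (without \<open>t\<close>), and the dodecad through \<open>a\<close>.\<close>

definition octad_b :: "bool list" where "octad_b = bits 23 [0,1,12,13,14,15,16]"

definition octads :: "bool list list" where
  "octads = map (\<lambda>k. bits 23 (0 # (2 + k) # (12 + fst (K5_edges ! k)) # (12 + snd (K5_edges ! k)) #
     map ((+) 17) (filter (\<lambda>m. pentagons ! m ! k) [0..<6]))) [0..<10]"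

definition dodecad :: "bool list" where "dodecad = bits 23 [0,12,13,14,15,16,17,18,19,20,21,22]"

text \<open>Generators of the hyperplanes of the shortened Golay code that are orthogonal to
  \<open>{a}\<close>, \<open>{b,c}\<close> and \<open>{a,b,c}\<close>, where \<open>c\<close> is the first edge, together with an orthonormal basis of
  the dual modulo the hyperplane.\<close>

definition B1_gens :: "bool list list" where "B1_gens = map (bxor octad_b) octads"
definition B1_glue :: "bool list list" where
  "B1_glue = map (bits 23) [[0], [12,13,14,15,16,17,18,19,20,21,22], [1,2,3,4,5,6,7,8,9,10,11]]"
definition B1_tests :: "bool list list" where
  "B1_tests = map (bits 23) [[2],[3],[4],[5],[6],[7],[8],[9],[10],[11]]"

definition B2_gens :: "bool list list" where
  "B2_gens = bxor octad_b (octads ! 0) # dodecad # map (bxor (octads ! 1)) (drop 2 octads)"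
definition B2_glue :: "bool list list" where
  "B2_glue = map (bits 23) [[0,3,4,5,6,7,8,9,10,11,12,13,14,15,16,17,18,19,20,21,22],
     [0,2,4,5,6,7,8,9,10,11,12,14,17,19,22], [0,1,4,5,6,7,8,9,10,11,12,14,17,19,22]]"
definition B2_tests :: "bool list list" where
  "B2_tests = map (bits 23) [[1],[0],[4],[5],[6],[7],[8],[9],[10],[11]]"

definition B3_gens :: "bool list list" where
  "B3_gens = bxor octad_b (octads ! 0) # map (\<lambda>x. bxor dodecad (bxor octad_b x)) (drop 1 octads)"
definition B3_glue :: "bool list list" where
  "B3_glue = map (bits 23) [[0,1,2], [1,2,12,13,14,15,16,17,18,19,20,21,22], [1,2,3,4,5,6,7,8,9,10,11]]"
definition B3_tests :: "bool list list" where
  "B3_tests = map (bits 23) [[2],[3],[4],[5],[6],[7],[8],[9],[10],[11]]"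

fun all_zero :: "bool list \<Rightarrow> bool" where
  "all_zero [] = True"
| "all_zero (x # xs) = (\<not> x \<and> all_zero xs)"

lemma all_zero_iff: "all_zero l \<longleftrightarrow> supp l = {}"
  by (induction l) (auto simp: supp_Cons)

section \<open>The three codes\<close>

abbreviation "n5 \<equiv> Suc (Suc (Suc (Suc (Suc 0))))"
abbreviation "n8 \<equiv> Suc (Suc (Suc n5))"

definition cyc :: "nat \<Rightarrow> nat set" where "cyc i = {7 * i..<7 * i + 7}"

definition pick :: "bool \<Rightarrow> 'a set \<Rightarrow> 'a set" where "pick s A = (if s then A else {})"

definition cycS :: "bool \<Rightarrow> bool \<Rightarrow> bool \<Rightarrow> nat set" where
  "cycS s0 s1 s2 = pick s0 (cyc 0) \<triangle> (pick s1 (cyc 1) \<triangle> pick s2 (cyc 2))"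

definition cycL :: "bool \<Rightarrow> bool \<Rightarrow> bool \<Rightarrow> bool list" where
  "cycL s0 s1 s2 = replicate 7 s0 @ replicate 7 s1 @ replicate 7 s2"

lemma supp_cycL: "supp (cycL s0 s1 s2) = cycS s0 s1 s2"
  by (auto simp: supp_def cycL_def nth_append cycS_def in_sd pick_def cyc_def)

abbreviation E_code :: "nat set set" where "E_code \<equiv> gspan (map supp E_gens)"

lemma E_checks: "triangular E_gens E_tests"
  "list_all (\<lambda>x. length x = 21) (E_gens @ E_tests)" "length E_gens = 9"
  by code_simp+

lemma E_length: "\<forall>g\<in>set E_gens. length g = 21" "\<forall>g\<in>set E_tests. length g = 21"
  using E_checks(2) by (auto simp: list_all_iff)

lemma E_subset: "x \<in> E_code \<Longrightarrow> x \<subseteq> {..<21}"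
  using code_onD(1)[OF code_on_span[of "map supp E_gens" "{..<21}"]] E_length supp_subset by fastforce

lemma length_cycL: "length (cycL s0 s1 s2) = 21"
  by (simp add: cycL_def)

lemma E_weight_checks:
  "span_all (\<lambda>l. all_zero l \<or> bge n8 l) E_gens (cycL False False False)"
  "span_all (bge (Suc (Suc n5))) E_gens (cycL True False False)"
  "span_all (bge (Suc (Suc n5))) E_gens (cycL False True False)"
  "span_all (bge (Suc (Suc n5))) E_gens (cycL False False True)"
  "span_all (bge (Suc n5)) E_gens (cycL True True False)"
  "span_all (bge (Suc n5)) E_gens (cycL True False True)"
  "span_all (bge (Suc n5)) E_gens (cycL False True True)"
  "span_all (bge n5) E_gens (cycL True True True)"
  by code_simp+

lemma E_weight_aux:
  assumes "x \<in> E_code" "span_all P E_gens (cycL s0 s1 s2)"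
  shows "\<exists>l. supp l = x \<triangle> cycS s0 s1 s2 \<and> P l"
  using span_all[OF assms(2) E_length(1) length_cycL assms(1)] by (auto simp: supp_cycL)

text \<open>Evaluated on all 512 words for each of the eight choices of full cycles. One, two or
  three full cycles leave weight at least 7, 6 or 5: each cycle used costs at most one unit, to be
  regained on the fixed coordinates.\<close>

lemma E_weight:
  assumes x: "x \<in> E_code"
  shows "x \<noteq> {} \<Longrightarrow> 8 \<le> card x"
    and "s0 \<or> s1 \<or> s2 \<Longrightarrow> 8 \<le> card (x \<triangle> cycS s0 s1 s2) + of_bool s0 + of_bool s1 + of_bool s2"
proof -
  note a = E_weight_aux[OF x]
  note r = bge_iff card_supp[symmetric]
  show "8 \<le> card x" if "x \<noteq> {}"
    using a[OF E_weight_checks(1)] that by (auto simp: r all_zero_iff cycS_def pick_def)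
  show "8 \<le> card (x \<triangle> cycS s0 s1 s2) + of_bool s0 + of_bool s1 + of_bool s2" if s: "s0 \<or> s1 \<or> s2"
    using s a[OF E_weight_checks(2)] a[OF E_weight_checks(3)] a[OF E_weight_checks(4)]
      a[OF E_weight_checks(5)] a[OF E_weight_checks(6)] a[OF E_weight_checks(7)] a[OF E_weight_checks(8)]
    by (cases s0; cases s1; cases s2) (auto simp: r)
qed

lemma E_count_checks:
  "span_count (\<lambda>l. bge (Suc n5) l \<and> \<not> bge (Suc (Suc n5)) l) E_gens (cycL True True False) = 56"
  "span_count (\<lambda>l. bge (Suc n5) l \<and> \<not> bge (Suc (Suc n5)) l) E_gens (cycL True False True) = 56"
  "span_count (\<lambda>l. bge (Suc n5) l \<and> \<not> bge (Suc (Suc n5)) l) E_gens (cycL False True True) = 56"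
  by code_simp+

text \<open>These light words serve twice: they show that two full cycles alone cannot form a
  codeword, and they bound the contribution of one glue coset to the words of weight 8.\<close>

lemma E_count:
  assumes "of_bool s0 + of_bool s1 + of_bool s2 = (2::nat)"
  shows "card {x \<in> E_code. card (x \<triangle> cycS s0 s1 s2) = 6} = 56"
proof -
  have "card {x \<in> E_code. card (x \<triangle> supp (cycL s0 s1 s2)) = 6}
      = span_count (\<lambda>l. bge (Suc n5) l \<and> \<not> bge (Suc (Suc n5)) l) E_gens (cycL s0 s1 s2)"
    by (rule span_count[OF E_checks(1) E_length length_cycL]) (auto simp: bge_iff card_supp)
  also have "\<dots> = 56"
    using assms E_count_checks by (cases s0; cases s1; cases s2) simp_all
  finally show ?thesis unfolding supp_cycL .
qed

definition fx :: "nat set \<Rightarrow> nat set" where "fx s = (+) 21 ` s"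

lemma fx_sd: "fx (A \<triangle> B) = fx A \<triangle> fx B"
  unfolding fx_def by (rule sd_image[where X=UNIV]) auto

lemma card_fx: "card (fx s) = card s"
  unfolding fx_def by (rule card_image) simp

lemma fx_Int: "fx A \<inter> fx B = fx (A \<inter> B)"
  unfolding fx_def by auto

lemma fx_ge: "i \<in> fx s \<Longrightarrow> 21 \<le> i"
  by (auto simp: fx_def)

definition gens44 :: "bool list list \<Rightarrow> bool list list \<Rightarrow> bool list list" where
  "gens44 B v = map (\<lambda>x. x @ replicate 23 False) E_gens @
     [cycL True False False @ v ! 0, cycL False True False @ v ! 1, cycL False False True @ v ! 2] @
     map (\<lambda>y. replicate 21 False @ y) B"

text \<open>The tests of the even part carry over because they do not see full cycles; the first
  point of each cycle tests the glue generator of that cycle.\<close>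

definition tests44 :: "bool list list \<Rightarrow> bool list list" where
  "tests44 us = map (\<lambda>x. x @ replicate 23 False) E_tests @ [bits 44 [0], bits 44 [7], bits 44 [14]] @
     map (\<lambda>y. replicate 21 False @ y) us"

text \<open>The finite computations that a standard code rests on. The weights of nonzero words on
  the fixed coordinates lie between 8 and 16, and the three glue words add up to the all-one word;
  hence the coset that goes with all three cycles consists of complements and has weights of at
  least 7.\<close>

definition std_checks :: "bool list list \<Rightarrow> bool list list \<Rightarrow> bool list list \<Rightarrow> bool" where
  "std_checks B v us \<longleftrightarrow> list_all (\<lambda>x. length x = 23) (B @ v @ us) \<and> length B = 10 \<and> length v = 3 \<and>
     triangular B us \<and> triangular (gens44 B v) (tests44 us) \<and> all_orth (gens44 B v) \<and>
     list_all (\<lambda>w. list_all (\<lambda>b. \<not> bdot w b) B) v \<and>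
     bdot (v ! 0) (v ! 0) \<and> bdot (v ! 1) (v ! 1) \<and> bdot (v ! 2) (v ! 2) \<and>
     \<not> bdot (v ! 0) (v ! 1) \<and> \<not> bdot (v ! 0) (v ! 2) \<and> \<not> bdot (v ! 1) (v ! 2) \<and>
     bxor (v ! 0) (bxor (v ! 1) (v ! 2)) = replicate 23 True \<and>
     span_all (\<lambda>l. all_zero l \<or> bge n8 l \<and> \<not> bge (Suc (n8 + n8)) l) B (replicate 23 False)"

lemma B1_checks: "std_checks B1_gens B1_glue B1_tests" by code_simp
lemma B2_checks: "std_checks B2_gens B2_glue B2_tests" by code_simp
lemma B3_checks: "std_checks B3_gens B3_glue B3_tests" by code_simp

definition Std :: "bool list list \<Rightarrow> bool list list \<Rightarrow> nat set set" where
  "Std B v = gspan (map supp (gens44 B v))"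

definition E8 :: "nat set set" where "E8 = {x \<in> E_code. card x = 8}"

locale std_code =
  fixes B v us :: "bool list list"
  assumes chk: "std_checks B v us"
begin

abbreviation "B_code \<equiv> gspan (map supp B)"
abbreviation "w i \<equiv> supp (v ! i)"

lemma lengths: "\<forall>b\<in>set B. length b = 23" "\<forall>u\<in>set us. length u = 23" "length v = 3"
  "i < 3 \<Longrightarrow> length (v ! i) = 23"
  using chk by (auto simp: std_checks_def list_all_iff)

lemma lengths44: "\<forall>g\<in>set (gens44 B v). length g = 44" "\<forall>u\<in>set (tests44 us). length u = 44"
  "length (gens44 B v) = 22"
  using lengths E_length chk E_checks(3)
  by (auto simp: gens44_def tests44_def length_cycL bits_def std_checks_def)

lemma Std_code: "code_on {..<44} (Std B v)"
  unfolding Std_def using lengths44 supp_subset by (intro code_on_span) fastforce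

lemma card_Std: "card (Std B v) = 2 ^ 22"
  unfolding Std_def using card_span[of "gens44 B v" "tests44 us" 44] lengths44 chk by (simp add: std_checks_def)

lemma Std_dual: "dual_on {..<44} (Std B v) = Std B v"
proof (rule self_dual_if_card[OF _ Std_code])
  show "Std B v \<subseteq> dual_on {..<44} (Std B v)"
  proof
    fix x assume x: "x \<in> Std B v"
    have "even (card (x \<inter> y))" if "y \<in> Std B v" for y
    proof (rule span_orthogonal)
      show "x \<in> gspan (map supp (gens44 B v))" "y \<in> gspan (map supp (gens44 B v))" using x that by (auto simp: Std_def)
      fix g h assume "g \<in> set (map supp (gens44 B v))" "h \<in> set (map supp (gens44 B v))"
      then show "even (card (g \<inter> h))"
        using all_orth_meet[of "gens44 B v" 44] lengths44(1) chk by (auto simp: std_checks_def)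
    qed auto
    then show "x \<in> dual_on {..<44} (Std B v)" using code_onD(1)[OF Std_code x] by (auto simp: dual_on_def)
  qed
qed (simp_all add: card_Std)

definition wS :: "bool \<Rightarrow> bool \<Rightarrow> bool \<Rightarrow> nat set" where
  "wS s0 s1 s2 = pick s0 (w 0) \<triangle> (pick s1 (w 1) \<triangle> pick s2 (w 2))"

lemma gspan_gens44: "Std B v = {x \<triangle> (g \<triangle> fx b) |x g b. x \<in> E_code \<and> b \<in> B_code \<and>
   g \<in> gspan [cyc 0 \<union> fx (w 0), cyc 1 \<union> fx (w 1), cyc 2 \<union> fx (w 2)]}"
proof -
  have 1: "map supp (map (\<lambda>x. x @ replicate 23 False) E_gens) = map supp E_gens"
    by (simp add: supp_append o_def)
  have 2: "map supp (map (\<lambda>y. replicate 21 False @ y) B) = map fx (map supp B)"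
    by (simp add: supp_append o_def fx_def)
  have 3: "map supp [cycL True False False @ v ! 0, cycL False True False @ v ! 1, cycL False False True @ v ! 2]
     = [cyc 0 \<union> fx (w 0), cyc 1 \<union> fx (w 1), cyc 2 \<union> fx (w 2)]"
    by (simp add: supp_append supp_cycL length_cycL cycS_def pick_def fx_def)
  have 4: "gspan (map fx gs) = fx ` gspan gs" for gs
    by (induction gs) (auto simp: fx_sd image_Un image_image, simp_all add: fx_def)
  show ?thesis
    unfolding Std_def gens44_def map_append 1 2 3 span_append 4 by blast
qed

lemma Std_cases:
  assumes "c \<in> Std B v"
  obtains x s0 s1 s2 b where "x \<in> E_code" "b \<in> B_code"
    "c = (x \<triangle> cycS s0 s1 s2) \<union> fx (wS s0 s1 s2 \<triangle> b)"
    "(x \<triangle> cycS s0 s1 s2) \<subseteq> {..<21}"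
proof -
  obtain x g b where c: "c = x \<triangle> (g \<triangle> fx b)" and x: "x \<in> E_code" and b: "b \<in> B_code"
    and g: "g \<in> gspan [cyc 0 \<union> fx (w 0), cyc 1 \<union> fx (w 1), cyc 2 \<union> fx (w 2)]"
    using assms unfolding gspan_gens44 by blast
  obtain s0 s1 s2 where g': "g = pick s0 (cyc 0 \<union> fx (w 0)) \<triangle> (pick s1 (cyc 1 \<union> fx (w 1)) \<triangle> pick s2 (cyc 2 \<union> fx (w 2)))"
  proof -
    have "\<exists>s0 s1 s2. g = pick s0 (cyc 0 \<union> fx (w 0)) \<triangle> (pick s1 (cyc 1 \<union> fx (w 1)) \<triangle> pick s2 (cyc 2 \<union> fx (w 2)))"
      using g unfolding gspan.simps pick_def by (auto simp: ex_bool_eq)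
    then show ?thesis using that by blast
  qed
  have cyc21: "cyc 0 \<subseteq> {..<21}" "cyc 1 \<subseteq> {..<21}" "cyc 2 \<subseteq> {..<21}" by (auto simp: cyc_def)
  have dis: "A \<union> fx A' = A \<triangle> fx A'" if "A \<subseteq> {..<21}" for A A'
    using that fx_ge by (fastforce simp: in_sd)
  have p: "pick s (cyc i \<union> fx A) = pick s (cyc i) \<triangle> fx (pick s A)" if "cyc i \<subseteq> {..<21}" for s i A
    using dis[OF that] by (simp add: pick_def) (simp add: fx_def)
  have g2: "g = cycS s0 s1 s2 \<triangle> fx (wS s0 s1 s2)"
    unfolding g' cycS_def wS_def p[OF cyc21(1)] p[OF cyc21(2)] p[OF cyc21(3)] fx_sd by (simp add: sd_ac)
  have cs: "cycS s0 s1 s2 \<subseteq> {..<21}" using supp_subset[of "cycL s0 s1 s2"] by (simp add: supp_cycL length_cycL)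
  have sub: "x \<triangle> cycS s0 s1 s2 \<subseteq> {..<21}" by (rule sd_subset[OF E_subset[OF x] cs])
  have "c = (x \<triangle> cycS s0 s1 s2) \<triangle> fx (wS s0 s1 s2 \<triangle> b)"
    unfolding c g2 fx_sd by (simp add: sd_ac)
  then have "c = (x \<triangle> cycS s0 s1 s2) \<union> fx (wS s0 s1 s2 \<triangle> b)" using dis[OF sub] by simp
  then show ?thesis using that x b sub by blast
qed

lemma card_split:
  assumes "A \<subseteq> {..<21}" and that: "finite F" shows "card (A \<union> fx F) = card A + card F"
proof -
  have "card (A \<union> fx F) = card A + card (fx F)"
    using assms that fx_ge by (intro card_Un_disjoint) (auto simp: fx_def finite_subset)
  then show ?thesis by (simp add: card_fx)
qed

lemma B_finite: "b \<in> B_code \<Longrightarrow> finite b" and B_subset: "b \<in> B_code \<Longrightarrow> b \<subseteq> {..<23}"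
proof -
  have C: "code_on {..<23} B_code" using lengths(1) supp_subset by (intro code_on_span) fastforce
  show "b \<in> B_code \<Longrightarrow> b \<subseteq> {..<23}" using code_onD(1)[OF C] .
  then show "b \<in> B_code \<Longrightarrow> finite b" by (meson finite_lessThan finite_subset)
qed

lemma B_weight:
  assumes "b \<in> B_code" shows "b \<noteq> {} \<Longrightarrow> 8 \<le> card b" "card b \<le> 16"
proof -
  have "\<exists>l. length l = 23 \<and> supp l = b \<triangle> supp (replicate 23 False) \<and> (all_zero l \<or> bge n8 l \<and> \<not> bge (Suc (n8 + n8)) l)"
    using chk lengths(1) assms by (intro span_all) (auto simp: std_checks_def)
  then obtain l where l: "b = supp l" "all_zero l \<or> bge n8 l \<and> \<not> bge (Suc (n8 + n8)) l" by auto
  then show "b \<noteq> {} \<Longrightarrow> 8 \<le> card b" "card b \<le> 16"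
    by (auto simp: bge_iff card_supp all_zero_iff) (metis all_zero_iff card.empty card_supp zero_le)+
qed

lemma w_orth:
  shows "odd (card (w 0 \<inter> w 0))" "odd (card (w 1 \<inter> w 1))" "odd (card (w 2 \<inter> w 2))"
    "even (card (w 0 \<inter> w 1))" "even (card (w 0 \<inter> w 2))" "even (card (w 1 \<inter> w 2))"
  using chk lengths(4)[of 0] lengths(4)[of 1] lengths(4)[of 2]
  by (simp_all add: std_checks_def bdot_iff)

lemma w_B_orth: "b \<in> B_code \<Longrightarrow> i < 3 \<Longrightarrow> even (card (b \<inter> w i))"
proof -
  assume b: "b \<in> B_code" and i: "i < 3"
  have "v ! i \<in> set v" using i lengths(3) by simp
  then have "finite g \<and> even (card (g \<inter> w i))" if "g \<in> set (map supp B)" for g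
    using that chk lengths(1) lengths(4)[OF i] by (auto simp: std_checks_def list_all_iff bdot_iff Int_commute)
  then show "even (card (b \<inter> w i))" using span_even_meet[OF _ b] by blast
qed

lemma w_all: "wS True True True = {..<23}"
proof -
  have "wS True True True = supp (bxor (v ! 0) (bxor (v ! 1) (v ! 2)))"
    using lengths(4)[of 0] lengths(4)[of 1] lengths(4)[of 2] by (simp add: wS_def pick_def supp_bxor)
  also have "\<dots> = supp (replicate 23 True)" using chk by (simp add: std_checks_def)
  also have "\<dots> = {..<23}" by (auto simp: supp_def)
  finally show ?thesis .
qed

lemma wS_meet:
  "odd (card (wS s0 s1 s2 \<inter> w 0)) = s0" "odd (card (wS s0 s1 s2 \<inter> w 1)) = s1" "odd (card (wS s0 s1 s2 \<inter> w 2)) = s2"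
  using w_orth by (simp_all add: wS_def pick_def even_meet_sd Int_commute)

lemma coset_meet:
  assumes b: "b \<in> B_code"
  shows "odd (card ((wS s0 s1 s2 \<triangle> b) \<inter> w 0)) = s0" "odd (card ((wS s0 s1 s2 \<triangle> b) \<inter> w 1)) = s1"
    "odd (card ((wS s0 s1 s2 \<triangle> b) \<inter> w 2)) = s2"
proof -
  have f: "finite (wS s0 s1 s2)" "finite b" using B_finite[OF b] by (simp_all add: wS_def pick_def)
  show "odd (card ((wS s0 s1 s2 \<triangle> b) \<inter> w 0)) = s0" "odd (card ((wS s0 s1 s2 \<triangle> b) \<inter> w 1)) = s1"
    "odd (card ((wS s0 s1 s2 \<triangle> b) \<inter> w 2)) = s2"
    using wS_meet[of s0 s1 s2] w_B_orth[OF b] by (simp_all add: even_meet_sd[OF f])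
qed

lemma coset_nonempty: "b \<in> B_code \<Longrightarrow> s0 \<or> s1 \<or> s2 \<Longrightarrow> wS s0 s1 s2 \<triangle> b \<noteq> {}"
  using coset_meet[of b s0 s1 s2] by (metis Int_empty_left card.empty even_zero)

lemma Std_even: "c \<in> Std B v \<Longrightarrow> even (card c)"
  using Std_dual dual_onD[of c "{..<44}" "Std B v" c] by simp

text \<open>With \<open>m > 0\<close> full cycles the cycle part has weight at least
  \<open>8 - m\<close>. For \<open>m = 1\<close> a nonempty fixed part suffices, for
  \<open>m = 2\<close> it gives 7 and evenness supplies the rest, and for \<open>m = 3\<close> the
  fixed part alone has weight at least 7.\<close>

lemma Std_min:
  assumes c: "c \<in> Std B v" "c \<noteq> {}" shows "8 \<le> card c"
proof -
  obtain x s0 s1 s2 b where x: "x \<in> E_code" and b: "b \<in> B_code"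
    and ce: "c = (x \<triangle> cycS s0 s1 s2) \<union> fx (wS s0 s1 s2 \<triangle> b)" and sub: "(x \<triangle> cycS s0 s1 s2) \<subseteq> {..<21}"
    using Std_cases[OF c(1)] .
  let ?F = "wS s0 s1 s2 \<triangle> b"
  have fF: "finite ?F" using B_finite[OF b] by (simp add: wS_def pick_def)
  have cc: "card c = card (x \<triangle> cycS s0 s1 s2) + card ?F" unfolding ce by (rule card_split[OF sub fF])
  show ?thesis
  proof (cases "s0 \<or> s1 \<or> s2")
    case False
    then have s: "cycS s0 s1 s2 = {}" "wS s0 s1 s2 = {}" by (simp_all add: cycS_def wS_def pick_def)
    then have "x \<noteq> {} \<or> b \<noteq> {}" using c(2) ce by (auto simp: fx_def)
    then show ?thesis using E_weight(1)[OF x] B_weight(1)[OF b] cc s by fastforce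
  next
    case True
    have F1: "1 \<le> card ?F" using coset_nonempty[OF b True] fF by (simp add: Suc_le_eq card_gt_0_iff)
    have F3: "7 \<le> card ?F" if "s0 \<and> s1 \<and> s2"
    proof -
      have "card ?F = 23 - card b"
        using that w_all even_card_complement[of "{..<23}" b] B_subset[OF b] by simp
      then show ?thesis using B_weight(2)[OF b] by simp
    qed
    have "8 \<le> card (x \<triangle> cycS s0 s1 s2) + of_bool s0 + of_bool s1 + of_bool s2" by (rule E_weight(2)[OF x True])
    then show ?thesis using F1 F3 cc Std_even[OF c(1)] True
      by (cases s0; cases s1; cases s2; simp; presburger)
  qed
qed

text \<open>The even part cannot cancel a nontrivial choice of full cycles, since an empty cycle
  part would violate the bound in \<open>E_weight\<close>.\<close>

lemma Std_fix:
  assumes c: "c \<in> Std B v" "c \<subseteq> {21..}" shows "\<exists>b\<in>B_code. c = fx b"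
proof -
  obtain x s0 s1 s2 b where x: "x \<in> E_code" and b: "b \<in> B_code"
    and ce: "c = (x \<triangle> cycS s0 s1 s2) \<union> fx (wS s0 s1 s2 \<triangle> b)" and sub: "(x \<triangle> cycS s0 s1 s2) \<subseteq> {..<21}"
    using Std_cases[OF c(1)] .
  have "x \<triangle> cycS s0 s1 s2 = {}" using c(2) ce sub by fastforce
  then have xc: "x = cycS s0 s1 s2" by simp
  have "\<not> (s0 \<or> s1 \<or> s2)"
  proof
    assume s: "s0 \<or> s1 \<or> s2"
    then have "8 \<le> card (x \<triangle> cycS s0 s1 s2) + of_bool s0 + of_bool s1 + of_bool s2" by (rule E_weight(2)[OF x])
    then show False using xc by (auto split: if_splits simp: of_bool_def)
  qed
  then show ?thesis using ce b xc by (auto simp: wS_def cycS_def pick_def)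
qed

section \<open>Counting words of weight 8\<close>

definition W8 :: "nat set set" where "W8 = {c \<in> Std B v. card c = 8}"
definition B8 :: "nat set set" where "B8 = {b \<in> B_code. card b = 8}"

lemma fin8: "finite W8" "finite E8" "finite B8"
  unfolding W8_def E8_def B8_def Std_def by (auto simp: finite_span)

lemma card_E8_B8: "card (E8 \<union> fx ` B8) = card E8 + card B8"
proof -
  have "E8 \<inter> fx ` B8 = {}"
  proof -
    have False if "x \<in> E8" "x = fx b" "b \<in> B8" for x b
    proof -
      have "x \<subseteq> {..<21}" using that E_subset by (auto simp: E8_def)
      moreover have "x \<noteq> {}" using that by (auto simp: E8_def)
      ultimately show False using that fx_ge by fastforce
    qed
    then show ?thesis by auto
  qed
  moreover have "card (fx ` B8) = card B8" by (rule card_image) (auto simp: inj_on_def fx_def inj_image_eq_iff)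
  ultimately show ?thesis using fin8 by (simp add: card_Un_disjoint)
qed

lemma W8_lower: "card E8 + card B8 \<le> card W8"
proof -
  have "x \<in> Std B v" if "x \<in> E_code" for x
  proof -
    have "x = x \<triangle> ({} \<triangle> fx {})" by (simp add: fx_def)
    then show ?thesis unfolding gspan_gens44 using that empty_in_span by blast
  qed
  moreover have "fx b \<in> Std B v" if "b \<in> B_code" for b
  proof -
    have "fx b = {} \<triangle> ({} \<triangle> fx b)" by simp
    then show ?thesis unfolding gspan_gens44 using that empty_in_span by blast
  qed
  ultimately have "E8 \<union> fx ` B8 \<subseteq> W8" by (auto simp: W8_def E8_def B8_def card_fx)
  then show ?thesis using card_mono[OF fin8(1)] card_E8_B8 by metis
qed

text \<open>Words with all three full cycles are too heavy. With one or two of them the cycle part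
  leaves at most that many points for the fixed part, so only light words in six glue cosets have to
  be inspected.\<close>

lemma W8_cases:
  assumes c: "c \<in> W8"
  shows "c \<in> E8 \<union> fx ` B8 \<or> (\<exists>x s0 s1 s2 b. x \<in> E_code \<and> b \<in> B_code \<and> (s0 \<or> s1 \<or> s2) \<and> \<not> (s0 \<and> s1 \<and> s2) \<and>
    c = (x \<triangle> cycS s0 s1 s2) \<union> fx (wS s0 s1 s2 \<triangle> b) \<and>
    card (x \<triangle> cycS s0 s1 s2) + card (wS s0 s1 s2 \<triangle> b) = 8 \<and>
    card (wS s0 s1 s2 \<triangle> b) \<le> of_bool s0 + of_bool s1 + of_bool s2)"
proof -
  have c8: "c \<in> Std B v" "card c = 8" using c by (auto simp: W8_def)
  obtain x s0 s1 s2 b where x: "x \<in> E_code" and b: "b \<in> B_code"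
    and ce: "c = (x \<triangle> cycS s0 s1 s2) \<union> fx (wS s0 s1 s2 \<triangle> b)" and sub: "(x \<triangle> cycS s0 s1 s2) \<subseteq> {..<21}"
    using Std_cases[OF c8(1)] .
  let ?F = "wS s0 s1 s2 \<triangle> b"
  have fF: "finite ?F" using B_finite[OF b] by (simp add: wS_def pick_def)
  have cc: "card (x \<triangle> cycS s0 s1 s2) + card ?F = 8" using card_split[OF sub fF] ce c8(2) by simp
  show ?thesis
  proof (cases "s0 \<or> s1 \<or> s2")
    case False
    then have s: "cycS s0 s1 s2 = {}" "wS s0 s1 s2 = {}" by (simp_all add: cycS_def wS_def pick_def)
    have "x = {} \<or> b = {}"
    proof (rule ccontr)
      assume "\<not> ?thesis"
      then have "8 \<le> card x" "8 \<le> card b" using E_weight(1)[OF x] B_weight(1)[OF b] by auto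
      then show False using cc s by simp
    qed
    then show ?thesis using ce s cc x b by (auto simp: E8_def B8_def fx_def)
  next
    case True
    have n3: "\<not> (s0 \<and> s1 \<and> s2)"
    proof
      assume s: "s0 \<and> s1 \<and> s2"
      have "card ?F = 23 - card b"
        using s w_all even_card_complement[of "{..<23}" b] B_subset[OF b] by simp
      then have "7 \<le> card ?F" using B_weight(2)[OF b] by simp
      moreover have "8 \<le> card (x \<triangle> cycS s0 s1 s2) + of_bool s0 + of_bool s1 + of_bool s2" by (rule E_weight(2)[OF x True])
      ultimately show False using cc s by simp
    qed
    have "8 \<le> card (x \<triangle> cycS s0 s1 s2) + of_bool s0 + of_bool s1 + of_bool s2" by (rule E_weight(2)[OF x True])
    then have "card ?F \<le> of_bool s0 + of_bool s1 + of_bool s2" using cc by linarith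
    then show ?thesis using x b True n3 ce cc by blast
  qed
qed

end

interpretation S1: std_code B1_gens B1_glue B1_tests by unfold_locales (rule B1_checks)
interpretation S2: std_code B2_gens B2_glue B2_tests by unfold_locales (rule B2_checks)
interpretation S3: std_code B3_gens B3_glue B3_tests by unfold_locales (rule B3_checks)

lemma (in std_code) card_B8:
  "card B8 = span_count (\<lambda>l. bge n8 l \<and> \<not> bge (Suc n8) l) B (replicate 23 False)"
proof -
  have "card {b \<in> B_code. card (b \<triangle> supp (replicate 23 False)) = 8}
    = span_count (\<lambda>l. bge n8 l \<and> \<not> bge (Suc n8) l) B (replicate 23 False)"
    using chk lengths by (intro span_count[of B us 23]) (auto simp: std_checks_def bge_iff card_supp)
  then show ?thesis by (simp add: B8_def)
qed

text \<open>In terms of Golay octads: 330 avoid \<open>t\<close> and \<open>a\<close>; 210 avoid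
  \<open>t\<close>, \<open>b\<close> and \<open>c\<close>, and 56 contain \<open>b\<close> and
  \<open>c\<close> but not \<open>t\<close>; 130 avoid all four points, and for each of the three
  pairs from \<open>a\<close>, \<open>b\<close>, \<open>c\<close> there are 40 that contain just
  this pair.\<close>

lemma B8_counts: "card S1.B8 = 330" "card S2.B8 = 266" "card S3.B8 = 250"
  unfolding S1.card_B8 S2.card_B8 S3.card_B8 by code_simp+

lemma coset_checks_2:
  "span_all (bge (Suc (Suc 0))) B2_gens (B2_glue ! 0)"
  "span_all (bge (Suc (Suc 0))) B2_gens (B2_glue ! 1)"
  "span_all (bge (Suc (Suc 0))) B2_gens (B2_glue ! 2)"
  "span_all (bge (Suc (Suc (Suc 0)))) B2_gens (bxor (B2_glue ! 0) (B2_glue ! 1))"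
  "span_all (bge (Suc (Suc (Suc 0)))) B2_gens (bxor (B2_glue ! 0) (B2_glue ! 2))"
  "span_all (\<lambda>l. l = bits 23 [1,2] \<or> bge (Suc (Suc (Suc 0))) l) B2_gens (bxor (B2_glue ! 1) (B2_glue ! 2))"
  by code_simp+

lemma coset_checks_3:
  "span_all (bge (Suc (Suc 0))) B3_gens (B3_glue ! 0)"
  "span_all (bge (Suc (Suc 0))) B3_gens (B3_glue ! 1)"
  "span_all (bge (Suc (Suc 0))) B3_gens (B3_glue ! 2)"
  "span_all (bge (Suc (Suc (Suc 0)))) B3_gens (bxor (B3_glue ! 0) (B3_glue ! 1))"
  "span_all (bge (Suc (Suc (Suc 0)))) B3_gens (bxor (B3_glue ! 0) (B3_glue ! 2))"
  "span_all (bge (Suc (Suc (Suc 0)))) B3_gens (bxor (B3_glue ! 1) (B3_glue ! 2))"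
  by code_simp+

lemma (in std_code) coset_span_all:
  assumes "b \<in> B_code" "span_all P B a" "length a = 23"
  shows "\<exists>l. length l = 23 \<and> supp l = supp a \<triangle> b \<and> P l"
  using span_all[OF assms(2) lengths(1) assms(3,1)] by (simp add: sd_comm)

lemma (in std_code) wS_lists:
  "wS True False False = supp (v ! 0)" "wS False True False = supp (v ! 1)" "wS False False True = supp (v ! 2)"
  "wS True True False = supp (bxor (v ! 0) (v ! 1))" "wS True False True = supp (bxor (v ! 0) (v ! 2))"
  "wS False True True = supp (bxor (v ! 1) (v ! 2))"
  using lengths(4)[of 0] lengths(4)[of 1] lengths(4)[of 2] by (simp_all add: wS_def pick_def supp_bxor)

lemma (in std_code) glue_lengths:
  "length (v ! 0) = 23" "length (v ! 1) = 23" "length (v ! 2) = 23"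
  "length (bxor (v ! 0) (v ! 1)) = 23" "length (bxor (v ! 0) (v ! 2)) = 23" "length (bxor (v ! 1) (v ! 2)) = 23"
  using lengths(4)[of 0] lengths(4)[of 1] lengths(4)[of 2] by simp_all

lemma (in std_code) coset_bge:
  assumes "b \<in> B_code" "span_all (bge n) B a" "length a = 23"
  shows "n \<le> card (supp a \<triangle> b)"
  using coset_span_all[OF assms] by (auto simp: bge_iff card_supp[symmetric])

text \<open>No glue coset of the third code is light enough, so it has no words of weight 8 that use
  both full cycles and glue.\<close>

lemma coset_min_3:
  assumes b: "b \<in> S3.B_code" and s: "s0 \<or> s1 \<or> s2" "\<not> (s0 \<and> s1 \<and> s2)"
  shows "of_bool s0 + of_bool s1 + of_bool s2 < card (S3.wS s0 s1 s2 \<triangle> b)"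
proof -
  note a = S3.coset_bge[OF b coset_checks_3(1) S3.glue_lengths(1)] S3.coset_bge[OF b coset_checks_3(2) S3.glue_lengths(2)]
    S3.coset_bge[OF b coset_checks_3(3) S3.glue_lengths(3)] S3.coset_bge[OF b coset_checks_3(4) S3.glue_lengths(4)]
    S3.coset_bge[OF b coset_checks_3(5) S3.glue_lengths(5)] S3.coset_bge[OF b coset_checks_3(6) S3.glue_lengths(6)]
  note a' = a[folded S3.wS_lists]
  show ?thesis using s a' by (cases s0; cases s1; cases s2; simp)
qed

text \<open>The exception is \<open>{b,c}\<close>, the set that defines the hyperplane. Being in the
  dual it lies in some glue coset, here in that of the last two glue words.\<close>

lemma coset_min_2:
  assumes b: "b \<in> S2.B_code" and s: "s0 \<or> s1 \<or> s2" "\<not> (s0 \<and> s1 \<and> s2)"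
  shows "of_bool s0 + of_bool s1 + of_bool s2 < card (S2.wS s0 s1 s2 \<triangle> b) \<or>
    \<not> s0 \<and> s1 \<and> s2 \<and> S2.wS s0 s1 s2 \<triangle> b = supp (bits 23 [1,2])"
proof -
  note a = S2.coset_bge[OF b coset_checks_2(1) S2.glue_lengths(1)] S2.coset_bge[OF b coset_checks_2(2) S2.glue_lengths(2)]
    S2.coset_bge[OF b coset_checks_2(3) S2.glue_lengths(3)] S2.coset_bge[OF b coset_checks_2(4) S2.glue_lengths(4)]
    S2.coset_bge[OF b coset_checks_2(5) S2.glue_lengths(5)]
  note a' = a[folded S2.wS_lists]
  have "3 \<le> card (S2.wS False True True \<triangle> b) \<or> S2.wS False True True \<triangle> b = supp (bits 23 [1,2])"
    using S2.coset_span_all[OF b coset_checks_2(6) S2.glue_lengths(6)] unfolding S2.wS_lists(6)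
    by (metis bge_iff card_supp numeral_3_eq_3)
  then show ?thesis using s a' by (cases s0; cases s1; cases s2; simp; linarith)
qed

lemma W8_3: "card S3.W8 = card E8 + 250"
proof -
  have "S3.W8 \<subseteq> E8 \<union> fx ` S3.B8"
  proof
    fix c assume c: "c \<in> S3.W8"
    show "c \<in> E8 \<union> fx ` S3.B8"
    proof (rule ccontr)
      assume "c \<notin> E8 \<union> fx ` S3.B8"
      then obtain x s0 s1 s2 b where h: "b \<in> S3.B_code" "s0 \<or> s1 \<or> s2" "\<not> (s0 \<and> s1 \<and> s2)"
        "card (S3.wS s0 s1 s2 \<triangle> b) \<le> of_bool s0 + of_bool s1 + of_bool s2"
        using S3.W8_cases[OF c] by blast
      then show False using coset_min_3[OF h(1-3)] by simp
    qed
  qed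
  then have "card S3.W8 \<le> card E8 + card S3.B8"
    using card_mono[of "E8 \<union> fx ` S3.B8" S3.W8] S3.fin8 S3.card_E8_B8 by simp
  then show ?thesis using S3.W8_lower B8_counts by simp
qed

text \<open>The exceptional coset adds at most 56 words to the 266 on the fixed coordinates. A range
  suffices: beyond \<open>card E8\<close>, it lies strictly between the 250 of the third code and
  the at least 330 of the first.\<close>

lemma W8_2: "card S2.W8 \<le> card E8 + 322" "card E8 + 266 \<le> card S2.W8"
proof -
  let ?F = "fx (supp (bits 23 [1,2]))"
  let ?X = "{x \<in> E_code. card (x \<triangle> cycS False True True) = 6}"
  let ?Z = "(\<lambda>x. (x \<triangle> cycS False True True) \<union> ?F) ` ?X"
  have c2: "card (supp (bits 23 [1,2])) = 2" unfolding card_supp by code_simp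
  have fX: "finite ?X" using finite_span[of "map supp E_gens"] by simp
  have "S2.W8 \<subseteq> (E8 \<union> fx ` S2.B8) \<union> ?Z"
  proof
    fix c assume c: "c \<in> S2.W8"
    show "c \<in> (E8 \<union> fx ` S2.B8) \<union> ?Z"
    proof (cases "c \<in> E8 \<union> fx ` S2.B8")
      case False
      then obtain x s0 s1 s2 b where h: "x \<in> E_code" "b \<in> S2.B_code" "s0 \<or> s1 \<or> s2" "\<not> (s0 \<and> s1 \<and> s2)"
        "c = (x \<triangle> cycS s0 s1 s2) \<union> fx (S2.wS s0 s1 s2 \<triangle> b)"
        "card (x \<triangle> cycS s0 s1 s2) + card (S2.wS s0 s1 s2 \<triangle> b) = 8"
        "card (S2.wS s0 s1 s2 \<triangle> b) \<le> of_bool s0 + of_bool s1 + of_bool s2"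
        using S2.W8_cases[OF c] by blast
      have "\<not> of_bool s0 + of_bool s1 + of_bool s2 < card (S2.wS s0 s1 s2 \<triangle> b)"
        using h(7) by (simp only: not_less)
      then have e: "\<not> s0 \<and> s1 \<and> s2 \<and> S2.wS s0 s1 s2 \<triangle> b = supp (bits 23 [1,2])"
        using coset_min_2[OF h(2-4)] by blast
      then have s: "s0 = False" "s1 = True" "s2 = True" and w: "S2.wS s0 s1 s2 \<triangle> b = supp (bits 23 [1,2])"
        by blast+
      have "card (x \<triangle> cycS s0 s1 s2) = 6" using h(6) unfolding w c2 by simp
      then have "x \<in> ?X" using h(1) unfolding s by simp
      moreover have "c = (x \<triangle> cycS False True True) \<union> ?F" using h(5) unfolding w unfolding s .
      ultimately show ?thesis by (intro UnI2 image_eqI)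
    qed simp
  qed
  then have "card S2.W8 \<le> card ((E8 \<union> fx ` S2.B8) \<union> ?Z)"
    using S2.fin8 fX by (intro card_mono) auto
  also have "\<dots> \<le> card (E8 \<union> fx ` S2.B8) + card ?Z" by (rule card_Un_le)
  also have "card ?Z \<le> card ?X" using fX by (rule card_image_le)
  finally show "card S2.W8 \<le> card E8 + 322" using E_count[of False True True] S2.card_E8_B8 B8_counts by simp
  show "card E8 + 266 \<le> card S2.W8" using S2.W8_lower B8_counts by simp
qed

lemma W8_1: "card E8 + 330 \<le> card S1.W8"
  using S1.W8_lower B8_counts by simp

section \<open>Codes invariant under the permutation\<close>

lemma code_on_image:
  assumes "inj_on f X" "code_on X C" shows "code_on (f ` X) ((`) f ` C)"
proof -
  have "f ` a \<triangle> f ` b \<in> (`) f ` C" if "a \<in> C" "b \<in> C" for a b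
    using sd_image[OF assms(1), of a b] code_onD[OF assms(2)] that by (metis image_eqI)
  then show ?thesis using code_onD(1,2)[OF assms(2)] unfolding code_on_def by blast
qed

lemma card_image_Int:
  assumes "inj_on f X" "a \<subseteq> X" "b \<subseteq> X" shows "card (f ` a \<inter> f ` b) = card (a \<inter> b)"
proof -
  have "f ` a \<inter> f ` b = f ` (a \<inter> b)" using assms inj_on_image_Int by metis
  moreover have "inj_on f (a \<inter> b)" using assms by (meson inf_le1 inj_on_subset order_trans)
  ultimately show ?thesis by (simp add: card_image)
qed

lemma dual_on_image:
  assumes "inj_on f X" "C \<subseteq> Pow X"
  shows "dual_on (f ` X) ((`) f ` C) = (`) f ` dual_on X C"
proof (rule set_eqI)
  fix u show "u \<in> dual_on (f ` X) ((`) f ` C) \<longleftrightarrow> u \<in> (`) f ` dual_on X C"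
  proof
    assume u: "u \<in> dual_on (f ` X) ((`) f ` C)"
    then have "u \<subseteq> f ` X" by (simp add: dual_on_def)
    then obtain a where a: "a \<subseteq> X" "u = f ` a" by (meson subset_imageE)
    have "even (card (a \<inter> c))" if "c \<in> C" for c
    proof -
      have "c \<subseteq> X" using that assms(2) by auto
      then show ?thesis using dual_onD[OF u, of "f ` c"] card_image_Int[OF assms(1) a(1)] a(2) that by simp
    qed
    then show "u \<in> (`) f ` dual_on X C" using a by (auto simp: dual_on_def)
  next
    assume "u \<in> (`) f ` dual_on X C"
    then obtain a where a: "a \<in> dual_on X C" "u = f ` a" by auto
    have aX: "a \<subseteq> X" using a by (simp add: dual_on_def)
    have "even (card (u \<inter> d))" if d: "d \<in> (`) f ` C" for d
    proof -
      obtain c where c: "c \<in> C" "d = f ` c" using d by auto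
      then have "c \<subseteq> X" using assms(2) by auto
      then show ?thesis using card_image_Int[OF assms(1) aX] dual_onD[OF a(1) c(1)] a c by simp
    qed
    then show "u \<in> dual_on (f ` X) ((`) f ` C)" using a aX by (auto simp: dual_on_def)
  qed
qed

section \<open>Rotations and reversals of the cycles\<close>

definition blk :: "nat \<Rightarrow> (nat \<Rightarrow> nat) \<Rightarrow> nat \<Rightarrow> nat" where
  "blk n p i = (if n \<le> i \<and> i < n + 7 then n + p (i - n) else i)"

text \<open>\<open>R\<close> is the operation on lists induced by moving the support with
  \<open>p\<close>; it reads each entry through the inverse \<open>q\<close>.\<close>

lemma blk_supp:
  assumes p: "\<And>j. j < 7 \<Longrightarrow> p j < 7" "\<And>j. j < 7 \<Longrightarrow> q j < 7" "\<And>j. j < 7 \<Longrightarrow> p (q j) = j" "\<And>j. j < 7 \<Longrightarrow> q (p j) = j"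
    and R: "length (R y) = 7" "\<And>j. j < 7 \<Longrightarrow> R y ! j = y ! q j"
    and l: "length x = n" "length y = 7"
  shows "blk n p ` supp (x @ y @ z) = supp (x @ R y @ z)"
proof -
  have 1: "blk n p ` supp x = supp x"
  proof -
    have "blk n p i = i" if "i \<in> supp x" for i using that l by (auto simp: blk_def supp_def)
    then show ?thesis by (simp cong: image_cong)
  qed
  have 2: "blk n p ` ((+) n ` supp y) = (+) n ` supp (R y)"
  proof -
    have "blk n p ((+) n j) = n + p j" if "j \<in> supp y" for j
      using that l by (simp add: blk_def supp_def)
    then have "blk n p ` ((+) n ` supp y) = (+) n ` (p ` supp y)"
      by (simp add: image_image cong: image_cong)
    also have "p ` supp y = supp (R y)"
    proof (intro equalityI subsetI)
      fix i assume "i \<in> p ` supp y"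
      then obtain j where "j < 7" "y ! j" "i = p j" using l by (auto simp: supp_def)
      then show "i \<in> supp (R y)" using p R by (simp add: supp_def)
    next
      fix i assume "i \<in> supp (R y)"
      then have "i < 7" "y ! q i" using R by (auto simp: supp_def)
      then have "q i \<in> supp y" "i = p (q i)" using p l by (auto simp: supp_def)
      then show "i \<in> p ` supp y" by blast
    qed
    finally show ?thesis .
  qed
  have 3: "blk n p ` ((+) n ` (+) 7 ` supp z) = (+) n ` (+) 7 ` supp z"
  proof -
    have "blk n p i = i" if "i \<in> (+) n ` (+) 7 ` supp z" for i using that by (auto simp: blk_def)
    then show ?thesis by (simp cong: image_cong)
  qed
  show ?thesis unfolding supp_append image_Un l R(1) 1 2 3 ..
qed

lemma blk_bij:
  assumes "\<And>j. j < 7 \<Longrightarrow> p j < 7" "\<And>j. j < 7 \<Longrightarrow> q j < 7" "\<And>j. j < 7 \<Longrightarrow> p (q j) = j" "\<And>j. j < 7 \<Longrightarrow> q (p j) = j"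
    and "n + 7 \<le> N"
  shows "bij_betw (blk n p) {..<N} {..<N}"
proof (rule bij_betwI[of _ _ _ "blk n q"])
  have "blk n p i < N" "blk n q i < N" if "i < N" for i
    using assms(1)[of "i - n"] assms(2)[of "i - n"] assms(5) that by (simp_all add: blk_def) linarith+
  then show "blk n p \<in> {..<N} \<rightarrow> {..<N}" "blk n q \<in> {..<N} \<rightarrow> {..<N}" by auto
  show "blk n q (blk n p i) = i" if "i \<in> {..<N}" for i
    using assms(1)[of "i - n"] assms(4)[of "i - n"] by (auto simp: blk_def)
  show "blk n p (blk n q i) = i" if "i \<in> {..<N}" for i
    using assms(2)[of "i - n"] assms(3)[of "i - n"] by (auto simp: blk_def)
qed

fun rot :: "bool list \<Rightarrow> bool list" where
  "rot [a,b,c,d,e,f,g] = [g,a,b,c,d,e,f]"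
| "rot l = l"

text \<open>Position \<open>j\<close> goes to \<open>- j\<close> modulo 7. This turns rotation into
  its inverse and exchanges the two minimal cyclic codes.\<close>

fun rev7 :: "bool list \<Rightarrow> bool list" where
  "rev7 [a,b,c,d,e,f,g] = [a,g,f,e,d,c,b]"
| "rev7 l = l"

definition rt :: "nat \<Rightarrow> nat" where "rt j = (j + 1) mod 7"
definition rt' :: "nat \<Rightarrow> nat" where "rt' j = (j + 6) mod 7"
definition ng :: "nat \<Rightarrow> nat" where "ng j = (7 - j) mod 7"

lemma less_7: "j < (7::nat) \<longleftrightarrow> j \<in> {0,1,2,3,4,5,6}"
  by (simp add: numeral_eq_Suc less_Suc_eq)

lemma rt_props: "j < 7 \<Longrightarrow> rt j < 7" "j < 7 \<Longrightarrow> rt' j < 7" "j < 7 \<Longrightarrow> rt (rt' j) = j" "j < 7 \<Longrightarrow> rt' (rt j) = j"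
  "j < 7 \<Longrightarrow> ng j < 7" "j < 7 \<Longrightarrow> ng (ng j) = j"
  by (auto simp: rt_def rt'_def ng_def less_7)

lemma length_7_cases:
  assumes "length (y::'a list) = 7" obtains a b c d e f g where "y = [a,b,c,d,e,f,g]"
  using assms by (auto simp: numeral_eq_Suc length_Suc_conv)

lemma length_rot: "length (rot y) = length y"
  by (cases y rule: rot.cases) auto

lemma length_rev7: "length (rev7 y) = length y"
  by (cases y rule: rev7.cases) auto

lemma nth_rot:
  assumes "length y = 7" "j < 7" shows "rot y ! j = y ! rt' j"
proof -
  obtain a b c d e f g where y: "y = [a,b,c,d,e,f,g]" using assms(1) by (rule length_7_cases)
  show ?thesis using assms(2) unfolding less_7 y by (auto simp: rt'_def)
qed

lemma nth_rev7:
  assumes "length y = 7" "j < 7" shows "rev7 y ! j = y ! ng j"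
proof -
  obtain a b c d e f g where y: "y = [a,b,c,d,e,f,g]" using assms(1) by (rule length_7_cases)
  show ?thesis using assms(2) unfolding less_7 y by (auto simp: ng_def)
qed

lemma blk_rot: "length x = n \<Longrightarrow> length y = 7 \<Longrightarrow> blk n rt ` supp (x @ y @ z) = supp (x @ rot y @ z)"
  by (rule blk_supp[where q=rt']) (simp_all add: rt_props length_rot nth_rot)

lemma blk_rev7: "length x = n \<Longrightarrow> length y = 7 \<Longrightarrow> blk n ng ` supp (x @ y @ z) = supp (x @ rev7 y @ z)"
  by (rule blk_supp[where q=ng]) (simp_all add: rt_props length_rev7 nth_rev7)

definition rho :: "nat \<Rightarrow> nat" where "rho = blk 0 rt \<circ> blk 7 rt \<circ> blk 14 rt"
definition flip :: "nat \<Rightarrow> nat" where "flip = blk 0 ng \<circ> blk 7 ng \<circ> blk 14 ng"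

lemma rho_supp:
  assumes "length x = 7" "length y = 7" "length z = 7"
  shows "rho ` supp (x @ y @ z @ w) = supp (rot x @ rot y @ rot z @ w)"
  using blk_rot[of "x @ y" 14 z w] blk_rot[of x 7 y "rot z @ w"] blk_rot[of "[]" 0 x "rot y @ rot z @ w"] assms
  unfolding rho_def image_comp[symmetric] by simp

lemma flip_supp:
  assumes "length x = 7" "length y = 7" "length z = 7"
  shows "flip ` supp (x @ y @ z @ w) = supp (rev7 x @ rev7 y @ rev7 z @ w)"
  using blk_rev7[of "x @ y" 14 z w] blk_rev7[of x 7 y "rev7 z @ w"] blk_rev7[of "[]" 0 x "rev7 y @ rev7 z @ w"] assms
  unfolding flip_def image_comp[symmetric] by simp

lemma blk_rt_bij: "n \<le> 14 \<Longrightarrow> bij_betw (blk n rt) {..<44} {..<44}"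
  by (rule blk_bij[where q=rt']) (simp_all add: rt_props)

lemma blk_ng_bij: "n \<le> 14 \<Longrightarrow> bij_betw (blk n ng) {..<44} {..<44}"
  by (rule blk_bij[where q=ng]) (simp_all add: rt_props)

lemma rho_bij: "bij_betw rho {..<44} {..<44}"
  unfolding rho_def by (intro bij_betw_trans[where B="{..<44}"] blk_rt_bij) auto

lemma flip_bij: "bij_betw flip {..<44} {..<44}"
  unfolding flip_def by (intro bij_betw_trans[where B="{..<44}"] blk_ng_bij) auto

lemma word_split:
  assumes "c \<subseteq> {..<44}"
  obtains x y z w where "length x = 7" "length y = 7" "length z = 7" "length w = 23" "c = supp (x @ y @ z @ w)"
proof -
  define l where "l = map (\<lambda>i. i \<in> c) [0..<44]"
  have l: "length l = 44" "supp l = c" using assms by (auto simp: l_def supp_def)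
  have "l = take 7 l @ take 7 (drop 7 l) @ take 7 (drop 14 l) @ drop 21 l"
    using append_take_drop_id[of 7 l] append_take_drop_id[of 7 "drop 7 l"] append_take_drop_id[of 7 "drop 14 l"]
    by (simp del: append_take_drop_id)
  then show ?thesis using that[of "take 7 l" "take 7 (drop 7 l)" "take 7 (drop 14 l)" "drop 21 l"] l by simp
qed

text \<open>The form in which the classification is carried out: the automorphism is the concrete
  permutation \<open>rho\<close>, and codes are compared by bijections of
  \<open>{..<44}\<close>.\<close>

definition good :: "nat set set \<Rightarrow> bool" where
  "good C \<longleftrightarrow> code_on {..<44} C \<and> dual_on {..<44} C = C \<and> (\<forall>c\<in>C. c \<noteq> {} \<longrightarrow> 8 \<le> card c) \<and> (\<forall>c\<in>C. rho ` c \<in> C)"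

lemma goodD:
  assumes "good C"
  shows "code_on {..<44} C" "dual_on {..<44} C = C" "c \<in> C \<Longrightarrow> c \<noteq> {} \<Longrightarrow> 8 \<le> card c" "c \<in> C \<Longrightarrow> rho ` c \<in> C"
    "c \<in> C \<Longrightarrow> c \<subseteq> {..<44}" "c \<in> C \<Longrightarrow> d \<in> C \<Longrightarrow> c \<triangle> d \<in> C" "{} \<in> C"
  using assms code_onD[of "{..<44}" C] by (auto simp: good_def)

lemma good_orth: "good C \<Longrightarrow> c \<in> C \<Longrightarrow> d \<in> C \<Longrightarrow> even (card (c \<inter> d))"
  using dual_onD[of c "{..<44}" C d] goodD(2) by metis

lemma good_memI:
  assumes "good C" "u \<subseteq> {..<44}" "\<And>c. c \<in> C \<Longrightarrow> even (card (u \<inter> c))" shows "u \<in> C"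
proof -
  have "u \<in> dual_on {..<44} C" using assms by (simp add: dual_on_def)
  then show ?thesis using goodD(2)[OF assms(1)] by simp
qed

lemma good_image:
  assumes f: "bij_betw f {..<44} {..<44}" and C: "good C"
    and inv: "\<And>c. c \<in> C \<Longrightarrow> rho ` f ` c \<in> (`) f ` C"
  shows "good ((`) f ` C)"
proof -
  have i: "inj_on f {..<44}" "f ` {..<44} = {..<44}" using f by (auto simp: bij_betw_def)
  have "code_on {..<44} ((`) f ` C)" using code_on_image[OF i(1) goodD(1)[OF C]] i(2) by simp
  moreover have "C \<subseteq> Pow {..<44}" using goodD(5)[OF C] by auto
  then have "dual_on {..<44} ((`) f ` C) = (`) f ` C"
    using dual_on_image[OF i(1)] goodD(2)[OF C] i(2) by metis
  moreover have "8 \<le> card (f ` c)" if "c \<in> C" "f ` c \<noteq> {}" for c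
  proof -
    have "card (f ` c) = card c" using goodD(5)[OF C that(1)] i(1) by (intro card_image) (meson inj_on_subset)
    then show ?thesis using goodD(3)[OF C that(1)] that(2) by auto
  qed
  ultimately show ?thesis using inv unfolding good_def by blast
qed

section \<open>The two modules of words that are even on every cycle\<close>

definition L1 :: "bool list list" where
  "L1 = zero7 # map (bits 7) [[0,1,2,4],[1,2,3,5],[2,3,4,6],[3,4,5,0],[4,5,6,1],[5,6,0,2],[6,0,1,3]]"
definition L2 :: "bool list list" where
  "L2 = zero7 # map (bits 7) [[0,3,5,6],[1,4,6,0],[2,5,0,1],[3,6,1,2],[4,0,2,3],[5,1,3,4],[6,2,4,5]]"

text \<open>Multiplication by the idempotents \<open>1 + x + x^2 + x^4\<close> and
  \<open>1 + x^3 + x^5 + x^6\<close> of the ring of cyclic words, that is, the projections onto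
  \<open>L1\<close> and \<open>L2\<close>.\<close>

definition th1 :: "bool list \<Rightarrow> bool list" where
  "th1 x = bxor x (bxor (rot x) (bxor (rot (rot x)) (rot (rot (rot (rot x))))))"
definition th2 :: "bool list \<Rightarrow> bool list" where
  "th2 x = bxor x (bxor (rot (rot (rot x))) (bxor (rot (rot (rot (rot (rot x))))) (rot (rot (rot (rot (rot (rot x))))))))"

fun rots :: "nat \<Rightarrow> bool list \<Rightarrow> bool list list" where
  "rots 0 x = []"
| "rots (Suc n) x = x # rots n (rot x)"

lemma L_checks:
  "list_all (\<lambda>x. length x = 7) (L1 @ L2)"
  "list_all (\<lambda>x. list_all (\<lambda>y. List.member L1 (bxor x y)) L1) L1"
  "list_all (\<lambda>x. list_all (\<lambda>y. List.member L2 (bxor x y)) L2) L2"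
  "list_all (\<lambda>x. List.member L1 (rot x) \<and> List.member L2 (rev7 x)) L1"
  "list_all (\<lambda>x. List.member L2 (rot x) \<and> List.member L1 (rev7 x)) L2"
  "list_all (\<lambda>x. all_zero x \<or> bcount x = Suc (Suc (Suc (Suc 0)))) (L1 @ L2)"
  "list_all (\<lambda>x. all_zero x \<or> list_all (\<lambda>y. all_zero y \<or> List.member (rots (Suc (Suc n5)) x) y) L1) L1"
  "list_all (\<lambda>x. all_zero x \<or> list_all (\<lambda>y. all_zero y \<or> \<not> list_all (\<lambda>z. \<not> bdot x z) (rots (Suc (Suc n5)) y)) L2) L1"
  by code_simp+

lemma th_checks:
  "list_all (\<lambda>x. List.member L1 (th1 x) \<and> List.member L2 (th2 x) \<and>
     list_all (\<lambda>z. bdot z x = bdot z (th1 x)) L2 \<and> list_all (\<lambda>z. bdot z x = bdot z (th2 x)) L1)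
     (List.n_lists (Suc (Suc n5)) [True, False])"
  by code_simp


lemma bxor_append: "length x = length x' \<Longrightarrow> bxor (x @ y) (x' @ y') = bxor x x' @ bxor y y'"
  by (induction x x' rule: bxor.induct) auto

lemma bdot_append: "length x = length x' \<Longrightarrow> bdot (x @ y) (x' @ y') \<longleftrightarrow> bdot x x' \<noteq> bdot y y'"
  by (induction x x' rule: bdot.induct) auto

lemma bcount_append: "bcount (x @ y) = bcount x + bcount y"
  by (induction x rule: bcount.induct) auto

lemma length_zero7 [simp]: "length zero7 = 7"
  by (simp add: zero7_def)

lemma all_zero_replicate: "all_zero x \<longleftrightarrow> x = replicate (length x) False"
  by (induction x) auto

lemma all_zero_7: "length x = 7 \<Longrightarrow> all_zero x \<longleftrightarrow> x = zero7"
  by (metis all_zero_replicate zero7_def)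

lemma bcount_zero7 [simp]: "bcount zero7 = 0"
  by (simp add: zero7_def numeral_eq_Suc)

lemma rots_funpow: "y \<in> set (rots n x) \<Longrightarrow> \<exists>k. y = (rot ^^ k) x"
proof (induction n arbitrary: x)
  case (Suc n)
  then consider "y = x" | "y \<in> set (rots n (rot x))" by auto
  then show ?case
  proof cases
    case 1 then show ?thesis by (intro exI[of _ 0]) simp
  next
    case 2
    then obtain k where "y = (rot ^^ k) (rot x)" using Suc.IH by blast
    then show ?thesis by (intro exI[of _ "Suc k"]) (simp add: funpow_swap1)
  qed
qed simp

lemma length_rot_pow [simp]: "length ((rot ^^ k) x) = length x"
  by (induction k) (auto simp: length_rot)

lemma bxor_self_7: "length x = 7 \<Longrightarrow> bxor x x = zero7"
  by (elim length_7_cases) (simp add: zero7_def numeral_eq_Suc)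

lemma bxor_zero7: "length x = 7 \<Longrightarrow> bxor x zero7 = x" "length x = 7 \<Longrightarrow> bxor zero7 x = x"
  by (elim length_7_cases, simp add: zero7_def numeral_eq_Suc)+

lemma bxor_eq_zero7: "length x = 7 \<Longrightarrow> length y = 7 \<Longrightarrow> bxor x y = zero7 \<Longrightarrow> x = y"
  by (elim length_7_cases) (simp add: zero7_def numeral_eq_Suc)

lemma rot_zero7: "rot zero7 = zero7"
  by (simp add: zero7_def numeral_eq_Suc)

lemma rot_pow_zero7 [simp]: "(rot ^^ k) zero7 = zero7"
  by (induction k) (auto simp: rot_zero7)

lemma bdot_zero7: "length x = 7 \<Longrightarrow> \<not> bdot x zero7" "length x = 7 \<Longrightarrow> \<not> bdot zero7 x"
  by (elim length_7_cases, simp add: zero7_def numeral_eq_Suc)+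

lemma L_length: "x \<in> set L1 \<Longrightarrow> length x = 7" "x \<in> set L2 \<Longrightarrow> length x = 7"
  using L_checks(1) by (auto simp: list_all_iff)

lemma L_zero: "zero7 \<in> set L1" "zero7 \<in> set L2"
  by (auto simp: L1_def L2_def)

lemma L_xor: "x \<in> set L1 \<Longrightarrow> y \<in> set L1 \<Longrightarrow> bxor x y \<in> set L1" "x \<in> set L2 \<Longrightarrow> y \<in> set L2 \<Longrightarrow> bxor x y \<in> set L2"
  using L_checks(2,3) by (simp_all add: list_all_iff)

lemma L_rot: "x \<in> set L1 \<Longrightarrow> rot x \<in> set L1" "x \<in> set L2 \<Longrightarrow> rot x \<in> set L2"
  and L_rev: "x \<in> set L1 \<Longrightarrow> rev7 x \<in> set L2" "x \<in> set L2 \<Longrightarrow> rev7 x \<in> set L1"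
  using L_checks(4,5) by (simp_all add: list_all_iff)

lemma L_rot_pow: "x \<in> set L1 \<Longrightarrow> (rot ^^ k) x \<in> set L1" "x \<in> set L2 \<Longrightarrow> (rot ^^ k) x \<in> set L2"
  by (induction k) (auto simp: L_rot)

lemma L_weight: "x \<in> set L1 \<union> set L2 \<Longrightarrow> x \<noteq> zero7 \<Longrightarrow> bcount x = 4"
proof -
  assume x: "x \<in> set L1 \<union> set L2" "x \<noteq> zero7"
  have "all_zero x \<or> bcount x = Suc (Suc (Suc (Suc 0)))"
    using L_checks(6) x(1) unfolding list_all_iff set_append by blast
  then show ?thesis using x all_zero_7[of x] L_length by auto
qed

text \<open>Rotation acts on \<open>L1\<close> as multiplication by a generator of the
  multiplicative group of the field with 8 elements. Scalar multiples of a triple are therefore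
  obtained by rotating all three cycles at once, under which the code is closed.\<close>

lemma L1_orbit: "x \<in> set L1 \<Longrightarrow> y \<in> set L1 \<Longrightarrow> x \<noteq> zero7 \<Longrightarrow> y \<noteq> zero7 \<Longrightarrow> \<exists>k. y = (rot ^^ k) x"
proof -
  assume a: "x \<in> set L1" "y \<in> set L1" "x \<noteq> zero7" "y \<noteq> zero7"
  have "all_zero x \<or> all_zero y \<or> y \<in> set (rots (Suc (Suc n5)) x)"
    using L_checks(7) a(1,2) unfolding list_all_iff List.member_iff by blast
  then have "y \<in> set (rots (Suc (Suc n5)) x)" using a all_zero_7 L_length by blast
  then show ?thesis by (rule rots_funpow)
qed

text \<open>The rotations of a nonzero \<open>y\<close> span \<open>L2\<close>, and the inner
  product pairs \<open>L1\<close> with \<open>L2\<close> without degeneracy.\<close>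

lemma L_nondegenerate:
  assumes "x \<in> set L1" "y \<in> set L2" "y \<noteq> zero7" "\<And>k. \<not> bdot x ((rot ^^ k) y)"
  shows "x = zero7"
proof -
  have "all_zero x \<or> all_zero y \<or> \<not> list_all (\<lambda>z. \<not> bdot x z) (rots (Suc (Suc n5)) y)"
    using L_checks(8) assms(1,2) unfolding list_all_iff by blast
  moreover have "list_all (\<lambda>z. \<not> bdot x z) (rots (Suc (Suc n5)) y)"
    using rots_funpow assms(4) unfolding list_all_iff by blast
  ultimately show ?thesis using assms all_zero_7 L_length by blast
qed

lemma lists_7: "length x = 7 \<Longrightarrow> x \<in> set (List.n_lists (Suc (Suc n5)) [True, False])"
  unfolding set_n_lists by auto

lemma th_props:
  assumes "length x = 7"
  shows "th1 x \<in> set L1" "th2 x \<in> set L2" "k \<in> set L2 \<Longrightarrow> bdot k x = bdot k (th1 x)"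
    "k \<in> set L1 \<Longrightarrow> bdot k x = bdot k (th2 x)"
  using bspec[OF th_checks[unfolded list_all_iff List.member_iff] lists_7[OF assms]] by blast+

lemma good_rot:
  assumes "good C" "length x = 7" "length y = 7" "length z = 7" "supp (x @ y @ z @ w) \<in> C"
  shows "supp (rot x @ rot y @ rot z @ w) \<in> C"
  using goodD(4)[OF assms(1,5)] rho_supp[OF assms(2-4)] by simp

text \<open>The fixed part \<open>w\<close> occurs four times and cancels.\<close>

lemma good_xor4:
  assumes C: "good C"
    and l: "\<And>i. length (x i) = 7" "\<And>i. length (y i) = 7" "\<And>i. length (z i) = 7"
    and m: "\<And>i::nat. supp (x i @ y i @ z i @ w) \<in> C"
  shows "supp (bxor (x a) (bxor (x b) (bxor (x c) (x d))) @ bxor (y a) (bxor (y b) (bxor (y c) (y d)))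
     @ bxor (z a) (bxor (z b) (bxor (z c) (z d)))) \<in> C"
proof -
  let ?f = "\<lambda>i. x i @ y i @ z i @ w"
  let ?X = "bxor (x a) (bxor (x b) (bxor (x c) (x d))) @ bxor (y a) (bxor (y b) (bxor (y c) (y d)))
     @ bxor (z a) (bxor (z b) (bxor (z c) (z d)))"
  have "supp (bxor (?f a) (bxor (?f b) (bxor (?f c) (?f d)))) = supp (?f a) \<triangle> (supp (?f b) \<triangle> (supp (?f c) \<triangle> supp (?f d)))"
    using l by (simp add: supp_bxor)
  also have "\<dots> \<in> C" using m goodD(6)[OF C] by blast
  also have "bxor (?f a) (bxor (?f b) (bxor (?f c) (?f d))) = ?X @ bxor w (bxor w (bxor w w))"
    using l by (simp add: bxor_append)
  also have "supp (?X @ bxor w (bxor w (bxor w w))) = supp ?X"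
    by (simp add: supp_append supp_bxor)
  finally show ?thesis by simp
qed

text \<open>Both idempotents have four terms, so applying them by means of \<open>rho\<close> clears
  the fixed coordinates: the code contains the projections of its words to the two modules.\<close>

lemma good_th:
  assumes C: "good C" and l: "length x = 7" "length y = 7" "length z = 7" and m: "supp (x @ y @ z @ w) \<in> C"
  shows "supp (th1 x @ th1 y @ th1 z) \<in> C" "supp (th2 x @ th2 y @ th2 z) \<in> C"
proof -
  have p: "supp ((rot ^^ i) x @ (rot ^^ i) y @ (rot ^^ i) z @ w) \<in> C" for i
    by (induction i) (use m good_rot[OF C] l in auto)
  note q = good_xor4[OF C, of "\<lambda>i. (rot ^^ i) x" "\<lambda>i. (rot ^^ i) y" "\<lambda>i. (rot ^^ i) z", OF _ _ _ p]
  show "supp (th1 x @ th1 y @ th1 z) \<in> C"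
    using q[of 0 1 2 4] l by (simp add: th1_def numeral_eq_Suc)
  show "supp (th2 x @ th2 y @ th2 z) \<in> C"
    using q[of 0 3 5 6] l by (simp add: th2_def numeral_eq_Suc)
qed

lemma good_dual_mem:
  assumes C: "good C" and k: "length k0 = 7" "length k1 = 7" "length k2 = 7"
    and th: "\<And>x y z w. length x = 7 \<Longrightarrow> length y = 7 \<Longrightarrow> length z = 7 \<Longrightarrow> supp (x @ y @ z @ w) \<in> C \<Longrightarrow>
      bdot k0 x \<longleftrightarrow> (bdot k1 y \<noteq> bdot k2 z)"
  shows "supp (k0 @ k1 @ k2) \<in> C"
proof (rule good_memI[OF C])
  show "supp (k0 @ k1 @ k2) \<subseteq> {..<44}" using supp_subset[of "k0 @ k1 @ k2"] k by auto
  fix c assume c: "c \<in> C"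
  obtain x y z w where l: "length x = 7" "length y = 7" "length z = 7" "length w = 23" "c = supp (x @ y @ z @ w)"
    using word_split[OF goodD(5)[OF C c]] .
  have e: "supp (k0 @ k1 @ k2) = supp (k0 @ k1 @ k2 @ replicate 23 False)" by (simp add: supp_append)
  have "bdot (k0 @ k1 @ k2 @ replicate 23 False) (x @ y @ z @ w)
     \<longleftrightarrow> bdot k0 x \<noteq> (bdot k1 y \<noteq> (bdot k2 z \<noteq> bdot (replicate 23 False) w))"
    using k l by (simp add: bdot_append)
  moreover have "\<not> bdot (replicate 23 False) w" using l by (simp add: bdot_iff)
  ultimately have "\<not> bdot (k0 @ k1 @ k2 @ replicate 23 False) (x @ y @ z @ w)"
    using th[OF l(1-3)] c l(5) by auto
  then show "even (card (supp (k0 @ k1 @ k2) \<inter> c))" unfolding e l(5) using k l by (simp add: bdot_iff)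
qed

text \<open>A triple over \<open>L2\<close> sees other words only through their projections to
  \<open>L1\<close>, so self-duality makes the \<open>L2\<close> part of the code the full dual of
  its \<open>L1\<close> part. The equation between truth values says that the three inner products
  add up to zero.\<close>

lemma good_mem_L2:
  assumes C: "good C" and k: "k0 \<in> set L2" "k1 \<in> set L2" "k2 \<in> set L2"
    and o: "\<And>x y z. x \<in> set L1 \<Longrightarrow> y \<in> set L1 \<Longrightarrow> z \<in> set L1 \<Longrightarrow> supp (x @ y @ z) \<in> C \<Longrightarrow>
      bdot k0 x \<longleftrightarrow> (bdot k1 y \<noteq> bdot k2 z)"
  shows "supp (k0 @ k1 @ k2) \<in> C"
proof (rule good_dual_mem[OF C])
  fix x y z w assume l: "length x = 7" "length y = 7" "length z = 7" "supp (x @ y @ z @ w) \<in> C"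
  show "bdot k0 x \<longleftrightarrow> (bdot k1 y \<noteq> bdot k2 z)"
    using o[OF _ _ _ good_th(1)[OF C l]] th_props[OF l(1)] th_props[OF l(2)] th_props[OF l(3)] k by simp
qed (use k L_length in auto)

lemma good_weight:
  assumes "good C" "supp (x @ y @ z) \<in> C" shows "bcount x + bcount y + bcount z \<noteq> 4"
proof
  assume "bcount x + bcount y + bcount z = 4"
  then have "card (supp (x @ y @ z)) = 4" by (simp add: card_supp bcount_append)
  then show False using goodD(3)[OF assms] by fastforce
qed

text \<open>Nonzero words of the two modules have weight 4, too little for a codeword on a single
  cycle.\<close>

lemma good_single:
  assumes C: "good C" and x: "x \<in> set L1 \<union> set L2"
  shows "supp (x @ zero7 @ zero7) \<in> C \<Longrightarrow> x = zero7" "supp (zero7 @ x @ zero7) \<in> C \<Longrightarrow> x = zero7"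
    "supp (zero7 @ zero7 @ x) \<in> C \<Longrightarrow> x = zero7"
  using good_weight[OF C] L_weight[OF x] by force+

lemma mem_rot_pow:
  assumes C: "good C" and l: "length x = 7" "length y = 7" "length z = 7" and m: "supp (x @ y @ z) \<in> C"
  shows "supp ((rot ^^ k) x @ (rot ^^ k) y @ (rot ^^ k) z) \<in> C"
proof (induction k)
  case (Suc k)
  then show ?case using good_rot[OF C, of "(rot ^^ k) x" "(rot ^^ k) y" "(rot ^^ k) z" "[]"] l by simp
qed (use m in simp)

lemma mem_xor:
  assumes C: "good C" and l: "length x = 7" "length y = 7" "length z = 7" "length x' = 7" "length y' = 7" "length z' = 7"
    and m: "supp (x @ y @ z) \<in> C" "supp (x' @ y' @ z') \<in> C"
  shows "supp (bxor x x' @ bxor y y' @ bxor z z') \<in> C"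
  using goodD(6)[OF C m] l by (simp add: supp_bxor[symmetric] bxor_append)

lemma mem_orth:
  assumes C: "good C" and l: "length x = 7" "length y = 7" "length z = 7" "length x' = 7" "length y' = 7" "length z' = 7"
    and m: "supp (x @ y @ z) \<in> C" "supp (x' @ y' @ z') \<in> C"
  shows "bdot x x' \<longleftrightarrow> (bdot y y' \<noteq> bdot z z')"
proof -
  have "\<not> bdot (x @ y @ z) (x' @ y' @ z')" using good_orth[OF C m] l by (simp add: bdot_iff)
  then show ?thesis using l by (simp add: bdot_append)
qed

text \<open>As a code of length 3 over the field with 8 elements, such a part is determined by its
  first coordinate and has dimension at most 1.\<close>

definition no_zero_first :: "bool list list \<Rightarrow> nat set set \<Rightarrow> bool" where
  "no_zero_first L C \<longleftrightarrow> (\<forall>y\<in>set L. \<forall>z\<in>set L. supp (zero7 @ y @ z) \<in> C \<longrightarrow> y = zero7 \<and> z = zero7)"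

text \<open>Otherwise any word of \<open>L2\<close> placed on the first cycle would be orthogonal to
  the \<open>L1\<close> part, and thus a codeword of weight 4.\<close>

lemma exists_nonzero_first:
  assumes C: "good C"
  shows "\<exists>x\<in>set L1. \<exists>y\<in>set L1. \<exists>z\<in>set L1. x \<noteq> zero7 \<and> supp (x @ y @ z) \<in> C"
proof (rule ccontr)
  assume n: "\<not> ?thesis"
  let ?k = "bits 7 [0,3,5,6]"
  have k: "?k \<in> set L2" by (simp add: L2_def)
  have "supp (?k @ zero7 @ zero7) \<in> C"
  proof (rule good_mem_L2[OF C k L_zero(2) L_zero(2)])
    fix x y z assume "x \<in> set L1" "y \<in> set L1" "z \<in> set L1" "supp (x @ y @ z) \<in> C"
    then show "bdot ?k x \<longleftrightarrow> (bdot zero7 y \<noteq> bdot zero7 z)"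
      using n bdot_zero7 L_length k by metis
  qed
  then have "?k = zero7" using good_single(1)[OF C] k by blast
  moreover have "bcount ?k = 4" by code_simp
  ultimately show False by simp
qed

text \<open>Suppose both parts have a nonzero word vanishing on the first cycle; neither of these
  words can live on one cycle. A multiple of the first one clears the third entry of a word
  \<open>(x,y,z)\<close> with \<open>x\<close> nonzero, and orthogonality to the rotations of the
  second one then clears the middle entry. What remains is \<open>x\<close> alone, of weight
  4.\<close>

lemma dichotomy:
  assumes C: "good C" shows "no_zero_first L1 C \<or> no_zero_first L2 C"
proof (rule ccontr)
  assume "\<not> ?thesis"
  then obtain j1 j2 k1 k2 where j: "j1 \<in> set L1" "j2 \<in> set L1" "supp (zero7 @ j1 @ j2) \<in> C" "\<not> (j1 = zero7 \<and> j2 = zero7)"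
    and k: "k1 \<in> set L2" "k2 \<in> set L2" "supp (zero7 @ k1 @ k2) \<in> C" "\<not> (k1 = zero7 \<and> k2 = zero7)"
    unfolding no_zero_first_def by blast
  have jn: "j2 \<noteq> zero7" using good_single(2)[OF C, of j1] j by auto
  have kn: "k1 \<noteq> zero7" using good_single(3)[OF C, of k2] k by auto
  obtain x y z where e: "x \<in> set L1" "y \<in> set L1" "z \<in> set L1" "x \<noteq> zero7" "supp (x @ y @ z) \<in> C"
    using exists_nonzero_first[OF C] by blast
  have "\<exists>y'\<in>set L1. supp (x @ y' @ zero7) \<in> C"
  proof (cases "z = zero7")
    case False
    then obtain m where m: "z = (rot ^^ m) j2" using L1_orbit j jn e by blast
    have "supp ((rot ^^ m) zero7 @ (rot ^^ m) j1 @ (rot ^^ m) j2) \<in> C"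
      by (rule mem_rot_pow[OF C _ _ _ j(3)]) (use j L_length in auto)
    then have "supp (zero7 @ (rot ^^ m) j1 @ z) \<in> C" using m by simp
    then have "supp (bxor x zero7 @ bxor y ((rot ^^ m) j1) @ bxor z z) \<in> C"
      by (intro mem_xor[OF C _ _ _ _ _ _ e(5)]) (use e j L_length in auto)
    then have "supp (x @ bxor y ((rot ^^ m) j1) @ zero7) \<in> C"
      using e L_length by (simp add: bxor_zero7 bxor_self_7)
    then show ?thesis using L_xor(1)[OF e(2) L_rot_pow(1)[OF j(1)]] by blast
  qed (use e in auto)
  then obtain y' where y': "y' \<in> set L1" "supp (x @ y' @ zero7) \<in> C" by blast
  have "y' = zero7"
  proof (rule L_nondegenerate[OF y'(1) k(1) kn])
    fix m
    have "supp ((rot ^^ m) zero7 @ (rot ^^ m) k1 @ (rot ^^ m) k2) \<in> C"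
      by (rule mem_rot_pow[OF C _ _ _ k(3)]) (use k L_length in auto)
    then have "bdot x zero7 \<longleftrightarrow> (bdot y' ((rot ^^ m) k1) \<noteq> bdot zero7 ((rot ^^ m) k2))"
      by (intro mem_orth[OF C _ _ _ _ _ _ y'(2)]) (use e y' k L_length in auto)
    then show "\<not> bdot y' ((rot ^^ m) k1)"
      using bdot_zero7(1)[of x] bdot_zero7(2)[of "(rot ^^ m) k2"] e k L_length by simp
  qed
  then show False using good_single(1)[OF C, of x] y' e by auto
qed

text \<open>In this case \<open>(x,y,z)\<close> spans the \<open>L1\<close> part: subtracting the
  multiple that agrees on the first cycle leaves a word vanishing there.\<close>

lemma mem_multiple:
  assumes C: "good C" and n: "no_zero_first L1 C"
    and e: "x \<in> set L1" "y \<in> set L1" "z \<in> set L1" "x \<noteq> zero7" "supp (x @ y @ z) \<in> C"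
    and e': "x' \<in> set L1" "y' \<in> set L1" "z' \<in> set L1" "supp (x' @ y' @ z') \<in> C"
  shows "x' = zero7 \<and> y' = zero7 \<and> z' = zero7 \<or> (\<exists>k. x' = (rot ^^ k) x \<and> y' = (rot ^^ k) y \<and> z' = (rot ^^ k) z)"
proof (cases "x' = zero7")
  case True
  then show ?thesis using n e' unfolding no_zero_first_def by blast
next
  case False
  then obtain k where k: "x' = (rot ^^ k) x" using L1_orbit e e' by blast
  have "supp ((rot ^^ k) x @ (rot ^^ k) y @ (rot ^^ k) z) \<in> C"
    by (rule mem_rot_pow[OF C _ _ _ e(5)]) (use e L_length in auto)
  then have "supp (bxor x' x' @ bxor y' ((rot ^^ k) y) @ bxor z' ((rot ^^ k) z)) \<in> C"
    unfolding k by (intro mem_xor[OF C]) (use e e' k L_length in auto)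
  then have "supp (zero7 @ bxor y' ((rot ^^ k) y) @ bxor z' ((rot ^^ k) z)) \<in> C"
    using e' L_length by (simp add: bxor_self_7)
  then have "bxor y' ((rot ^^ k) y) = zero7 \<and> bxor z' ((rot ^^ k) z) = zero7"
    using n e e' L_xor(1) L_rot_pow(1) unfolding no_zero_first_def by blast
  then have "y' = (rot ^^ k) y" "z' = (rot ^^ k) z" using bxor_eq_zero7 e e' L_length by auto
  then show ?thesis using k by blast
qed

text \<open>If the spanning word vanished on a cycle, so would the whole \<open>L1\<close> part, and
  the dual part would contain words of weight 4 on that cycle.\<close>

lemma case1_nonzero:
  assumes C: "good C" and n: "no_zero_first L1 C"
    and e: "x \<in> set L1" "y \<in> set L1" "z \<in> set L1" "x \<noteq> zero7" "supp (x @ y @ z) \<in> C"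
  shows "y \<noteq> zero7" "z \<noteq> zero7"
proof -
  let ?k = "bits 7 [0,3,5,6]"
  have k: "?k \<in> set L2" by (simp add: L2_def)
  have "bcount ?k = 4" by code_simp
  then have kn: "?k \<noteq> zero7" by auto
  have kl: "length ?k = 7" using k L_length by blast
  show "y \<noteq> zero7"
  proof
    assume y: "y = zero7"
    have "supp (zero7 @ ?k @ zero7) \<in> C"
    proof (rule good_mem_L2[OF C L_zero(2) k L_zero(2)])
      fix x' y' z' assume e': "x' \<in> set L1" "y' \<in> set L1" "z' \<in> set L1" "supp (x' @ y' @ z') \<in> C"
      have "y' = zero7" using mem_multiple[OF C n e e'] y by auto
      then show "bdot zero7 x' \<longleftrightarrow> (bdot ?k y' \<noteq> bdot zero7 z')"
        using bdot_zero7 L_length e' kl by metis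
    qed
    then show False using good_single(2)[OF C] k kn by blast
  qed
  show "z \<noteq> zero7"
  proof
    assume z: "z = zero7"
    have "supp (zero7 @ zero7 @ ?k) \<in> C"
    proof (rule good_mem_L2[OF C L_zero(2) L_zero(2) k])
      fix x' y' z' assume e': "x' \<in> set L1" "y' \<in> set L1" "z' \<in> set L1" "supp (x' @ y' @ z') \<in> C"
      have "z' = zero7" using mem_multiple[OF C n e e'] z by auto
      then show "bdot zero7 x' \<longleftrightarrow> (bdot zero7 y' \<noteq> bdot ?k z')"
        using bdot_zero7 L_length e' kl by metis
    qed
    then show False using good_single(3)[OF C] k kn by blast
  qed
qed


lemma rot_pow_supp:
  assumes "length x = 7" "length y = 7" "length z = 7"
  shows "(blk 0 rt ^^ a) ` (blk 7 rt ^^ b) ` (blk 14 rt ^^ c) ` supp (x @ y @ z @ w)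
    = supp ((rot ^^ a) x @ (rot ^^ b) y @ (rot ^^ c) z @ w)"
proof -
  have 3: "(blk 14 rt ^^ c) ` supp (x @ y @ z @ w) = supp (x @ y @ (rot ^^ c) z @ w)" for c
  proof (induction c)
    case (Suc c)
    have "(blk 14 rt ^^ Suc c) ` supp (x @ y @ z @ w) = blk 14 rt ` (blk 14 rt ^^ c) ` supp (x @ y @ z @ w)"
      by (simp add: image_comp)
    then show ?case using Suc blk_rot[of "x @ y" 14 "(rot ^^ c) z" w] assms by simp
  qed simp
  have 2: "(blk 7 rt ^^ b) ` supp (x @ y @ v) = supp (x @ (rot ^^ b) y @ v)" for b v
  proof (induction b)
    case (Suc b)
    have "(blk 7 rt ^^ Suc b) ` supp (x @ y @ v) = blk 7 rt ` (blk 7 rt ^^ b) ` supp (x @ y @ v)"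
      by (simp add: image_comp)
    then show ?case using Suc blk_rot[of x 7 "(rot ^^ b) y" v] assms by simp
  qed simp
  have 1: "(blk 0 rt ^^ a) ` supp (x @ v) = supp ((rot ^^ a) x @ v)" for a v
  proof (induction a)
    case (Suc a)
    have "(blk 0 rt ^^ Suc a) ` supp (x @ v) = blk 0 rt ` (blk 0 rt ^^ a) ` supp (x @ v)"
      by (simp add: image_comp)
    then show ?case using Suc blk_rot[of "[]" 0 "(rot ^^ a) x" v] assms by simp
  qed simp
  show ?thesis unfolding 3 2 1 ..
qed

lemma bij_betw_pow: "bij_betw f A A \<Longrightarrow> bij_betw (f ^^ k) A A"
proof (induction k)
  case (Suc k)
  show ?case unfolding funpow.simps(2) by (rule bij_betw_trans[OF Suc.IH[OF Suc.prems] Suc.prems])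
qed simp

lemma rot_pow_7: "length x = 7 \<Longrightarrow> (rot ^^ 7) x = x"
  by (elim length_7_cases) (simp add: numeral_eq_Suc)

lemma L1_rot_to_A0:
  assumes "x \<in> set L1" "x \<noteq> zero7" shows "\<exists>k. (rot ^^ k) x = A0"
proof -
  have "A0 \<in> set L1" by (simp add: L1_def A0_def)
  moreover have "bcount A0 = 4" by code_simp
  then have "A0 \<noteq> zero7" by auto
  ultimately show ?thesis using L1_orbit[OF assms(1) _ assms(2)] by metis
qed

lemma E_gens_rot: "A1 = rot A0" "A2 = rot A1" "C1 = rot C0" "C2 = rot C1"
  "C0 \<in> set L2" "C1 \<in> set L2" "C2 \<in> set L2" "A0 \<in> set L1"
  by code_simp+

text \<open>Rotating the cycles independently commutes with \<open>rho\<close> and takes each entry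
  of the spanning word to \<open>A0\<close>. All triples of the \<open>L1\<close> part are then
  constant, which puts \<open>(k,k,0)\<close> and \<open>(0,k,k)\<close> into the dual part.\<close>

lemma case1:
  assumes C: "good C" and n: "no_zero_first L1 C"
  shows "\<exists>f. bij_betw f {..<44} {..<44} \<and> good ((`) f ` C) \<and> supp ` set E_gens \<subseteq> (`) f ` C"
proof -
  obtain x y z where e: "x \<in> set L1" "y \<in> set L1" "z \<in> set L1" "x \<noteq> zero7" "supp (x @ y @ z) \<in> C"
    using exists_nonzero_first[OF C] by blast
  obtain a b c where abc: "(rot ^^ a) x = A0" "(rot ^^ b) y = A0" "(rot ^^ c) z = A0"
    using L1_rot_to_A0 e case1_nonzero[OF C n e] by meson
  define f where "f = (blk 0 rt ^^ a) \<circ> (blk 7 rt ^^ b) \<circ> (blk 14 rt ^^ c)"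
  have f: "bij_betw f {..<44} {..<44}"
    unfolding f_def by (intro bij_betw_trans[where B="{..<44}"] bij_betw_pow blk_rt_bij) auto
  have fs: "f ` supp (x @ y @ z @ w) = supp ((rot ^^ a) x @ (rot ^^ b) y @ (rot ^^ c) z @ w)"
    if "length x = 7" "length y = 7" "length z = 7" for x y z w
    using rot_pow_supp[OF that] unfolding f_def image_comp[symmetric] by simp
  let ?C = "(`) f ` C"
  have rr: "rot ((rot ^^ k) u) = (rot ^^ k) (rot u)" for k u by (simp add: funpow_swap1)
  have C': "good ?C"
  proof (rule good_image[OF f C])
    fix d assume d: "d \<in> C"
    obtain x y z w where l: "length x = 7" "length y = 7" "length z = 7" "d = supp (x @ y @ z @ w)"
      using word_split[OF goodD(5)[OF C d]] by metis
    have "rho ` f ` d = f ` supp (rot x @ rot y @ rot z @ w)"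
      unfolding l(4) fs[OF l(1-3)] using l by (simp add: rho_supp fs rr length_rot)
    moreover have "supp (rot x @ rot y @ rot z @ w) \<in> C" using good_rot[OF C l(1-3)] d l(4) by simp
    ultimately show "rho ` f ` d \<in> ?C" by blast
  qed
  have n': "no_zero_first L1 ?C"
    unfolding no_zero_first_def
  proof (intro ballI impI)
    fix y z assume yz: "y \<in> set L1" "z \<in> set L1" "supp (zero7 @ y @ z) \<in> ?C"
    have p7: "(rot ^^ (7 * k)) u = u" if "length u = 7" for k u
    proof (induction k)
      case (Suc k)
      have "(rot ^^ (7 * Suc k)) u = (rot ^^ 7) ((rot ^^ (7 * k)) u)"
        by (metis comp_apply funpow_add mult_Suc_right)
      then show ?case using Suc rot_pow_7 that by simp
    qed simp
    \<comment> \<open>Rotating by \<open>6 * k\<close> undoes a rotation by \<open>k\<close>, as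
      \<open>7 * k\<close> steps are the identity.\<close>
    have inv: "\<exists>u\<in>set L1. (rot ^^ k) u = v" if "v \<in> set L1" for k v
    proof (intro bexI)
      have "(rot ^^ k) ((rot ^^ (6 * k)) v) = (rot ^^ (7 * k)) v"
        by (simp flip: funpow_add[THEN fun_cong, unfolded o_apply])
      then show "(rot ^^ k) ((rot ^^ (6 * k)) v) = v" using p7 L_length that by simp
      show "(rot ^^ (6 * k)) v \<in> set L1" using that by (rule L_rot_pow)
    qed
    obtain y' where y': "y' \<in> set L1" "(rot ^^ b) y' = y" using inv yz(1) by metis
    obtain z' where z': "z' \<in> set L1" "(rot ^^ c) z' = z" using inv yz(2) by metis
    have "f ` supp (zero7 @ y' @ z') = supp (zero7 @ y @ z)"
      using fs[of zero7 y' z' "[]"] y' z' L_length by simp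
    with yz(3) obtain d where d: "d \<in> C" "f ` d = f ` supp (zero7 @ y' @ z')" by auto
    have "supp (zero7 @ y' @ z') \<subseteq> {..<44}"
      using supp_subset[of "zero7 @ y' @ z'"] y' z' L_length by fastforce
    then have "d = supp (zero7 @ y' @ z')"
      using d f goodD(5)[OF C d(1)] by (meson bij_betw_def inj_on_image_eq_iff)
    then have "y' = zero7 \<and> z' = zero7" using n y' z' d unfolding no_zero_first_def by blast
    then show "y = zero7 \<and> z = zero7" using y' z' by auto
  qed
  have A0L: "A0 \<in> set L1" "C0 \<in> set L2" "C1 \<in> set L2" "C2 \<in> set L2" using E_gens_rot by auto
  have A0n: "A0 \<noteq> zero7"
  proof -
    have "bcount A0 = 4" by code_simp
    then show ?thesis by auto
  qed
  have "supp (A0 @ A0 @ A0) = f ` supp (x @ y @ z)" using fs[of x y z "[]"] abc e L_length by simp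
  then have A: "supp (A0 @ A0 @ A0) \<in> ?C" using e(5) by simp
  have lA: "length A0 = 7" using A0L L_length by blast
  have AA: "supp ((rot ^^ k) A0 @ (rot ^^ k) A0 @ (rot ^^ k) A0) \<in> ?C" for k
    by (rule mem_rot_pow[OF C' lA lA lA A])
  have K: "supp (k @ k @ zero7) \<in> ?C \<and> supp (zero7 @ k @ k) \<in> ?C" if k: "k \<in> set L2" for k
  proof
    have diag: "x' = y' \<and> y' = z'" if "x' \<in> set L1" "y' \<in> set L1" "z' \<in> set L1" "supp (x' @ y' @ z') \<in> ?C" for x' y' z'
      using mem_multiple[OF C' n' A0L(1) A0L(1) A0L(1) A0n A that] by auto
    show "supp (k @ k @ zero7) \<in> ?C"
    proof (rule good_mem_L2[OF C' k k L_zero(2)])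
      fix x' y' z' assume h: "x' \<in> set L1" "y' \<in> set L1" "z' \<in> set L1" "supp (x' @ y' @ z') \<in> ?C"
      show "bdot k x' \<longleftrightarrow> (bdot k y' \<noteq> bdot zero7 z')" using diag[OF h] bdot_zero7(2)[of z'] h L_length by auto
    qed
    show "supp (zero7 @ k @ k) \<in> ?C"
    proof (rule good_mem_L2[OF C' L_zero(2) k k])
      fix x' y' z' assume h: "x' \<in> set L1" "y' \<in> set L1" "z' \<in> set L1" "supp (x' @ y' @ z') \<in> ?C"
      show "bdot zero7 x' \<longleftrightarrow> (bdot k y' \<noteq> bdot k z')" using diag[OF h] bdot_zero7(2)[of x'] h L_length by auto
    qed
  qed
  have "supp ` set E_gens \<subseteq> ?C"
    unfolding E_gens_def using AA[of 0] AA[of 1] AA[of 2] K[OF A0L(2)] K[OF A0L(3)] K[OF A0L(4)]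
    by (simp add: E_gens_rot(1,2) numeral_2_eq_2 del: image_eqI)
  then show ?thesis using f C' by blast
qed

lemma rev7_rot: "length x = 7 \<Longrightarrow> rot (rev7 x) = rev7 ((rot ^^ 6) x)"
  by (elim length_7_cases) (simp add: numeral_eq_Suc)

lemma rev7_rev7: "length x = 7 \<Longrightarrow> rev7 (rev7 x) = x"
  by (elim length_7_cases) simp

text \<open>Reversal conjugates \<open>rho\<close> to its inverse, the sixth power, under which the
  code is closed as well.\<close>

lemma good_flip:
  assumes C: "good C" shows "good ((`) flip ` C)"
proof (rule good_image[OF flip_bij C])
  fix d assume d: "d \<in> C"
  obtain x y z w where l: "length x = 7" "length y = 7" "length z = 7" "d = supp (x @ y @ z @ w)"
    using word_split[OF goodD(5)[OF C d]] by metis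
  have p: "supp ((rot ^^ i) x @ (rot ^^ i) y @ (rot ^^ i) z @ w) \<in> C" for i
    by (induction i) (use d good_rot[OF C] l in auto)
  have e: "rho ` flip ` d = flip ` supp ((rot ^^ 6) x @ (rot ^^ 6) y @ (rot ^^ 6) z @ w)"
    unfolding l(4) using l by (simp add: flip_supp rho_supp length_rev7 rev7_rot)
  show "rho ` flip ` d \<in> (`) flip ` C" unfolding e by (rule imageI[OF p])
qed

lemma no_zero_first_flip:
  assumes C: "good C" and n: "no_zero_first L2 C" shows "no_zero_first L1 ((`) flip ` C)"
  unfolding no_zero_first_def
proof (intro ballI impI)
  fix y z assume yz: "y \<in> set L1" "z \<in> set L1" "supp (zero7 @ y @ z) \<in> (`) flip ` C"
  have r0: "rev7 zero7 = zero7" by (simp add: zero7_def numeral_eq_Suc)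
  have l: "length y = 7" "length z = 7" using yz L_length by auto
  have "flip ` supp (zero7 @ rev7 y @ rev7 z) = supp (zero7 @ y @ z)"
    using flip_supp[of zero7 "rev7 y" "rev7 z" "[]"] l by (simp add: length_rev7 rev7_rev7 r0)
  with yz(3) obtain d where d: "d \<in> C" "flip ` d = flip ` supp (zero7 @ rev7 y @ rev7 z)" by auto
  have "supp (zero7 @ rev7 y @ rev7 z) \<subseteq> {..<44}"
    using supp_subset[of "zero7 @ rev7 y @ rev7 z"] l by (fastforce simp: length_rev7)
  then have "d = supp (zero7 @ rev7 y @ rev7 z)"
    using d flip_bij goodD(5)[OF C d(1)] by (meson bij_betw_def inj_on_image_eq_iff)
  then have "rev7 y = zero7 \<and> rev7 z = zero7" using n yz d L_rev unfolding no_zero_first_def by blast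
  then show "y = zero7 \<and> z = zero7" using rev7_rev7 l r0 by metis
qed

lemma E_normal_form:
  assumes C: "good C"
  shows "\<exists>f. bij_betw f {..<44} {..<44} \<and> good ((`) f ` C) \<and> supp ` set E_gens \<subseteq> (`) f ` C"
proof (cases "no_zero_first L1 C")
  case True
  then show ?thesis by (rule case1[OF C])
next
  case False
  then have "no_zero_first L2 C" using dichotomy[OF C] by blast
  then obtain f where f: "bij_betw f {..<44} {..<44}" "good ((`) f ` (`) flip ` C)" "supp ` set E_gens \<subseteq> (`) f ` (`) flip ` C"
    using case1[OF good_flip[OF C] no_zero_first_flip[OF C]] by blast
  have "(`) f ` (`) flip ` C = (`) (f \<circ> flip) ` C" by (auto simp: image_comp)
  moreover have "bij_betw (f \<circ> flip) {..<44} {..<44}" using flip_bij f(1) by (rule bij_betw_trans)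
  ultimately show ?thesis using f(2,3) by metis
qed

section \<open>Uniqueness of the glue up to a permutation of the cycles\<close>

lemma self_dual_eq:
  assumes "dual_on X C = C" "dual_on X S = S" "S \<subseteq> C" shows "C = S"
proof -
  have "dual_on X C \<subseteq> dual_on X S" using assms(3) by (auto simp: dual_on_def)
  then show ?thesis using assms by auto
qed

definition spread :: "nat set \<Rightarrow> bool list \<Rightarrow> nat set" where
  "spread J k = (\<Union>i\<in>J. (+) (7 * i) ` supp k)"

definition cperm :: "(nat \<Rightarrow> nat) \<Rightarrow> nat \<Rightarrow> nat" where
  "cperm p i = (if i < 21 then 7 * p (i div 7) + i mod 7 else i)"

lemma cperm_spread:
  assumes "length k = 7" "J \<subseteq> {..<3}" shows "cperm p ` spread J k = spread (p ` J) k"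
proof -
  have "cperm p ` (+) (7 * i) ` supp k = (+) (7 * p i) ` supp k" if "i \<in> J" for i
  proof -
    have "cperm p (7 * i + j) = 7 * p i + j" if "j \<in> supp k" for j
    proof -
      have "j < 7" "i < 3" using that \<open>i \<in> J\<close> assms by (auto simp: supp_def)
      then show ?thesis by (simp add: cperm_def)
    qed
    then show ?thesis by (simp add: image_image cong: image_cong)
  qed
  then show ?thesis by (simp add: spread_def image_UN cong: SUP_cong)
qed

lemma cperm_cyc: "i < 3 \<Longrightarrow> cperm p ` cyc i = cyc (p i)"
proof -
  assume i: "i < 3"
  have c: "cyc n = spread {n} (replicate 7 True)" for n
  proof -
    have "supp (replicate 7 True) = {0..<7}" by (auto simp: supp_def)
    then show ?thesis by (simp add: spread_def cyc_def ac_simps)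
  qed
  show ?thesis unfolding c using cperm_spread[of "replicate 7 True" "{i}" p] i by simp
qed

lemma cperm_fx: "cperm p ` fx s = fx s"
proof -
  have "cperm p i = i" if "i \<in> fx s" for i using fx_ge[OF that] by (simp add: cperm_def)
  then show ?thesis by (simp cong: image_cong)
qed

lemma cperm_bij:
  assumes p: "\<And>i. i < 3 \<Longrightarrow> p i < 3" "inj_on p {..<3}"
  shows "bij_betw (cperm p) {..<44} {..<44}"
proof -
  have lt: "cperm p i < 21" if "i < 21" for i
  proof -
    have "i div 7 < 3" using that by (simp add: div_less_iff_less_mult)
    then have "p (i div 7) \<le> 2" using p(1)[of "i div 7"] by simp
    then show ?thesis using that by (simp add: cperm_def)
  qed
  have inj: "inj_on (cperm p) {..<44}"
  proof (rule inj_onI)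
    fix i j assume ij: "i \<in> {..<44}" "j \<in> {..<44}" "cperm p i = cperm p j"
    show "i = j"
    proof (cases "i < 21 \<and> j < 21")
      case True
      then have e: "7 * p (i div 7) + i mod 7 = 7 * p (j div 7) + j mod 7" using ij by (simp add: cperm_def)
      have "p (i div 7) = (7 * p (i div 7) + i mod 7) div 7" by simp
      also have "\<dots> = p (j div 7)" unfolding e by simp
      finally have e': "p (i div 7) = p (j div 7)" .
      have "i div 7 < 3" "j div 7 < 3" using True by (simp_all add: div_less_iff_less_mult)
      then have "i div 7 = j div 7" using inj_onD[OF p(2) e'] by simp
      moreover have "i mod 7 = j mod 7" using e calculation by simp
      ultimately show ?thesis by (metis div_mult_mod_eq)
    next
      case False
      then show ?thesis using lt[of i] lt[of j] ij(3) by (auto simp: cperm_def split: if_splits)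
    qed
  qed
  moreover have "cperm p ` {..<44} \<subseteq> {..<44}"
  proof
    fix x assume "x \<in> cperm p ` {..<44}"
    then obtain i where i: "i < 44" "x = cperm p i" by auto
    show "x \<in> {..<44}"
    proof (cases "i < 21")
      case True then show ?thesis using lt[OF True] i by simp
    next
      case False then show ?thesis using i by (simp add: cperm_def)
    qed
  qed
  ultimately show ?thesis by (simp add: bij_betw_def endo_inj_surj)
qed

lemma supp_spread:
  assumes "length k = 7"
  shows "supp (k @ k @ k) = spread {0,1,2} k" "supp (k @ k @ zero7) = spread {0,1} k" "supp (zero7 @ k @ k) = spread {1,2} k"
proof -
  have z: "supp zero7 = {}" by (simp add: zero7_def)
  have i: "(+) 7 ` (+) 7 ` s = (+) 14 ` s" for s :: "nat set" by (auto simp: image_image)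
  show "supp (k @ k @ k) = spread {0,1,2} k" "supp (k @ k @ zero7) = spread {0,1} k" "supp (zero7 @ k @ k) = spread {1,2} k"
    unfolding supp_append spread_def using assms by (auto simp: z image_Un i)
qed

lemma spread_sd: "spread {0,1} k \<triangle> spread {1,2} k = spread {0,2} k" if "length k = 7"
proof -
  have "x < 7" if "x \<in> supp k" for x using that \<open>length k = 7\<close> by (simp add: supp_def)
  then have "(+) 0 ` supp k \<inter> (+) 7 ` supp k = {}" "(+) 0 ` supp k \<inter> (+) 14 ` supp k = {}" "(+) 7 ` supp k \<inter> (+) 14 ` supp k = {}"
    by fastforce+
  moreover have "(A \<union> M) \<triangle> (M \<union> Z) = A \<union> Z" if "A \<inter> M = {}" "A \<inter> Z = {}" "M \<inter> Z = {}" for A M Z :: "nat set"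
    using that by (auto simp: in_sd)
  ultimately show ?thesis unfolding spread_def by (simp add: Un_commute)
qed

text \<open>The rows of an orthogonal 3 by 3 matrix over the field with two elements. Each row has
  odd weight, and the row of three ones is orthogonal only to rows of even weight; so all rows are
  unit vectors and the matrix is a permutation.\<close>

lemma boolean_orthogonal_3:
  fixes a b :: "nat \<Rightarrow> bool"
  assumes "a0 \<noteq> (a1 \<noteq> a2)" "b0 \<noteq> (b1 \<noteq> b2)" "c0 \<noteq> (c1 \<noteq> c2)"
    "(a0 \<and> b0) = ((a1 \<and> b1) \<noteq> (a2 \<and> b2))" "(a0 \<and> c0) = ((a1 \<and> c1) \<noteq> (a2 \<and> c2))"
    "(b0 \<and> c0) = ((b1 \<and> c1) \<noteq> (b2 \<and> c2))"
  shows "\<exists>p q r. {p,q,r} = {0,1,2::nat} \<and> p \<noteq> q \<and> p \<noteq> r \<and> q \<noteq> r \<and>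
     a0 = (p = 0) \<and> a1 = (p = 1) \<and> a2 = (p = 2) \<and> b0 = (q = 0) \<and> b1 = (q = 1) \<and> b2 = (q = 2) \<and>
     c0 = (r = 0) \<and> c1 = (r = 1) \<and> c2 = (r = 2)"
proof -
  define p where "p = (if a0 then 0 else if a1 then 1 else 2 :: nat)"
  define q where "q = (if b0 then 0 else if b1 then 1 else 2 :: nat)"
  define r where "r = (if c0 then 0 else if c1 then 1 else 2 :: nat)"
  show ?thesis
    using assms
    by (intro exI[of _ p] exI[of _ q] exI[of _ r])
       (cases a0; cases a1; cases a2; cases b0; simp; cases b1; cases b2; simp; cases c0; cases c1; cases c2; simp add: p_def q_def r_def; auto)
qed

context std_code
begin

text \<open>Modulo \<open>B_code\<close> each \<open>V i\<close> is a combination \<open>W i\<close>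
  of the words \<open>w j\<close>, with coefficients read off from inner products. The matrix of
  coefficients is orthogonal, hence a permutation, and permuting the cycles accordingly yields a
  code that contains the standard one. Of two self-dual codes neither is properly contained in the
  other.\<close>

lemma glue_unique:
  assumes C: "code_on {..<44} C" "dual_on {..<44} C = C"
    and E: "supp ` set E_gens \<subseteq> C" and BC: "\<And>y. y \<in> set B \<Longrightarrow> fx (supp y) \<in> C"
    and V: "\<And>i. i < 3 \<Longrightarrow> V i \<subseteq> {..<23}" "\<And>i. i < 3 \<Longrightarrow> cyc i \<union> fx (V i) \<in> C"
  shows "\<exists>f. bij_betw f {..<44} {..<44} \<and> (`) f ` C = Std B v"
proof -
  have orth: "even (card (c \<inter> d))" if "c \<in> C" "d \<in> C" for c d using dual_onD[of c "{..<44}" C d] C(2) that by simp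
  have fV: "finite (V i)" if "i < 3" for i using V(1)[OF that] finite_subset by blast
  have BC': "fx b \<in> C" if "b \<in> B_code" for b
  proof -
    have "gspan (map (\<lambda>y. fx (supp y)) B) \<subseteq> C" by (rule span_least[OF C(1)]) (use BC in auto)
    moreover have "gspan (map fx gs) = fx ` gspan gs" for gs
      by (induction gs) (auto simp: fx_sd image_Un image_image, simp_all add: fx_def)
    from this[of "map supp B"] have "fx ` B_code = gspan (map (\<lambda>y. fx (supp y)) B)" by (simp add: o_def)
    ultimately show ?thesis using that by blast
  qed
  have cycf: "cyc i \<inter> fx s = {}" if "i < 3" for i s using fx_ge that by (fastforce simp: cyc_def)
  have cyc_fin: "finite (cyc i)" "card (cyc i) = 7" for i by (simp_all add: cyc_def)
  have cyc_dis: "cyc i \<inter> cyc j = {}" if "i \<noteq> j" for i j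
  proof -
    have "x div 7 = i" if "x \<in> cyc i" for x i using that by (auto simp: cyc_def)
    then show ?thesis using that by blast
  qed
  have VB: "even (card (V i \<inter> b))" if i: "i < 3" and b: "b \<in> B_code" for i b
  proof -
    have "(cyc i \<union> fx (V i)) \<inter> fx b = fx (V i \<inter> b)" using cycf[OF i] by (auto simp: fx_Int[symmetric])
    then show ?thesis using orth[OF V(2)[OF i] BC'[OF b]] by (simp add: card_fx)
  qed
  \<comment> \<open>The full cycles meet in 7 points or in none, and the glued words meet evenly; so
    the \<open>V i\<close> are orthonormal.\<close>
  have VV: "odd (card (V i \<inter> V j)) \<longleftrightarrow> i = j" if i: "i < 3" and j: "j < 3" for i j
  proof -
    have "(cyc i \<union> fx (V i)) \<inter> (cyc j \<union> fx (V j)) = (cyc i \<inter> cyc j) \<union> fx (V i \<inter> V j)"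
      using cycf[OF i] cycf[OF j] by (auto simp: fx_Int[symmetric])
    moreover have "card ((cyc i \<inter> cyc j) \<union> fx (V i \<inter> V j)) = card (cyc i \<inter> cyc j) + card (fx (V i \<inter> V j))"
      using cycf[OF i] fV[OF i] cyc_fin by (intro card_Un_disjoint) (auto simp: fx_def)
    ultimately have "even (card (cyc i \<inter> cyc j) + card (V i \<inter> V j))"
      using orth[OF V(2)[OF i] V(2)[OF j]] by (simp add: card_fx)
    then show ?thesis using cyc_dis[of i j] cyc_fin by (cases "i = j") auto
  qed
  define s where "s i j = odd (card (V i \<inter> w j))" for i j
  define W where "W i = wS (s i 0) (s i 1) (s i 2)" for i
  have fW: "finite (W i)" for i by (simp add: W_def wS_def pick_def)
  have Wsub: "W i \<subseteq> {..<23}" for i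
    using supp_subset[of "v ! 0"] supp_subset[of "v ! 1"] supp_subset[of "v ! 2"] lengths(4)
    unfolding W_def wS_def pick_def by (intro sd_subset) auto
  \<comment> \<open>Placed on the fixed coordinates, the difference is orthogonal to the whole
    standard code. It therefore belongs to that code and, vanishing on the cycles, comes from
    \<open>B_code\<close>.\<close>
  have y: "V i \<triangle> W i \<in> B_code" if i: "i < 3" for i
  proof -
    let ?y = "V i \<triangle> W i"
    have fy: "finite ?y" using fV[OF i] fW by simp
    have ysub: "?y \<subseteq> {..<23}" by (rule sd_subset[OF V(1)[OF i] Wsub])
    have yw: "even (card (?y \<inter> w j))" if "j < 3" for j
    proof -
      have "odd (card (W i \<inter> w j)) = s i j"
        using wS_meet[of "s i 0" "s i 1" "s i 2"] that unfolding W_def less_Suc_eq numeral_3_eq_3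
        by (elim disjE) (simp_all add: numeral_2_eq_2)
      then show ?thesis unfolding even_meet_sd(1)[OF fV[OF i] fW] by (auto simp: s_def)
    qed
    have wB: "even (card (W i \<inter> b))" if "b \<in> B_code" for b
      using w_B_orth[OF that, of 0] w_B_orth[OF that, of 1] w_B_orth[OF that, of 2]
      unfolding W_def wS_def pick_def by (simp add: even_meet_sd Int_commute)
    have yB: "even (card (?y \<inter> b))" if "b \<in> B_code" for b
      unfolding even_meet_sd(1)[OF fV[OF i] fW] using VB[OF i that] wB[OF that] by simp
    have "fx ?y \<in> dual_on {..<44} (Std B v)"
    proof -
      have "fx ?y \<subseteq> {..<44}" using ysub by (auto simp: fx_def)
      moreover have "even (card (fx ?y \<inter> c))" if c: "c \<in> Std B v" for c
      proof -
        obtain x s0 s1 s2 b where b: "b \<in> B_code" and ce: "c = (x \<triangle> cycS s0 s1 s2) \<union> fx (wS s0 s1 s2 \<triangle> b)"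
          and sub: "(x \<triangle> cycS s0 s1 s2) \<subseteq> {..<21}" using Std_cases[OF c] .
        have "fx ?y \<inter> (x \<triangle> cycS s0 s1 s2) = {}"
        proof -
          have False if "i \<in> fx ?y" "i < 21" for i using fx_ge[OF that(1)] that(2) by simp
          then show ?thesis using sub by blast
        qed
        then have "fx ?y \<inter> c = fx (?y \<inter> (wS s0 s1 s2 \<triangle> b))" unfolding ce by (simp add: Int_Un_distrib fx_Int)
        moreover have "even (card (?y \<inter> (wS s0 s1 s2 \<triangle> b)))"
        proof -
          have f: "finite (wS s0 s1 s2)" "finite b" using B_finite[OF b] by (simp_all add: wS_def pick_def)
          have "even (card (?y \<inter> wS s0 s1 s2))"
            using yw[of 0] yw[of 1] yw[of 2] unfolding wS_def pick_def by (simp add: even_meet_sd(2))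
          then show ?thesis unfolding even_meet_sd(2)[OF f] using yB[OF b] by simp
        qed
        ultimately show ?thesis by (simp add: card_fx)
      qed
      ultimately show ?thesis by (simp add: dual_on_def)
    qed
    then have "fx ?y \<in> Std B v" using Std_dual by simp
    moreover have "fx ?y \<subseteq> {21..}" using fx_ge by auto
    ultimately obtain b where "b \<in> B_code" "fx ?y = fx b" using Std_fix by blast
    moreover have "inj fx" unfolding fx_def inj_on_def by (simp add: inj_image_eq_iff)
    ultimately show ?thesis by (simp add: inj_eq)
  qed
  have VVs: "(i = j) = ((s i 0 \<and> s j 0) \<noteq> ((s i 1 \<and> s j 1) \<noteq> (s i 2 \<and> s j 2)))" if i: "i < 3" and j: "j < 3" for i j
  proof -
    have Vi: "V i = W i \<triangle> (V i \<triangle> W i)" by (simp add: sd_ac)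
    have fy: "finite (V i \<triangle> W i)" using fV[OF i] fW by simp
    have "odd (card (V i \<inter> V j)) = odd (card ((W i \<triangle> (V i \<triangle> W i)) \<inter> V j))" using Vi by simp
    also have "\<dots> = (odd (card (W i \<inter> V j)) \<noteq> odd (card ((V i \<triangle> W i) \<inter> V j)))"
      using even_meet_sd(1)[OF fW fy] by auto
    also have "\<dots> = odd (card (W i \<inter> V j))" using VB[OF j y[OF i]] by (simp add: Int_commute)
    also have "\<dots> = ((s i 0 \<and> s j 0) \<noteq> ((s i 1 \<and> s j 1) \<noteq> (s i 2 \<and> s j 2)))"
      unfolding W_def wS_def pick_def by (auto simp: even_meet_sd s_def Int_commute)
    finally show ?thesis using VV[OF i j] by simp
  qed
  have h: "s 0 0 \<noteq> (s 0 1 \<noteq> s 0 2)" "s 1 0 \<noteq> (s 1 1 \<noteq> s 1 2)" "s 2 0 \<noteq> (s 2 1 \<noteq> s 2 2)"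
    "(s 0 0 \<and> s 1 0) = ((s 0 1 \<and> s 1 1) \<noteq> (s 0 2 \<and> s 1 2))"
    "(s 0 0 \<and> s 2 0) = ((s 0 1 \<and> s 2 1) \<noteq> (s 0 2 \<and> s 2 2))"
    "(s 1 0 \<and> s 2 0) = ((s 1 1 \<and> s 2 1) \<noteq> (s 1 2 \<and> s 2 2))"
    using VVs[of 0 0] VVs[of 1 1] VVs[of 2 2] VVs[of 0 1] VVs[of 0 2] VVs[of 1 2] by simp_all
  obtain p q r where pqr: "{p,q,r} = {0,1,2::nat}" "p \<noteq> q" "p \<noteq> r" "q \<noteq> r"
    and s0: "s 0 0 = (p = 0)" "s 0 1 = (p = 1)" "s 0 2 = (p = 2)"
    and s1: "s 1 0 = (q = 0)" "s 1 1 = (q = 1)" "s 1 2 = (q = 2)"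
    and s2: "s 2 0 = (r = 0)" "s 2 1 = (r = 1)" "s 2 2 = (r = 2)"
    using boolean_orthogonal_3[OF h] by (elim exE conjE) (rule that; assumption)
  define pp where "pp i = (if i = 0 then p else if i = 1 then q else r)" for i :: nat
  have lt3: "i < 3 \<longleftrightarrow> i \<in> {0,1,2}" for i :: nat by auto
  have pp: "pp i < 3" if "i < 3" for i
  proof -
    have "pp i \<in> {p,q,r}" by (simp add: pp_def)
    then show ?thesis unfolding pqr(1) by auto
  qed
  have pinj: "inj_on pp {..<3}" unfolding inj_on_def using pqr by (auto simp: pp_def less_Suc_eq numeral_3_eq_3)
  have psurj: "pp ` {..<3} = {..<3}" using pp pinj by (intro endo_inj_surj) auto
  have Wpp: "W i = w (pp i)" if "i < 3" for i
  proof -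
    have "i = 0 \<or> i = 1 \<or> i = 2" using that by auto
    moreover have "p \<in> {0,1,2}" "q \<in> {0,1,2}" "r \<in> {0,1,2}" unfolding pqr(1)[symmetric] by simp_all
    then have "p = 0 \<or> p = 1 \<or> p = 2" "q = 0 \<or> q = 1 \<or> q = 2" "r = 0 \<or> r = 1 \<or> r = 2" by simp_all
    ultimately show ?thesis
      unfolding W_def pp_def by (elim disjE) (simp_all add: s0 s1 s2 s1[unfolded One_nat_def] s0[unfolded One_nat_def] s2[unfolded One_nat_def] wS_def pick_def)
  qed
  let ?f = "cperm pp" and ?D = "(`) (cperm pp) ` C"
  have f: "bij_betw ?f {..<44} {..<44}" by (rule cperm_bij[OF pp pinj])
  have fi: "inj_on ?f {..<44}" "?f ` {..<44} = {..<44}" using f by (auto simp: bij_betw_def)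
  have D: "code_on {..<44} ?D" using code_on_image[OF fi(1) C(1)] fi(2) by simp
  have "C \<subseteq> Pow {..<44}" using C(1) by (simp add: code_on_def)
  then have Dd: "dual_on {..<44} ?D = ?D" using dual_on_image[OF fi(1)] C(2) fi(2) by metis
  \<comment> \<open>The two given pairs of cycles add up to the third, so the even part survives
    every permutation of the cycles.\<close>
  have sprC: "spread {0,1} k \<in> C" "spread {1,2} k \<in> C" "spread {0,2} k \<in> C" if k: "k \<in> {C0,C1,C2}" for k
  proof -
    have l: "length k = 7" using k by (auto simp: C0_def C1_def C2_def bits_def)
    have "supp (k @ k @ zero7) \<in> C" "supp (zero7 @ k @ k) \<in> C" using k E by (auto simp: E_gens_def)
    then show a: "spread {0,1} k \<in> C" "spread {1,2} k \<in> C" unfolding supp_spread[OF l] .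
    show "spread {0,2} k \<in> C" using code_onD(3)[OF C(1) a] spread_sd[OF l] by simp
  qed
  have spr2: "spread J k \<in> C" if "k \<in> {C0,C1,C2}" "J \<subseteq> {..<3}" "card J = 2" for J k
  proof -
    have fJ: "finite J" using that(2) finite_subset by blast
    have "J \<subseteq> {0,1,2}" using that(2) by auto
    then have "J \<in> Pow {0,1,2}" by simp
    then have "J = {0,1} \<or> J = {1,2} \<or> J = {0,2}" using that(3) by (auto simp: Pow_insert)
    then show ?thesis using sprC[OF that(1)] by auto
  qed
  have spreadD: "spread J k \<in> ?D" if k: "k \<in> {C0,C1,C2}" and J: "J \<subseteq> {..<3}" "card J = 2" for J k
  proof -
    have l: "length k = 7" using k by (auto simp: C0_def C1_def C2_def bits_def)
    obtain I where I: "I \<subseteq> {..<3}" "J = pp ` I" using J(1) psurj by (metis subset_imageE)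
    have "card I = 2" using J(2) I pinj by (metis card_image inj_on_subset)
    then have "spread I k \<in> C" using spr2[OF k I(1)] by simp
    moreover have "?f ` spread I k = spread J k" using cperm_spread[OF l I(1)] I(2) by simp
    ultimately show ?thesis by (metis imageI)
  qed
  have spread3: "spread {0,1,2} k \<in> ?D" if k: "k \<in> {A0,A1,A2}" for k
  proof -
    have l: "length k = 7" using k by (auto simp: A0_def A1_def A2_def bits_def)
    have "supp (k @ k @ k) \<in> C" using k E by (auto simp: E_gens_def)
    then have "spread {0,1,2} k \<in> C" unfolding supp_spread[OF l] .
    moreover have "{0,1,2} = {..<3::nat}" by auto
    then have "?f ` spread {0,1,2} k = spread {0,1,2} k" using cperm_spread[OF l, of "{0,1,2}" pp] psurj by simp
    ultimately show ?thesis by (metis imageI)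
  qed
  have "supp ` set E_gens \<subseteq> ?D"
  proof -
    have l: "length A0 = 7" "length A1 = 7" "length A2 = 7" "length C0 = 7" "length C1 = 7" "length C2 = 7"
      by (simp_all add: A0_def A1_def A2_def C0_def C1_def C2_def bits_def)
    have "spread {0,1,2} A0 \<in> ?D" "spread {0,1,2} A1 \<in> ?D" "spread {0,1,2} A2 \<in> ?D"
      "spread {0,1} C0 \<in> ?D" "spread {0,1} C1 \<in> ?D" "spread {0,1} C2 \<in> ?D"
      "spread {1,2} C0 \<in> ?D" "spread {1,2} C1 \<in> ?D" "spread {1,2} C2 \<in> ?D"
      using spread3 spreadD by auto
    then show ?thesis unfolding E_gens_def by (simp only: supp_spread[OF l(1)] supp_spread[OF l(2)] supp_spread[OF l(3)]
        supp_spread[OF l(4)] supp_spread[OF l(5)] supp_spread[OF l(6)] list.set image_insert image_empty insert_subset empty_subsetI simp_thms)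
  qed
  then have ED: "E_code \<subseteq> ?D" by (intro span_least[OF D]) auto
  have BD: "fx b \<in> ?D" if "b \<in> B_code" for b
    using BC'[OF that] cperm_fx[of pp b] by (metis imageI)
  have glueD: "cyc j \<union> fx (w j) \<in> ?D" if j: "j < 3" for j
  proof -
    obtain i where i: "i < 3" "j = pp i" using j psurj by (metis imageE lessThan_iff)
    have "?f ` (cyc i \<union> fx (V i)) = cyc j \<union> fx (V i)" using cperm_cyc[OF i(1)] cperm_fx i(2) by (simp add: image_Un)
    then have g: "cyc j \<union> fx (V i) \<in> ?D" using V(2)[OF i(1)] by (metis imageI)
    have e: "cyc j \<union> fx s = cyc j \<triangle> fx s" for s using cycf[OF j, of s] by (auto simp: in_sd)
    have "fx (V i \<triangle> W i) \<in> ?D" using BD y[OF i(1)] by blast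
    then have "(cyc j \<union> fx (V i)) \<triangle> fx (V i \<triangle> W i) \<in> ?D" using code_onD(3)[OF D g] by blast
    moreover have "(cyc j \<union> fx (V i)) \<triangle> fx (V i \<triangle> W i) = cyc j \<union> fx (w j)"
      unfolding e fx_sd using Wpp[OF i(1)] i(2) by (simp add: sd_ac)
    ultimately show ?thesis by simp
  qed
  have "Std B v \<subseteq> ?D"
  proof -
    have "gspan [cyc 0 \<union> fx (w 0), cyc 1 \<union> fx (w 1), cyc 2 \<union> fx (w 2)] \<subseteq> ?D"
      using glueD[of 0] glueD[of 1] glueD[of 2] by (intro span_least[OF D]) auto
    then have gD: "g \<in> ?D" if "g \<in> gspan [cyc 0 \<union> fx (w 0), cyc 1 \<union> fx (w 1), cyc 2 \<union> fx (w 2)]" for g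
      using that by (rule subsetD)
    show ?thesis
    proof
      fix c assume "c \<in> Std B v"
      then obtain x g b where c: "c = x \<triangle> (g \<triangle> fx b)" and x: "x \<in> E_code" and b: "b \<in> B_code"
        and g: "g \<in> gspan [cyc 0 \<union> fx (w 0), cyc 1 \<union> fx (w 1), cyc 2 \<union> fx (w 2)]"
        unfolding gspan_gens44 by blast
      show "c \<in> ?D" unfolding c
        by (intro code_onD(3)[OF D] subsetD[OF ED x] gD[OF g] BD[OF b])
    qed
  qed
  then have "?D = Std B v" by (rule self_dual_eq[OF Dd Std_dual])
  then show ?thesis using f by blast
qed

end

section \<open>Existence of glue words and the fixed-point code\<close>

abbreviation one7 :: "bool list" where "one7 \<equiv> replicate 7 True"

lemma average_check:
  "list_all (\<lambda>x. bxor x (bxor (th1 x) (th2 x)) = replicate 7 (bdot x one7)) (List.n_lists (Suc (Suc n5)) [True, False])"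
  by code_simp

text \<open>One plus the two idempotents is the sum of all seven powers of \<open>x\<close>, which
  sends a word to the constant word given by its parity.\<close>

lemma average: "length x = 7 \<Longrightarrow> bxor x (bxor (th1 x) (th2 x)) = replicate 7 (bdot x one7)"
  using bspec[OF average_check[unfolded list_all_iff] lists_7] by blast

locale normal_code =
  fixes C
  assumes good: "good C" and E: "supp ` set E_gens \<subseteq> C"
begin

lemmas add = goodD(6)[OF good] and sub = goodD(5)[OF good] and min8 = goodD(3)[OF good] and orth = good_orth[OF good]

lemma finC: "c \<in> C \<Longrightarrow> finite c"
  using sub finite_subset by blast

lemma EC: "x \<in> E_code \<Longrightarrow> x \<in> C"
  using span_least[OF goodD(1)[OF good], of "map supp E_gens"] E by auto

text \<open>Removing both projections from a codeword makes it constant on each cycle and does not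
  touch the fixed part.\<close>

lemma averaged:
  assumes l: "length x = 7" "length y = 7" "length z = 7" and m: "supp (x @ y @ z @ w) \<in> C"
  shows "supp (cycL (bdot x one7) (bdot y one7) (bdot z one7) @ w) \<in> C"
proof -
  let ?W = "replicate (length w) False"
  have z: "supp (a @ b @ c @ ?W) = supp (a @ b @ c)" for a b c by (simp add: supp_append)
  have t: "length (th1 u) = 7" "length (th2 u) = 7" if "length u = 7" for u
    using th_props(1,2)[OF that] L_length by auto
  have bW: "bxor w (bxor ?W ?W) = w"
  proof -
    have "bxor ?W ?W = ?W" by (induction w) auto
    moreover have "bxor w ?W = w" by (induction w) auto
    ultimately show ?thesis by simp
  qed
  have "supp (x @ y @ z @ w) \<triangle> (supp (th1 x @ th1 y @ th1 z @ ?W) \<triangle> supp (th2 x @ th2 y @ th2 z @ ?W)) \<in> C"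
    unfolding z using add m good_th[OF good l m] by blast
  also have "supp (x @ y @ z @ w) \<triangle> (supp (th1 x @ th1 y @ th1 z @ ?W) \<triangle> supp (th2 x @ th2 y @ th2 z @ ?W))
     = supp (bxor (x @ y @ z @ w) (bxor (th1 x @ th1 y @ th1 z @ ?W) (th2 x @ th2 y @ th2 z @ ?W)))"
    using l t by (simp add: supp_bxor)
  also have "bxor (x @ y @ z @ w) (bxor (th1 x @ th1 y @ th1 z @ ?W) (th2 x @ th2 y @ th2 z @ ?W))
     = cycL (bdot x one7) (bdot y one7) (bdot z one7) @ w"
    using l t by (simp add: bxor_append average bW cycL_def)
  finally show ?thesis .
qed

text \<open>One or three full cycles have odd weight. Two full cycles have weight 14, but adding a
  suitable even word brings this down to 6.\<close>

lemma cycS_in: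
  assumes c: "cycS s0 s1 s2 \<in> C" shows "\<not> s0 \<and> \<not> s1 \<and> \<not> s2"
proof (rule ccontr)
  assume n: "\<not> ?thesis"
  have cc: "card (cycS s0 s1 s2) = bcount (cycL s0 s1 s2)" by (simp add: card_supp[symmetric] supp_cycL)
  have bc: "bcount (replicate 7 s) = (if s then 7 else 0)" for s by (cases s) (simp_all add: numeral_eq_Suc)
  have cc': "card (cycS s0 s1 s2) = 7 * (of_bool s0 + of_bool s1 + of_bool s2)"
    unfolding cc cycL_def bcount_append bc by simp
  have ev: "even (card (cycS s0 s1 s2))" using orth[OF c c] by simp
  have "card (cycS s0 s1 s2) \<noteq> 0" using cc' n by auto
  then have "cycS s0 s1 s2 \<noteq> {}" by auto
  then have "8 \<le> card (cycS s0 s1 s2)" using min8[OF c] by simp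
  then have two: "of_bool s0 + of_bool s1 + of_bool s2 = (2::nat)" using cc' ev n by (cases s0; cases s1; cases s2) auto
  have "{x \<in> E_code. card (x \<triangle> cycS s0 s1 s2) = 6} \<noteq> {}"
    using E_count[OF two] by (metis card.empty zero_neq_numeral)
  then obtain x where x: "x \<in> E_code" "card (x \<triangle> cycS s0 s1 s2) = 6" by auto
  then have "x \<triangle> cycS s0 s1 s2 \<in> C" using add EC c by blast
  moreover have "x \<triangle> cycS s0 s1 s2 \<noteq> {}" using x(2) by (metis card.empty zero_neq_numeral)
  ultimately show False using min8 x(2) by fastforce
qed

definition patt :: "nat set \<Rightarrow> nat set" where "patt c = {i. i < 3 \<and> odd (card (c \<inter> cyc i))}"

text \<open>If the parity patterns did not fill the space of dimension 3, some nonempty set of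
  cycles would meet all patterns evenly. The union of these cycles would then be orthogonal to the
  code, hence a codeword, which \<open>cycS_in\<close> excludes.\<close>

lemma pattern_exists:
  assumes P: "P \<subseteq> {..<3}" shows "\<exists>c\<in>C. patt c = P"
proof -
  define R where "R = patt ` C"
  have psd: "patt (c \<triangle> d) = patt c \<triangle> patt d" if "c \<in> C" "d \<in> C" for c d
    using finC that by (auto simp: patt_def in_sd even_meet_sd)
  have R: "code_on {..<3} R"
    unfolding code_on_def
  proof (intro conjI ballI)
    show "R \<subseteq> Pow {..<3}" by (auto simp: R_def patt_def)
    have "patt {} = {}" by (simp add: patt_def)
    then show "{} \<in> R" unfolding R_def using goodD(7)[OF good] by (metis imageI)
    fix a b assume "a \<in> R" "b \<in> R"
    then obtain c d where "c \<in> C" "d \<in> C" "a = patt c" "b = patt d" by (auto simp: R_def)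
    then show "a \<triangle> b \<in> R" using psd add by (metis R_def imageI)
  qed
  have "dual_on {..<3} R = {{}}"
  proof -
    have "S = {}" if S: "S \<in> dual_on {..<3} R" for S
    proof -
      let ?s = "\<lambda>i. i \<in> S"
      have S3: "S \<subseteq> {..<3}" using S by (simp add: dual_on_def)
      have Se: "S = pick (?s 0) {0} \<triangle> (pick (?s 1) {1} \<triangle> pick (?s 2) {2})"
        using S3 by (auto simp: pick_def in_sd less_Suc_eq numeral_3_eq_3 numeral_2_eq_2)
      have "cycS (?s 0) (?s 1) (?s 2) \<in> C"
      proof (rule good_memI[OF good])
        show "cycS (?s 0) (?s 1) (?s 2) \<subseteq> {..<44}"
          using supp_subset[of "cycL (?s 0) (?s 1) (?s 2)"] unfolding supp_cycL length_cycL by auto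
        fix c assume c: "c \<in> C"
        have f: "finite (cyc i)" for i by (simp add: cyc_def)
        have o: "odd (card ({i} \<inter> patt c)) = (i \<in> patt c)" for i by (cases "i \<in> patt c") auto
        have "even (card (S \<inter> patt c))" using dual_onD[OF S, of "patt c"] c by (simp add: R_def)
        then have "((?s 0 \<and> 0 \<in> patt c) \<noteq> ((?s 1 \<and> 1 \<in> patt c) \<noteq> (?s 2 \<and> 2 \<in> patt c))) = False"
          unfolding arg_cong[OF Se, of "\<lambda>S. even (card (S \<inter> patt c))"]
          using o[of 0] o[of 1] o[of 2] by (auto simp: pick_def even_meet_sd split: if_splits)
        moreover have "even (card (cycS (?s 0) (?s 1) (?s 2) \<inter> c)) =
          (((?s 0 \<and> odd (card (cyc 0 \<inter> c))) \<noteq> ((?s 1 \<and> odd (card (cyc 1 \<inter> c))) \<noteq> (?s 2 \<and> odd (card (cyc 2 \<inter> c))))) = False)"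
          unfolding cycS_def pick_def by (auto simp: even_meet_sd f)
        ultimately show "even (card (cycS (?s 0) (?s 1) (?s 2) \<inter> c))" by (simp add: patt_def Int_commute)
      qed
      then have "\<not> ?s 0 \<and> \<not> ?s 1 \<and> \<not> ?s 2" by (rule cycS_in)
      then show "S = {}" using Se by (simp add: pick_def)
    qed
    moreover have "{} \<in> dual_on {..<3} R" by (simp add: dual_on_def)
    ultimately show ?thesis by auto
  qed
  then have "card R = 2 ^ card {..<3::nat}" using card_dual_on[OF _ R] by simp
  moreover have "R \<subseteq> Pow {..<3}" using R by (simp add: code_on_def)
  ultimately have "R = Pow {..<3}" by (intro card_subset_eq) (auto simp: card_Pow)
  then have "P \<in> R" using P by simp
  then show ?thesis by (auto simp: R_def)
qed

lemma patt_parts: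
  assumes l: "length x = 7" "length y = 7" "length z = 7" "length w = 23"
  shows "odd (card (supp (x @ y @ z @ w) \<inter> cyc 0)) = bdot x one7"
    "odd (card (supp (x @ y @ z @ w) \<inter> cyc 1)) = bdot y one7"
    "odd (card (supp (x @ y @ z @ w) \<inter> cyc 2)) = bdot z one7"
proof -
  have c: "cyc 0 = supp (one7 @ zero7 @ zero7 @ replicate 23 False)" "cyc 1 = supp (zero7 @ one7 @ zero7 @ replicate 23 False)"
    "cyc 2 = supp (zero7 @ zero7 @ one7 @ replicate 23 False)"
    by (auto simp: supp_def cyc_def zero7_def nth_append)
  have w: "\<not> bdot w (replicate 23 False)" using l by (simp add: bdot_iff)
  show "odd (card (supp (x @ y @ z @ w) \<inter> cyc 0)) = bdot x one7"
    "odd (card (supp (x @ y @ z @ w) \<inter> cyc 1)) = bdot y one7"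
    "odd (card (supp (x @ y @ z @ w) \<inter> cyc 2)) = bdot z one7"
    unfolding c using l w by (simp_all add: bdot_iff[symmetric] bdot_append bdot_zero7)
qed

lemma averaged_word:
  assumes c: "c \<in> C"
  obtains w where "w \<subseteq> {..<23}" "c \<inter> {21..} = fx w"
    "cycS (0 \<in> patt c) (1 \<in> patt c) (2 \<in> patt c) \<union> fx w \<in> C"
proof -
  obtain x y z w where l: "length x = 7" "length y = 7" "length z = 7" "length w = 23" "c = supp (x @ y @ z @ w)"
    using word_split[OF sub[OF c]] .
  have p: "0 \<in> patt c \<longleftrightarrow> bdot x one7" "1 \<in> patt c \<longleftrightarrow> bdot y one7" "2 \<in> patt c \<longleftrightarrow> bdot z one7"
    using patt_parts[OF l(1-4)] unfolding l(5) patt_def by auto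
  have "supp (cycL (bdot x one7) (bdot y one7) (bdot z one7) @ w) \<in> C"
    using averaged[OF l(1-3)] c l(5) by simp
  then have "cycS (0 \<in> patt c) (1 \<in> patt c) (2 \<in> patt c) \<union> fx (supp w) \<in> C"
    unfolding p supp_append supp_cycL length_cycL fx_def .
  moreover have "c \<inter> {21..} = fx (supp w)"
  proof -
    have "c = supp (x @ y @ z) \<union> fx (supp w)"
      unfolding l(5) using supp_append[of "x @ y @ z" w] l by (simp add: fx_def)
    moreover have "supp (x @ y @ z) \<subseteq> {..<21}" using supp_subset[of "x @ y @ z"] l by simp
    ultimately show ?thesis using fx_ge by fastforce
  qed
  moreover have "supp w \<subseteq> {..<23}" using supp_subset[of w] l by simp
  ultimately show ?thesis using that by blast
qed

lemma glue_exists: "\<exists>V. \<forall>i<3. V i \<subseteq> {..<23} \<and> cyc i \<union> fx (V i) \<in> C"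
proof -
  have "\<exists>v. v \<subseteq> {..<23} \<and> cyc i \<union> fx v \<in> C" if i: "i < 3" for i
  proof -
    obtain c where c: "c \<in> C" "patt c = {i}" using pattern_exists[of "{i}"] i by auto
    obtain w where w: "w \<subseteq> {..<23}" "c \<inter> {21..} = fx w"
      "cycS (0 \<in> patt c) (1 \<in> patt c) (2 \<in> patt c) \<union> fx w \<in> C" using averaged_word[OF c(1)] .
    have "cycS (0 \<in> patt c) (1 \<in> patt c) (2 \<in> patt c) = cyc i"
      using i unfolding c(2) less_Suc_eq numeral_3_eq_3 by (elim disjE) (simp_all add: cycS_def pick_def numeral_2_eq_2)
    then show ?thesis using w(1,3) by auto
  qed
  then show ?thesis by metis
qed

end

locale glued_code = normal_code +
  fixes V
  assumes V: "\<And>i. i < 3 \<Longrightarrow> V i \<subseteq> {..<23}" "\<And>i. i < 3 \<Longrightarrow> cyc i \<union> fx (V i) \<in> C"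
begin

definition VS :: "bool \<Rightarrow> bool \<Rightarrow> bool \<Rightarrow> nat set" where
  "VS s0 s1 s2 = pick s0 (V 0) \<triangle> (pick s1 (V 1) \<triangle> pick s2 (V 2))"

definition Bc :: "nat set set" where "Bc = {b. b \<subseteq> {..<23} \<and> fx b \<in> C}"

lemma Bc_code: "code_on {..<23} Bc"
  unfolding code_on_def Bc_def using add goodD(7)[OF good]
  by (auto simp: fx_sd dest: sd_subset) (simp_all add: fx_def)

lemma cyc_fx: "i < 3 \<Longrightarrow> cyc i \<inter> fx s = {}"
  using fx_ge by (fastforce simp: cyc_def)

lemma fV: "i < 3 \<Longrightarrow> finite (V i)"
  using V(1) finite_subset by blast

lemma fVS: "finite (VS s0 s1 s2)"
  using fV by (simp add: VS_def pick_def)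

lemma VS_sub: "VS s0 s1 s2 \<subseteq> {..<23}"
  using V(1)[of 0] V(1)[of 1] V(1)[of 2] unfolding VS_def pick_def by (intro sd_subset) auto

lemma V_Bc: "i < 3 \<Longrightarrow> b \<in> Bc \<Longrightarrow> even (card (V i \<inter> b))"
proof -
  assume i: "i < 3" and b: "b \<in> Bc"
  have "(cyc i \<union> fx (V i)) \<inter> fx b = fx (V i \<inter> b)" using cyc_fx[OF i] by (auto simp: fx_Int[symmetric])
  then show ?thesis using orth[OF V(2)[OF i], of "fx b"] b by (simp add: card_fx Bc_def)
qed

lemma V_V: "i < 3 \<Longrightarrow> j < 3 \<Longrightarrow> odd (card (V i \<inter> V j)) \<longleftrightarrow> i = j"
proof -
  assume i: "i < 3" and j: "j < 3"
  have fin: "finite (cyc i)" "card (cyc i) = 7" for i by (simp_all add: cyc_def)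
  have dis: "cyc i \<inter> cyc j = {}" if "i \<noteq> j"
  proof -
    have "x div 7 = i" if "x \<in> cyc i" for x i using that by (auto simp: cyc_def)
    then show ?thesis using that by blast
  qed
  have "(cyc i \<union> fx (V i)) \<inter> (cyc j \<union> fx (V j)) = (cyc i \<inter> cyc j) \<union> fx (V i \<inter> V j)"
    using cyc_fx[OF i] cyc_fx[OF j] by (auto simp: fx_Int[symmetric])
  moreover have "card ((cyc i \<inter> cyc j) \<union> fx (V i \<inter> V j)) = card (cyc i \<inter> cyc j) + card (fx (V i \<inter> V j))"
    using cyc_fx[OF i] fV[OF i] fin by (intro card_Un_disjoint) (auto simp: fx_def)
  ultimately have "even (card (cyc i \<inter> cyc j) + card (V i \<inter> V j))"
    using orth[OF V(2)[OF i] V(2)[OF j]] by (simp add: card_fx)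
  then show ?thesis using dis fin by (cases "i = j") auto
qed

lemma VS_V:
  "odd (card (VS s0 s1 s2 \<inter> V 0)) = s0" "odd (card (VS s0 s1 s2 \<inter> V 1)) = s1" "odd (card (VS s0 s1 s2 \<inter> V 2)) = s2"
  using V_V[of 0 0] V_V[of 0 1] V_V[of 0 2] V_V[of 1 0] V_V[of 1 1] V_V[of 1 2] V_V[of 2 0] V_V[of 2 1] V_V[of 2 2] fV
  by (simp_all add: VS_def pick_def even_meet_sd)

lemma VS_Bc: "b \<in> Bc \<Longrightarrow> even (card (VS s0 s1 s2 \<inter> b))"
  using V_Bc[of 0 b] V_Bc[of 1 b] V_Bc[of 2 b] fV by (simp add: VS_def pick_def even_meet_sd)

lemma glue_in: "cycS s0 s1 s2 \<triangle> fx (VS s0 s1 s2) \<in> C"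
proof -
  have g: "pick s (cyc i) \<triangle> fx (pick s (V i)) \<in> C" if "i < 3" for s i
  proof -
    have "cyc i \<union> fx (V i) = cyc i \<triangle> fx (V i)" using cyc_fx[OF that, of "V i"] by (auto simp: in_sd)
    then show ?thesis using V(2)[OF that] goodD(7)[OF good] by (cases s) (auto simp: pick_def fx_def)
  qed
  have "(pick s0 (cyc 0) \<triangle> fx (pick s0 (V 0))) \<triangle> ((pick s1 (cyc 1) \<triangle> fx (pick s1 (V 1))) \<triangle> (pick s2 (cyc 2) \<triangle> fx (pick s2 (V 2)))) \<in> C"
    using g[of 0 s0] g[of 1 s1] g[of 2 s2] add by simp
  then show ?thesis unfolding cycS_def VS_def fx_sd by (simp add: sd_ac)
qed

lemma fix_part:
  assumes c: "c \<in> C" shows "\<exists>s0 s1 s2. \<exists>b\<in>Bc. c \<inter> {21..} = fx (VS s0 s1 s2 \<triangle> b)"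
proof -
  obtain w where w: "w \<subseteq> {..<23}" "c \<inter> {21..} = fx w"
    "cycS (0 \<in> patt c) (1 \<in> patt c) (2 \<in> patt c) \<union> fx w \<in> C" using averaged_word[OF c] .
  define s0 s1 s2 where "s0 = (0 \<in> patt c)" and "s1 = (1 \<in> patt c)" and "s2 = (2 \<in> patt c)"
  have cs: "cycS s0 s1 s2 \<subseteq> {..<21}" using supp_subset[of "cycL s0 s1 s2"] unfolding supp_cycL length_cycL .
  have "cycS s0 s1 s2 \<union> fx w = cycS s0 s1 s2 \<triangle> fx w" using cs fx_ge by (fastforce simp: in_sd)
  then have "cycS s0 s1 s2 \<triangle> fx w \<in> C" using w(3) by (simp add: s0_def s1_def s2_def)
  then have "(cycS s0 s1 s2 \<triangle> fx w) \<triangle> (cycS s0 s1 s2 \<triangle> fx (VS s0 s1 s2)) \<in> C" using add glue_in by blast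
  moreover have "(cycS s0 s1 s2 \<triangle> fx w) \<triangle> (cycS s0 s1 s2 \<triangle> fx (VS s0 s1 s2)) = fx (w \<triangle> VS s0 s1 s2)"
    unfolding fx_sd by (simp add: sd_ac)
  ultimately have "w \<triangle> VS s0 s1 s2 \<in> Bc" using sd_subset[OF w(1) VS_sub] by (simp add: Bc_def)
  moreover have "w = VS s0 s1 s2 \<triangle> (w \<triangle> VS s0 s1 s2)" by (simp add: sd_ac)
  ultimately show ?thesis using w(2) by metis
qed

text \<open>From a dual word the glue combination with the same inner products against the
  \<open>V i\<close> is subtracted. The rest is orthogonal to the fixed part of every codeword, so
  on the fixed coordinates it is itself a codeword.\<close>

lemma dual_Bc: "dual_on {..<23} Bc = (\<lambda>(s0,s1,s2,b). VS s0 s1 s2 \<triangle> b) ` (UNIV \<times> UNIV \<times> UNIV \<times> Bc)"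
proof (intro equalityI subsetI)
  fix u assume u: "u \<in> dual_on {..<23} Bc"
  have uX: "u \<subseteq> {..<23}" using u by (simp add: dual_on_def)
  have fu: "finite u" using uX finite_subset by blast
  define s0 s1 s2 where "s0 = odd (card (u \<inter> V 0))" and "s1 = odd (card (u \<inter> V 1))" and "s2 = odd (card (u \<inter> V 2))"
  let ?y = "u \<triangle> VS s0 s1 s2"
  have yX: "?y \<subseteq> {..<23}" by (rule sd_subset[OF uX VS_sub])
  have yV: "even (card (?y \<inter> V 0))" "even (card (?y \<inter> V 1))" "even (card (?y \<inter> V 2))"
    using VS_V[of s0 s1 s2] unfolding even_meet_sd(1)[OF fu fVS] by (auto simp: s0_def s1_def s2_def)
  have yB: "even (card (?y \<inter> b))" if "b \<in> Bc" for b
    unfolding even_meet_sd(1)[OF fu fVS] using dual_onD[OF u that] VS_Bc[OF that] by simp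
  have "fx ?y \<in> C"
  proof (rule good_memI[OF good])
    show "fx ?y \<subseteq> {..<44}" using yX by (auto simp: fx_def)
    fix c assume c: "c \<in> C"
    obtain r0 r1 r2 b where b: "b \<in> Bc" "c \<inter> {21..} = fx (VS r0 r1 r2 \<triangle> b)" using fix_part[OF c] by blast
    have "fx ?y \<inter> c = fx ?y \<inter> (c \<inter> {21..})" using fx_ge by blast
    also have "\<dots> = fx (?y \<inter> (VS r0 r1 r2 \<triangle> b))" unfolding b(2) fx_Int ..
    finally have "card (fx ?y \<inter> c) = card (?y \<inter> (VS r0 r1 r2 \<triangle> b))" by (simp add: card_fx)
    moreover have "finite b" using b(1) finite_subset by (auto simp: Bc_def)
    moreover have "even (card (?y \<inter> VS r0 r1 r2))"
      using yV fV unfolding VS_def[of r0 r1 r2] pick_def by (simp add: even_meet_sd(2))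
    ultimately show "even (card (fx ?y \<inter> c))" using yB[OF b(1)] fVS by (simp add: even_meet_sd(2))
  qed
  then have "?y \<in> Bc" using yX by (simp add: Bc_def)
  moreover have "u = VS s0 s1 s2 \<triangle> ?y" by (simp add: sd_ac)
  ultimately show "u \<in> (\<lambda>(s0,s1,s2,b). VS s0 s1 s2 \<triangle> b) ` (UNIV \<times> UNIV \<times> UNIV \<times> Bc)"
    by (intro image_eqI[of _ _ "(s0,s1,s2,?y)"]) auto
next
  fix u assume "u \<in> (\<lambda>(s0,s1,s2,b). VS s0 s1 s2 \<triangle> b) ` (UNIV \<times> UNIV \<times> UNIV \<times> Bc)"
  then obtain s0 s1 s2 b where b: "b \<in> Bc" "u = VS s0 s1 s2 \<triangle> b" by auto
  have fb: "finite b" and bX: "b \<subseteq> {..<23}" using b(1) finite_subset by (auto simp: Bc_def)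
  have "even (card (u \<inter> d))" if d: "d \<in> Bc" for d
  proof -
    have "even (card (fx b \<inter> fx d))" using orth b(1) d by (simp add: Bc_def)
    then have "even (card (b \<inter> d))" by (simp add: fx_Int card_fx)
    then show ?thesis unfolding b(2) even_meet_sd(1)[OF fVS fb] using VS_Bc[OF d] by simp
  qed
  then show "u \<in> dual_on {..<23} Bc" using sd_subset[OF VS_sub bX] b(2) by (auto simp: dual_on_def)
qed

text \<open>The inner products with the \<open>V i\<close> recover the glue coefficients, so the
  dual is eight times as large as \<open>Bc\<close>, while the product of the two sizes is
  \<open>2 ^ 23\<close>.\<close>

lemma card_Bc: "card Bc = 1024"
proof -
  have fB: "finite Bc" by (rule code_on_finite[OF _ Bc_code]) simp
  have "inj_on (\<lambda>(s0,s1,s2,b). VS s0 s1 s2 \<triangle> b) (UNIV \<times> UNIV \<times> UNIV \<times> Bc)"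
  proof (rule inj_onI)
    fix P Q assume PQ: "P \<in> UNIV \<times> UNIV \<times> UNIV \<times> Bc" "Q \<in> UNIV \<times> UNIV \<times> UNIV \<times> Bc"
      "(\<lambda>(s0,s1,s2,b). VS s0 s1 s2 \<triangle> b) P = (\<lambda>(s0,s1,s2,b). VS s0 s1 s2 \<triangle> b) Q"
    obtain s0 s1 s2 b where P: "P = (s0,s1,s2,b)" by (cases P)
    obtain r0 r1 r2 d where Q: "Q = (r0,r1,r2,d)" by (cases Q)
    have bd: "b \<in> Bc" "d \<in> Bc" and e: "VS s0 s1 s2 \<triangle> b = VS r0 r1 r2 \<triangle> d" using PQ by (auto simp: P Q)
    have f: "finite b" "finite d" using bd finite_subset by (auto simp: Bc_def)
    have m: "odd (card ((VS s0 s1 s2 \<triangle> b) \<inter> V i)) = odd (card (VS s0 s1 s2 \<inter> V i))" if "i < 3" "b \<in> Bc" "finite b" for s0 s1 s2 b i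
      using V_Bc[OF that(1,2)] even_meet_sd(1)[OF fVS that(3)] by (simp add: Int_commute)
    have q: "odd (card (VS s0 s1 s2 \<inter> V i)) = odd (card (VS r0 r1 r2 \<inter> V i))" if "i < 3" for i
      using m[OF that bd(1) f(1), of s0 s1 s2] m[OF that bd(2) f(2), of r0 r1 r2] unfolding e by simp
    have s: "s0 = r0" "s1 = r1" "s2 = r2"
      using q[of 0] q[of 1] q[of 2] unfolding VS_V by simp_all
    have "b = d" using e unfolding s by (metis sd_cancel)
    then show "P = Q" using s by (simp add: P Q)
  qed
  then have "card (dual_on {..<23} Bc) = 8 * card Bc"
    unfolding dual_Bc by (simp add: card_image card_cartesian_product)
  moreover have "card Bc * card (dual_on {..<23} Bc) = 2 ^ 23" using card_dual_on[OF _ Bc_code] by simp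
  ultimately have "card Bc ^ 2 = 1024 ^ 2" by (simp add: power2_eq_square)
  then show ?thesis by (metis power2_eq_iff_nonneg zero_le)
qed

text \<open>Coordinate 23 plays the part of \<open>t\<close>: it is absent from the words of
  \<open>Bc\<close> and present in their complements.\<close>

lemma extends: "\<exists>D. golay {..<24} D \<and> Bc \<subseteq> {c \<in> D. 23 \<notin> c}"
proof -
  let ?X = "{..<24::nat}" and ?K = "Bc \<union> (\<triangle>) {..<24} ` Bc"
  have BX: "b \<subseteq> {..<23}" if "b \<in> Bc" for b using that by (simp add: Bc_def)
  have Bcode: "code_on ?X Bc" using Bc_code unfolding code_on_def by fastforce
  have fB: "finite Bc" by (rule code_on_finite[OF _ Bc_code]) simp
  have borth: "even (card (b \<inter> d))" if "b \<in> Bc" "d \<in> Bc" for b d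
  proof -
    have "even (card (fx b \<inter> fx d))" using orth that by (simp add: Bc_def)
    then show ?thesis by (simp add: fx_Int card_fx)
  qed
  have fb: "finite b" if "b \<in> Bc" for b using BX[OF that] finite_subset by blast
  have t: "23 \<in> ?X \<triangle> b" "23 \<notin> b" if "b \<in> Bc" for b using BX[OF that] by (auto simp: in_sd)
  have bX: "?X \<inter> b = b" if "b \<in> Bc" for b using BX[OF that] by auto
  have "pregolay ?X ?K 23"
  proof
    show "finite ?X" "card ?X = 24" "23 \<in> ?X" by simp_all
    show K: "code_on ?X ?K" by (rule code_on_coset_union[OF Bcode]) simp
    show "?X \<in> ?K" using code_onD(2)[OF Bc_code] by (auto intro!: image_eqI[of _ _ "{}"])
    show "?K \<subseteq> dual_on ?X ?K"
    proof
      fix c assume c: "c \<in> ?K"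
      have "even (card (c \<inter> d))" if d: "d \<in> ?K" for d
      proof -
        obtain b where b: "b \<in> Bc" "c = b \<or> c = ?X \<triangle> b" using c by auto
        obtain e where e: "e \<in> Bc" "d = e \<or> d = ?X \<triangle> e" using d by auto
        have ev: "even (card (b \<inter> e))" "even (card (?X \<inter> e))" "even (card (b \<inter> ?X))" "even (card (?X \<inter> ?X))"
          using borth[OF b(1) e(1)] borth[OF e(1) e(1)] borth[OF b(1) b(1)] bX[OF e(1)] bX[OF b(1)] by (simp_all add: Int_commute)
        have f: "finite b" "finite e" using fb b e by auto
        show ?thesis using b(2) e(2) ev f by (elim disjE) (simp_all add: even_meet_sd)
      qed
      then show "c \<in> dual_on ?X ?K" using code_onD(1)[OF K c] by (auto simp: dual_on_def)
    qed
    have "Bc \<inter> (\<triangle>) ?X ` Bc = {}" using t by blast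
    then show "card ?K = 2048" using fB card_Bc by (simp add: card_Un_disjoint card_image[OF inj_sd])
    show "8 \<le> card c" if "c \<in> ?K" "23 \<notin> c" "c \<noteq> {}" for c
    proof -
      have "c \<in> Bc" using that t by auto
      then have "fx c \<in> C" by (simp add: Bc_def)
      moreover have "fx c \<noteq> {}" using that(3) by (simp add: fx_def)
      ultimately show ?thesis using min8[of "fx c"] by (simp add: card_fx)
    qed
  qed
  from pregolay.extends_to_golay[OF this] obtain G where G: "golay ?X G" "?K \<subseteq> G" by (elim exE conjE)
  have "Bc \<subseteq> {c \<in> G. 23 \<notin> c}" using G(2) t(2) by (simp add: subset_iff)
  then show ?thesis using G(1) by (intro exI[of _ G] conjI)
qed

lemma Bc_hyperplane:
  "\<exists>D v. golay {..<24} D \<and> v \<subseteq> {..<23} \<and> v \<noteq> {} \<and> card v \<le> 3 \<and> Bc = {c \<in> D. 23 \<notin> c \<and> even (card (v \<inter> c))}"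
proof -
  obtain G where G: "golay {..<24} G" "Bc \<subseteq> {c \<in> G. 23 \<notin> c}" using extends by blast
  interpret gc: golay_code "{..<24}" G by unfold_locales (rule G(1))
  have Bcode: "code_on {..<24} Bc" using Bc_code unfolding code_on_def by fastforce
  have "{..<24} - {23} = {..<23::nat}" by auto
  moreover have "23 \<in> {..<24::nat}" by simp
  from gc.shortened_hyperplane[OF this Bcode G(2) card_Bc] obtain v where
    "v \<subseteq> {..<24} - {23}" "v \<noteq> {}" "card v \<le> 3" "Bc = {c \<in> G. 23 \<notin> c \<and> even (card (v \<inter> c))}"
    by (elim exE conjE)
  ultimately show ?thesis using G(1) by (intro exI[of _ G] exI[of _ v] conjI) simp_all
qed

end

section \<open>Transporting the labelled Golay code to the fixed coordinates\<close>

lemma supp_bits: "supp (bits n ps) = {i. i < n \<and> i \<in> set ps}"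
  by (auto simp: supp_def bits_def)

lemma length_bits: "length (bits n ps) = n"
  by (simp add: bits_def)

lemma hyperplane_checks:
  "list_all (\<lambda>y. \<not> bdot (bits 23 [0]) y) B1_gens" "list_all (\<lambda>y. \<not> bdot (bits 23 [1,2]) y) B2_gens"
  "list_all (\<lambda>y. \<not> bdot (bits 23 [0,1,2]) y) B3_gens"
  by code_simp+

text \<open>The list \<open>L\<close> follows the order of the standard coordinates. The point
  \<open>t\<close>, here 23, is left out of it and reappears as the element inserted into the
  octads.\<close>

lemma golay_label_gens:
  assumes G: "golay {..<24::nat} G" and pts: "a < 23" "b < 23" "c < 23" "distinct [a,b,c]"
  shows "\<exists>h. bij_betw h {..<23} {..<23} \<and> h 0 = a \<and> h 1 = b \<and> h 2 = c \<and>
    insert 23 (h ` supp octad_b) \<in> G \<and> (\<forall>x\<in>set octads. insert 23 (h ` supp x) \<in> G) \<and> h ` supp dodecad \<in> G"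
proof -
  interpret gc: golay_code "{..<24}" G by unfold_locales (rule G)
  obtain es us zs where len: "length es = 10" "length us = 5" "length zs = 6"
    and dist: "distinct (23 # a # b # es @ us @ zs)" and set: "set (23 # a # b # es @ us @ zs) = {..<24}"
    and es0: "es ! 0 = c" and ob: "{23,a,b} \<union> set us \<in> G"
    and ok: "\<forall>k<10. {23,a,es ! k,us ! fst (K5_edges ! k),us ! snd (K5_edges ! k)} \<union> {zs ! m |m. m < 6 \<and> pentagons ! m ! k} \<in> G"
    and dd: "insert a (set us \<union> set zs) \<in> G"
    using gc.golay_labelling[of 23 a b c] pts by auto
  define L where "L = a # b # es @ us @ zs"
  have lL: "length L = 23" by (simp add: L_def len)
  have sL: "set L = {..<23}"
  proof -
    have "23 \<notin> set L" using dist by (auto simp: L_def)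
    moreover have "insert 23 (set L) = {..<24}" using set by (simp add: L_def)
    ultimately have "set L = {..<24} - {23}" by (metis Diff_insert_absorb)
    also have "\<dots> = {..<23}" by auto
    finally show ?thesis .
  qed
  have dL: "distinct L" using dist by (simp add: L_def)
  let ?h = "(!) L"
  have bij: "bij_betw ?h {..<23} {..<23}"
    by (rule bij_betw_nth[OF dL]) (simp_all only: lL sL)
  have n1: "L ! 0 = a" "L ! 1 = b" by (simp_all add: L_def)
  have nes: "L ! (2 + k) = es ! k" if "k < 10" for k using that len by (simp add: L_def nth_append)
  have nus: "L ! (12 + p) = us ! p" if "p < 5" for p
  proof -
    have "L ! (12 + p) = (es @ us @ zs) ! (10 + p)" by (simp add: L_def)
    then show ?thesis using that len by (simp add: nth_append)
  qed
  have nzs: "L ! (17 + m) = zs ! m" if "m < 6" for m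
  proof -
    have "L ! (17 + m) = (es @ us @ zs) ! (15 + m)" by (simp add: L_def)
    then show ?thesis using that len by (simp add: nth_append)
  qed
  have img: "?h ` supp (bits 23 ps) = ?h ` set ps" if "\<forall>p\<in>set ps. p < 23" for ps
  proof -
    have "supp (bits 23 ps) = set ps" using that by (auto simp: supp_bits)
    then show ?thesis by simp
  qed
  have sus: "set us = {us ! 0, us ! 1, us ! 2, us ! 3, us ! 4}"
    using len(2) by (auto simp: numeral_eq_Suc length_Suc_conv)
  have szs: "set zs = {zs ! 0, zs ! 1, zs ! 2, zs ! 3, zs ! 4, zs ! 5}"
    using len(3) by (auto simp: numeral_eq_Suc length_Suc_conv)
  have u: "L ! 12 = us ! 0" "L ! 13 = us ! 1" "L ! 14 = us ! 2" "L ! 15 = us ! 3" "L ! 16 = us ! 4"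
    using nus[of 0] nus[of 1] nus[of 2] nus[of 3] nus[of 4] by simp_all
  have z: "L ! 17 = zs ! 0" "L ! 18 = zs ! 1" "L ! 19 = zs ! 2" "L ! 20 = zs ! 3" "L ! 21 = zs ! 4" "L ! 22 = zs ! 5"
    using nzs[of 0] nzs[of 1] nzs[of 2] nzs[of 3] nzs[of 4] nzs[of 5] by simp_all
  have "insert 23 (?h ` supp octad_b) = {23,a,b} \<union> set us"
    unfolding octad_b_def sus
    by (subst img, simp, simp only: list.set image_insert image_empty u n1, blast)
  then have 1: "insert 23 (?h ` supp octad_b) \<in> G" using ob by simp
  have "?h ` supp dodecad = insert a (set us \<union> set zs)"
    unfolding dodecad_def sus szs
    by (subst img, simp, simp only: list.set image_insert image_empty u z n1, blast)
  then have 2: "?h ` supp dodecad \<in> G" using dd by simp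
  have 3: "insert 23 (?h ` supp x) \<in> G" if x: "x \<in> set octads" for x
  proof -
    obtain k where k: "k < 10" "x = bits 23 (0 # (2 + k) # (12 + fst (K5_edges ! k)) # (12 + snd (K5_edges ! k)) #
     map ((+) 17) (filter (\<lambda>m. pentagons ! m ! k) [0..<6]))" (is "_ = bits 23 ?ps") using x by (auto simp: octads_def)
    have b: "fst (K5_edges ! k) < 5" "snd (K5_edges ! k) < 5" using K5_less[OF k(1)] by auto
    have "\<forall>p\<in>set ?ps. p < 23" using k b by auto
    then have "?h ` supp x = ?h ` set ?ps" using img k(2) by simp
    also have "\<dots> = {a, es ! k, us ! fst (K5_edges ! k), us ! snd (K5_edges ! k)} \<union> (\<lambda>m. L ! (17 + m)) ` {m. m < 6 \<and> pentagons ! m ! k}"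
      using nes[OF k(1)] nus[OF b(1)] nus[OF b(2)] n1 by (simp add: image_image)
    also have "(\<lambda>m. L ! (17 + m)) ` {m. m < 6 \<and> pentagons ! m ! k} = {zs ! m |m. m < 6 \<and> pentagons ! m ! k}"
      using nzs by force
    finally have "insert 23 (?h ` supp x) = {23,a,es ! k,us ! fst (K5_edges ! k),us ! snd (K5_edges ! k)} \<union> {zs ! m |m. m < 6 \<and> pentagons ! m ! k}"
      by auto
    then show ?thesis using ok k(1) by simp
  qed
  have "L ! 2 = c" using nes[of 0] es0 by simp
  then show ?thesis using bij n1 1 2 3 by blast
qed

context glued_code
begin

text \<open>The fixed coordinates are renamed by the inverse of \<open>h\<close> and the cycles are
  kept. The code then contains the generators that \<open>glue_unique\<close> asks for.\<close>

lemma relabel_fixed: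
  assumes h: "bij_betw h {..<23} {..<23}" and S: "std_code B v us" and B: "\<And>y. y \<in> set B \<Longrightarrow> h ` supp y \<in> Bc"
  shows "\<exists>f. bij_betw f {..<44} {..<44} \<and> (`) f ` C = Std B v"
proof -
  interpret st: std_code B v us by (rule S)
  define hi where "hi = inv_into {..<23} h"
  define f where "f i = (if i < 21 then i else 21 + hi (i - 21))" for i :: nat
  have hi: "bij_betw hi {..<23} {..<23}" unfolding hi_def by (rule bij_betw_inv_into[OF h])
  have hih: "hi (h i) = i" if "i < 23" for i
    unfolding hi_def using h that by (intro inv_into_f_f) (auto simp: bij_betw_def)
  have hil: "hi i < 23" if "i < 23" for i using hi that by (auto simp: bij_betw_def)
  have ffx: "f ` fx s = fx (hi ` s)" for s
    unfolding fx_def image_image by (simp add: f_def)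
  have flow: "f ` s = s" if "s \<subseteq> {..<21}" for s
  proof -
    have "f i = i" if "i \<in> s" for i using that \<open>s \<subseteq> {..<21}\<close> by (auto simp: f_def)
    then show ?thesis by (simp cong: image_cong)
  qed
  have bij: "bij_betw f {..<44} {..<44}"
  proof -
    have "inj_on f {..<44}"
    proof (rule inj_onI)
      fix i j assume ij: "i \<in> {..<44}" "j \<in> {..<44}" "f i = f j"
      show "i = j"
      proof (cases "i < 21 \<or> j < 21")
        case True then show ?thesis using ij(3) by (auto simp: f_def split: if_splits)
      next
        case False
        then have "hi (i - 21) = hi (j - 21)" "i - 21 < 23" "j - 21 < 23" using ij by (auto simp: f_def)
        then have "i - 21 = j - 21" using hi by (auto simp: bij_betw_def inj_on_def)
        then show ?thesis using False by linarith
      qed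
    qed
    moreover have "f ` {..<44} \<subseteq> {..<44}"
    proof
      fix x assume "x \<in> f ` {..<44}"
      then obtain i where i: "i < 44" "x = f i" by auto
      show "x \<in> {..<44}"
      proof (cases "i < 21")
        case True then show ?thesis using i by (simp add: f_def)
      next
        case False
        then have "hi (i - 21) < 23" using i by (intro hil) simp
        then show ?thesis using False i by (simp add: f_def)
      qed
    qed
    ultimately show ?thesis by (simp add: bij_betw_def endo_inj_surj)
  qed
  have fi: "inj_on f {..<44}" "f ` {..<44} = {..<44}" using bij by (auto simp: bij_betw_def)
  let ?D = "(`) f ` C"
  have D: "code_on {..<44} ?D" using code_on_image[OF fi(1) goodD(1)[OF good]] fi(2) by simp
  have "C \<subseteq> Pow {..<44}" using sub by auto
  then have Dd: "dual_on {..<44} ?D = ?D" using dual_on_image[OF fi(1)] goodD(2)[OF good] fi(2) by metis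
  have ED: "supp ` set E_gens \<subseteq> ?D"
  proof
    fix e assume e: "e \<in> supp ` set E_gens"
    then have "e \<subseteq> {..<21}" using E_length(1) supp_subset by fastforce
    then have "f ` e = e" by (rule flow)
    then show "e \<in> ?D" using E e by (metis image_eqI subsetD)
  qed
  have BD: "fx (supp y) \<in> ?D" if y: "y \<in> set B" for y
  proof -
    have "supp y \<subseteq> {..<23}" using supp_subset[of y] st.lengths(1) y by simp
    then have "hi ` h ` supp y = supp y" using hih by (force simp: image_image)
    then have "f ` fx (h ` supp y) = fx (supp y)" by (simp add: ffx)
    moreover have "fx (h ` supp y) \<in> C" using B[OF y] by (simp add: Bc_def)
    ultimately show ?thesis by (metis imageI)
  qed
  have VD: "hi ` V i \<subseteq> {..<23}" "cyc i \<union> fx (hi ` V i) \<in> ?D" if i: "i < 3" for i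
  proof -
    show "hi ` V i \<subseteq> {..<23}" using V(1)[OF i] hil by auto
    have "cyc i \<subseteq> {..<21}" using i by (auto simp: cyc_def)
    then have "f ` (cyc i \<union> fx (V i)) = cyc i \<union> fx (hi ` V i)" by (simp add: image_Un flow ffx)
    then show "cyc i \<union> fx (hi ` V i) \<in> ?D" using V(2)[OF i] by (metis imageI)
  qed
  obtain g where g: "bij_betw g {..<44} {..<44}" "(`) g ` ?D = Std B v"
    using st.glue_unique[OF D Dd ED BD VD] by blast
  have "(`) g ` (`) f ` C = (`) (g \<circ> f) ` C" by (auto simp: image_comp)
  moreover have "bij_betw (g \<circ> f) {..<44} {..<44}" using bij g(1) by (rule bij_betw_trans)
  ultimately show ?thesis using g(2) by metis
qed

text \<open>Any three distinct coordinates may be named \<open>a\<close>, \<open>b\<close>,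
  \<open>c\<close> by the labelling, so the set that defines the hyperplane can be given one of
  three standard names.\<close>

lemma classification:
  "\<exists>f. bij_betw f {..<44} {..<44} \<and>
     (`) f ` C \<in> {Std B1_gens B1_glue, Std B2_gens B2_glue, Std B3_gens B3_glue}"
proof -
  obtain G v where G: "golay {..<24} G" and v: "v \<subseteq> {..<23}" "v \<noteq> {}" "card v \<le> 3"
    and Bv: "Bc = {c \<in> G. 23 \<notin> c \<and> even (card (v \<inter> c))}" using Bc_hyperplane by blast
  interpret gc: golay_code "{..<24}" G by unfold_locales (rule G)
  have fv: "finite v" using v finite_subset by blast
  \<comment> \<open>Names that do not occur in \<open>v\<close> go to arbitrary further
    coordinates.\<close>
  obtain a b c where abc: "a < 23" "b < 23" "c < 23" "distinct [a,b,c]" and vv: "v = {a} \<or> v = {b,c} \<or> v = {a,b,c}"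
  proof -
    have "card v \<noteq> 0" using v fv by auto
    then consider "card v = 1" | "card v = 2" | "card v = 3" using v by linarith
    then show ?thesis
    proof cases
      case 1
      then obtain a where a: "v = {a}" by (auto simp: card_1_singleton_iff)
      have "2 \<le> card ({..<23} - v)" using v fv 1 by (simp add: card_Diff_subset)
      then obtain T where "T \<subseteq> {..<23} - v" "card T = 2" using obtain_subset_with_card_n by metis
      then obtain b c where "b \<noteq> c" "b < 23" "c < 23" "b \<noteq> a" "c \<noteq> a" using a by (auto simp: card_2_iff)
      then show ?thesis using that[of a b c] a v(1) by auto
    next
      case 2
      then obtain b c where bc: "v = {b,c}" "b \<noteq> c" by (auto simp: card_2_iff)
      have "card ({..<23} - v) \<noteq> 0" using v fv 2 by (simp add: card_Diff_subset)
      then obtain a where "a \<in> {..<23} - v" by (metis card.empty equals0I)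
      then show ?thesis using that[of a b c] bc v(1) by auto
    next
      case 3
      then obtain a b c where "v = {a,b,c}" "a \<noteq> b" "b \<noteq> c" "a \<noteq> c" by (auto simp: card_3_iff)
      then show ?thesis using that[of a b c] v(1) by auto
    qed
  qed
  obtain h where h: "bij_betw h {..<23} {..<23}" "h 0 = a" "h 1 = b" "h 2 = c"
    and ob: "insert 23 (h ` supp octad_b) \<in> G" and oc: "\<And>x. x \<in> set octads \<Longrightarrow> insert 23 (h ` supp x) \<in> G"
    and dd: "h ` supp dodecad \<in> G"
    using golay_label_gens[OF G abc] by blast
  have hi: "inj_on h {..<23}" using h(1) by (simp add: bij_betw_def)
  have lO: "length octad_b = 23" "\<And>x. x \<in> set octads \<Longrightarrow> length x = 23" "length dodecad = 23"
    by (auto simp: octad_b_def octads_def dodecad_def length_bits)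
  have sub: "supp y \<subseteq> {..<23}" if "length y = 23" for y using supp_subset[of y] that by simp
  have n23: "23 \<notin> h ` supp y" if "length y = 23" for y
  proof -
    have "h ` supp y \<subseteq> {..<23}" using sub[OF that] h(1) by (metis bij_betw_def image_mono)
    then show ?thesis by auto
  qed
  have hx: "h ` supp (bxor x y) = h ` supp x \<triangle> h ` supp y" if "length x = 23" "length y = 23" for x y
    using that sd_image[OF hi sub sub] by (simp add: supp_bxor)
  have pair: "h ` supp (bxor x y) \<in> G"
    if "length x = 23" "length y = 23" "insert 23 (h ` supp x) \<in> G" "insert 23 (h ` supp y) \<in> G" for x y
  proof -
    have "insert 23 (h ` supp x) \<triangle> insert 23 (h ` supp y) = h ` supp x \<triangle> h ` supp y"
      using n23[OF that(1)] n23[OF that(2)] by (auto simp: in_sd)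
    then show ?thesis using gc.add[OF that(3,4)] hx[OF that(1,2)] by simp
  qed
  have o8: "octads ! k \<in> set octads" if "k < 10" for k using that by (simp add: octads_def)
  have mem: "h ` supp y \<in> Bc"
    if y: "length y = 23" "h ` supp y \<in> G" and k: "v = h ` supp k" "length k = 23" "\<not> bdot k y" for y k
  proof -
    have "card (v \<inter> h ` supp y) = card (supp k \<inter> supp y)"
      unfolding k(1) by (rule card_image_Int[OF hi sub[OF k(2)] sub[OF y(1)]])
    then have "even (card (v \<inter> h ` supp y))" using k(2,3) y(1) by (simp add: bdot_iff)
    then show ?thesis unfolding Bv using y n23 by simp
  qed
  have hb: "h ` supp (bits 23 [0]) = {a}" "h ` supp (bits 23 [1,2]) = {b,c}" "h ` supp (bits 23 [0,1,2]) = {a,b,c}"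
  proof -
    have "supp (bits 23 [0]) = {0}" "supp (bits 23 [1,2]) = {1,2}" "supp (bits 23 [0,1,2]) = {0,1,2}" by (auto simp: supp_bits)
    then show "h ` supp (bits 23 [0]) = {a}" "h ` supp (bits 23 [1,2]) = {b,c}" "h ` supp (bits 23 [0,1,2]) = {a,b,c}"
      using h(2-4) by simp_all
  qed
  have lB: "\<And>y. y \<in> set B1_gens \<Longrightarrow> length y = 23" "\<And>y. y \<in> set B2_gens \<Longrightarrow> length y = 23" "\<And>y. y \<in> set B3_gens \<Longrightarrow> length y = 23"
    using S1.lengths(1) S2.lengths(1) S3.lengths(1) by auto
  from vv show ?thesis
  proof (elim disjE)
    assume v1: "v = {a}"
    \<comment> \<open>All generating octads contain \<open>t\<close> and \<open>a\<close>, so adding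
      the octad of \<open>b\<close> removes both points.\<close>
    have "h ` supp y \<in> Bc" if y: "y \<in> set B1_gens" for y
    proof (rule mem[OF lB(1)[OF y] _ _ length_bits])
      show "h ` supp y \<in> G" using y pair[OF lO(1) lO(2) ob oc] by (auto simp: B1_gens_def)
      show "v = h ` supp (bits 23 [0])" using hb v1 by simp
      show "\<not> bdot (bits 23 [0]) y" using hyperplane_checks(1) y unfolding list_all_iff by blast
    qed
    then show ?thesis using relabel_fixed[OF h(1) S1.std_code_axioms] by blast
  next
    assume v2: "v = {b,c}"
    \<comment> \<open>Of the octads only that of \<open>b\<close> contains \<open>b\<close> and only
      the first edge octad contains \<open>c\<close>. Their sum contains both points; the dodecad
      and the sums of later octads contain neither.\<close>
    have "h ` supp y \<in> Bc" if y: "y \<in> set B2_gens" for y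
    proof (rule mem[OF lB(2)[OF y] _ _ length_bits])
      have "set (drop 2 octads) \<subseteq> set octads" by (rule set_drop_subset)
      then show "h ` supp y \<in> G"
        using y pair[OF lO(1) lO(2)[OF o8[of 0]] ob oc[OF o8[of 0]]] pair[OF lO(2)[OF o8[of 1]] lO(2) oc[OF o8[of 1]] oc] dd
        unfolding B2_gens_def by auto
      show "v = h ` supp (bits 23 [1,2])" using hb v2 by simp
      show "\<not> bdot (bits 23 [1,2]) y" using hyperplane_checks(2) y unfolding list_all_iff by blast
    qed
    then show ?thesis using relabel_fixed[OF h(1) S2.std_code_axioms] by blast
  next
    assume v3: "v = {a,b,c}"
    \<comment> \<open>The octad of \<open>b\<close> plus a later octad meets \<open>{a,b,c}\<close>
      in \<open>b\<close> alone, and the dodecad adds \<open>a\<close>; with the first octad the sum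
      meets it in \<open>b\<close> and \<open>c\<close>.\<close>
    have "h ` supp y \<in> Bc" if y: "y \<in> set B3_gens" for y
    proof (rule mem[OF lB(3)[OF y] _ _ length_bits])
      have d: "set (drop 1 octads) \<subseteq> set octads" by (rule set_drop_subset)
      have "h ` supp (bxor dodecad (bxor octad_b x)) \<in> G" if "x \<in> set octads" for x
        using hx[OF lO(3), of "bxor octad_b x"] lO that gc.add[OF dd pair[OF lO(1) lO(2)[OF that] ob oc[OF that]]] by simp
      then show "h ` supp y \<in> G"
        using y d pair[OF lO(1) lO(2)[OF o8[of 0]] ob oc[OF o8[of 0]]]
        unfolding B3_gens_def by auto
      show "v = h ` supp (bits 23 [0,1,2])" using hb v3 by simp
      show "\<not> bdot (bits 23 [0,1,2]) y" using hyperplane_checks(3) y unfolding list_all_iff by blast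
    qed
    then show ?thesis using relabel_fixed[OF h(1) S3.std_code_axioms] by blast
  qed
qed

end

theorem good_classification:
  assumes C: "good C"
  shows "\<exists>f. bij_betw f {..<44} {..<44} \<and>
     (`) f ` C \<in> {Std B1_gens B1_glue, Std B2_gens B2_glue, Std B3_gens B3_glue}"
proof -
  obtain f where f: "bij_betw f {..<44} {..<44}" "good ((`) f ` C)" "supp ` set E_gens \<subseteq> (`) f ` C"
    using E_normal_form[OF C] by blast
  interpret nc: normal_code "(`) f ` C" using f by unfold_locales auto
  obtain V where V: "\<forall>i<3. V i \<subseteq> {..<23} \<and> cyc i \<union> fx (V i) \<in> (`) f ` C" using nc.glue_exists by blast
  interpret gl: glued_code "(`) f ` C" V using V by unfold_locales auto
  obtain g where g: "bij_betw g {..<44} {..<44}"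
    "(`) g ` (`) f ` C \<in> {Std B1_gens B1_glue, Std B2_gens B2_glue, Std B3_gens B3_glue}"
    using gl.classification by blast
  have "(`) g ` (`) f ` C = (`) (g \<circ> f) ` C" by (auto simp: image_comp)
  moreover have "bij_betw (g \<circ> f) {..<44} {..<44}" using f(1) g(1) by (rule bij_betw_trans)
  ultimately show ?thesis using g(2) by metis
qed

section \<open>Transfer to vectors\<close>

lemma rho_low:
  assumes "q < 3" "j < 7" shows "rho (7 * q + j) = 7 * q + (j + 1) mod 7"
proof -
  have m: "(j + 1) mod 7 < 7" by simp
  have "q = 0 \<or> q = 1 \<or> q = 2" using assms(1) by auto
  then show ?thesis using assms(2) m
    by (elim disjE) (simp_all add: rho_def blk_def rt_def)
qed

lemma rho_high: "21 \<le> i \<Longrightarrow> rho i = i"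
  by (simp add: rho_def blk_def)

lemma rot_replicate: "rot (replicate 7 s) = replicate 7 s"
  by (simp add: numeral_eq_Suc)

text \<open>On the first module the rotation satisfies \<open>x^3 = 1 + x\<close>, on the second
  \<open>x^3 = 1 + x^2\<close>.\<close>

lemma E_rot_checks: "rot A0 = A1" "rot A1 = A2" "rot A2 = bxor A0 A1" "rot C0 = C1" "rot C1 = C2" "rot C2 = bxor C0 C2"
  "length A0 = 7" "length A1 = 7" "length A2 = 7" "length C0 = 7" "length C1 = 7" "length C2 = 7"
  by code_simp+

lemma E_code_rho:
  assumes "g \<in> set E_gens" shows "rho ` supp g \<in> E_code"
proof -
  have m: "supp g \<in> E_code" if "g \<in> set E_gens" for g using gen_in_span[of "supp g" "map supp E_gens"] that by simp
  have ad: "x \<triangle> y \<in> E_code" if "x \<in> E_code" "y \<in> E_code" for x y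
    using code_onD(3)[OF code_on_span[of "map supp E_gens" UNIV]] that by blast
  note r = rho_supp[where w="[]", unfolded append_Nil2]
  have z: "rot zero7 = zero7" by (rule rot_zero7)
  have x: "supp (bxor a b @ bxor c d @ bxor e f) = supp (a @ c @ e) \<triangle> supp (b @ d @ f)"
    if "length a = 7" "length b = 7" "length c = 7" "length d = 7" "length e = 7" "length f = 7" for a b c d e f
    using that by (simp add: supp_bxor[symmetric] bxor_append)
  have zz: "zero7 = bxor zero7 zero7" by (simp add: bxor_self_7)
  note l = E_rot_checks(7-12)
  have mm: "supp (A0 @ A0 @ A0) \<in> E_code" "supp (A1 @ A1 @ A1) \<in> E_code" "supp (A2 @ A2 @ A2) \<in> E_code"
    "supp (C0 @ C0 @ zero7) \<in> E_code" "supp (C1 @ C1 @ zero7) \<in> E_code" "supp (C2 @ C2 @ zero7) \<in> E_code"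
    "supp (zero7 @ C0 @ C0) \<in> E_code" "supp (zero7 @ C1 @ C1) \<in> E_code" "supp (zero7 @ C2 @ C2) \<in> E_code"
    by (rule m, simp add: E_gens_def)+
  have x1: "supp (bxor A0 A1 @ bxor A0 A1 @ bxor A0 A1) \<in> E_code" unfolding x[OF l(1,2,1,2,1,2)] by (rule ad[OF mm(1,2)])
  have x2: "supp (bxor C0 C2 @ bxor C0 C2 @ zero7) \<in> E_code"
    using x[OF l(4,6,4,6) length_zero7 length_zero7] ad[OF mm(4,6)] zz by simp
  have x3: "supp (zero7 @ bxor C0 C2 @ bxor C0 C2) \<in> E_code"
    using x[OF length_zero7 length_zero7 l(4,6,4,6)] ad[OF mm(7,9)] zz by simp
  have d: "g = A0 @ A0 @ A0 \<or> g = A1 @ A1 @ A1 \<or> g = A2 @ A2 @ A2 \<or> g = C0 @ C0 @ zero7 \<or> g = C1 @ C1 @ zero7 \<or> g = C2 @ C2 @ zero7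
    \<or> g = zero7 @ C0 @ C0 \<or> g = zero7 @ C1 @ C1 \<or> g = zero7 @ C2 @ C2"
    using assms by (simp only: E_gens_def list.set insert_iff empty_iff) blast
  then show ?thesis
    by (elim disjE; simp only: r l length_zero7 E_rot_checks(1-6) z mm x1 x2 x3)
qed

text \<open>By linearity only generators matter: the even part is closed under rotation, and words
  constant on the cycles are fixed by it.\<close>

lemma (in std_code) Std_rho:
  assumes c: "c \<in> Std B v" shows "rho ` c \<in> Std B v"
proof -
  let ?R = "{c \<in> Std B v. rho ` c \<in> Std B v}"
  have i: "inj_on rho {..<44}" using rho_bij by (simp add: bij_betw_def)
  have R: "code_on {..<44} ?R"
    unfolding code_on_def
  proof (intro conjI ballI)
    fix a b assume ab: "a \<in> ?R" "b \<in> ?R"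
    have "rho ` (a \<triangle> b) = rho ` a \<triangle> rho ` b"
      using sd_image[OF i] code_onD(1)[OF Std_code] ab by blast
    then show "a \<triangle> b \<in> ?R" using ab code_onD(3)[OF Std_code] by auto
  qed (use code_onD[OF Std_code] in auto)
  have ES: "x \<in> Std B v" if "x \<in> E_code" for x
  proof -
    have "x = x \<triangle> ({} \<triangle> fx {})" by (simp add: fx_def)
    then show ?thesis unfolding gspan_gens44 using that empty_in_span by blast
  qed
  have "supp g \<in> ?R" if g: "g \<in> set (gens44 B v)" for g
  proof -
    have gS: "supp g \<in> Std B v" unfolding Std_def using g by (intro gen_in_span) simp
    have fixed: "rho ` supp (cycL s0 s1 s2 @ w) = supp (cycL s0 s1 s2 @ w)" for s0 s1 s2 w
      unfolding cycL_def using rho_supp[of "replicate 7 s0" "replicate 7 s1" "replicate 7 s2" w] by (simp add: rot_replicate)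
    have z21: "replicate 21 False = cycL False False False" by (simp add: cycL_def flip: replicate_add)
    consider x where "x \<in> set E_gens" "g = x @ replicate 23 False" | s0 s1 s2 w where "g = cycL s0 s1 s2 @ w"
      using g unfolding gens44_def z21 by auto
    then have "rho ` supp g \<in> Std B v"
    proof cases
      case 1
      then have "supp g = supp x" by (simp add: supp_append)
      then show ?thesis using ES[OF E_code_rho[OF 1(1)]] by simp
    next
      case 2
      then show ?thesis using fixed gS by simp
    qed
    then show ?thesis using gS by simp
  qed
  then have "Std B v \<subseteq> ?R" unfolding Std_def[of B v, symmetric]
    by (subst (1) Std_def) (rule span_least[OF R], auto)
  then show ?thesis using c by auto
qed

section \<open>Words as vectors\<close>

definition wsup :: "bit ^ 'n::finite \<Rightarrow> 'n set" where "wsup u = {i. u $ i \<noteq> 0}"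
definition wvec :: "'n set \<Rightarrow> bit ^ 'n::finite" where "wvec s = (\<chi> i. if i \<in> s then 1 else 0)"

lemma wsup_wvec [simp]: "wsup (wvec s) = s"
  by (simp add: wsup_def wvec_def)

lemma wvec_wsup [simp]: "wvec (wsup u) = u"
  by (simp add: wsup_def wvec_def vec_eq_iff)

lemma inj_wsup: "inj wsup"
  by (metis injI wvec_wsup)

lemma finite_bit_vec [simp]: "finite (C :: (bit ^ 'n::finite) set)"
  by (rule finite_subset[OF subset_UNIV]) (rule finite_imageD[OF _ inj_wsup], simp)

lemma wsup_zero [simp]: "wsup 0 = {}"
  by (simp add: wsup_def)

lemma wsup_eq_empty: "wsup u = {} \<longleftrightarrow> u = 0"
  by (metis wsup_zero wvec_wsup)

lemma wsup_add: "wsup (u + v) = wsup u \<triangle> wsup v"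
proof -
  have "(a + b \<noteq> 0) = ((a \<noteq> 0) \<noteq> (b \<noteq> 0))" for a b :: bit by (cases a; cases b) auto
  then show ?thesis by (auto simp: wsup_def in_sd)
qed

lemma weight_wsup: "weight u = card (wsup u)"
  by (simp add: weight_def wsup_def)

lemma of_nat_bit: "(of_nat n :: bit) = 0 \<longleftrightarrow> even n"
proof (induction n)
  case (Suc n)
  have "(1 + b = 0) = (b \<noteq> 0)" for b :: bit by (cases b) auto
  then show ?case using Suc by simp
qed simp

lemma wsup_inner: "(\<Sum>i\<in>UNIV. u $ i * v $ i) = 0 \<longleftrightarrow> even (card (wsup u \<inter> wsup v))"
proof -
  have "u $ i * v $ i = (if i \<in> wsup u \<inter> wsup v then 1 else 0)" for i
    by (auto simp: wsup_def)
  then have "(\<Sum>i\<in>UNIV. u $ i * v $ i) = (\<Sum>i\<in>UNIV. if i \<in> wsup u \<inter> wsup v then 1 else 0)" by simp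
  also have "\<dots> = of_nat (card (wsup u \<inter> wsup v))" by (simp only: sum.If_cases[OF finite] Collect_mem_eq Int_UNIV_left sum_constant mult_zero_right mult_1_right add_0_right)
  also have "\<dots> = 0 \<longleftrightarrow> even (card (wsup u \<inter> wsup v))" by (rule of_nat_bit)
  finally show ?thesis .
qed

lemma wsup_permute:
  assumes "\<sigma> permutes UNIV" shows "wsup (permute_coords \<sigma> u) = \<sigma> ` wsup u"
proof (intro equalityI subsetI)
  fix i assume "i \<in> wsup (permute_coords \<sigma> u)"
  then have "inv \<sigma> i \<in> wsup u" by (simp add: wsup_def permute_coords_def)
  moreover have "i = \<sigma> (inv \<sigma> i)" using permutes_inverses(1)[OF assms] by simp
  ultimately show "i \<in> \<sigma> ` wsup u" by (rule image_eqI[rotated])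
next
  fix i assume "i \<in> \<sigma> ` wsup u"
  then obtain j where j: "j \<in> wsup u" "i = \<sigma> j" by (rule imageE)
  moreover have "inv \<sigma> (\<sigma> j) = j" by (rule permutes_inverses(2)[OF assms])
  ultimately show "i \<in> wsup (permute_coords \<sigma> u)" by (simp add: wsup_def permute_coords_def)
qed

lemma wsup_subspace:
  assumes "vec.subspace (C :: (bit ^ 'n::finite) set)" shows "code_on UNIV (wsup ` C)"
  using assms unfolding code_on_def vec.subspace_def by (auto simp flip: wsup_add) (metis imageI wsup_zero)

lemma wvec_subspace:
  assumes "code_on UNIV F" shows "vec.subspace (wvec ` F)"
  unfolding vec.subspace_def
proof (intro conjI allI ballI)
  show "0 \<in> wvec ` F" using code_onD(2)[OF assms] by (metis imageI wsup_zero wvec_wsup)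
next
  fix x y assume "x \<in> wvec ` F" "y \<in> wvec ` F"
  then obtain a b where ab: "a \<in> F" "b \<in> F" "x = wvec a" "y = wvec b" by auto
  have "x + y = wvec (wsup (x + y))" by simp
  then show "x + y \<in> wvec ` F" using code_onD(3)[OF assms ab(1,2)] ab by (metis imageI wsup_add wsup_wvec)
next
  fix k :: bit and x assume "x \<in> wvec ` F"
  then show "k *s x \<in> wvec ` F"
    using code_onD(2)[OF assms] by (cases k) (auto, metis imageI wsup_zero wvec_wsup)
qed

lemma wsup_self_dual: "self_dual C \<longleftrightarrow> dual_on UNIV (wsup ` C) = wsup ` C"
proof -
  have d: "dual_code C = {u. \<forall>v\<in>C. even (card (wsup u \<inter> wsup v))}"
    unfolding dual_code_def wsup_inner ..
  have "wsup ` dual_code C = dual_on UNIV (wsup ` C)"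
  proof (intro equalityI subsetI)
    fix s assume "s \<in> wsup ` dual_code C"
    then show "s \<in> dual_on UNIV (wsup ` C)" by (auto simp: d dual_on_def)
  next
    fix s assume "s \<in> dual_on UNIV (wsup ` C)"
    then have "wvec s \<in> dual_code C" by (auto simp: d dual_on_def)
    then show "s \<in> wsup ` dual_code C" by (metis imageI wsup_wvec)
  qed
  then show ?thesis unfolding self_dual_def by (metis inj_image_eq_iff inj_wsup)
qed

lemma card_span_bit:
  fixes S :: "(bit ^ 'n::finite) set"
  assumes "finite S" "vec.independent S" shows "card (vec.span S) = 2 ^ card S"
  using assms
proof (induction S)
  case (insert b S)
  have ind: "vec.independent S" and nb: "b \<notin> vec.span S" using insert by (auto simp: vec.independent_insert)
  have fin: "finite (vec.span S)" by simp
  have "vec.span (insert b S) = vec.span S \<union> (+) b ` vec.span S"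
  proof (intro equalityI subsetI)
    fix x assume "x \<in> vec.span (insert b S)"
    then obtain k where k: "x - k *s b \<in> vec.span S" by (auto simp: vec.span_insert)
    show "x \<in> vec.span S \<union> (+) b ` vec.span S"
    proof (cases k)
      case zero then show ?thesis using k by simp
    next
      case one
      then have "x = b + (x - k *s b)" by simp
      then show ?thesis using k by blast
    qed
  next
    fix x assume "x \<in> vec.span S \<union> (+) b ` vec.span S"
    then show "x \<in> vec.span (insert b S)"
      by (auto intro: vec.span_add vec.span_base vec.span_mono[THEN subsetD, OF subset_insertI])
  qed
  moreover have "vec.span S \<inter> (+) b ` vec.span S = {}"
  proof -
    have "b \<in> vec.span S" if "x \<in> vec.span S" "x = b + y" "y \<in> vec.span S" for x y
      using vec.span_diff[OF that(1,3)] that(2) by simp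
    then show ?thesis using nb by auto
  qed
  moreover have "card ((+) b ` vec.span S) = card (vec.span S)" by (rule card_image) simp
  ultimately show ?case using insert ind fin by (simp add: card_Un_disjoint)
qed simp

lemma card_subspace:
  fixes C :: "(bit ^ 'n::finite) set"
  assumes "vec.subspace C" shows "card C = 2 ^ vec.dim C"
proof -
  obtain S where S: "S \<subseteq> C" "vec.independent S" "C \<subseteq> vec.span S" "card S = vec.dim C" using vec.basis_exists by blast
  have "vec.span S = C" using S assms by (metis subset_antisym vec.span_minimal)
  moreover have "finite S" by simp
  ultimately show ?thesis using card_span_bit[of S] S by simp
qed


section \<open>Coordinates adapted to an automorphism of order 7\<close>

lemma perm_order_pow:
  assumes "\<sigma> permutes (UNIV :: 'n::finite set)" shows "\<sigma> ^^ perm_order \<sigma> = id"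
proof -
  have "permutation \<sigma>" using assms by (auto simp: permutation_permutes)
  then obtain n where "\<sigma> ^^ n = id" "0 < n" using permutation_is_nilpotent by blast
  then have "\<exists>m. 0 < m \<and> \<sigma> ^^ m = id" by blast
  then show ?thesis unfolding perm_order_def by (rule LeastI2_ex) simp
qed

definition orb7 :: "('n \<Rightarrow> 'n) \<Rightarrow> 'n \<Rightarrow> 'n set" where "orb7 \<sigma> x = (\<lambda>j. (\<sigma> ^^ j) x) ` {..<7}"

locale order7 =
  fixes \<sigma> :: "'n::finite \<Rightarrow> 'n"
  assumes s7: "\<sigma> ^^ 7 = id"
begin

lemma pow_mod: "(\<sigma> ^^ (m mod 7)) x = (\<sigma> ^^ m) x"
  by (rule funpow_mod_eq) (simp only: s7 id_apply)

lemma pow_in_orb: "(\<sigma> ^^ m) x \<in> orb7 \<sigma> x"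
  unfolding orb7_def by (rule image_eqI[where x="m mod 7"]) (simp_all add: pow_mod)

lemma pow_back: "m \<le> 7 \<Longrightarrow> (\<sigma> ^^ (7 - m)) ((\<sigma> ^^ m) x) = x"
proof -
  assume m: "m \<le> 7"
  have "(\<sigma> ^^ (7 - m)) ((\<sigma> ^^ m) x) = (\<sigma> ^^ (7 - m + m)) x" by (simp only: funpow_add o_apply)
  then show ?thesis using m s7 by simp
qed

lemma pow_cancel: "m \<le> 7 \<Longrightarrow> (\<sigma> ^^ m) x = (\<sigma> ^^ m) y \<Longrightarrow> x = y"
  by (metis pow_back)

lemma fixed_if_pow:
  assumes d: "0 < d" "d < 7" "(\<sigma> ^^ d) x = x" shows "\<sigma> x = x"
proof -
  have "d = 1 \<or> d = 2 \<or> d = 3 \<or> d = 4 \<or> d = 5 \<or> d = 6" using d(1,2) by auto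
  \<comment> \<open>The inverses of 1 to 6 modulo 7 are 1, 4, 5, 2, 3, 6.\<close>
  then have "\<exists>m. (d * m) mod 7 = 1"
    by (elim disjE; simp only:) (rule exI[of _ 1], simp, rule exI[of _ 4], simp, rule exI[of _ 5], simp,
      rule exI[of _ 2], simp, rule exI[of _ 3], simp, rule exI[of _ 6], simp)
  then obtain m where m: "(d * m) mod 7 = 1" by blast
  have "(\<sigma> ^^ (d * m)) x = x"
  proof (induction m)
    case (Suc m)
    have "(\<sigma> ^^ (d * Suc m)) x = (\<sigma> ^^ d) ((\<sigma> ^^ (d * m)) x)" by (simp only: mult_Suc_right funpow_add o_apply)
    then show ?case using Suc d(3) by simp
  qed simp
  then show ?thesis using pow_mod[of "d * m" x] m by simp
qed

lemma pow_inj: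
  assumes x: "\<sigma> x \<noteq> x" shows "inj_on (\<lambda>j. (\<sigma> ^^ j) x) {..<7}"
proof -
  have "False" if "a < b" "b < 7" "(\<sigma> ^^ a) x = (\<sigma> ^^ b) x" for a b
  proof -
    have "(\<sigma> ^^ b) x = (\<sigma> ^^ (a + (b - a))) x" using that by simp
    then have "(\<sigma> ^^ a) x = (\<sigma> ^^ a) ((\<sigma> ^^ (b - a)) x)" using that(3) by (simp only: funpow_add o_apply)
    then have "(\<sigma> ^^ (b - a)) x = x" using pow_cancel[of a x "(\<sigma> ^^ (b - a)) x"] that(1,2) by (metis less_imp_le less_trans)
    then show False using fixed_if_pow[of "b - a" x] that(1,2) x by linarith
  qed
  then show ?thesis unfolding inj_on_def by (metis lessThan_iff linorder_neqE_nat)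
qed

lemma card_orb7: "\<sigma> x \<noteq> x \<Longrightarrow> card (orb7 \<sigma> x) = 7"
  unfolding orb7_def by (simp add: card_image pow_inj)

lemma orb7_disjoint:
  assumes "y \<notin> orb7 \<sigma> x" shows "orb7 \<sigma> x \<inter> orb7 \<sigma> y = {}"
proof -
  have "y \<in> orb7 \<sigma> x" if "b < 7" "(\<sigma> ^^ a) x = (\<sigma> ^^ b) y" for a b
  proof -
    have "y = (\<sigma> ^^ (7 - b)) ((\<sigma> ^^ a) x)" using pow_back[of b y] that by simp
    also have "\<dots> = (\<sigma> ^^ (7 - b + a)) x" by (simp only: funpow_add o_apply)
    finally show ?thesis using pow_in_orb by metis
  qed
  then show ?thesis using assms by (auto simp: orb7_def)
qed

lemma orb7_moved:
  assumes "\<sigma> x \<noteq> x" shows "orb7 \<sigma> x \<subseteq> {i. \<sigma> i \<noteq> i}"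
proof -
  have "\<sigma> ((\<sigma> ^^ a) x) \<noteq> (\<sigma> ^^ a) x" if "a < 7" for a
    using pow_cancel[of a "\<sigma> x" x] that assms by (metis funpow_swap1 less_imp_le)
  then show ?thesis by (auto simp: orb7_def)
qed

text \<open>Outside the 23 fixed points 21 points move, in orbits of seven, so three starting points
  chosen one after the other exhaust them. Labels follow the powers of the permutation along each
  orbit, which turns it into \<open>rho\<close>.\<close>

lemma labelling:
  assumes f: "card {i. \<sigma> i = i} = 23" and n: "CARD('n) = 44"
  shows "\<exists>h. bij_betw h {..<44} (UNIV :: 'n set) \<and> (\<forall>i<44. h (rho i) = \<sigma> (h i))"
proof -
  let ?F = "{i. \<sigma> i = i}" and ?N = "{i. \<sigma> i \<noteq> i}"
  have "?N = - ?F" by auto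
  then have N: "card ?N = 21" using card_Diff_subset[of ?F UNIV] f n by (simp add: Compl_eq_Diff_UNIV)
  have ex: "\<exists>p. p \<in> ?N - A" if "card A < 21" for A
  proof (rule ccontr)
    assume "\<not> ?thesis"
    then have "?N \<subseteq> A" by blast
    then have "card ?N \<le> card A" by (rule card_mono[rotated]) simp
    then show False using that N by simp
  qed
  obtain p0 where p0: "\<sigma> p0 \<noteq> p0" using ex[of "{}"] by auto
  obtain p1 where p1: "\<sigma> p1 \<noteq> p1" "p1 \<notin> orb7 \<sigma> p0" using ex[of "orb7 \<sigma> p0"] card_orb7[OF p0] by auto
  have c01: "card (orb7 \<sigma> p0 \<union> orb7 \<sigma> p1) = 14"
    using orb7_disjoint[OF p1(2)] card_orb7[OF p0] card_orb7[OF p1(1)] by (simp add: card_Un_disjoint)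
  obtain p2 where p2: "\<sigma> p2 \<noteq> p2" "p2 \<notin> orb7 \<sigma> p0" "p2 \<notin> orb7 \<sigma> p1"
    using ex[of "orb7 \<sigma> p0 \<union> orb7 \<sigma> p1"] c01 by auto
  have "card (orb7 \<sigma> p0 \<union> orb7 \<sigma> p1 \<union> orb7 \<sigma> p2) = 21"
    using c01 orb7_disjoint[OF p2(2)] orb7_disjoint[OF p2(3)] card_orb7[OF p2(1)]
    by (subst card_Un_disjoint) (auto simp: Int_Un_distrib2)
  then have NO: "orb7 \<sigma> p0 \<union> orb7 \<sigma> p1 \<union> orb7 \<sigma> p2 = ?N"
    using orb7_moved p0 p1(1) p2(1) N by (intro card_subset_eq) auto
  define p where "p q = (if q = 0 then p0 else if q = (1::nat) then p1 else p2)" for q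
  obtain e where e: "bij_betw e {0..<23::nat} ?F" using ex_bij_betw_nat_finite[of ?F] f by auto
  define h where "h i = (if i < 21 then (\<sigma> ^^ (i mod 7)) (p (i div 7)) else e (i - 21))" for i
  have low: "h (7 * q + j) = (\<sigma> ^^ j) (p q)" if "q < 3" "j < 7" for q j
    using that by (simp add: h_def)
  have lown: "orb7 \<sigma> (p q) \<subseteq> h ` {..<44}" if "q < 3" for q
  proof
    fix x assume "x \<in> orb7 \<sigma> (p q)"
    then obtain j where "j < 7" "x = (\<sigma> ^^ j) (p q)" by (auto simp: orb7_def)
    then have "x = h (7 * q + j)" "7 * q + j < 44" using low that by auto
    then show "x \<in> h ` {..<44}" by blast
  qed
  have "x \<in> h ` {..<44}" for x
  proof (cases "x \<in> ?F")
    case True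
    then have "x \<in> e ` {0..<23}" using e by (simp only: bij_betw_def)
    then obtain k where "k < 23" "x = e k" by auto
    then have "x = h (21 + k)" "21 + k < 44" by (auto simp: h_def)
    then show ?thesis by blast
  next
    case False
    then have "x \<in> orb7 \<sigma> (p 0) \<union> orb7 \<sigma> (p 1) \<union> orb7 \<sigma> (p 2)" using NO by (auto simp: p_def)
    then show ?thesis using lown[of 0] lown[of 1] lown[of 2] by auto
  qed
  then have im: "h ` {..<44} = UNIV" by auto
  then have "inj_on h {..<44}" using n by (intro eq_card_imp_inj_on) auto
  then have "bij_betw h {..<44} UNIV" using im by (simp add: bij_betw_def)
  moreover have "h (rho i) = \<sigma> (h i)" if "i < 44" for i
  proof (cases "i < 21")
    case True
    define q j where "q = i div 7" and "j = i mod 7"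
    have qj: "i = 7 * q + j" "q < 3" "j < 7" using True by (auto simp: q_def j_def)
    have "h (rho i) = (\<sigma> ^^ ((j + 1) mod 7)) (p q)" unfolding qj(1) rho_low[OF qj(2,3)] using low[OF qj(2)] by simp
    also have "\<dots> = (\<sigma> ^^ (j + 1)) (p q)" by (rule pow_mod)
    finally show ?thesis unfolding qj(1) low[OF qj(2,3)] by simp
  next
    case False
    then have "e (i - 21) \<in> ?F" using e that by (auto simp: bij_betw_def)
    then show ?thesis using False by (simp add: rho_high h_def)
  qed
  ultimately show ?thesis by blast
qed

end

definition the_class :: "(bit ^ 44) set set" where
  "the_class = {C. linear_code 44 22 8 C \<and> self_dual C \<and>
           (\<exists>\<sigma>. code_automorphism \<sigma> C \<and> perm_of_type 7 3 23 \<sigma>)}"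

lemma min_weight_le:
  assumes "c \<in> C" "c \<noteq> 0" shows "min_weight C \<le> weight c"
  unfolding min_weight_def using assms by (intro Min_le) auto

lemma class_good:
  assumes "C \<in> the_class"
  shows "\<exists>h C'. bij_betw h {..<44} (UNIV :: 44 set) \<and> good C' \<and> wsup ` C = (`) h ` C'"
proof -
  obtain \<sigma> where C: "vec.subspace C" "min_weight C = 8" "self_dual C"
    and s: "\<sigma> permutes UNIV" "permute_coords \<sigma> ` C = C" "perm_order \<sigma> = 7" "card {i. \<sigma> i = i} = 23"
    using assms unfolding the_class_def linear_code_def code_automorphism_def perm_of_type_def by blast
  interpret order7 \<sigma> using perm_order_pow[OF s(1)] s(3) by unfold_locales simp
  obtain h where h: "bij_betw h {..<44} UNIV" and hr: "\<And>i. i < 44 \<Longrightarrow> h (rho i) = \<sigma> (h i)"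
    using labelling[OF s(4)] by auto
  define k where "k = inv_into {..<44} h"
  have k: "bij_betw k UNIV {..<44}" unfolding k_def using h by (rule bij_betw_inv_into)
  then have ki: "inj k" "k ` UNIV = {..<44}" by (auto simp: bij_betw_def)
  have hk: "h (k x) = x" for x using bij_betw_inv_into_right[OF h] by (simp add: k_def)
  have kh: "k (h i) = i" if "i < 44" for i using bij_betw_inv_into_left[OF h] that by (simp add: k_def)
  have klt: "k x < 44" for x using ki(2) by auto
  have ks: "rho (k x) = k (\<sigma> x)" for x
  proof -
    have "rho (k x) < 44" using rho_bij klt by (auto simp: bij_betw_def)
    then show ?thesis using kh[of "rho (k x)"] hr[OF klt[of x]] hk by simp
  qed
  let ?C = "(`) k ` (wsup ` C)"
  have "good ?C" unfolding good_def
  proof (intro conjI ballI impI)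
    show "code_on {..<44} ?C" using code_on_image[OF ki(1) wsup_subspace[OF C(1)]] ki(2) by simp
    show "dual_on {..<44} ?C = ?C" using dual_on_image[OF ki(1), of "wsup ` C"] ki(2) C(3) by (simp add: wsup_self_dual)
  next
    fix c assume "c \<in> ?C" "c \<noteq> {}"
    then obtain u where u: "u \<in> C" "c = k ` wsup u" "wsup u \<noteq> {}" by auto
    then have "8 \<le> weight u" using min_weight_le[OF u(1)] C(2) by (auto simp: wsup_eq_empty)
    then show "8 \<le> card c" using u(2) ki(1) by (simp add: weight_wsup card_image inj_on_subset)
  next
    fix c assume "c \<in> ?C"
    then obtain u where u: "u \<in> C" "c = k ` wsup u" by auto
    have "rho ` c = k ` wsup (permute_coords \<sigma> u)" unfolding wsup_permute[OF s(1)] u(2) image_image ks ..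
    moreover have "permute_coords \<sigma> u \<in> C" using u(1) s(2) by blast
    ultimately show "rho ` c \<in> ?C" by blast
  qed
  moreover have "wsup ` C = (`) h ` ?C" by (simp add: image_image hk)
  ultimately show ?thesis using h by blast
qed

section \<open>Representatives of the classes and their number\<close>

definition rep :: "(nat \<Rightarrow> 'n) \<Rightarrow> nat set set \<Rightarrow> (bit ^ 'n::finite) set" where
  "rep h S = (\<lambda>c. wvec (h ` c)) ` S"

lemma wsup_rep: "wsup ` rep h S = (`) h ` S"
  by (simp add: rep_def image_image)

text \<open>The permutation sought runs back along the labelling of \<open>C\<close>, through the
  classifying bijection, and out along the common labelling \<open>h0\<close>.\<close>

lemma equiv_rep:
  assumes C: "wsup ` C = (`) h ` C'" "C' \<subseteq> Pow {..<44}" and h: "bij_betw h {..<44} (UNIV :: 'n::finite set)"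
    and h0: "bij_betw h0 {..<44} (UNIV :: 'n set)" and f: "bij_betw f {..<44} {..<44}" "(`) f ` C' = S"
  shows "(C, rep h0 S) \<in> code_equiv"
proof -
  define \<pi> where "\<pi> = h0 \<circ> f \<circ> inv_into {..<44} h"
  have "bij \<pi>" unfolding \<pi>_def
    using bij_betw_trans[OF bij_betw_trans[OF bij_betw_inv_into[OF h] f(1)] h0] by (simp add: comp_assoc)
  then have p: "\<pi> permutes UNIV" by (rule bij_imp_permutes) simp
  have ph: "\<pi> (h i) = h0 (f i)" if "i < 44" for i
    using bij_betw_inv_into_left[OF h] that by (simp add: \<pi>_def)
  have pc: "\<pi> ` h ` c = h0 ` f ` c" if "c \<in> C'" for c
    unfolding image_image using that C(2) ph by (intro image_cong) auto
  have "wsup ` permute_coords \<pi> ` C = (`) \<pi> ` wsup ` C" by (simp add: image_image wsup_permute[OF p])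
  also have "\<dots> = (\<lambda>c. \<pi> ` h ` c) ` C'" by (simp add: C(1) image_image)
  also have "\<dots> = (\<lambda>c. h0 ` f ` c) ` C'" using pc by (rule image_cong[OF refl])
  also have "\<dots> = (`) h0 ` (`) f ` C'" by (simp only: image_image)
  also have "\<dots> = wsup ` rep h0 S" by (simp only: f(2) wsup_rep)
  finally have "permute_coords \<pi> ` C = rep h0 S" by (simp only: inj_image_eq_iff[OF inj_wsup])
  then show ?thesis using p unfolding code_equiv_def by blast
qed

lemma rho_pow: "q < 3 \<Longrightarrow> j < 7 \<Longrightarrow> (rho ^^ m) (7 * q + j) = 7 * q + (j + m) mod 7"
proof (induction m)
  case (Suc m)
  then show ?case using rho_low[of q "(j + m) mod 7"] by (simp add: mod_Suc_eq)
qed simp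

lemma rho_pow_high: "21 \<le> i \<Longrightarrow> (rho ^^ m) i = i"
  by (induction m) (simp_all add: rho_high)

lemma rho_type:
  assumes h: "bij_betw h {..<44} (UNIV :: 'n::finite set)"
  defines "\<sigma> \<equiv> h \<circ> rho \<circ> inv_into {..<44} h"
  shows "perm_of_type 7 3 23 \<sigma>" "\<sigma> permutes UNIV" "i < 44 \<Longrightarrow> \<sigma> (h i) = h (rho i)"
proof -
  have inj: "inj_on h {..<44}" and im: "h ` {..<44} = UNIV" using h by (auto simp: bij_betw_def)
  have "bij \<sigma>" unfolding \<sigma>_def
    using bij_betw_trans[OF bij_betw_trans[OF bij_betw_inv_into[OF h] rho_bij] h] by (simp add: comp_assoc)
  then show p: "\<sigma> permutes UNIV" by (rule bij_imp_permutes) simp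
  have sh: "\<sigma> (h i) = h (rho i)" if "i < 44" for i
    using bij_betw_inv_into_left[OF h] that by (simp add: \<sigma>_def)
  then show "i < 44 \<Longrightarrow> \<sigma> (h i) = h (rho i)" .
  have lt: "(rho ^^ m) i < 44" if "i < 44" for i m
    using that rho_bij by (induction m) (auto simp: bij_betw_def)
  have pw: "(\<sigma> ^^ m) (h i) = h ((rho ^^ m) i)" if "i < 44" for i m
    by (induction m) (simp_all add: sh lt that)
  have split: thesis if "i < 44" "\<And>q j. q < 3 \<Longrightarrow> j < 7 \<Longrightarrow> i = 7 * q + j \<Longrightarrow> thesis" "21 \<le> i \<Longrightarrow> thesis" for i :: nat and thesis
    using that(2)[of "i div 7" "i mod 7"] that(1,3) by (cases "i < 21") auto
  have heq: "h i = h j \<longleftrightarrow> i = j" if "i < 44" "j < 44" for i j using inj that by (auto simp: inj_on_def)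
  have r7: "(rho ^^ 7) i = i" if "i < 44" for i
    using that by (rule split) (simp_all only: rho_pow rho_pow_high, simp)
  have "\<sigma> ^^ 7 = id"
  proof
    fix x
    obtain i where i: "i < 44" "x = h i" using im by (metis UNIV_I imageE lessThan_iff)
    show "(\<sigma> ^^ 7) x = id x" using pw[OF i(1), of 7] r7[OF i(1)] i(2) by (simp only: id_apply)
  qed
  moreover have "7 \<le> m" if "0 < m" "\<sigma> ^^ m = id" for m
  proof (rule ccontr)
    assume "\<not> 7 \<le> m"
    moreover have "h ((rho ^^ m) 0) = h 0" using pw[of 0 m] that(2) by simp
    ultimately show False using rho_pow[of 0 0 m] heq[of m 0] that(1) by simp
  qed
  ultimately have ord: "perm_order \<sigma> = 7" unfolding perm_order_def by (intro Least_equality) auto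
  have lo: "orbit \<sigma> (h (7 * q + j)) = h ` cyc q" if q: "q < 3" "j < 7" for q j
  proof -
    have l: "7 * q + j < 44" using q by simp
    have o: "orbit \<sigma> (h (7 * q + j)) = {h (7 * q + (j + m) mod 7) |m. 0 < m}"
      unfolding orbit_altdef by (simp only: pw[OF l] rho_pow[OF q])
    show ?thesis
    proof (intro equalityI subsetI)
      fix x assume "x \<in> orbit \<sigma> (h (7 * q + j))"
      then obtain m where "x = h (7 * q + (j + m) mod 7)" unfolding o by blast
      then show "x \<in> h ` cyc q" by (auto simp: cyc_def)
    next
      fix x assume "x \<in> h ` cyc q"
      then obtain i where i: "7 * q \<le> i" "i < 7 * q + 7" "x = h i" by (auto simp: cyc_def)
      \<comment> \<open>Orbits are described by positive exponents;
        \<open>7 - j + (i - 7 * q)\<close> is positive because \<open>j < 7\<close>, even when the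
        target is the starting point.\<close>
      moreover have "j + (7 - j + (i - 7 * q)) = (i - 7 * q) + 7" using q by simp
      ultimately have e: "i = 7 * q + (j + (7 - j + (i - 7 * q))) mod 7" and z: "0 < 7 - j + (i - 7 * q)"
        using q by (simp_all only: mod_add_self2) auto
      have "h i = h (7 * q + (j + (7 - j + (i - 7 * q))) mod 7)" by (rule arg_cong[where f=h]) (rule e)
      then have "\<exists>m. h i = h (7 * q + (j + m) mod 7) \<and> 0 < m" using z by (intro exI conjI)
      then show "x \<in> orbit \<sigma> (h (7 * q + j))" unfolding o i(3) by (rule CollectI)
    qed
  qed
  have hi: "orbit \<sigma> (h i) = {h i}" if "21 \<le> i" "i < 44" for i
    unfolding orbit_altdef by (auto simp: pw[OF that(2)] rho_pow_high[OF that(1)] intro: exI[of _ 1])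
  have cs: "cyc q \<subseteq> {..<44}" if "q < 3" for q using that by (auto simp: cyc_def)
  have cc: "card (h ` cyc q) = 7" if "q < 3" for q
    using card_image[OF inj_on_subset[OF inj cs[OF that]]] by (simp add: cyc_def)
  have "{X \<in> range (orbit \<sigma>). card X = 7} = (\<lambda>q. h ` cyc q) ` {..<3}"
  proof (intro equalityI subsetI)
    fix X assume "X \<in> {X \<in> range (orbit \<sigma>). card X = 7}"
    then obtain x where x: "X = orbit \<sigma> x" "card X = 7" by auto
    obtain i where i: "i < 44" "x = h i" using im by (metis UNIV_I imageE lessThan_iff)
    from i(1) show "X \<in> (\<lambda>q. h ` cyc q) ` {..<3}"
    proof (rule split)
      fix q j assume "q < 3" "j < 7" "i = 7 * q + j"
      then have "X = h ` cyc q" using lo i(2) x(1) by simp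
      then show ?thesis using \<open>q < 3\<close> by blast
    next
      assume "21 \<le> i"
      then show ?thesis using hi[OF _ i(1)] x i(2) by simp
    qed
  next
    fix X assume "X \<in> (\<lambda>q. h ` cyc q) ` {..<3}"
    then obtain q where q: "q < 3" "X = h ` cyc q" by auto
    then show "X \<in> {X \<in> range (orbit \<sigma>). card X = 7}" using lo[of q 0] cc[of q] by (auto simp: image_iff)
  qed
  moreover have "inj_on (\<lambda>q. h ` cyc q) {..<3}"
  proof (rule inj_onI)
    fix q r :: nat assume a: "q \<in> {..<3}" "r \<in> {..<3}" "h ` cyc q = h ` cyc r"
    then have "cyc q = cyc r" using inj_on_image_eq_iff[OF inj cs cs, of q r] by auto
    moreover have "7 * q \<in> cyc q" by (simp add: cyc_def)
    ultimately have "7 * q \<in> cyc r" by simp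
    then show "q = r" by (auto simp: cyc_def)
  qed
  ultimately have "card {X \<in> range (orbit \<sigma>). card X = 7} = 3" by (simp add: card_image)
  moreover have "card {i. \<sigma> i = i} = 23"
  proof -
    have "{i. \<sigma> i = i} = h ` {21..<44}"
    proof (intro equalityI subsetI)
      fix x assume x: "x \<in> {i. \<sigma> i = i}"
      obtain i where i: "i < 44" "x = h i" using im by (metis UNIV_I imageE lessThan_iff)
      have ri: "rho i = i" using x i heq[OF _ i(1), of "rho i"] sh[OF i(1)] lt[OF i(1), of 1] by simp
      from i(1) show "x \<in> h ` {21..<44}"
      proof (rule split)
        fix q j :: nat assume qj: "q < 3" "j < 7" "i = 7 * q + j"
        then have "(j + 1) mod 7 = j" using ri rho_low[OF qj(1,2)] by simp
        then show ?thesis using qj(2) by (cases "j = 6") auto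
      next
        assume "21 \<le> i" then show ?thesis using i by simp
      qed
    next
      fix x assume "x \<in> h ` {21..<44}"
      then show "x \<in> {i. \<sigma> i = i}" by (auto simp: sh rho_high)
    qed
    moreover have "inj_on h {21..<44}" using inj by (rule inj_on_subset) auto
    ultimately show ?thesis by (simp add: card_image)
  qed
  moreover have "CARD('n) = 44" using bij_betw_same_card[OF h] by simp
  moreover have "prime (7::nat)" by code_simp
  ultimately show "perm_of_type 7 3 23 \<sigma>" unfolding perm_of_type_def using p ord by simp
qed

context std_code begin

lemma inj_rep:
  assumes h: "bij_betw h {..<44} (UNIV :: 'n::finite set)"
  shows "inj_on (\<lambda>c. wvec (h ` c)) (Std B v)"
proof (rule inj_onI)
  fix c d assume cd: "c \<in> Std B v" "d \<in> Std B v" "wvec (h ` c) = wvec (h ` d)"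
  then have "h ` c = h ` d" by (metis wsup_wvec)
  then show "c = d" using inj_on_image_eq_iff[of h "{..<44}" c d] h cd(1,2) code_onD(1)[OF Std_code] by (auto simp: bij_betw_def)
qed

lemma weight_rep:
  assumes h: "bij_betw h {..<44} (UNIV :: 'n::finite set)" and c: "c \<in> Std B v"
  shows "weight (wvec (h ` c)) = card c"
  using card_image[OF inj_on_subset[of h "{..<44}" c]] h code_onD(1)[OF Std_code] c by (simp add: weight_wsup bij_betw_def)

lemma rep_count:
  assumes h: "bij_betw h {..<44} (UNIV :: 'n::finite set)"
  shows "card {u \<in> rep h (Std B v). weight u = 8} = card W8"
proof -
  have "{u \<in> rep h (Std B v). weight u = 8} = (\<lambda>c. wvec (h ` c)) ` W8"
    unfolding rep_def W8_def using weight_rep[OF h] by auto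
  moreover have "inj_on (\<lambda>c. wvec (h ` c)) W8" by (rule inj_on_subset[OF inj_rep[OF h]]) (auto simp: W8_def)
  ultimately show ?thesis by (simp add: card_image)
qed

text \<open>\<open>Std_min\<close> bounds the weights from below; that 8 is attained is what
  \<open>ne\<close> provides.\<close>

lemma rep_in_class:
  assumes h: "bij_betw h {..<44} (UNIV :: 44 set)" and ne: "card W8 \<noteq> 0"
  shows "rep h (Std B v) \<in> the_class"
proof -
  let ?R = "rep h (Std B v)"
  have hi: "inj_on h {..<44}" "h ` {..<44} = UNIV" using h by (auto simp: bij_betw_def)
  have sub: "vec.subspace ?R"
    using wvec_subspace[of "(`) h ` Std B v"] code_on_image[OF hi(1) Std_code] hi(2) by (simp add: rep_def image_image)
  have "(2::nat) ^ vec.dim ?R = 2 ^ 22"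
    using card_subspace[OF sub] card_image[OF inj_rep[OF h]] card_Std by (simp add: rep_def)
  then have dim: "vec.dim ?R = 22" by (simp only: power_inject_exp one_less_numeral_iff semiring_norm)
  have "min_weight ?R = 8" unfolding min_weight_def
  proof (rule Min_eqI)
    fix m assume "m \<in> weight ` (?R - {0})"
    then obtain c where c: "c \<in> Std B v" "wvec (h ` c) \<noteq> 0" "m = weight (wvec (h ` c))" by (auto simp: rep_def)
    then have "c \<noteq> {}" by (metis image_empty wsup_eq_empty wsup_wvec)
    then show "8 \<le> m" using Std_min c weight_rep[OF h] by simp
  next
    obtain c where c: "c \<in> Std B v" "card c = 8" using ne unfolding W8_def by (metis (mono_tags, lifting) Collect_empty_eq card.empty)
    then have "weight (wvec (h ` c)) = 8" using weight_rep[OF h] by simp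
    moreover have "weight (0 :: bit ^ 44) = 0" by (simp add: weight_def)
    ultimately have "wvec (h ` c) \<in> ?R - {0}" "weight (wvec (h ` c)) = 8" using c(1) by (auto simp: rep_def)
    then show "8 \<in> weight ` (?R - {0})" by (metis imageI)
  qed simp
  moreover have "self_dual ?R"
    unfolding wsup_self_dual wsup_rep using dual_on_image[OF hi(1), of "Std B v"] code_onD(1)[OF Std_code] hi(2) Std_dual by auto
  moreover define \<sigma> where "\<sigma> = h \<circ> rho \<circ> inv_into {..<44} h"
  note s = rho_type[OF h, folded \<sigma>_def]
  have "permute_coords \<sigma> ` ?R = ?R"
  proof (rule card_subset_eq)
    show "permute_coords \<sigma> ` ?R \<subseteq> ?R"
    proof
      fix u assume "u \<in> permute_coords \<sigma> ` ?R"
      then obtain c where c: "c \<in> Std B v" "u = permute_coords \<sigma> (wvec (h ` c))" by (auto simp: rep_def)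
      have "wsup u = \<sigma> ` h ` c" using c(2) wsup_permute[OF s(2)] by simp
      also have "\<dots> = h ` rho ` c" unfolding image_image using s(3) code_onD(1)[OF Std_code c(1)] by (intro image_cong) auto
      finally have "u = wvec (h ` rho ` c)" by (metis wvec_wsup)
      then show "u \<in> ?R" using Std_rho[OF c(1)] by (auto simp: rep_def)
    qed
    have "inj (permute_coords \<sigma>)"
    proof (rule injI)
      fix x y assume "permute_coords \<sigma> x = permute_coords \<sigma> y"
      then have "\<sigma> ` wsup x = \<sigma> ` wsup y" by (metis wsup_permute[OF s(2)])
      then have "wsup x = wsup y" using s(2) by (simp add: inj_image_eq_iff permutes_inj)
      then show "x = y" using inj_wsup by (rule injD[rotated])
    qed
    then show "card (permute_coords \<sigma> ` ?R) = card ?R" by (simp add: card_image inj_on_subset)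
  qed simp
  ultimately show ?thesis using sub dim s(1,2)
    unfolding the_class_def linear_code_def code_automorphism_def by auto
qed

end

lemma equiv_count:
  assumes "(C, D) \<in> code_equiv" shows "card {u \<in> C. weight u = k} = card {u \<in> D. weight u = k}"
proof -
  obtain \<sigma> where s: "\<sigma> permutes UNIV" "D = permute_coords \<sigma> ` C" using assms by (auto simp: code_equiv_def)
  have w: "weight (permute_coords \<sigma> u) = weight u" for u
    using s(1) by (simp add: weight_wsup wsup_permute card_image permutes_inj_on)
  have "inj (permute_coords \<sigma>)"
    by (rule inj_on_inverseI[where g="permute_coords (inv \<sigma>)"])
      (simp add: permute_coords_comp permutes_inv s(1) permutes_inv_o(2)[OF s(1)] permute_coords_id)
  then have "card (permute_coords \<sigma> ` {u \<in> C. weight u = k}) = card {u \<in> C. weight u = k}"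
    by (simp add: card_image inj_on_subset)
  moreover have "permute_coords \<sigma> ` {u \<in> C. weight u = k} = {u \<in> D. weight u = k}" using s(2) w by auto
  ultimately show ?thesis by simp
qed

theorem mainTheorem7:
  "card ({C :: (bit ^ 44) set. linear_code 44 22 8 C \<and> self_dual C \<and>
           (\<exists>\<sigma>. code_automorphism \<sigma> C \<and> perm_of_type 7 3 23 \<sigma>)} // code_equiv) = 3"
proof -
  obtain h :: "nat \<Rightarrow> 44" where h: "bij_betw h {..<44} UNIV"
    using ex_bij_betw_nat_finite[of "UNIV :: 44 set"] by (auto simp: atLeast0LessThan)
  let ?R1 = "rep h (Std B1_gens B1_glue)" and ?R2 = "rep h (Std B2_gens B2_glue)" and ?R3 = "rep h (Std B3_gens B3_glue)"
  let ?E = "code_equiv :: ((bit ^ 44) set \<times> (bit ^ 44) set) set"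
  have R: "?R1 \<in> the_class" "?R2 \<in> the_class" "?R3 \<in> the_class"
    using S1.rep_in_class[OF h] S2.rep_in_class[OF h] S3.rep_in_class[OF h] W8_1 W8_2 W8_3 by auto
  have eq: "?E `` {C} = ?E `` {D} \<longleftrightarrow> (C, D) \<in> ?E" for C D
    using eq_equiv_class_iff[OF equiv_code_equiv] by simp
  have "?E `` {C} \<in> {?E `` {?R1}, ?E `` {?R2}, ?E `` {?R3}}" if C: "C \<in> the_class" for C
  proof -
    obtain h' C' where h': "bij_betw h' {..<44} (UNIV :: 44 set)" and C': "good C'" "wsup ` C = (`) h' ` C'"
      using class_good[OF C] by blast
    obtain f where f: "bij_betw f {..<44} {..<44}"
      "(`) f ` C' \<in> {Std B1_gens B1_glue, Std B2_gens B2_glue, Std B3_gens B3_glue}"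
      using good_classification[OF C'(1)] by blast
    have "C' \<subseteq> Pow {..<44}" using goodD(5)[OF C'(1)] by blast
    then have "(C, rep h ((`) f ` C')) \<in> ?E" by (rule equiv_rep[OF C'(2) _ h' h f(1) refl])
    then have "?E `` {C} = ?E `` {rep h ((`) f ` C')}" by (simp only: eq)
    then show ?thesis using f(2) by auto
  qed
  then have "the_class // ?E = {?E `` {?R1}, ?E `` {?R2}, ?E `` {?R3}}"
    using R unfolding quotient_def by blast
  \<comment> \<open>With \<open>card E8\<close> subtracted, the numbers of words of weight 8 are at
    least 330, between 266 and 322, and exactly 250.\<close>
  moreover have "?E `` {?R1} \<noteq> ?E `` {?R2}" "?E `` {?R1} \<noteq> ?E `` {?R3}" "?E `` {?R2} \<noteq> ?E `` {?R3}"
    unfolding eq using equiv_count[of _ _ 8] S1.rep_count[OF h] S2.rep_count[OF h] S3.rep_count[OF h] W8_1 W8_2 W8_3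
    by fastforce+
  ultimately show ?thesis unfolding the_class_def by simp
qed

end
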